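(* Let $\rho$ be a critical radius function on $\mathbb{R}^d$, let $T$ be a linear operator with associated kernel $K$ and let $T_0$ be a Calderón-Zygmund operator with kernel $K_0$. (i) Suppose that for some $1<s<\infty$: for each $N>0$ there exists $C_N$ such that $$\left(\int_{R<|x_0-x|<2R}|K(x,y)|^s\,dx\right)^{1/s}\le C_N R^{-d/s'}\left(1+\frac{R}{\rho(x_0)}\right)^{-N}$$ whenever $|y-x_0|<R/2$; and there exist $C,\delta>0$ such that $$\left(\int_{R<|x_0-x|<2R}|K(x,y)-K_0(x,y)|^s\,dx\right)^{1/s}\le C R^{-d/s'}\left(\frac{R}{\rho(x_0)}\right)^{\delta}$$ whenever $|y-x_0|<R/2$ and $R\le\rho(x_0)$. Then for each $\theta\ge0$, every weight $w$ and every $f$, $$w(\{|Tf|>\lambda\})\le\frac{C_\theta}{\lambda}\int|f|\,M_{s'}^\theta w\qquad\text{for all }\lambda>0.$$ (ii) Suppose that for each $N>0$ there exists $C_N$ such that $$|K(x,y)|\le\frac{C_N}{|x-y|^d}\left(1+\frac{|x-y|}{\rho(x)}\right)^{-N}\qquad (x\neq y),$$ and that there exist $C,\delta>0$ such that $$|K(x,y)-K_0(x,y)|\le\frac{C}{|x-y|^d}\left(\frac{|x-y|}{\rho(y)}\right)^{\delta}\qquad (x\ne y).$$ Then for each $\theta\ge0$, every Young function $A\in\bigcup_{p>1}\mathcal{D}_p$, every weight $w$ and every $f$, $$w(\{|Tf|>\lambda\})\le\frac{C_\theta}{\lambda}\int|f|\,(M_A^{\mathrm{loc}}+M^\theta)w\qquad\text{for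 all }\lambda>0,$$ and the same inequality holds with $T$ replaced by its adjoint $T^\star$. The constants $C_\theta$ do not depend on $f$, $w$ or $\lambda$.
   Context: For $1\le t\le\infty$, $t'$ is the conjugate exponent. A weight is a function $w\ge0$ in $L^1_{\mathrm{loc}}(\mathbb{R}^d)$, and $w(E)=\int_E w$. The function $f$ ranges over bounded measurable functions with compact support. A critical radius function is a function $\rho:\mathbb{R}^d\to(0,\infty)$ for which there are constants $C_0,N_0\ge1$ such that for all $x,y$ $$C_0^{-1}\rho(x)\left(1+\tfrac{|x-y|}{\rho(x)}\right)^{-N_0}\le\rho(y)\le C_0\,\rho(x)\left(1+\tfrac{|x-y|}{\rho(x)}\right)^{\frac{N_0}{N_0+1}}.$$ A Young function is a continuous, convex, increasing $A:[0,\infty)\to[0,\infty)$ with $A(0)=0$. For a ball $B$, $\|f\|_{A,B}=\inf\{\lambda>0:\frac1{|B|}\int_B A(|f|/\lambda)\le1\}$. For $1<p<\infty$, $\mathcal{D}_p$ is the class of Young functions $A$ such that $\int_c^\infty (t/A(t))^{p'-1}\frac{dt}{t}<\infty$ for some $c>0$. Maximal operators: $M_A^{\mathrm{loc}}f(x)=\sup\|f\|_{A,B}$, the supremum over balls $B=B(x_0,r_0)\ni x$ with $r_0\le\rho(x_0)$; and for $\theta\ge0$, $M_A^\theta f(x)=\sup_{B(x_0,r_0)\ni x}\left(1+\frac{r_0}{\rho(x_0)}\right)^{-\theta}\|f\|_{A,B(x_0,r_0)}$. When $A(t)=t^r$ write $M_r^{\mathrm{loc}},M_r^\theta$; $M^\theta=M_1^\theta$.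 Calderón-Zygmund operators are understood in the standard sense ($L^2$-bounded, with a kernel satisfying the standard size and smoothness conditions in both variables). "$T$ has associated kernel $K$" means that $Tg(x)=\int K(x,y)g(y)\,dy$ for a.e. $x$ outside the support of $g$ and, when $T$ is compared with $T_0$ of kernel $K_0$, that $T-T_0$ is the integral operator with kernel $K-K_0$. The adjoint $T^\star$ has the kernel with variables interchanged: $T^\star g(y)=\int K(x,y)g(x)\,dx$ for $y$ outside the support of $g$, and $T^\star-T_0^\star$ is the integral operator with kernel $(y,x)\mapsto K(x,y)-K_0(x,y)$. *)

theory Defs
  imports "HOL-Analysis.Analysis"
begin

(* Euclidean d-space is an arbitrary type 'a of class euclidean_space, with d = DIM('a).
   "Measurable" means Lebesgue measurable.  Functions and kernels are complex-valued. *)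

definition conj_exp :: "real \<Rightarrow> real" where
  "conj_exp p = p / (p - 1)"

(* Only used with exponent a > 0; thus the value at infinity is infinity. *)
definition epowr :: "ennreal \<Rightarrow> real \<Rightarrow> ennreal" where
  "epowr x a = (if x = \<infinity> then \<infinity> else ennreal (enn2real x powr a))"

definition critical_radius :: "('a::euclidean_space \<Rightarrow> real) \<Rightarrow> bool" where
  "critical_radius \<rho> \<longleftrightarrow> (\<forall>x. 0 < \<rho> x) \<and>
     (\<exists>C0\<ge>1. \<exists>N0\<ge>1. \<forall>x y.
        inverse C0 * \<rho> x * (1 + dist x y / \<rho> x) powr (- N0) \<le> \<rho> y \<and>
        \<rho> y \<le> C0 * \<rho> x * (1 + dist x y / \<rho> x) powr (N0 / (N0 + 1)))"

definition weight :: "('a::euclidean_space \<Rightarrow> real) \<Rightarrow> bool" where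
  "weight w \<longleftrightarrow> w \<in> borel_measurable lebesgue \<and> (\<forall>x. 0 \<le> w x) \<and>
     (\<forall>S. compact S \<longrightarrow> set_integrable lebesgue S w)"

definition wmeasure :: "('a::euclidean_space \<Rightarrow> real) \<Rightarrow> 'a set \<Rightarrow> ennreal" where
  "wmeasure w E = (\<integral>\<^sup>+x\<in>E. ennreal (w x) \<partial>lebesgue)"

definition fun_support :: "('a::euclidean_space \<Rightarrow> complex) \<Rightarrow> 'a set" where
  "fun_support f = closure {x. f x \<noteq> 0}"

definition bdd_compact_supp :: "('a::euclidean_space \<Rightarrow> complex) set" where
  "bdd_compact_supp =
     {f. f \<in> borel_measurable lebesgue \<and> bounded (range f) \<and> compact (fun_support f)}"


(* Only the values of A on the half-line t >= 0 matter.  "Increasing" is taken in the weak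
   sense, the more general reading. *)
definition young_function :: "(real \<Rightarrow> real) \<Rightarrow> bool" where
  "young_function A \<longleftrightarrow> continuous_on {0..} A \<and> convex_on {0..} A \<and> mono_on {0..} A \<and>
     (\<forall>t\<ge>0. 0 \<le> A t) \<and> A 0 = 0"

(* The infimum of the empty set is infinity in ennreal. *)
definition luxemburg :: "(real \<Rightarrow> real) \<Rightarrow> 'a::euclidean_space set \<Rightarrow> ('a \<Rightarrow> real) \<Rightarrow> ennreal" where
  "luxemburg A B f = Inf {ennreal l | l::real. 0 < l \<and>
     (\<integral>\<^sup>+x\<in>B. ennreal (A (\<bar>f x\<bar> / l)) \<partial>lebesgue) / emeasure lebesgue B \<le> 1}"

(* The quotient t / A t is taken in ennreal, so that it is infinity (and not 0, as it would be
   for reals) where A t = 0 and t > 0. *)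
definition D_class :: "real \<Rightarrow> (real \<Rightarrow> real) set" where
  "D_class p = {A. young_function A \<and>
     (\<exists>c>0. (\<integral>\<^sup>+t\<in>{c..}. epowr (ennreal t / ennreal (A t)) (conj_exp p - 1) * ennreal (1 / t)
              \<partial>lebesgue) < \<infinity>)}"

definition M_loc :: "('a::euclidean_space \<Rightarrow> real) \<Rightarrow> (real \<Rightarrow> real) \<Rightarrow> ('a \<Rightarrow> real) \<Rightarrow> 'a \<Rightarrow> ennreal" where
  "M_loc \<rho> A f x =
     (SUP (x0, r0) \<in> {(x0, r0). 0 < r0 \<and> r0 \<le> \<rho> x0 \<and> x \<in> ball x0 r0}. luxemburg A (ball x0 r0) f)"

definition M_theta ::
    "('a::euclidean_space \<Rightarrow> real) \<Rightarrow> real \<Rightarrow> (real \<Rightarrow> real) \<Rightarrow> ('a \<Rightarrow> real) \<Rightarrow> 'a \<Rightarrow> ennreal" where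
  "M_theta \<rho> \<theta> A f x =
     (SUP (x0, r0) \<in> {(x0, r0). 0 < r0 \<and> x \<in> ball x0 r0}.
        ennreal ((1 + r0 / \<rho> x0) powr (- \<theta>)) * luxemburg A (ball x0 r0) f)"

definition M_theta_pow ::
    "('a::euclidean_space \<Rightarrow> real) \<Rightarrow> real \<Rightarrow> real \<Rightarrow> ('a \<Rightarrow> real) \<Rightarrow> 'a \<Rightarrow> ennreal" where
  "M_theta_pow \<rho> \<theta> r = M_theta \<rho> \<theta> (\<lambda>t. t powr r)"


(* Operators act on everywhere defined functions; all identities hold almost everywhere. *)
definition linear_operator_on ::
    "('a::euclidean_space \<Rightarrow> complex) set \<Rightarrow> (('a \<Rightarrow> complex) \<Rightarrow> ('a \<Rightarrow> complex)) \<Rightarrow> bool" where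
  "linear_operator_on D T \<longleftrightarrow>
     (\<forall>f\<in>D. T f \<in> borel_measurable lebesgue) \<and>
     (\<forall>f\<in>D. \<forall>g\<in>D. AE x in lebesgue. T (\<lambda>z. f z + g z) x = T f x + T g x) \<and>
     (\<forall>f\<in>D. \<forall>c. AE x in lebesgue. T (\<lambda>z. c * f z) x = c * T f x)"

definition has_kernel ::
    "(('a::euclidean_space \<Rightarrow> complex) \<Rightarrow> ('a \<Rightarrow> complex)) \<Rightarrow> ('a \<Rightarrow> 'a \<Rightarrow> complex) \<Rightarrow> bool" where
  "has_kernel T K \<longleftrightarrow>
     (\<lambda>(x, y). K x y) \<in> borel_measurable lebesgue \<and>
     (\<forall>g\<in>bdd_compact_supp. AE x in lebesgue. x \<notin> fun_support g \<longrightarrow>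
        integrable lebesgue (\<lambda>y. K x y * g y) \<and> T g x = (LINT y|lebesgue. K x y * g y))"

definition diff_integral_operator ::
    "(('a::euclidean_space \<Rightarrow> complex) \<Rightarrow> ('a \<Rightarrow> complex)) \<Rightarrow> ('a \<Rightarrow> 'a \<Rightarrow> complex) \<Rightarrow>
     (('a \<Rightarrow> complex) \<Rightarrow> ('a \<Rightarrow> complex)) \<Rightarrow> ('a \<Rightarrow> 'a \<Rightarrow> complex) \<Rightarrow> bool" where
  "diff_integral_operator T K T0 K0 \<longleftrightarrow>
     (\<forall>g\<in>bdd_compact_supp. AE x in lebesgue.
        integrable lebesgue (\<lambda>y. (K x y - K0 x y) * g y) \<and>
        T g x - T0 g x = (LINT y|lebesgue. (K x y - K0 x y) * g y))"

definition L2_functions :: "('a::euclidean_space \<Rightarrow> complex) set" where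
  "L2_functions = {f. f \<in> borel_measurable lebesgue \<and> integrable lebesgue (\<lambda>x. (cmod (f x))\<^sup>2)}"

definition L2_fun_norm :: "('a::euclidean_space \<Rightarrow> complex) \<Rightarrow> real" where
  "L2_fun_norm f = sqrt (LINT x|lebesgue. (cmod (f x))\<^sup>2)"

definition cz_kernel :: "('a::euclidean_space \<Rightarrow> 'a \<Rightarrow> complex) \<Rightarrow> bool" where
  "cz_kernel K \<longleftrightarrow>
     (\<exists>C \<gamma>. 0 < \<gamma> \<and> \<gamma> \<le> 1 \<and>
        (\<forall>x y. x \<noteq> y \<longrightarrow> cmod (K x y) \<le> C / dist x y ^ DIM('a)) \<and>
        (\<forall>x x' y. x \<noteq> y \<longrightarrow> 2 * dist x x' \<le> dist x y \<longrightarrow>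
           cmod (K x y - K x' y) + cmod (K y x - K y x')
             \<le> C * dist x x' powr \<gamma> / dist x y powr (real DIM('a) + \<gamma>)))"

definition calderon_zygmund ::
    "(('a::euclidean_space \<Rightarrow> complex) \<Rightarrow> ('a \<Rightarrow> complex)) \<Rightarrow> ('a \<Rightarrow> 'a \<Rightarrow> complex) \<Rightarrow> bool" where
  "calderon_zygmund T K \<longleftrightarrow>
     linear_operator_on L2_functions T \<and>
     (\<exists>C. \<forall>f\<in>L2_functions. T f \<in> L2_functions \<and> L2_fun_norm (T f) \<le> C * L2_fun_norm f) \<and>
     cz_kernel K \<and> has_kernel T K"

(* Adjoint with respect to the bilinear pairing (the integral of f g), so that its kernel is
   K(y,x) without complex conjugation.  The Hermitian adjoint is obtained from it by
   conjugating both input and output, which changes neither |f| nor the modulus of the image. *)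
definition adjoint_operator ::
    "(('a::euclidean_space \<Rightarrow> complex) \<Rightarrow> ('a \<Rightarrow> complex)) \<Rightarrow>
     (('a \<Rightarrow> complex) \<Rightarrow> ('a \<Rightarrow> complex)) \<Rightarrow> bool" where
  "adjoint_operator T T' \<longleftrightarrow>
     linear_operator_on bdd_compact_supp T' \<and>
     (\<forall>f\<in>bdd_compact_supp. \<forall>g\<in>bdd_compact_supp.
        integrable lebesgue (\<lambda>x. T f x * g x) \<and> integrable lebesgue (\<lambda>y. f y * T' g y) \<and>
        (LINT x|lebesgue. T f x * g x) = (LINT y|lebesgue. f y * T' g y))"


definition annulus :: "'a::euclidean_space \<Rightarrow> real \<Rightarrow> 'a set" where
  "annulus x0 R = {x. R < dist x0 x \<and> dist x0 x < 2 * R}"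

definition Ls_norm_on :: "real \<Rightarrow> 'a::euclidean_space set \<Rightarrow> ('a \<Rightarrow> complex) \<Rightarrow> ennreal" where
  "Ls_norm_on s E F = epowr (\<integral>\<^sup>+x\<in>E. ennreal (cmod (F x) powr s) \<partial>lebesgue) (1 / s)"

definition kernel_size_Ls ::
    "('a::euclidean_space \<Rightarrow> real) \<Rightarrow> real \<Rightarrow> ('a \<Rightarrow> 'a \<Rightarrow> complex) \<Rightarrow> bool" where
  "kernel_size_Ls \<rho> s K \<longleftrightarrow>
     (\<forall>N>0. \<exists>C::real. \<forall>x0 y R. 0 < R \<and> dist y x0 < R / 2 \<longrightarrow>
        Ls_norm_on s (annulus x0 R) (\<lambda>x. K x y)
          \<le> ennreal (C * R powr (- (real DIM('a) / conj_exp s)) * (1 + R / \<rho> x0) powr (- N)))"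

definition kernel_diff_Ls ::
    "('a::euclidean_space \<Rightarrow> real) \<Rightarrow> real \<Rightarrow> ('a \<Rightarrow> 'a \<Rightarrow> complex) \<Rightarrow> ('a \<Rightarrow> 'a \<Rightarrow> complex) \<Rightarrow> bool" where
  "kernel_diff_Ls \<rho> s K K0 \<longleftrightarrow>
     (\<exists>(C::real) \<delta>. 0 < C \<and> 0 < \<delta> \<and> (\<forall>x0 y R. 0 < R \<and> dist y x0 < R / 2 \<and> R \<le> \<rho> x0 \<longrightarrow>
        Ls_norm_on s (annulus x0 R) (\<lambda>x. K x y - K0 x y)
          \<le> ennreal (C * R powr (- (real DIM('a) / conj_exp s)) * (R / \<rho> x0) powr \<delta>)))"

definition kernel_size_ptw ::
    "('a::euclidean_space \<Rightarrow> real) \<Rightarrow> ('a \<Rightarrow> 'a \<Rightarrow> complex) \<Rightarrow> bool" where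
  "kernel_size_ptw \<rho> K \<longleftrightarrow>
     (\<forall>N>0. \<exists>C. \<forall>x y. x \<noteq> y \<longrightarrow>
        cmod (K x y) \<le> C / dist x y ^ DIM('a) * (1 + dist x y / \<rho> x) powr (- N))"

definition kernel_diff_ptw ::
    "('a::euclidean_space \<Rightarrow> real) \<Rightarrow> ('a \<Rightarrow> 'a \<Rightarrow> complex) \<Rightarrow> ('a \<Rightarrow> 'a \<Rightarrow> complex) \<Rightarrow> bool" where
  "kernel_diff_ptw \<rho> K K0 \<longleftrightarrow>
     (\<exists>C \<delta>. 0 < C \<and> 0 < \<delta> \<and> (\<forall>x y. x \<noteq> y \<longrightarrow>
        cmod (K x y - K0 x y) \<le> C / dist x y ^ DIM('a) * (dist x y / \<rho> y) powr \<delta>))"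

end

theory Submission
 imports Defs
begin

text \<open>T is compared with T0 near the support of f, and far from it the size of the kernel suffices.
For T0 the inequality holds with the full maximal operator MA: the weak (1,1) bound of T0 and of a
dyadic maximal operator gives a sparse pointwise domination of T0 f by averages. Grouping the cubes
of a chain by the Luxemburg norm of the weight and summing the groups by the D_p condition turns
this, via Carleson embedding, into a bound of T0 from L^p(MA v) to L^p(v), from which a weighted
Calderon-Zygmund decomposition yields the weak-type bound.

The passage from T0 to T uses maximal dyadic cubes q of side comparable to the critical radius,
whose neighbourhoods nb q have bounded overlap. For f supported in q, on nb q one has T f = T0 f
plus the integral of K - K0, which is summed over annuli of at most critical radius; there only
balls of at most critical radius matter, so that MA reduces to its local version. Off nb q the
decay of K is summed over larger annuli. For (i) take A(t) = t^s', which lies in some D_p.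

For the adjoint, T* minus the transposed difference operator is the formal adjoint of T0; duality
and Fubini show that it is again a Calderon-Zygmund operator, so that the same argument applies.\<close>

text \<open>No doubling or A_p condition on the weight v is at hand, so the D_p condition has to act
  on finite sums. Fix a point x with V = v x and the chain of sparse cubes around it. Hoelder's
  inequality with suitable weights splits the sum of averages into a dual sum of ((V / 2^m) / (1 + A
  (V / 2^m)))^(1 / (p - 1)) over the levels m, which D_p bounds independently of V, and a sum in
  which V appears only inside 1 + A (V / 2^m); the latter is integrable, because on a cube of level
  m the function 1 + A (v / 2^m) has mean at most 2. To pass from the L^p bound to the weak-type
  bound, the maximal weight should be nearly constant on the Calderon-Zygmund cubes; cutting the
  weight off on their neighbourhoods brings this about. For T the difficulty is that weak-type
  bounds cannot be added: bounded overlap replaces addition by a pigeonhole argument with a fixed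
  loss. Throughout, measurability is Lebesgue measurability, for which Fubini's theorem on a product
  space needs Borel versions of the kernels.\<close>

abbreviation (input) lmeas :: "('a::euclidean_space \<Rightarrow> 'b::topological_space) set" where
 "lmeas \<equiv> borel_measurable lebesgue"
abbreviation (input) bcs :: "('a::euclidean_space \<Rightarrow> complex) set" where "bcs \<equiv> bdd_compact_supp"
abbreviation (input) lintegrable :: "('a::euclidean_space \<Rightarrow> 'b::{banach,second_countable_topology}) \<Rightarrow> bool" where "lintegrable \<equiv> integrable lebesgue"
abbreviation (input) en :: "real \<Rightarrow> ennreal" where "en \<equiv> ennreal"
abbreviation (input) enorm :: "complex \<Rightarrow> ennreal" where "enorm z \<equiv> en (cmod z)"
abbreviation (input) lebesgue_emeasure :: "'a::euclidean_space set \<Rightarrow> ennreal" ("\<mu>") where "\<mu> \<equiv> emeasure lebesgue"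

syntax
 "_leb_integral" :: "pttrn \<Rightarrow> ennreal \<Rightarrow> ennreal" ("(\<integral>_./ _)" [0, 10] 10)
 "_leb_integral_on" :: "pttrn \<Rightarrow> 'a set \<Rightarrow> ennreal \<Rightarrow> ennreal" ("(\<integral>_\<in>_./ _)" [0, 51, 10] 10)
 "_nn_sum" :: "pttrn \<Rightarrow> 'a set \<Rightarrow> ennreal \<Rightarrow> ennreal" ("(\<Sum>\<^sup>+_\<in>_./ _)" [0, 51, 10] 10)
 "_leb_LINT" :: "pttrn \<Rightarrow> 'b \<Rightarrow> 'b" ("(LINT _./ _)" [0, 10] 10)
 "_leb_AE" :: "pttrn \<Rightarrow> bool \<Rightarrow> bool" ("(AE _./ _)" [0, 10] 10)
translations
 "\<integral>x. F" \<rightharpoonup> "CONST nn_integral (CONST completion CONST lborel) (\<lambda>x. F)"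
 "\<integral>x\<in>A. F" \<rightharpoonup> "CONST set_nn_integral (CONST completion CONST lborel) A (\<lambda>x. F)"
 "\<Sum>\<^sup>+x\<in>A. F" \<rightharpoonup> "CONST nn_integral (CONST count_space A) (\<lambda>x. F)"
 "LINT x. F" \<rightharpoonup> "CONST lebesgue_integral (CONST completion CONST lborel) (\<lambda>x. F)"
 "AE x. P" \<rightharpoonup> "CONST almost_everywhere (CONST completion CONST lborel) (\<lambda>x. P)"

lemma bm_ennreal: "f : borel_measurable M ==> (%x. ennreal (f x)) : borel_measurable M"
 by (rule measurable_compose[OF _ measurable_ennreal])

lemma bm_cmod: "f : borel_measurable M ==> (%x. cmod (f x)) : borel_measurable M"
 by (rule measurable_compose[OF _ borel_measurable_norm])

lemma bm_enorm: "f : borel_measurable M ==> (%x. enorm (f x)) : borel_measurable M"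
 by (intro bm_ennreal bm_cmod)

lemma bm_on: "f : borel_measurable M ==> A : sets M ==> (%x. f x * indicator A x :: ennreal) : borel_measurable M"
 by (intro borel_measurable_times_ennreal borel_measurable_indicator)

subsection \<open>Dyadic cubes\<close>

(* The cube with code (k, n) is the product of the intervals [n_i / 2^k, (n_i + 1) / 2^k): larger
  levels are smaller cubes. *)
definition idx :: "int => 'a::euclidean_space => 'a" where
 "idx k x = (\<Sum>i\<in>Basis. of_int \<lfloor>2 powi k * (x \<bullet> i)\<rfloor> *\<^sub>R i)"

definition zvec :: "'a::euclidean_space set" where
 "zvec = {u. \<forall>i\<in>Basis. u \<bullet> i : \<int>}"

definition cub :: "int \<times> 'a::euclidean_space => 'a set" where
 "cub q = {x. idx (fst q) x = snd q}"

definition side :: "int \<times> 'a::euclidean_space => real" where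
 "side q = 2 powi (- fst q)"

definition vol :: "int \<times> 'a::euclidean_space => real" where
 "vol q = side q ^ DIM('a)"

(* The width 2 d makes the distance from cub q to the complement of nb q at least twice the
  diameter of cub q, as needed for the smoothness condition on kernels. *)
definition nb :: "int \<times> 'a::euclidean_space => 'a set" where
 "nb q = {x. \<forall>i\<in>Basis. \<bar>idx (fst q) x \<bullet> i - snd q \<bullet> i\<bar> <= 2 * real DIM('a)}"

definition dq :: "int => 'a::euclidean_space => int \<times> 'a" where
 "dq k x = (k, idx k x)"

text \<open>A code whose second component is not integral denotes the empty set although its
  \<open>vol\<close> is positive; membership in \<open>cubes\<close> excludes such codes.\<close>

definition cubes :: "(int \<times> 'a::euclidean_space) set" where
 "cubes = UNIV \<times> zvec"

lemma idx_inner [simp]: "i : Basis ==> idx k x \<bullet> i = of_int \<lfloor>2 powi k * (x \<bullet> i)\<rfloor>" by (simp add: idx_def)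

lemma idx_zvec [simp]: "idx k x : zvec" by (simp add: zvec_def)

lemma fst_dq [simp]: "fst (dq k x) = k" and snd_dq [simp]: "snd (dq k x) = idx k x" by (simp_all add: dq_def)

lemma dq_cubes [simp]: "dq k x : cubes" by (simp add: dq_def cubes_def)

lemma mem_cub_dq [simp]: "x : cub (dq k x)" by (simp add: cub_def)

lemma side_pos [simp]: "0 < side q" by (simp add: side_def)

lemma vol_pos [simp]: "0 < vol q" by (simp add: vol_def)

lemma mem_cub_iff: "x : cub q \<longleftrightarrow> q = dq (fst q) x" by (cases q) (auto simp: cub_def dq_def)

text \<open>Nesting of the grids comes from floor (t / m) = floor t div m for a natural number m >
  0, applied to each coordinate.\<close>

lemma idx_coarsen_inner:
 assumes "j <= k" "i : Basis"
 shows "\<lfloor>2 powi j * (x \<bullet> i)\<rfloor> = \<lfloor>2 powi k * (x \<bullet> i)\<rfloor> div 2 ^ nat (k - j)"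
proof -
 have "(2::real) powi k = 2 powi j * 2 powi (k - j)" using assms by (simp flip: power_int_add)
 also have "(2::real) powi (k - j) = 2 ^ nat (k - j)" using assms by (simp add: power_int_def)
 finally have "2 powi j * (x \<bullet> i) = 2 powi k * (x \<bullet> i) / real_of_int (2 ^ nat (k - j))" by simp
 thus ?thesis using floor_divide_real_eq_div[of "2 ^ nat (k - j)" "2 powi k * (x \<bullet> i)"] by simp
qed

lemma euclidean_eq_iff_zvec: "idx k x = idx k y \<longleftrightarrow> (\<forall>i\<in>Basis. \<lfloor>2 powi k * (x \<bullet> i)\<rfloor> = \<lfloor>2 powi k * (y \<bullet> i)\<rfloor>)"
 by (subst euclidean_eq_iff) auto

lemma idx_coarsen: "j <= k ==> idx k x = idx k y ==> idx j x = idx j y" unfolding euclidean_eq_iff_zvec by (metis idx_coarsen_inner)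

lemma cub_eq_dq: "x : cub q ==> q = dq (fst q) x" by (simp add: mem_cub_iff)

lemma dq_coarsen: "j <= k ==> y : cub (dq k x) ==> dq j y = dq j x" using idx_coarsen[of j k y x] by (auto simp: cub_def dq_def)

lemma cub_mono: "j <= k ==> cub (dq k x) <= cub (dq j x)" using dq_coarsen by (metis mem_cub_dq subsetI)

lemma nb_iff: "y : nb (dq k x) \<longleftrightarrow>
  (\<forall>i\<in>Basis. \<bar>\<lfloor>2 powi k * (y \<bullet> i)\<rfloor> - \<lfloor>2 powi k * (x \<bullet> i)\<rfloor>\<bar> <= 2 * int DIM('a))"
 for x y :: "'a::euclidean_space"
proof -
 have "\<bar>real_of_int a - real_of_int b\<bar> <= 2 * real n \<longleftrightarrow> \<bar>a - b\<bar> <= 2 * int n" for a b n by linarith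
 thus ?thesis unfolding nb_def by auto
qed

lemma nb_sym: "y : nb (dq k x) \<longleftrightarrow> x : nb (dq k y)" unfolding nb_iff by (simp add: abs_minus_commute)

text \<open>For \<open>nb_coarsen\<close>: passing to an ancestor divides integer coordinates, which
  cannot enlarge a bound on their difference. Thus neighbourhoods, and not only cubes, increase
  along a chain of ancestors.\<close>

lemma int_div_diff_le:
 fixes a b c M :: int
 assumes "\<bar>a - b\<bar> <= M" "c >= 1"
 shows "\<bar>a div c - b div c\<bar> <= M"
proof -
 have *: "a div c <= b div c + M" if "a <= b + M" "0 <= M" for a b :: int
 proof -
  have "a <= b + M * c" using that assms(2) by (smt (verit, best) mult_le_cancel_left1)
  hence "a div c <= (b + M * c) div c" using assms(2) by (intro zdiv_mono1) auto
  also have "... = b div c + M" using assms(2) by simp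
  finally show ?thesis .
 qed
 have "a div c <= b div c + M" "b div c <= a div c + M" using assms by (auto intro!: *)
 thus ?thesis by linarith
qed

lemma nb_coarsen:
 assumes "j <= k" "y : nb (dq k x)"
 shows "y : nb (dq j x)" using assms unfolding nb_iff by (auto simp: idx_coarsen_inner[OF assms(1)] intro!: int_div_diff_le)

lemma nb_mono: "j <= k ==> nb (dq k x) <= nb (dq j x)" using nb_coarsen by blast

lemma cub_subset_nb: "cub q <= nb q"
proof
 fix x assume "x : cub q"
 hence "snd q = idx (fst q) x" by (simp add: cub_def)
 thus "x : nb q" by (simp add: nb_def)
qed

lemma mem_nb_dq [simp]: "x : nb (dq k x)" using cub_subset_nb mem_cub_dq by blast

lemma idx_measurable [measurable]: "idx k : borel_measurable borel" unfolding idx_def by measurable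

lemma cub_borel [measurable, simp]: "cub q : sets borel"
proof -
 have "cub q = idx (fst q) -` {snd q} Int space borel" by (auto simp: cub_def)
 moreover have "idx (fst q) -` {snd q} Int space borel : sets borel" by (rule measurable_sets[OF idx_measurable]) simp
 ultimately show ?thesis by simp
qed

lemma nb_borel [measurable, simp]: "nb q : sets borel"
proof -
 have "nb q = idx (fst q) -` {y. \<forall>i\<in>Basis. \<bar>y \<bullet> i - snd q \<bullet> i\<bar> <= 2 * real DIM('a)} Int space borel"
  by (auto simp: nb_def)
 moreover have cl: "closed {y. \<forall>i\<in>Basis. \<bar>y \<bullet> i - snd q \<bullet> i\<bar> <= 2 * real DIM('a)}"
 proof -
  have "{y. \<forall>i\<in>Basis. \<bar>y \<bullet> i - snd q \<bullet> i\<bar> <= 2 * real DIM('a)} =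
   (\<Inter>i\<in>Basis. {y. \<bar>y \<bullet> i - snd q \<bullet> i\<bar> <= 2 * real DIM('a)})" by auto
  thus ?thesis by (auto intro!: closed_INT closed_Collect_le continuous_intros)
 qed
 ultimately show ?thesis using measurable_sets[OF idx_measurable borel_closed[OF cl]] by simp
qed

lemma cub_lebesgue [measurable, simp]: "cub q : sets lebesgue"
 and nb_lebesgue [measurable, simp]: "nb q : sets lebesgue" by simp_all

lemma mem_cub_zvec: fixes n :: "'a::euclidean_space" shows "n : zvec ==> (1 / 2 powi k) *\<^sub>R n : cub (k, n)"
proof -
 assume n: "n : zvec"
 have "idx k ((1 / 2 powi k) *\<^sub>R n) = n"
 proof (rule euclidean_eqI)
  fix i :: 'a assume i: "i : Basis"
  with n obtain z where "n \<bullet> i = real_of_int z" by (auto simp: zvec_def Ints_def)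
  thus "idx k ((1 / 2 powi k) *\<^sub>R n) \<bullet> i = n \<bullet> i" using i by simp
 qed
 thus ?thesis by (simp add: cub_def)
qed

lemma cubes_ex: assumes "q : cubes" shows "\<exists>x. q = dq (fst q) x" using assms mem_cub_zvec[of "snd q" "fst q"] unfolding cubes_def
 by (auto simp: mem_cub_iff)

lemma cub_ne: "q : cubes ==> cub q ~= {}" using cubes_ex mem_cub_dq by (metis empty_iff)

text \<open>The half-open cube lies between the open and the closed box with the same corners, and
  these two have the same volume.\<close>

lemma emeasure_cub:
 fixes q :: "int \<times> 'a::euclidean_space"
 assumes "q : cubes"
 shows "\<mu> (cub q) = en (vol q)"
proof -
 obtain k n where q: "q = (k, n)" "n : zvec" using assms by (auto simp: cubes_def)
 define s where "s = (1::real) / 2 powi k"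
 have s: "s > 0" "2 powi k = 1 / s" by (auto simp: s_def)
 have mem: "x : cub q \<longleftrightarrow> (\<forall>i\<in>Basis. n \<bullet> i <= 2 powi k * (x \<bullet> i) & 2 powi k * (x \<bullet> i) < n \<bullet> i + 1)" for x
 proof -
  have "x : cub q \<longleftrightarrow> (\<forall>i\<in>Basis. real_of_int \<lfloor>2 powi k * (x \<bullet> i)\<rfloor> = n \<bullet> i)"
   unfolding cub_def q by (subst euclidean_eq_iff) auto
  also have "... \<longleftrightarrow> (\<forall>i\<in>Basis. n \<bullet> i <= 2 powi k * (x \<bullet> i) & 2 powi k * (x \<bullet> i) < n \<bullet> i + 1)"
  proof (intro ball_cong refl)
   fix i :: 'a assume "i : Basis"
   with q(2) obtain z where z: "n \<bullet> i = real_of_int z" by (auto simp: zvec_def Ints_def)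
   show "real_of_int \<lfloor>2 powi k * (x \<bullet> i)\<rfloor> = n \<bullet> i \<longleftrightarrow> n \<bullet> i <= 2 powi k * (x \<bullet> i) & 2 powi k * (x \<bullet> i) < n \<bullet> i + 1"
    unfolding z by (simp add: floor_eq_iff)
  qed
  finally show ?thesis .
 qed
 define a b where "a = s *\<^sub>R n" and "b = s *\<^sub>R (n + One)"
 have ab: "b \<bullet> i - a \<bullet> i = s" "a \<bullet> i <= b \<bullet> i" if "i : Basis" for i
  using that s by (auto simp: a_def b_def inner_add_left algebra_simps)
 have 1: "box a b <= cub q"
 proof
  fix x assume x: "x : box a b"
  show "x : cub q" unfolding mem
  proof
   fix i :: 'a assume i: "i : Basis"
   have "s * (n \<bullet> i) < x \<bullet> i" "x \<bullet> i < s * (n \<bullet> i + 1)" using x i by (auto simp: a_def b_def mem_box inner_add_left)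
   thus "n \<bullet> i <= 2 powi k * (x \<bullet> i) & 2 powi k * (x \<bullet> i) < n \<bullet> i + 1"
    unfolding s(2) using s(1) by (simp add: field_simps)
  qed
 qed
 have 2: "cub q <= cbox a b"
 proof
  fix x assume x: "x : cub q"
  show "x : cbox a b" unfolding mem_box
  proof
   fix i :: 'a assume i: "i : Basis"
   show "a \<bullet> i <= x \<bullet> i & x \<bullet> i <= b \<bullet> i"
    using x i s(1) unfolding mem s(2) by (auto simp: a_def b_def inner_add_left field_simps)
  qed
 qed
 have pr: "(\<Prod>i\<in>Basis. (b - a) \<bullet> i) = vol q"
 proof -
  have "side q = s" by (simp add: side_def q s_def power_int_minus divide_inverse)
  moreover have "(\<Prod>i\<in>Basis. (b - a) \<bullet> i) = (\<Prod>i\<in>(Basis::'a set). s)"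
   by (intro prod.cong refl) (simp add: inner_diff_left ab)
  ultimately show ?thesis by (simp add: vol_def)
 qed
 have "emeasure lborel (box a b) = vol q" "emeasure lborel (cbox a b) = vol q"
 proof -
  have abb: "\<forall>i\<in>Basis. a \<bullet> i <= b \<bullet> i" using ab(2) by blast
  show "emeasure lborel (box a b) = vol q" "emeasure lborel (cbox a b) = vol q"
   unfolding emeasure_lborel_box_eq emeasure_lborel_cbox_eq if_P[OF abb] pr by (rule refl)+
 qed
 hence "emeasure lborel (cub q) = vol q" using 1 2 emeasure_mono[OF 1, of lborel] emeasure_mono[OF 2, of lborel] by simp
 thus ?thesis by simp
qed

lemma norm_le_DIM:
 fixes x :: "'a::euclidean_space"
 assumes "!!i. i : Basis ==> \<bar>x \<bullet> i\<bar> <= c"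
 shows "norm x <= real DIM('a) * c"
proof -
 have "norm x <= (\<Sum>i\<in>Basis. \<bar>x \<bullet> i\<bar>)" by (rule norm_le_l1)
 also have "... <= (\<Sum>i\<in>(Basis::'a set). c)" by (intro sum_mono assms)
 finally show ?thesis by simp
qed

lemma floor_diff_bounds:
 fixes s t :: real
 shows "\<bar>\<lfloor>s\<rfloor> - \<lfloor>t\<rfloor>\<bar> <= M ==> \<bar>s - t\<bar> <= M + 1"
  and "\<not> \<bar>\<lfloor>s\<rfloor> - \<lfloor>t\<rfloor>\<bar> <= M ==> M <= \<bar>s - t\<bar>" by linarith+

lemma dist_nb_le:
 fixes x y :: "'a::euclidean_space"
 assumes "x : cub q" "y : nb q"
 shows "dist x y <= real DIM('a) * (2 * real DIM('a) + 1) * side q"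
proof -
 obtain k where q: "q = dq k x" using assms(1) cub_eq_dq by blast
 have "norm (x - y) <= real DIM('a) * ((2 * real DIM('a) + 1) * side q)"
 proof (rule norm_le_DIM)
  fix i :: 'a assume i: "i : Basis"
  have "\<bar>\<lfloor>2 powi k * (x \<bullet> i)\<rfloor> - \<lfloor>2 powi k * (y \<bullet> i)\<rfloor>\<bar> <= 2 * int DIM('a)"
   using assms(2) i unfolding q nb_iff by (simp add: abs_minus_commute)
  from floor_diff_bounds(1)[OF this]
  have "\<bar>2 powi k * (x \<bullet> i) - 2 powi k * (y \<bullet> i)\<bar> <= 2 * real DIM('a) + 1" by simp
  also have "2 powi k * (x \<bullet> i) - 2 powi k * (y \<bullet> i) = ((x - y) \<bullet> i) * 2 powi k" by (simp add: inner_diff_left algebra_simps)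
  finally show "\<bar>(x - y) \<bullet> i\<bar> <= (2 * real DIM('a) + 1) * side q" by (simp add: side_def q power_int_minus field_simps abs_mult)
 qed
 thus ?thesis by (simp add: dist_norm)
qed

lemma dist_cub_le:
 fixes x y :: "'a::euclidean_space"
 assumes "x : cub q" "y : cub q"
 shows "dist x y <= real DIM('a) * side q"
proof -
 obtain k where q: "q = dq k x" using assms(1) cub_eq_dq by blast
 have "norm (x - y) <= real DIM('a) * side q"
 proof (rule norm_le_DIM)
  fix i :: 'a assume i: "i : Basis"
  have "\<bar>\<lfloor>2 powi k * (x \<bullet> i)\<rfloor> - \<lfloor>2 powi k * (y \<bullet> i)\<rfloor>\<bar> <= 0"
   using assms(2) i euclidean_eq_iff_zvec[of k y x] unfolding q cub_def by simp
  from floor_diff_bounds(1)[OF this]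
  have "\<bar>2 powi k * (x \<bullet> i) - 2 powi k * (y \<bullet> i)\<bar> <= 1" by simp
  also have "2 powi k * (x \<bullet> i) - 2 powi k * (y \<bullet> i) = ((x - y) \<bullet> i) * 2 powi k" by (simp add: inner_diff_left algebra_simps)
  finally show "\<bar>(x - y) \<bullet> i\<bar> <= side q" by (simp add: side_def q power_int_minus field_simps abs_mult)
 qed
 thus ?thesis by (simp add: dist_norm)
qed

text \<open>Outside \<open>nb q\<close> some integer coordinate differs from that of
  \<open>q\<close> by at least 2 d + 1, so the rescaled coordinates themselves differ by at least 2
  d.\<close>

lemma dist_not_nb_ge:
 fixes x y :: "'a::euclidean_space"
 assumes "x : cub q" "y ~: nb q"
 shows "2 * real DIM('a) * side q <= dist x y"
proof -
 obtain k where q: "q = dq k x" using assms(1) cub_eq_dq by blast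
 then obtain i :: 'a where i: "i : Basis"
   "\<not> \<bar>\<lfloor>2 powi k * (x \<bullet> i)\<rfloor> - \<lfloor>2 powi k * (y \<bullet> i)\<rfloor>\<bar> <= 2 * int DIM('a)"
  using assms(2) unfolding q nb_iff by (auto simp: abs_minus_commute)
 from floor_diff_bounds(2)[OF i(2)]
 have "2 * real DIM('a) <= \<bar>2 powi k * (x \<bullet> i) - 2 powi k * (y \<bullet> i)\<bar>" by simp
 also have "2 powi k * (x \<bullet> i) - 2 powi k * (y \<bullet> i) = ((x - y) \<bullet> i) * 2 powi k" by (simp add: inner_diff_left algebra_simps)
 finally have "2 * real DIM('a) * side q <= \<bar>(x - y) \<bullet> i\<bar>" by (simp add: side_def q power_int_minus field_simps abs_mult)
 also have "... <= dist x y" using Basis_le_norm[OF i(1), of "x - y"] by (simp add: dist_norm)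
 finally show ?thesis .
qed

text \<open>The kernel represents the operator only off the closed support; the gap between
  \<open>cub q\<close> and the complement of \<open>nb q\<close> survives taking closures.\<close>

lemma cub_not_closure: "x : cub q ==> S Int nb q = {} ==> x ~: closure S"
 for x :: "'a::euclidean_space"
proof
 assume x: "x : cub q" "S Int nb q = {}" "x : closure S"
 have "0 < 2 * real DIM('a) * side q" by simp
 then obtain y where "y : S" "dist y x < 2 * real DIM('a) * side q" using x(3) closure_approachable by blast
 moreover have "2 * real DIM('a) * side q <= dist x y" using x \<open>y : S\<close> by (intro dist_not_nb_ge) auto
 ultimately show False by (simp add: dist_commute)
qed

lemma countable_zvec: "countable (zvec :: 'a::euclidean_space set)"
proof -
 have "countable (PiE (Basis::'a set) (%_. \<int>) :: ('a => real) set)" by (intro countable_PiE) (auto simp: Ints_def)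
 hence c: "countable ((%f. \<Sum>i\<in>Basis. f i *\<^sub>R i) ` (PiE (Basis::'a set) (%_. \<int>)))" by blast
 have "zvec <= (%f. \<Sum>i\<in>Basis. f i *\<^sub>R i) ` (PiE (Basis::'a set) (%_. \<int>))"
 proof
  fix u :: 'a assume u: "u : zvec"
  have "u = (\<Sum>i\<in>Basis. (restrict (%i. u \<bullet> i) Basis) i *\<^sub>R i)" by (simp add: euclidean_representation)
  moreover have "restrict (%i. u \<bullet> i) Basis : PiE (Basis::'a set) (%_. \<int>)" using u by (auto simp: zvec_def)
  ultimately show "u : (%f. \<Sum>i\<in>Basis. f i *\<^sub>R i) ` (PiE (Basis::'a set) (%_. \<int>))" by blast
 qed
 thus ?thesis using c countable_subset by blast
qed

lemma countable_cubes: "countable (cubes :: (int \<times> 'a::euclidean_space) set)" unfolding cubes_def using countable_zvec by blast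

lemma finite_zvec_bounded:
 "finite {u::'a::euclidean_space. u : zvec & (\<forall>i\<in>Basis. \<bar>u \<bullet> i\<bar> <= c)}" (is "finite ?U")
proof -
 have fin: "finite {r::real. r : \<int> & \<bar>r\<bar> <= c}"
 proof -
  have "{r::real. r : \<int> & \<bar>r\<bar> <= c} <= real_of_int ` {-\<lceil>c\<rceil>..\<lceil>c\<rceil>}"
  proof
   fix r :: real assume "r : {r. r : \<int> & \<bar>r\<bar> <= c}"
   then obtain z where "r = real_of_int z" "\<bar>real_of_int z\<bar> <= c" by (auto simp: Ints_def)
   thus "r : real_of_int ` {-\<lceil>c\<rceil>..\<lceil>c\<rceil>}" by (intro image_eqI[of _ _ z]) (auto, linarith+)
  qed
  thus ?thesis using finite_subset by blast
 qed
 have "finite ((%f. \<Sum>i\<in>Basis. f i *\<^sub>R i) ` (PiE (Basis::'a set) (%_. {r::real. r : \<int> & \<bar>r\<bar> <= c})))"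
  using fin by (intro finite_imageI finite_PiE) auto
 moreover have "?U <= (%f. \<Sum>i\<in>Basis. f i *\<^sub>R i) ` (PiE (Basis::'a set) (%_. {r. r : \<int> & \<bar>r\<bar> <= c}))"
 proof
  fix u :: 'a assume u: "u : ?U"
  have "u = (\<Sum>i\<in>Basis. (restrict (%i. u \<bullet> i) Basis) i *\<^sub>R i)" by (simp add: euclidean_representation)
  moreover have "restrict (%i. u \<bullet> i) Basis : PiE (Basis::'a set) (%_. {r. r : \<int> & \<bar>r\<bar> <= c})"
   using u by (auto simp: zvec_def)
  ultimately show "u : (%f. \<Sum>i\<in>Basis. f i *\<^sub>R i) ` (PiE (Basis::'a set) (%_. {r. r : \<int> & \<bar>r\<bar> <= c}))" by blast
 qed
 ultimately show ?thesis using finite_subset by blast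
qed

section \<open>Neighbourhoods as finite unions of cubes of the same level\<close>

definition offs :: "'a::euclidean_space set" where
 "offs = {u. u : zvec & (\<forall>i\<in>Basis. \<bar>u \<bullet> i\<bar> <= 2 * real DIM('a))}"

text \<open>The number of cubes of the level of \<open>q\<close> that make up \<open>nb q\<close>,
  namely (4 d + 1)^d.\<close>

definition nnb :: "'a::euclidean_space itself => real" where
 "nnb _ = real (card (offs :: 'a set))"

lemma finite_offs [simp]: "finite offs" unfolding offs_def by (rule finite_zvec_bounded)

lemma zero_offs: "0 : offs" by (simp add: offs_def zvec_def)

lemma nnb_ge1: "nnb TYPE('a::euclidean_space) >= 1"
proof -
 have "card (offs :: 'a set) > 0" using zero_offs finite_offs card_gt_0_iff by blast
 thus ?thesis unfolding nnb_def by linarith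
qed

lemma zvec_add: "u : zvec ==> v : zvec ==> u + v : zvec"
 and zvec_diff: "u : zvec ==> v : zvec ==> u - v : zvec" by (auto simp: zvec_def inner_add_left inner_diff_left)

lemma nb_eq_Union:
 fixes q :: "int \<times> 'a::euclidean_space"
 assumes "q : cubes"
 shows "nb q = (\<Union>u\<in>offs. cub (fst q, snd q + u))"
proof safe
 fix x assume "x : nb q"
 hence "idx (fst q) x - snd q : offs" using assms by (auto simp: nb_def offs_def cubes_def inner_diff_left intro!: zvec_diff)
 moreover have "x : cub (fst q, snd q + (idx (fst q) x - snd q))" by (simp add: cub_def)
 ultimately show "x : (\<Union>u\<in>offs. cub (fst q, snd q + u))" by blast
next
 fix x u :: 'a assume "u : offs" "x : cub (fst q, snd q + u)"
 thus "x : nb q" by (auto simp: nb_def offs_def cub_def inner_add_left simp del: idx_inner)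
qed

lemma emeasure_nb_le:
 fixes q :: "int \<times> 'a::euclidean_space"
 assumes "q : cubes"
 shows "\<mu> (nb q) <= en (nnb TYPE('a) * vol q)"
proof -
 have "\<mu> (nb q) <= (\<Sum>u\<in>offs. \<mu> (cub (fst q, snd q + u)))" unfolding nb_eq_Union[OF assms] by (intro emeasure_subadditive_finite) auto
 also have "... = (\<Sum>u\<in>(offs::'a set). en (vol q))"
 proof (intro sum.cong refl)
  fix u :: 'a assume "u : offs"
  hence "(fst q, snd q + u) : cubes" using assms by (auto simp: cubes_def offs_def intro!: zvec_add)
  thus "\<mu> (cub (fst q, snd q + u)) = en (vol q)" using emeasure_cub[of "(fst q, snd q + u)"] by (simp only: vol_def side_def fst_conv)
 qed
 also have "... = en (nnb TYPE('a) * vol q)" by (simp add: nnb_def ennreal_mult' ennreal_of_nat_eq_real_of_nat)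
 finally show ?thesis .
qed

lemma side_dq: "side (dq k x) = 2 powi (- k)" by (simp add: side_def)

lemma vol_dq_coarsen: "vol (dq (k - 1) x) = 2 ^ DIM('a) * vol (dq k x)" for x :: "'a::euclidean_space"
proof -
 have "side (dq (k - 1) x) = 2 * side (dq k x)" unfolding side_dq using power_int_add[of "2::real" "-k" 1] by (simp add: algebra_simps)
 thus ?thesis by (simp add: vol_def power_mult_distrib)
qed

lemma side_unbounded: "\<exists>k0. \<forall>k\<le>k0. \<forall>x::'a::euclidean_space. side (dq k x) > c"
proof -
 obtain n :: nat where n: "c < 2 ^ n" using real_arch_pow[of 2 c] by auto
 show ?thesis
 proof (intro exI[of _ "- int n"] allI impI)
  fix k x assume "k <= - int n"
  hence "(2::real) powi (int n) <= 2 powi (- k)" by (intro power_int_increasing) auto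
  thus "c < side (dq k x)" using n by (simp add: side_dq)
 qed
qed

lemma side_small: "c > 0 ==> \<exists>k0. \<forall>k\<ge>k0. \<forall>x::'a::euclidean_space. side (dq k x) < c"
proof -
 assume "c > 0"
 obtain n :: nat where n: "inverse c < 2 ^ n" using real_arch_pow[of 2 "inverse c"] by auto
 show ?thesis
 proof (intro exI[of _ "int n"] allI impI)
  fix k x assume "k >= int n"
  hence "(2::real) powi (- k) <= 2 powi (- int n)" by (intro power_int_increasing) auto
  also have "... < c" using n \<open>c > 0\<close> by (simp add: power_int_minus field_simps)
  finally show "side (dq k x) < c" by (simp add: side_dq)
 qed
qed

lemma vol_ge_side: "side q >= 1 ==> vol q >= side q"
 for q :: "int \<times> 'a::euclidean_space" unfolding vol_def using power_increasing[of 1 "DIM('a)" "side q"] DIM_positive[where 'a='a] by simp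

lemma vol_unbounded: "\<exists>k0. \<forall>k\<le>k0. \<forall>x::'a::euclidean_space. vol (dq k x) > c"
proof -
 obtain k0 where k0: "\<forall>k\<le>k0. \<forall>x::'a. side (dq k x) > max c 1" using side_unbounded by blast
 have "vol (dq k x) > c" if "k <= k0" for k and x :: 'a
 proof -
  have "side (dq k x) > max c 1" using k0 that by blast
  thus ?thesis using vol_ge_side[of "dq k x"] by linarith
 qed
 thus ?thesis by blast
qed

text \<open>Levels below \<open>fst q\<close> belong to the ancestors of \<open>q\<close>, so these
  are the maximal cubes with property \<open>P\<close>. The same selection produces the
  Calderon-Zygmund cubes, the sparse children and the critical cubes.\<close>

definition stop :: "(int \<times> 'a::euclidean_space => bool) => (int \<times> 'a) set" where
 "stop P = {q : cubes. P q & (\<forall>x\<in>cub q. \<forall>j<fst q. \<not> P (dq j x))}"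

lemma stop_cubes: "stop P <= cubes" by (auto simp: stop_def)

lemma countable_stop [simp]: "countable (stop P)" using countable_subset[OF stop_cubes countable_cubes] .

lemma stop_disjoint:
 assumes "q : stop P" "q' : stop P" "x : cub q" "x : cub q'"
 shows "q = q'"
proof -
 have "q = dq (fst q) x" "q' = dq (fst q') x" using assms cub_eq_dq by blast+
 moreover have "\<not> fst q < fst q'" "\<not> fst q' < fst q"
  using assms calculation unfolding stop_def by (metis (mono_tags, lifting) mem_Collect_eq)+
 ultimately show ?thesis by (metis linorder_neqE)
qed

lemma disjoint_family_stop: "disjoint_family_on cub (stop P)" unfolding disjoint_family_on_def using stop_disjoint by blast

lemma int_least:
 fixes P :: "int => bool"
 assumes "P k" "!!j. j <= j0 ==> \<not> P j"
 obtains l where "l <= k" "P l" "!!j. j < l ==> \<not> P j"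
proof -
 define l where "l = j0 + int (LEAST n. P (j0 + int n))"
 have k: "P (j0 + int (nat (k - j0)))" using assms by (cases "k <= j0") auto
 have Pl: "P l" unfolding l_def by (rule LeastI[of "%n. P (j0 + int n)", OF k])
 have "\<not> P j" if "j < l" for j
 proof (cases "j <= j0")
  case False
  hence "nat (j - j0) < (LEAST n. P (j0 + int n))" using that by (simp add: l_def)
  from not_less_Least[OF this] show ?thesis using False by simp
 qed (use assms in auto)
 moreover from this have "l <= k" using assms(1) by force
 ultimately show ?thesis using Pl that by blast
qed

text \<open>The integer levels are not well-founded; failure of \<open>P\<close> at all sufficiently
  large scales takes the place of well-foundedness and gives a coarsest cube.\<close>

lemma stop_ex:
 assumes "P (dq k x)" "!!j. j <= j0 ==> \<not> P (dq j x)"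
 shows "\<exists>q\<in>stop P. x : cub q & fst q <= k"
proof -
 obtain l where l: "l <= k" "P (dq l x)" "!!j. j < l ==> \<not> P (dq j x)" using int_least[of "%j. P (dq j x)", OF assms] by blast
 have "dq l x : stop P" unfolding stop_def using l(2,3) dq_coarsen[OF less_imp_le] by fastforce
 thus ?thesis using l by force
qed

subsection \<open>The dyadic maximal function\<close>

lemma sigma_finite_lebesgue: "sigma_finite_measure (lebesgue :: 'a::euclidean_space measure)"
proof (rule sigma_finite_measure.intro)
 have *: "(\<Union>n. ball 0 (real n)) = (UNIV :: 'a set)" by (auto intro: reals_Archimedean2)
 show "\<exists>A. countable A & A <= sets (lebesgue :: 'a measure) & \<Union> A = space lebesgue & (\<forall>a\<in>A. \<mu> a ~= \<infinity>)"
  using * by (intro exI[of _ "range (%n. ball (0::'a) (real n))"])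
    (auto simp: less_top emeasure_lborel_ball_finite[unfolded infinity_ennreal_def])
qed

text \<open>Countable additivity of the measure with density \<open>F\<close>.\<close>

lemma nn_integral_UN_cub:
 assumes "countable S" "disjoint_family_on cub S" "F : lmeas"
 shows "(\<integral>x\<in>(\<Union>q\<in>S. cub q). F x) = (\<Sum>\<^sup>+q\<in>S. (\<integral>x\<in>cub q. F x))"
proof -
 have "emeasure (density lebesgue F) (\<Union>q\<in>S. cub q) = (\<Sum>\<^sup>+q\<in>S. emeasure (density lebesgue F) (cub q))"
  using assms by (intro emeasure_UN_countable) auto
 moreover have "(\<Union>q\<in>S. cub q) : sets lebesgue" using assms(1) by (intro sets.countable_UN'') auto
 ultimately show ?thesis using assms by (simp add: emeasure_density)
qed

lemma nn_integral_UN_le: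
 assumes "countable S" "!!q. q : S ==> A q : sets M" "F : borel_measurable M"
 shows "(\<integral>\<^sup>+x\<in>(\<Union>q\<in>S. A q). F x \<partial>M) <= (\<Sum>\<^sup>+q\<in>S. (\<integral>\<^sup>+x\<in>A q. F x \<partial>M))"
proof -
 have "(\<integral>\<^sup>+x\<in>(\<Union>q\<in>S. A q). F x \<partial>M) <= (\<integral>\<^sup>+x. (\<Sum>\<^sup>+q\<in>S. F x * indicator (A q) x) \<partial>M)"
 proof (rule nn_integral_mono)
  fix x
  show "F x * indicator (\<Union>q\<in>S. A q) x <= (\<Sum>\<^sup>+q\<in>S. F x * indicator (A q) x)"
  proof (cases "x : (\<Union>q\<in>S. A q)")
   case True
   then obtain q where q: "q : S" "x : A q" by blast
   have "F x * indicator (A q) x <= (\<Sum>\<^sup>+q\<in>S. F x * indicator (A q) x)" using q(1) by (rule nn_integral_ge_point)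
   thus ?thesis using q True by simp
  qed auto
 qed
 also have "... = (\<Sum>\<^sup>+q\<in>S. (\<integral>\<^sup>+x\<in>A q. F x \<partial>M))"
  using assms by (intro nn_integral_count_space_nn_integral) auto
 finally show ?thesis .
qed

lemma emeasure_UN_le:
 assumes "countable S" "!!q. q : S ==> A q : sets M"
 shows "emeasure M (\<Union>q\<in>S. A q) <= (\<Sum>\<^sup>+q\<in>S. emeasure M (A q))"
proof -
 have "(\<Union>q\<in>S. A q) : sets M" using assms by (intro sets.countable_UN'') auto
 thus ?thesis using nn_integral_UN_le[of S A M "%_. 1", OF assms] assms(2) by (simp cong: nn_integral_cong_simp)
qed

definition cav :: "('a::euclidean_space => ennreal) => int \<times> 'a => ennreal" where
 "cav F q = en (1 / vol q) * (\<integral>x\<in>cub q. F x)"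

text \<open>Normalised by the volume of \<open>cub q\<close> rather than of \<open>nb q\<close>,
  which differs from the mean over \<open>nb q\<close> by the factor \<open>nnb\<close>
  only.\<close>

definition mns :: "('a::euclidean_space => ennreal) => int \<times> 'a => ennreal" where
 "mns F q = en (1 / vol q) * (\<integral>x\<in>nb q. F x)"

definition MN :: "('a::euclidean_space => ennreal) => 'a => ennreal" where
 "MN F x = (SUP k. mns F (dq k x))"

text \<open>A function of the cube of level \<open>k\<close> around x is constant on each of
  countably many Borel sets, so \<open>g\<close> may be arbitrary.\<close>

lemma measurable_dq: "(!!q. g q : space N) ==> (%x. g (dq k x)) : measurable borel N"
proof (rule measurableI)
 fix B assume "B : sets N"
 have "(%x. g (dq k x)) -` B Int space borel = (\<Union>n\<in>{n : zvec. g (k, n) : B}. cub (k, n))" by (auto simp: cub_def dq_def)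
 moreover have "(\<Union>n\<in>{n : zvec. g (k, n) : B}. cub (k, n)) : sets borel"
  by (intro sets.countable_UN'' countable_subset[OF _ countable_zvec]) auto
 ultimately show "(%x. g (dq k x)) -` B Int space borel : sets borel" by simp
qed auto

lemma MN_measurable [measurable]: "MN F : borel_measurable borel" unfolding MN_def[abs_def] by (intro borel_measurable_SUP measurable_dq) auto

lemma ennreal_cancel:
 assumes "0 < c"
 shows "en c * (en (1 / c) * y) = y" "en (1 / c) * (en c * y) = y" using assms by (simp_all add: mult.assoc[symmetric] ennreal_mult'[symmetric])

lemma ennreal_inv_le:
 assumes "0 < c"
 shows "en (1 / c) * y <= x \<longleftrightarrow> y <= en c * x" by (metis assms ennreal_cancel mult_left_mono zero_le)

lemma ennreal_le_inv:
 assumes "0 < c"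
 shows "x <= en (1 / c) * y \<longleftrightarrow> en c * x <= y" by (metis assms ennreal_cancel mult_left_mono zero_le)

lemma cav_le_iff: "cav F q <= l \<longleftrightarrow> (\<integral>x\<in>cub q. F x) <= en (vol q) * l" unfolding cav_def by (rule ennreal_inv_le) simp

lemma less_cav_iff: "l < cav F q \<longleftrightarrow> en (vol q) * l < (\<integral>x\<in>cub q. F x)" using cav_le_iff not_le by metis

lemma mns_le_iff: "mns F q <= l \<longleftrightarrow> (\<integral>x\<in>nb q. F x) <= en (vol q) * l" unfolding mns_def by (rule ennreal_inv_le) simp

lemma sum_stop_le:
 assumes "0 < l" "F : lmeas" "!!q. q : S ==> ennreal l < cav F q"
  and S: "countable S" "disjoint_family_on cub S"
 shows "en l * (\<Sum>\<^sup>+q\<in>S. en (vol q)) <= (\<integral>x\<in>(\<Union>q\<in>S. cub q). F x)"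
proof -
 have "en l * (\<Sum>\<^sup>+q\<in>S. en (vol q)) = (\<Sum>\<^sup>+q\<in>S. en l * en (vol q))" by (simp add: nn_integral_cmult)
 also have "... <= (\<Sum>\<^sup>+q\<in>S. (\<integral>x\<in>cub q. F x))"
  using assms(3) by (intro nn_integral_mono) (auto simp: less_cav_iff mult.commute intro: less_imp_le)
 also have "... = (\<integral>x\<in>(\<Union>q\<in>S. cub q). F x)" using nn_integral_UN_cub[OF S assms(2)] by simp
 finally show ?thesis .
qed

lemma emeasure_UN_nb_le:
 fixes S :: "(int \<times> 'a::euclidean_space) set"
 assumes "countable S" "S <= cubes"
 shows "\<mu> (\<Union>q\<in>S. nb q) <= en (nnb TYPE('a)) * (\<Sum>\<^sup>+q\<in>S. en (vol q))"
proof -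
 have "\<mu> (\<Union>q\<in>S. nb q) <= (\<Sum>\<^sup>+q\<in>S. \<mu> (nb q))" using assms(1) by (intro emeasure_UN_le) auto
 also have "... <= (\<Sum>\<^sup>+q\<in>S. en (nnb TYPE('a)) * en (vol q))" using assms(2) emeasure_nb_le nnb_ge1[where 'a='a]
  by (intro nn_integral_mono) (auto simp: ennreal_mult'[symmetric])
 also have "... = en (nnb TYPE('a)) * (\<Sum>\<^sup>+q\<in>S. en (vol q))" by (simp add: nn_integral_cmult)
 finally show ?thesis .
qed

lemma cav_small:
 fixes F :: "'a::euclidean_space => ennreal"
 assumes "(\<integral>x. F x) < \<infinity>" "0 < l"
 shows "\<exists>j0. \<forall>j\<le>j0. \<forall>x. cav F (dq j x) <= en l"
proof -
 obtain r where r: "(\<integral>x. F x) = en r" "0 <= r" using assms(1) by (cases "\<integral>\<^sup>+x. F x \<partial>lebesgue") auto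
 obtain j0 where j0: "\<forall>j\<le>j0. \<forall>x::'a. vol (dq j x) > r / l" using vol_unbounded by blast
 have "cav F (dq j x) <= en l" if "j <= j0" for j x
 proof -
  have "(\<integral>y\<in>cub (dq j x). F y) <= (\<integral>x. F x)" by (intro nn_integral_mono) (auto split: split_indicator)
  also have "... <= en (vol (dq j x) * l)" unfolding r using j0[rule_format, OF that, of x] assms(2) by (intro ennreal_leI) (auto simp: field_simps)
  finally show ?thesis unfolding cav_le_iff using assms(2) by (simp add: ennreal_mult less_imp_le)
 qed
 thus ?thesis by blast
qed

text \<open>One power of N = \<open>nnb\<close> is lost by pigeonhole: a large integral over a
  neighbourhood forces a mean above l / N on one of its N cubes. The other is lost since the level
  set is covered by the neighbourhoods of the maximal cubes with such a mean, not by the cubes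
  themselves.\<close>

lemma MN_weak:
 fixes F :: "'a::euclidean_space => ennreal"
 assumes F: "F : lmeas" and l: "0 < l"
 shows "\<mu> {x. en l < MN F x}
  <= en ((nnb TYPE('a))\<^sup>2 / l) * (\<integral>x. F x)"
proof (cases "(\<integral>x. F x) = \<infinity>")
 case True
 thus ?thesis using l nnb_ge1[where 'a='a] by (auto simp: ennreal_mult_top)
next
 case False
 define N where "N = nnb TYPE('a)"
 have N: "N >= 1" unfolding N_def by (rule nnb_ge1)
 define P where "P q \<longleftrightarrow> en (l / N) < cav F q" for q :: "int \<times> 'a"
 define S where "S = stop P"
 have lN: "0 < l / N" using N l by simp
 obtain j0 where j0: "!!j x. j <= j0 ==> \<not> P (dq j x)"
  using cav_small[OF _ lN, of F] False unfolding P_def by (metis not_less top.not_eq_extremum infinity_ennreal_def)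
 have sub: "{x. en l < MN F x} <= (\<Union>q\<in>S. nb q)"
 proof
  fix x assume "x : {x. en l < MN F x}"
  then obtain k where "en l < mns F (dq k x)" unfolding MN_def by (auto simp: less_SUP_iff)
  hence k: "\<not> (\<integral>x\<in>nb (dq k x). F x) <= en (vol (dq k x)) * en l" using mns_le_iff not_le by metis
  have "\<exists>u\<in>offs. P (k, idx k x + u)"
  proof (rule ccontr)
   assume contr: "\<not> ?thesis"
   have "(\<integral>x\<in>nb (dq k x). F x) <= (\<Sum>\<^sup>+u\<in>offs. (\<integral>x\<in>cub (k, idx k x + u). F x))"
    unfolding nb_eq_Union[OF dq_cubes, of k x] fst_dq snd_dq using F by (intro nn_integral_UN_le countable_finite) auto
   also have "... <= (\<Sum>\<^sup>+u\<in>(offs::'a set). en (vol (dq k x)) * en (l / N))"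
   proof (intro nn_integral_mono)
    fix u :: 'a assume "u : space (count_space offs)"
    hence "cav F (k, idx k x + u) <= en (l / N)" using contr by (auto simp: P_def not_less)
    thus "(\<integral>x\<in>cub (k, idx k x + u). F x) <= en (vol (dq k x)) * en (l / N)" by (simp add: cav_le_iff vol_def side_def)
   qed
   also have "... = en (vol (dq k x)) * (en N * en (l / N))" by (simp add: N_def nnb_def ennreal_of_nat_eq_real_of_nat mult_ac)
   also have "en N * en (l / N) = en l" using N l by (simp add: ennreal_mult'[symmetric])
   finally show False using k by simp
  qed
  then obtain u where u: "u : offs" "P (k, idx k x + u)" by blast
  have qc: "(k, idx k x + u) : cubes" using u by (auto simp: cubes_def offs_def intro: zvec_add)
  then obtain y where y: "(k, idx k x + u) = dq k y" using cubes_ex by fastforce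
  have yx: "y : nb (dq k x)" unfolding nb_eq_Union[OF dq_cubes] using y by (intro UN_I[OF u(1)]) (simp add: cub_def dq_def)
  obtain q where q: "q : S" "y : cub q" "fst q <= k" using stop_ex[of P k y j0] u(2) y j0 unfolding S_def by metis
  \<comment> \<open>Symmetry of neighbourhoods, followed by coarsening to the level of the maximal
    cube \<open>q\<close> around y, puts x into \<open>nb q\<close>.\<close>
  have "x : nb (dq k y)" using yx nb_sym by blast
  hence "x : nb (dq (fst q) y)" using nb_coarsen q(3) by blast
  hence "x : nb q" using q(2) cub_eq_dq by metis
  thus "x : (\<Union>q\<in>S. nb q)" using q(1) by blast
 qed
 have "\<mu> {x. en l < MN F x} <= \<mu> (\<Union>q\<in>S. nb q)" by (intro emeasure_mono sub sets.countable_UN'') (auto simp: S_def)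
 also have "... <= en N * (\<Sum>\<^sup>+q\<in>S. en (vol q))" unfolding N_def S_def using stop_cubes by (intro emeasure_UN_nb_le) auto
 also have "... <= en N * (en (N / l) * (\<integral>x. F x))"
 proof (intro mult_left_mono)
  have "en (l / N) * (\<Sum>\<^sup>+q\<in>S. en (vol q)) <= (\<integral>x\<in>(\<Union>q\<in>S. cub q). F x)"
   using F lN by (intro sum_stop_le) (auto simp: S_def stop_def P_def intro: disjoint_family_stop[unfolded stop_def] countable_stop[unfolded stop_def])
  also have "... <= (\<integral>x. F x)" by (intro nn_integral_mono) (auto split: split_indicator)
  finally show "(\<Sum>\<^sup>+q\<in>S. en (vol q)) <= en (N / l) * (\<integral>x. F x)"
   using ennreal_le_inv[OF lN, of "\<integral>\<^sup>+q. en (vol q) \<partial>count_space S"] by simp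
 qed simp
 also have "... = en (N\<^sup>2 / l) * (\<integral>x. F x)" using N l by (simp add: mult.assoc[symmetric] ennreal_mult'[symmetric] power2_eq_square)
 finally show ?thesis unfolding N_def .
qed

lemma cub_in_open:
 assumes "open U" "x : U"
 shows "\<exists>k\<ge>k0. cub (dq k x) <= U"
proof -
 obtain e where e: "e > 0" "ball x e <= U" using assms open_contains_ball by blast
 have "e / real DIM('a) > 0" using e by simp
 then obtain k1 where k1: "\<forall>k\<ge>k1. \<forall>x::'a. side (dq k x) < e / real DIM('a)" using side_small by blast
 define k where "k = max k0 k1"
 have "real DIM('a) * side (dq k x) < e" using k1[rule_format, of k x] by (simp add: k_def field_simps)
 hence "cub (dq k x) <= ball x e" using dist_cub_le[of x "dq k x"] by force
 thus ?thesis using e k_def by (intro exI[of _ k]) auto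
qed

lemma cav_measurable [measurable]: "(%x. cav F (dq k x)) : borel_measurable borel" by (rule measurable_dq) auto

text \<open>A one-sided differentiation theorem. The points where F exceeds l + \<epsilon> although
  all fine averages are at most l form a set H; covering H by maximal cubes inside an open set of
  measure at most |H| + \<eta> gives (l + \<epsilon>) |H| <= l (|H| + \<eta>) for every \<eta>, so H
  is null.\<close>

lemma dyadic_lebesgue:
 fixes F :: "'a::euclidean_space => real"
 assumes F[measurable]: "F : lmeas" and F0: "!!x. 0 <= F x"
  and fin: "(\<integral>x. en (F x)) < \<infinity>" and l: "0 <= l"
  and S: "!!x. x : S ==> \<exists>k0. \<forall>k\<ge>k0. cav (%x. en (F x)) (dq k x) <= en l"
 shows "AE x. x : S --> F x <= l"
proof -
 define H where "H k0 n = {x. (\<forall>k\<ge>k0. cav (%x. en (F x)) (dq k x) <= en l) & F x > l + 1 / real (Suc n)}"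
  for k0 :: int and n
 have Hnull: "H k0 n : null_sets lebesgue" for k0 n
 proof -
  define \<epsilon> where "\<epsilon> = 1 / real (Suc n)"
  have \<epsilon>: "\<epsilon> > 0" by (simp add: \<epsilon>_def)
  have "H k0 n = (\<Inter>k\<in>{k0..}. {x\<in>space lebesgue. cav (%x. en (F x)) (dq k x) <= en l}) Int {x\<in>space lebesgue. F x > l + \<epsilon>}"
   by (auto simp: H_def \<epsilon>_def)
  also have "... : sets lebesgue"
  proof -
   have c[measurable]: "(%x. cav (%x. en (F x)) (dq k x)) : lmeas" for k
    using cav_measurable[of "%x. en (F x)"] by (intro measurable_completion) simp
   have "{x\<in>space lebesgue. cav (%x. en (F x)) (dq k x) <= en l} : sets lebesgue" for k by measurable
   moreover have "{x\<in>space lebesgue. F x > l + \<epsilon>} : sets lebesgue" by measurable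
   ultimately show ?thesis by (intro sets.Int sets.countable_INT'') auto
  qed
  finally have Hm[measurable]: "H k0 n : sets lebesgue" .
  have int: "en (l + \<epsilon>) * \<mu> (H k0 n) <= (\<integral>x\<in>H k0 n. en (F x))"
  proof -
   have "en (l + \<epsilon>) * \<mu> (H k0 n) = (\<integral>x. en (l + \<epsilon>) * indicator (H k0 n) x)" by (simp add: nn_integral_cmult_indicator)
   also have "... <= (\<integral>x\<in>H k0 n. en (F x))"
    by (intro nn_integral_mono) (auto split: split_indicator simp: H_def \<epsilon>_def intro!: ennreal_leI)
   finally show ?thesis .
  qed
  have "(\<integral>x\<in>H k0 n. en (F x)) <= (\<integral>x. en (F x))" by (intro nn_integral_mono) (auto split: split_indicator)
  with int fin have "en (l + \<epsilon>) * \<mu> (H k0 n) < \<infinity>" by (meson le_less_trans)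
  hence Hf: "\<mu> (H k0 n) ~= \<infinity>" using \<epsilon> l by (auto simp: ennreal_mult_top)
  then obtain h where h: "\<mu> (H k0 n) = en h" "h >= 0" by (cases "\<mu> (H k0 n)") auto
  have "(l + \<epsilon>) * h <= l * (h + \<eta>)" if \<eta>: "\<eta> > 0" for \<eta> :: real
  proof -
   obtain U where U: "open U" "H k0 n <= U" "U - H k0 n : lmeasurable" "\<mu> (U - H k0 n) < en \<eta>"
    using sets_lebesgue_outer_open[OF Hm \<eta>] by metis
   \<comment> \<open>A cube that meets \<open>H k0 n\<close> at a level at least k0 has average at
     most l; the same lower bound on the level makes maximal cubes exist.\<close>
   define P where "P q \<longleftrightarrow> cub q <= U & k0 <= fst q & cub q Int H k0 n ~= {}" for q :: "int \<times> 'a"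
   have cov: "H k0 n <= (\<Union>q\<in>stop P. cub q)"
   proof
    fix x assume x: "x : H k0 n"
    then obtain k where k: "k >= k0" "cub (dq k x) <= U" using cub_in_open[OF U(1)] U(2) by blast
    have "P (dq k x)" unfolding P_def using k x mem_cub_dq by (metis disjoint_iff fst_dq)
    moreover have "\<not> P (dq j x)" if "j <= k0 - 1" for j using that by (simp add: P_def)
    ultimately show "x : (\<Union>q\<in>stop P. cub q)" using stop_ex[of P k x "k0 - 1"] by blast
   qed
   have "en (l + \<epsilon>) * \<mu> (H k0 n) <= (\<integral>x\<in>H k0 n. en (F x))" by (rule int)
   also have "... <= (\<integral>x\<in>(\<Union>q\<in>stop P. cub q). en (F x))" using cov by (intro nn_integral_mono) (auto split: split_indicator)
   also have "... = (\<Sum>\<^sup>+q\<in>(stop P). (\<integral>x\<in>cub q. en (F x)))" by (intro nn_integral_UN_cub disjoint_family_stop) auto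
   also have "... <= (\<Sum>\<^sup>+q\<in>(stop P). en l * (\<integral>x\<in>cub q. 1))"
   proof (intro nn_integral_mono)
    fix q assume "q : space (count_space (stop P))"
    hence q: "q : cubes" "P q" by (auto simp: stop_def)
    then obtain x where x: "x : cub q" "x : H k0 n" by (auto simp: P_def)
    have "q = dq (fst q) x" using x cub_eq_dq by blast
    hence "cav (%x. en (F x)) q <= en l" using x(2) q(2) unfolding H_def P_def by (metis (mono_tags, lifting) mem_Collect_eq)
    thus "(\<integral>x\<in>cub q. en (F x)) <= en l * (\<integral>x\<in>cub q. 1)"
     using q(1) by (simp add: cav_le_iff emeasure_cub mult.commute del: emeasure_completion)
   qed
   also have "... = en l * (\<Sum>\<^sup>+q\<in>(stop P). (\<integral>x\<in>cub q. 1))" by (simp add: nn_integral_cmult)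
   also have "(\<Sum>\<^sup>+q\<in>(stop P). (\<integral>x\<in>cub q. 1)) = (\<integral>x\<in>(\<Union>q\<in>stop P. cub q). 1)"
    by (intro nn_integral_UN_cub[symmetric] disjoint_family_stop) auto
   also have "... <= (\<integral>x. indicator (H k0 n) x + indicator (U - H k0 n) x)"
    by (intro nn_integral_mono) (auto split: split_indicator simp: stop_def P_def)
   also have "... = \<mu> (H k0 n) + \<mu> (U - H k0 n)" using U(3) by (subst nn_integral_add) (auto simp: fmeasurable_def)
   also have "... <= en h + en \<eta>" using U(4) h by (intro add_mono) auto
   finally have "en (l + \<epsilon>) * en h <= en l * (en h + en \<eta>)" using h(1) by (simp add: mult_left_mono)
   thus ?thesis using l \<epsilon> h(2) \<eta> by (simp add: ennreal_mult'[symmetric] ennreal_plus[symmetric] del: ennreal_plus)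
  qed
  hence le: "\<epsilon> * h <= l * \<eta>" if "\<eta> > 0" for \<eta> using that by (force simp: algebra_simps)
  have "\<epsilon> * h <= 0"
  proof (rule field_le_epsilon)
   fix e :: real assume "e > 0"
   have "\<epsilon> * h <= l * (e / (l + 1))" using \<open>e > 0\<close> l by (intro le) auto
   also have "... <= e" using l \<open>e > 0\<close> by (simp add: field_simps)
   finally show "\<epsilon> * h <= 0 + e" by simp
  qed
  hence "h = 0" using \<epsilon> h(2) by (simp add: mult_le_0_iff)
  thus ?thesis using h Hm by (simp add: null_sets_def del: emeasure_completion)
 qed
 have "(\<Union>k0. \<Union>n. H k0 n) : null_sets lebesgue" using Hnull by (intro null_sets_UN') auto
 moreover have "{x\<in>space lebesgue. \<not> (x : S --> F x <= l)} <= (\<Union>k0. \<Union>n. H k0 n)"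
 proof
  fix x assume "x : {x\<in>space lebesgue. \<not> (x : S --> F x <= l)}"
  hence x: "x : S" "F x > l" by auto
  from x(2) obtain n where "F x - l > inverse (real (Suc n))" using reals_Archimedean[of "F x - l"] by auto
  moreover obtain k0 where "\<forall>k\<ge>k0. cav (%x. en (F x)) (dq k x) <= en l" using S[OF x(1)] by blast
  ultimately have "x : H k0 n" by (auto simp: H_def field_simps)
  thus "x : (\<Union>k0. \<Union>n. H k0 n)" by blast
 qed
 ultimately show ?thesis by (intro AE_I') 
qed

lemma nn_integral_powr_from_0:
 assumes "-1 < a" "0 <= c"
 shows "(\<integral>\<^sup>+s. en (s powr a) * indicator {0..c} s \<partial>lborel) = en (c powr (a + 1) / (a + 1))"
proof -
 have "(\<integral>\<^sup>+s. en (indicator {0..c} s * s powr a) \<partial>lborel) = en (c powr (a + 1) / (a + 1))"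
  using has_integral_powr_from_0[OF assms] by (intro nn_integral_has_integral_lebesgue) auto
 moreover have "(\<integral>\<^sup>+s. en (indicator {0..c} s * s powr a) \<partial>lborel) = (\<integral>\<^sup>+s. en (s powr a) * indicator {0..c} s \<partial>lborel)"
  by (intro nn_integral_cong) (auto split: split_indicator)
 ultimately show ?thesis by simp
qed

lemma pair_sigma_finite_lebesgue_lborel:
 "pair_sigma_finite (lebesgue :: 'a::euclidean_space measure) (lborel :: 'b::euclidean_space measure)"
 by (intro pair_sigma_finite.intro sigma_finite_lebesgue sigma_finite_lborel)

text \<open>The part of F below t / (2 N) contributes at most t / 2 to every \<open>mns\<close>, as
  a neighbourhood consists of N cubes. This is the cut-off for the interpolation in
  \<open>MN_strong\<close>.\<close>

lemma MN_cutoff: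
 fixes F :: "'a::euclidean_space => real"
 assumes F[measurable]: "F : lmeas" and F0: "!!x. 0 <= F x" and t: "0 < t"
  and less: "en t < MN (%x. en (F x)) x"
 shows "en (t / 2) < MN (%x. en (F x) * indicator {x. t / (2 * nnb TYPE('a)) < F x} x) x"
proof -
 define N where "N = nnb TYPE('a)"
 have N: "N >= 1" unfolding N_def by (rule nnb_ge1)
 define F1 where "F1 x = en (F x) * indicator {x. t / (2 * N) < F x} x" for x
 have F1[measurable]: "F1 : lmeas"
 proof -
  have "{x\<in>space lebesgue. t / (2 * N) < F x} : sets lebesgue" by measurable
  thus ?thesis unfolding F1_def[abs_def] by auto
 qed
 obtain k where k: "en t < mns (%x. en (F x)) (dq k x)" using less unfolding MN_def by (auto simp: less_SUP_iff)
 have "(\<integral>y\<in>nb (dq k x). en (F y)) <=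
    (\<integral>y. F1 y * indicator (nb (dq k x)) y + en (t / (2 * N)) * indicator (nb (dq k x)) y)"
  by (intro nn_integral_mono) (auto split: split_indicator simp: F1_def intro!: ennreal_leI)
 also have "... = (\<integral>y\<in>nb (dq k x). F1 y) + en (t / (2 * N)) * \<mu> (nb (dq k x))"
  by (subst nn_integral_add) (auto simp: nn_integral_cmult_indicator)
 also have "... <= (\<integral>y\<in>nb (dq k x). F1 y) + en (t / (2 * N)) * en (N * vol (dq k x))"
  using emeasure_nb_le[of "dq k x"] by (intro add_left_mono mult_left_mono) (auto simp: N_def)
 also have "en (t / (2 * N)) * en (N * vol (dq k x)) = en (vol (dq k x)) * en (t / 2)" using N t by (simp add: ennreal_mult'[symmetric] less_imp_le)
 finally have "mns (%x. en (F x)) (dq k x) <= mns F1 (dq k x) + en (t / 2)" unfolding mns_le_iff distrib_left by (simp add: mns_def ennreal_cancel)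
 hence "en t < mns F1 (dq k x) + en (t / 2)" using k by (meson less_le_trans)
 moreover have "en t = en (t / 2) + en (t / 2)" using t by (simp flip: ennreal_plus)
 ultimately have "en (t / 2) < mns F1 (dq k x)" by (metis add_right_mono leI not_less)
 thus ?thesis unfolding MN_def F1_def N_def by (auto simp: less_SUP_iff)
qed

text \<open>Interpolation between the weak bound and the trivial bound at infinity: G^p is the
  integral of p s^(p - 1) over 0 < s < G, the weak bound at height s / 2 is applied to F cut off
  below s / (2 N), and the order of integration is exchanged. \<open>G\<close> is real-valued
  because \<open>powr\<close> is.\<close>

lemma MN_strong:
 fixes F G :: "'a::euclidean_space => real"
 assumes F[measurable]: "F : lmeas" and F0: "!!x. 0 <= F x"
  and G[measurable]: "G : lmeas" and G0: "!!x. 0 <= G x"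
  and le: "!!x. en (G x) <= MN (%x. en (F x)) x" and p: "1 < p"
 shows "(\<integral>x. en (G x powr p))
  <= en (p / (p - 1) * (2 * nnb TYPE('a)) powr (p + 1)) * (\<integral>x. en (F x powr p))"
proof -
 interpret P: pair_sigma_finite "lebesgue :: 'a measure" "lborel :: real measure" by (rule pair_sigma_finite_lebesgue_lborel)
 define N where "N = nnb TYPE('a)"
 have N: "N >= 1" unfolding N_def by (rule nnb_ge1)
 have ind: "(%x. en (F x) * indicator {x. c < F x} x) : lmeas" for c
 proof -
  have "{x\<in>space lebesgue. c < F x} : sets lebesgue" by measurable
  thus ?thesis by auto
 qed
 have "(\<integral>x. en (G x powr p)) =
   (\<integral>x. (\<integral>\<^sup>+s. en (p * s powr (p - 1)) * indicator {0<..<G x} s \<partial>lborel))"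
 proof (intro nn_integral_cong)
  fix x
  have "(\<integral>\<^sup>+s. en (p * s powr (p - 1)) * indicator {0<..<G x} s \<partial>lborel)
    = (\<integral>\<^sup>+s. en p * (en (s powr (p - 1)) * indicator {0..G x} s) \<partial>lborel)"
  proof (intro nn_integral_cong_AE)
   have "AE s in lborel. s ~= 0 & s ~= G x" by (intro AE_conjI AE_lborel_singleton)
   thus "AE s in lborel. en (p * s powr (p - 1)) * indicator {0<..<G x} s = en p * (en (s powr (p - 1)) * indicator {0..G x} s)"
    by eventually_elim (use p in \<open>auto split: split_indicator simp: ennreal_mult'\<close>)
  qed
  also have "... = en p * en (G x powr (p - 1 + 1) / (p - 1 + 1))" using p G0[of x] by (subst nn_integral_cmult) (auto simp: nn_integral_powr_from_0)
  also have "... = en (G x powr p)" using p by (simp add: ennreal_mult'[symmetric])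
  finally show "en (G x powr p) = (\<integral>\<^sup>+s. en (p * s powr (p - 1)) * indicator {0<..<G x} s \<partial>lborel)" ..
 qed
 also have "... = (\<integral>x. (\<integral>\<^sup>+s. (if 0 < s & s < G x then en (p * s powr (p - 1)) else 0) \<partial>lborel))"
  by (intro nn_integral_cong) (auto split: split_indicator)
 also have "... = (\<integral>\<^sup>+s. (\<integral>x. (if 0 < s & s < G x then en (p * s powr (p - 1)) else 0)) \<partial>lborel)"
  by (rule P.Fubini'[symmetric]) measurable
 also have "... <= (\<integral>\<^sup>+s. (\<integral>x. (if 0 < s & s < 2 * N * F x then en (2 * N\<^sup>2 * p * s powr (p - 2) * F x) else 0)) \<partial>lborel)"
 proof (rule nn_integral_mono)
  fix s :: real
  show "(\<integral>x. (if 0 < s & s < G x then en (p * s powr (p - 1)) else 0))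
   <= (\<integral>x. (if 0 < s & s < 2 * N * F x then en (2 * N\<^sup>2 * p * s powr (p - 2) * F x) else 0))"
  proof (cases "0 < s")
   case True
   define F1 where "F1 x = en (F x) * indicator {x. s / (2 * N) < F x} x" for x
   have F1[measurable]: "F1 : lmeas" unfolding F1_def[abs_def] by (rule ind)
   have sub: "{x. s < G x} <= {x. en (s / 2) < MN F1 x}"
   proof
    fix x assume "x : {x. s < G x}"
    hence "en s < en (G x)" using True by (simp add: ennreal_less_iff)
    hence "en s < MN (%x. en (F x)) x" using le[of x] by (rule less_le_trans)
    from MN_cutoff[OF F F0 True this]
    show "x : {x. en (s / 2) < MN F1 x}" by (simp add: F1_def[abs_def] N_def)
   qed
   have pt: "en (2 * N\<^sup>2 * p * s powr (p - 2)) * F1 x =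
     (if 0 < s & s < 2 * N * F x then en (2 * N\<^sup>2 * p * s powr (p - 2) * F x) else 0)" for x
   proof -
    have "s / (2 * N) < F x \<longleftrightarrow> s < 2 * N * F x" using N by (simp add: field_simps)
    moreover have "en (2 * N\<^sup>2 * p * s powr (p - 2) * F x) = en (2 * N\<^sup>2 * p * s powr (p - 2)) * en (F x)"
     using F0[of x] by (rule ennreal_mult'')
    ultimately show ?thesis using True by (simp add: F1_def indicator_def)
   qed
   have mm: "{x. en (s / 2) < MN F1 x} : sets lebesgue"
   proof -
    have "{x\<in>space borel. en (s / 2) < MN F1 x} : sets borel" by measurable
    thus ?thesis by simp
   qed
   have "(\<integral>x. (if 0 < s & s < G x then en (p * s powr (p - 1)) else 0))
    <= (\<integral>x. en (p * s powr (p - 1)) * indicator {x. en (s / 2) < MN F1 x} x)"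
    using sub by (intro nn_integral_mono) (auto split: split_indicator)
   also have "... = en (p * s powr (p - 1)) * \<mu> {x. en (s / 2) < MN F1 x}" by (rule nn_integral_cmult_indicator[OF mm])
   also have "... <= en (p * s powr (p - 1)) * (en (N\<^sup>2 / (s / 2)) * (\<integral>x. F1 x))"
    unfolding N_def using True by (intro mult_left_mono MN_weak) auto
   also have "... = en (2 * N\<^sup>2 * p * s powr (p - 2)) * (\<integral>x. F1 x)"
   proof -
    have "p * s powr (p - 1) * (N\<^sup>2 / (s / 2)) = 2 * N\<^sup>2 * p * s powr (p - 2)" using True powr_diff[of s "p - 1" 1] by simp
    hence "en (p * s powr (p - 1)) * en (N\<^sup>2 / (s / 2)) = en (2 * N\<^sup>2 * p * s powr (p - 2))"
     using p by (subst ennreal_mult'[symmetric]) auto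
    thus ?thesis by (simp only: mult.assoc[symmetric])
   qed
   also have "... = (\<integral>x. en (2 * N\<^sup>2 * p * s powr (p - 2)) * F1 x)" by (rule nn_integral_cmult[symmetric]) measurable
   also have "... = (\<integral>x. (if 0 < s & s < 2 * N * F x then en (2 * N\<^sup>2 * p * s powr (p - 2) * F x) else 0))"
    by (rule nn_integral_cong) (rule pt)
   finally show ?thesis .
  qed auto
 qed
 also have "... = (\<integral>x. (\<integral>\<^sup>+s. (if 0 < s & s < 2 * N * F x then en (2 * N\<^sup>2 * p * s powr (p - 2) * F x) else 0) \<partial>lborel))"
  by (rule P.Fubini') measurable
 also have "... <= (\<integral>x. en (p / (p - 1) * (2 * N) powr (p + 1)) * en (F x powr p))"
 proof (intro nn_integral_mono)
  fix x
  have "(\<integral>\<^sup>+s. (if 0 < s & s < 2 * N * F x then en (2 * N\<^sup>2 * p * s powr (p - 2) * F x) else 0) \<partial>lborel)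
   <= (\<integral>\<^sup>+s. en (2 * N\<^sup>2 * p * F x) * (en (s powr (p - 2)) * indicator {0..2 * N * F x} s) \<partial>lborel)"
   using N p F0[of x] by (intro nn_integral_mono) (auto split: split_indicator simp: ennreal_mult'[symmetric] mult_ac)
  also have "... = en (2 * N\<^sup>2 * p * F x) * en ((2 * N * F x) powr (p - 2 + 1) / (p - 2 + 1))"
   using p N F0[of x] by (subst nn_integral_cmult) (auto simp: nn_integral_powr_from_0)
  also have "... = en (2 * N\<^sup>2 * p * F x * ((2 * N * F x) powr (p - 1) / (p - 1)))" using p N F0[of x] by (simp add: ennreal_mult'[symmetric])
  also have "... <= en (p / (p - 1) * (2 * N) powr (p + 1) * F x powr p)"
  proof (cases "F x = 0")
   case False
   hence Fx: "F x > 0" using F0[of x] by simp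
   have e: "(2 * N) powr (p + 1) = (2 * N) powr (p - 1) * (2 * N)\<^sup>2"
    using N powr_add[of "2 * N" "p - 1" 2] by (simp add: powr_numeral add.commute)
   have e2: "F x powr p = F x powr (p - 1) * F x" using Fx powr_add[of "F x" "p - 1" 1] by simp
   have "2 * N\<^sup>2 * p * F x * ((2 * N * F x) powr (p - 1) / (p - 1)) <= p / (p - 1) * (2 * N) powr (p + 1) * F x powr p"
    unfolding e e2 using N p Fx by (simp add: powr_mult field_simps power2_eq_square)
   thus ?thesis by (rule ennreal_leI)
  qed auto
  also have "... = en (p / (p - 1) * (2 * N) powr (p + 1)) * en (F x powr p)" using p by (intro ennreal_mult) auto
  finally show "(\<integral>\<^sup>+s. (if 0 < s & s < 2 * N * F x then en (2 * N\<^sup>2 * p * s powr (p - 2) * F x) else 0) \<partial>lborel)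
   <= en (p / (p - 1) * (2 * N) powr (p + 1)) * en (F x powr p)" .
 qed
 also have "... = en (p / (p - 1) * (2 * N) powr (p + 1)) * (\<integral>x. en (F x powr p))" by (rule nn_integral_cmult) measurable
 finally show ?thesis unfolding N_def .
qed

subsection \<open>Bounded functions with compact support\<close>

lemma bcsI:
 assumes "f : lmeas" "!!x. cmod (f x) <= M" "!!x. f x ~= 0 ==> x : S" "bounded S"
 shows "f : bcs"
proof -
 have "{x. f x ~= 0} <= S" using assms(3) by auto
 hence "bounded {x. f x ~= 0}" by (rule bounded_subset[OF assms(4)])
 moreover have "bounded (range f)" by (rule boundedI[of _ M]) (use assms(2) in auto)
 ultimately show ?thesis using assms(1) unfolding bdd_compact_supp_def fun_support_def by (auto simp: compact_closure)
qed

lemma bcs_measurable: "f : bcs ==> f : lmeas" by (simp add: bdd_compact_supp_def)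

lemma bcsE:
 assumes "f : bcs"
 obtains M R where "!!x. cmod (f x) <= M" "0 <= M" "!!x. f x ~= 0 ==> x : ball 0 R" "0 < R"
proof -
 have "bounded (range f)" "bounded (fun_support f)" using assms by (auto simp: bdd_compact_supp_def compact_imp_bounded)
 then obtain M R where M: "\<forall>y\<in>range f. norm y < M" and R: "0 < R" "\<forall>x\<in>fun_support f. norm x < R"
  unfolding bounded_pos_less by blast
 have "cmod (f x) <= M" for x using M by (auto intro: less_imp_le)
 moreover have "x : fun_support f" if "f x ~= 0" for x using that closure_subset[of "{x. f x ~= 0}"] unfolding fun_support_def by blast
 hence "x : ball 0 R" if "f x ~= 0" for x using R(2) that by auto
 moreover have "0 <= M" using calculation(1) norm_ge_zero order_trans by blast
 ultimately show ?thesis using that[of M R] R(1) by blast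
qed

lemma bcs_indicator:
 assumes f: "f : bcs" and A: "A : sets lebesgue"
 shows "(%x. f x * indicator A x) : bcs"
proof -
 obtain M R where MR: "!!x. cmod (f x) <= M" "0 <= M" "!!x. f x ~= 0 ==> x : ball 0 R" "0 < R" by (rule bcsE[OF f]) (rule that)
 note [measurable] = bcs_measurable[OF f] A
 show ?thesis
 proof (rule bcsI[where M = M and S = "ball 0 R"])
  show "cmod (f x * indicator A x) <= M" for x using MR(1)[of x] MR(2) by (simp add: indicator_def)
  show "x : ball 0 R" if "f x * indicator A x ~= 0" for x using MR(3)[of x] that by auto
  show "(%x. f x * indicator A x) : lmeas" by measurable
 qed simp
qed

lemma bcs_add:
 assumes f: "f : bcs" and g: "g : bcs"
 shows "(%x. f x + g x) : bcs"
proof -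
 obtain M R where MR: "!!x. cmod (f x) <= M" "0 <= M" "!!x. f x ~= 0 ==> x : ball 0 R" "0 < R" by (rule bcsE[OF f]) (rule that)
 obtain M' R' where MR': "!!x. cmod (g x) <= M'" "0 <= M'" "!!x. g x ~= 0 ==> x : ball 0 R'" "0 < R'" by (rule bcsE[OF g]) (rule that)
 note [measurable] = bcs_measurable[OF f] bcs_measurable[OF g]
 show ?thesis
 proof (rule bcsI[where M = "M + M'" and S = "ball 0 R Un ball 0 R'"])
  show "cmod (f x + g x) <= M + M'" for x using MR MR' by (meson add_mono norm_triangle_le)
  show "x : ball 0 R Un ball 0 R'" if "f x + g x ~= 0" for x using MR(3)[of x] MR'(3)[of x] that by (cases "f x = 0") auto
  show "(%x. f x + g x) : lmeas" by measurable
 qed simp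
qed

lemma bcs_scale:
 assumes f: "f : bcs"
 shows "(%x. c * f x) : bcs"
proof -
 obtain M R where MR: "!!x. cmod (f x) <= M" "0 <= M" "!!x. f x ~= 0 ==> x : ball 0 R" "0 < R" by (rule bcsE[OF f]) (rule that)
 note [measurable] = bcs_measurable[OF f]
 show ?thesis
 proof (rule bcsI[where M = "cmod c * M" and S = "ball 0 R"])
  show "cmod (c * f x) <= cmod c * M" for x using MR(1)[of x] by (simp add: norm_mult mult_left_mono)
  show "x : ball 0 R" if "c * f x ~= 0" for x using MR(3)[of x] that by auto
  show "(%x. c * f x) : lmeas" by measurable
 qed simp
qed

lemma bcs_diff:
 assumes "f : bcs" "g : bcs"
 shows "(%x. f x - g x) : bcs"
proof -
 have "(%x. f x + (- 1) * g x) : bcs" by (intro bcs_add bcs_scale assms)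
 thus ?thesis by simp
qed

lemma bcs_zero: "(%x. 0) : bcs" by (rule bcsI[where M = 0 and S = "{}"]) auto

lemma bcs_sum:
 assumes "finite I" "!!i. i : I ==> f i : bcs"
 shows "(%x. \<Sum>i\<in>I. f i x) : bcs" using assms
proof (induction I rule: finite_induct)
 case empty
 show ?case using bcs_zero by simp
next
 case (insert i I)
 have "(%x. f i x + (\<Sum>i\<in>I. f i x)) : bcs" by (rule bcs_add) (use insert in auto)
 thus ?case using insert.hyps by simp
qed

lemma bcs_powr_fin:
 fixes f :: "'a::euclidean_space => complex"
 assumes f: "f : bcs" and p: "0 < p"
 shows "(\<integral>x. en (cmod (f x) powr p)) < \<infinity>"
proof -
 obtain M R where MR: "!!x. cmod (f x) <= M" "0 <= M" "!!x. f x ~= 0 ==> x : ball 0 R" "0 < R" by (rule bcsE[OF f]) (rule that)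
 have "(\<integral>x. en (cmod (f x) powr p)) <= (\<integral>x. en (M powr p) * indicator (ball (0::'a) R) x)"
 proof (rule nn_integral_mono)
  fix x
  show "en (cmod (f x) powr p) <= en (M powr p) * indicator (ball 0 R) x"
  proof (cases "f x = 0")
   case False
   have "cmod (f x) powr p <= M powr p" using MR(1)[of x] p by (intro powr_mono2) auto
   thus ?thesis using MR(3)[OF False] by (simp add: ennreal_leI)
  qed auto
 qed
 also have "... = en (M powr p) * \<mu> (ball (0::'a) R)" by (simp add: nn_integral_cmult_indicator)
 also have "... < \<infinity>" using emeasure_lborel_ball_finite[of "0::'a" R] by (simp add: ennreal_mult_less_top)
 finally show ?thesis .
qed

lemma bcs_fin:
 assumes f: "f : bcs"
 shows "(\<integral>x. enorm (f x)) < \<infinity>" using bcs_powr_fin[OF f, of 1] by simp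

lemma bcs_sq_fin:
 assumes f: "f : bcs"
 shows "(\<integral>x. en ((cmod (f x))\<^sup>2)) < \<infinity>"
proof -
 have "cmod (f x) powr 2 = (cmod (f x))\<^sup>2" for x by (cases "f x = 0") (simp_all add: powr_numeral)
 thus ?thesis using bcs_powr_fin[OF f, of 2] by simp
qed

lemma bcs_integrable: "f : bcs ==> integrable lebesgue f" by (intro integrableI_bounded bcs_measurable) (use bcs_fin in auto)

subsection \<open>Calderon-Zygmund operators on bounded functions with compact support\<close>

text \<open>All arguments are bounded with compact support, because the adjoint is given only there
  and is to be treated in the same locale. \<open>smooth2\<close> serves the cancellation of atoms,
  \<open>smooth1\<close> the oscillation estimate for sparse domination; transposing the kernel
  exchanges them.\<close>

locale cz_op =
 fixes T :: "('a::euclidean_space => complex) => ('a => complex)" and K :: "'a => 'a => complex"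
  and C2 CK \<gamma> :: real
 assumes lin: "linear_operator_on bcs T"
  and C2: "0 <= C2"
  and l2: "f : bcs ==>
   (\<integral>x. en ((cmod (T f x))\<^sup>2)) <= en C2 * (\<integral>x. en ((cmod (f x))\<^sup>2))"
  and rep: "g : bcs ==> AE x. x ~: fun_support g -->
    lintegrable (%y. K x y * g y) & T g x = (LINT y. K x y * g y)"
  and CK: "0 <= CK" and \<gamma>: "0 < \<gamma>" "\<gamma> <= 1"
  and smooth1: "x ~= y ==> 2 * dist x x' <= dist x y ==>
    cmod (K x y - K x' y) <= CK * dist x x' powr \<gamma> / dist x y powr (real DIM('a) + \<gamma>)"
  and smooth2: "x ~= y ==> 2 * dist x x' <= dist x y ==>
    cmod (K y x - K y x') <= CK * dist x x' powr \<gamma> / dist x y powr (real DIM('a) + \<gamma>)"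
begin

lemma T_measurable [measurable]: "f : bcs ==> T f : lmeas" using lin by (simp add: linear_operator_on_def)

lemma T_add: "f : bcs ==> g : bcs ==>
  AE x. T (%z. f z + g z) x = T f x + T g x" using lin by (simp add: linear_operator_on_def)

lemma T_scale: "f : bcs ==> AE x. T (%z. c * f z) x = c * T f x" using lin by (simp add: linear_operator_on_def)

lemma T_diff:
 assumes "f : bcs" "g : bcs"
 shows "AE x. T (%z. f z - g z) x = T f x - T g x" using T_add[OF assms(1) bcs_scale[OF assms(2), of "-1"]] T_scale[OF assms(2), of "-1"]
 by eventually_elim simp

lemma T_null:
 assumes f: "f : bcs" and "AE x. f x = 0"
 shows "AE x. T f x = 0"
proof -
 have "(\<integral>x. en ((cmod (f x))\<^sup>2)) = (\<integral>\<^sup>+x. 0 \<partial>(lebesgue :: 'a measure))"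
  using assms(2) by (intro nn_integral_cong_AE) auto
 hence "(\<integral>x. en ((cmod (T f x))\<^sup>2)) = 0" using l2[OF f] by simp
 moreover have [measurable]: "T f : lmeas" using f by (rule T_measurable)
 ultimately have "AE x. en ((cmod (T f x))\<^sup>2) = 0" by (subst (asm) nn_integral_0_iff_AE) auto
 thus ?thesis by eventually_elim (simp add: ennreal_eq_0_iff)
qed

lemma T_sum:
 assumes "finite I" "!!i. i : I ==> f i : bcs"
 shows "AE x. T (%z. \<Sum>i\<in>I. f i z) x = (\<Sum>i\<in>I. T (f i) x)" using assms
proof (induction I rule: finite_induct)
 case empty
 show ?case using T_null[OF bcs_zero] by simp
next
 case (insert i I)
 have "AE x. T (%z. f i z + (\<Sum>i\<in>I. f i z)) x = T (f i) x + T (%z. \<Sum>i\<in>I. f i z) x" using insert by (intro T_add bcs_sum) auto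
 moreover have "AE x. T (%z. \<Sum>i\<in>I. f i z) x = (\<Sum>i\<in>I. T (f i) x)" using insert by auto
 ultimately show ?case by eventually_elim (use insert.hyps in simp)
qed

text \<open>T is additive over finite sums only; infinite ones are reached through the L2 bound,
  which gives almost everywhere convergence along a subsequence.\<close>

lemma T_l2_subseq:
 assumes f: "f : bcs" and g: "!!n. g n : bcs"
  and lim: "(%n. \<integral>\<^sup>+x. en ((cmod (g n x - f x))\<^sup>2) \<partial>lebesgue) \<longlonglongrightarrow> 0"
 shows "\<exists>r. strict_mono r & (AE x. (%n. T (g (r n)) x) \<longlonglongrightarrow> T f x)"
proof -
 define u where "u n x = (cmod (T (g n) x - T f x))\<^sup>2" for n x
 have Tm[measurable]: "T f : lmeas" "!!n. T (g n) : lmeas" by (rule T_measurable[OF f]) (rule T_measurable[OF g])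
 have um[measurable]: "u n : lmeas" for n unfolding u_def[abs_def] by measurable
 have ub: "(\<integral>x. en (u n x)) <= en C2 * (\<integral>x. en ((cmod (g n x - f x))\<^sup>2))" for n
 proof -
  have "(\<integral>x. en (u n x)) = (\<integral>x. en ((cmod (T (%z. g n z - f z) x))\<^sup>2))"
   using T_diff[OF g[of n] f] by (intro nn_integral_cong_AE) (auto simp: u_def)
  also have "... <= en C2 * (\<integral>x. en ((cmod (g n x - f x))\<^sup>2))" by (rule l2[OF bcs_diff[OF g f]])
  finally show ?thesis .
 qed
 have fin: "(\<integral>x. en (norm (u n x))) < \<infinity>" for n
 proof -
  have "en C2 * (\<integral>x. en ((cmod (g n x - f x))\<^sup>2)) < \<infinity>"
   using bcs_sq_fin[OF bcs_diff[OF g f], of n] by (simp add: ennreal_mult_less_top)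
  with ub[of n] have "(\<integral>x. en (u n x)) < \<infinity>" by (rule le_less_trans)
  thus ?thesis by (simp add: u_def)
 qed
 have int: "lintegrable (u n)" for n using fin by (intro integrableI_bounded) auto
 have "(%n. en C2 * (\<integral>x. en ((cmod (g n x - f x))\<^sup>2))) \<longlonglongrightarrow> en C2 * 0" by (intro ennreal_tendsto_cmult lim) auto
 hence lim0: "(%n. en C2 * (\<integral>x. en ((cmod (g n x - f x))\<^sup>2))) \<longlonglongrightarrow> 0" by simp
 have nu: "norm (u n x) = u n x" for n x by (simp add: u_def)
 have "(%n. \<integral>\<^sup>+x. en (norm (u n x)) \<partial>lebesgue) \<longlonglongrightarrow> 0"
  unfolding nu by (rule tendsto_sandwich[OF _ _ tendsto_const lim0]) (use ub in simp_all)
 hence "(%n. LINT x. norm (u n x)) \<longlonglongrightarrow> 0"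
 proof -
  assume a: "(%n. \<integral>\<^sup>+x. en (norm (u n x)) \<partial>lebesgue) \<longlonglongrightarrow> 0"
  have "(\<integral>x. en (norm (u n x))) = en (LINT x. norm (u n x))" for n using int[of n] by (intro nn_integral_eq_integral) auto
  thus ?thesis using a by (simp add: tendsto_ennreal_iff[of _ _ 0, simplified])
 qed
 then obtain r where r: "strict_mono r" "AE x. (%n. u (r n) x) \<longlonglongrightarrow> 0" using tendsto_L1_AE_subseq[of lebesgue u, OF int] by blast
 have "AE x. (%n. T (g (r n)) x) \<longlonglongrightarrow> T f x" using r(2)
 proof eventually_elim
  fix x assume "(%n. u (r n) x) \<longlonglongrightarrow> 0"
  hence "(%n. sqrt (u (r n) x)) \<longlonglongrightarrow> sqrt 0" by (intro tendsto_real_sqrt)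
  hence "(%n. cmod (T (g (r n)) x - T f x)) \<longlonglongrightarrow> 0" by (simp add: u_def)
  thus "(%n. T (g (r n)) x) \<longlonglongrightarrow> T f x" by (simp add: tendsto_norm_zero_iff LIM_zero_cancel)
 qed
 thus ?thesis using r(1) by blast
qed

end

text \<open>The complement of \<open>nb q\<close> splits into the shells between neighbourhoods of
  consecutive ancestors. On the i-th shell the kernel is at most 2^d 2^(-\<gamma> i) divided by the
  volume of the larger ancestor, and \<open>B\<close> bounds the normalised integral of v there, so
  the series is geometric.\<close>

lemma kernel_tail:
 fixes v :: "'a::euclidean_space => ennreal"
 assumes v[measurable]: "v : lmeas" and \<gamma>: "0 < \<gamma>" and x0: "x0 : cub q"
  and B: "!!j. j <= fst q ==> mns v (dq j x0) <= B"
 shows "(\<integral>y\<in>- nb q. en (side q powr \<gamma> / dist x0 y powr (real DIM('a) + \<gamma>)) * v y)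
   <= en (2 ^ DIM('a) / (1 - 2 powr (- \<gamma>))) * B"
proof -
 define k where "k = fst q"
 have q: "q = dq k x0" using x0 cub_eq_dq k_def by blast
 define A where "A i = nb (dq (k - int (Suc i)) x0) - nb (dq (k - int i) x0)" for i
 define h where "h y = en (side q powr \<gamma> / dist x0 y powr (real DIM('a) + \<gamma>)) * v y" for y
 have Am[measurable]: "A i : sets lebesgue" for i unfolding A_def by (intro sets.Diff nb_lebesgue)
 have hm[measurable]: "h : lmeas"
 proof -
  have "(%y. dist x0 y) : lmeas" by (intro measurable_completion) (simp add: borel_measurable_dist)
  hence "(%y. side q powr \<gamma> / dist x0 y powr (real DIM('a) + \<gamma>)) : lmeas"
   by (intro borel_measurable_divide powr_real_measurable borel_measurable_const)
  hence "(%y. en (side q powr \<gamma> / dist x0 y powr (real DIM('a) + \<gamma>))) : lmeas"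
   by (rule measurable_compose) (rule measurable_ennreal)
  thus ?thesis unfolding h_def[abs_def] by (intro borel_measurable_times_ennreal v)
 qed
 have cov: "y : (\<Union>i. A i)" if y: "y ~: nb q" for y
 proof -
  have "\<exists>i. y : nb (dq (k - int i) x0)"
  proof -
   obtain k0 where k0: "\<forall>k\<le>k0. \<forall>x::'a. side (dq k x) > dist x0 y" using side_unbounded by blast
   define i where "i = nat (k - k0)"
   have "k - int i <= k0" by (simp add: i_def)
   hence "side (dq (k - int i) x0) > dist x0 y" using k0 by blast
   moreover have "1 <= 2 * real DIM('a)" using DIM_positive[where 'a='a] by linarith
   hence "side (dq (k - int i) x0) <= 2 * real DIM('a) * side (dq (k - int i) x0)"
    using side_pos[of "dq (k - int i) x0"] by (metis mult_le_cancel_right1 not_less_iff_gr_or_eq)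
   ultimately have "\<not> 2 * real DIM('a) * side (dq (k - int i) x0) <= dist x0 y" by linarith
   hence "y : nb (dq (k - int i) x0)" using dist_not_nb_ge[of x0 "dq (k - int i) x0" y] by auto
   thus ?thesis ..
  qed
  then obtain i where i: "y : nb (dq (k - int i) x0)" "!!j. j < i ==> y ~: nb (dq (k - int j) x0)"
   using exists_least_iff[of "%i. y : nb (dq (k - int i) x0)"] by blast
  have "i ~= 0" using i(1) y q by (metis diff_zero of_nat_0)
  then obtain j where "i = Suc j" using not0_implies_Suc by blast
  hence "y : A j" using i by (simp add: A_def)
  thus ?thesis by blast
 qed
 have Ai: "(\<integral>y\<in>A i. h y) <= en (2 ^ DIM('a) * (2 powr (- \<gamma>)) ^ i) * B" for i
 proof -
  define k' where "k' = k - int (Suc i)"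
  define s where "s = side (dq (k - int i) x0)"
  have s: "s = 2 ^ i * side q" unfolding s_def q side_dq using power_int_add[of "2::real" "-k" "int i"] by simp
  have s0: "s > 0" by (simp add: s_def)
  have vk: "vol (dq k' x0) = 2 ^ DIM('a) * s ^ DIM('a)"
   unfolding k'_def using vol_dq_coarsen[of "k - int i" x0] by (simp add: vol_def s_def algebra_simps)
  have "side q powr \<gamma> / dist x0 y powr (real DIM('a) + \<gamma>) <= 2 ^ DIM('a) * (2 powr (- \<gamma>)) ^ i * (1 / vol (dq k' x0))"
   if y: "y : A i" for y
  proof -
   have "2 * real DIM('a) * s <= dist x0 y" using y unfolding s_def A_def by (intro dist_not_nb_ge) auto
   moreover have "1 <= 2 * real DIM('a)" using DIM_positive[where 'a='a] by linarith
   hence "s <= 2 * real DIM('a) * s" using s0 by (metis mult_le_cancel_right1 not_less_iff_gr_or_eq)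
   ultimately have "s <= dist x0 y" by linarith
   hence "s powr (real DIM('a) + \<gamma>) <= dist x0 y powr (real DIM('a) + \<gamma>)" using s0 \<gamma> by (intro powr_mono2) auto
   hence "side q powr \<gamma> / dist x0 y powr (real DIM('a) + \<gamma>) <= side q powr \<gamma> / s powr (real DIM('a) + \<gamma>)"
    using s0 by (intro divide_left_mono mult_pos_pos) (auto intro: less_le_trans)
   also have "... = (side q / s) powr \<gamma> / s ^ DIM('a)" using s0 by (simp add: powr_add powr_divide powr_realpow field_simps)
   also have "side q / s = 2 powr (- real i)" unfolding s using less_imp_neq[OF side_pos[of q]] by (simp add: powr_minus powr_realpow field_simps)
   also have "(2 powr (- real i)) powr \<gamma> = (2 powr (- \<gamma>)) ^ i" by (simp add: powr_powr powr_realpow[symmetric] mult.commute)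
   also have "(2 powr (- \<gamma>)) ^ i / s ^ DIM('a) = 2 ^ DIM('a) * (2 powr (- \<gamma>)) ^ i * (1 / vol (dq k' x0))" unfolding vk by simp
   finally show ?thesis .
  qed
  hence "(\<integral>y\<in>A i. h y) <= (\<integral>y. en (2 ^ DIM('a) * (2 powr (- \<gamma>)) ^ i) * (en (1 / vol (dq k' x0)) * (v y * indicator (nb (dq k' x0)) y)))"
   unfolding h_def by (intro nn_integral_mono)
     (auto split: split_indicator simp: A_def k'_def mult.assoc[symmetric] ennreal_mult'[symmetric] intro!: mult_right_mono ennreal_leI)
  also have "... = en (2 ^ DIM('a) * (2 powr (- \<gamma>)) ^ i) * mns v (dq k' x0)" unfolding mns_def by (simp add: nn_integral_cmult)
  also have "... <= en (2 ^ DIM('a) * (2 powr (- \<gamma>)) ^ i) * B" by (intro mult_left_mono B) (auto simp: k'_def k_def)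
  finally show ?thesis .
 qed
 have lt1: "2 powr (- \<gamma>) < (1::real)" using \<gamma> by (simp add: powr_less_one)
 have "(\<integral>y\<in>- nb q. h y) <= (\<integral>y. (\<Sum>i. h y * indicator (A i) y))"
 proof (intro nn_integral_mono)
  fix y
  show "h y * indicator (- nb q) y <= (\<Sum>i. h y * indicator (A i) y)"
  proof (cases "y : nb q")
   case False
   then obtain i where i: "y : A i" using cov by blast
   have "(\<Sum>i\<in>{i}. h y * indicator (A i) y) <= (\<Sum>i. h y * indicator (A i) y)" by (intro sum_le_suminf) auto
   thus ?thesis using i False by simp
  qed auto
 qed
 also have "... = (\<Sum>i. \<integral>\<^sup>+y\<in>A i. h y \<partial>lebesgue)" by (intro nn_integral_suminf) measurable
 also have "... <= (\<Sum>i. en (2 ^ DIM('a) * (2 powr (- \<gamma>)) ^ i) * B)" by (intro suminf_le Ai) auto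
 also have "... = (\<Sum>i. en (2 ^ DIM('a) * (2 powr (- \<gamma>)) ^ i)) * B" by simp
 also have "(\<Sum>i. en (2 ^ DIM('a) * (2 powr (- \<gamma>)) ^ i)) = en (2 ^ DIM('a) * (1 / (1 - 2 powr (- \<gamma>))))"
  using lt1 geometric_sums[of "2 powr (- \<gamma>)"] by (intro suminf_ennreal_eq sums_mult) auto
 finally show ?thesis unfolding h_def by simp
qed

subsection \<open>Calderon-Zygmund decomposition\<close>

lemma not_nb_not_closure:
 fixes x :: "'a::euclidean_space"
 assumes "x ~: nb q"
 shows "x ~: closure (cub q)"
proof
 assume "x : closure (cub q)"
 moreover have "0 < 2 * real DIM('a) * side q" by simp
 ultimately obtain y where "y : cub q" "dist y x < 2 * real DIM('a) * side q" using closure_approachable by blast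
 thus False using dist_not_nb_ge[OF _ assms, of y] by simp
qed

lemma DIM_ge1: "1 <= real DIM('a::euclidean_space)" using DIM_positive[where 'a='a] by linarith

definition cell :: "(int \<times> 'a::euclidean_space) set => 'a => int \<times> 'a" where
 "cell S x = (THE q. q : S & x : cub q)"

lemma cell_eq:
 assumes "disjoint_family_on cub S" "q : S" "x : cub q"
 shows "cell S x = q" unfolding cell_def using assms(2,3) disjoint_family_onD[OF assms(1) assms(2)] by (intro the_equality) blast+

lemma measurable_cell:
 assumes S: "countable S" "disjoint_family_on cub S" and N: "!!q. c q : space N" "z : space N"
 shows "(%x. if x : (\<Union>q\<in>S. cub q) then c (cell S x) else z) : measurable borel N"
proof (rule measurableI)
 fix B assume "B : sets N"
 let ?A = "\<Union>q\<in>{q\<in>S. c q : B}. cub q" and ?O = "\<Union>q\<in>S. cub q"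
 have eq: "(%x. if x : ?O then c (cell S x) else z) -` B Int space borel
  = ?A Un (if z : B then - ?O else {})"
 proof (rule set_eqI)
  fix x
  show "x : (%x. if x : ?O then c (cell S x) else z) -` B Int space borel \<longleftrightarrow> x : ?A Un (if z : B then - ?O else {})"
  proof (cases "x : ?O")
   case True
   then obtain q where q: "q : S" "x : cub q" by blast
   have "x : ?A \<longleftrightarrow> c q : B" using q cell_eq[OF S(2)] by (metis (mono_tags, lifting) UN_iff mem_Collect_eq)
   thus ?thesis using q cell_eq[OF S(2) q] by auto
  qed auto
 qed
 have A: "?A : sets borel" and O: "?O : sets borel" using S(1) by (auto intro!: sets.countable_UN'')
 show "(%x. if x : ?O then c (cell S x) else z) -` B Int space borel : sets borel" unfolding eq using A borel_comp[OF O]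
  by (cases "z : B") (simp_all only: if_True if_False sets.Un sets.empty_sets)
qed (use N in auto)

context
 fixes f :: "'a::euclidean_space => complex" and l :: real
begin

definition cz_cubes where
 "cz_cubes = stop (%q. en l < cav (%x. enorm (f x)) q)"

definition cmean where
 "cmean q = (LINT y. f y * indicator (cub q) y) / of_real (vol q)"

definition cz_good where
 "cz_good x = (if x : (\<Union>q\<in>cz_cubes. cub q) then cmean (cell cz_cubes x) else f x)"

definition cz_atom where
 "cz_atom q x = (f x - cmean q) * indicator (cub q) x"

lemma countable_cz_cubes [simp]: "countable cz_cubes"
 and disjoint_cz_cubes: "disjoint_family_on cub cz_cubes"
 and cz_cubes_cubes: "cz_cubes <= cubes" by (auto simp: cz_cubes_def disjoint_family_stop stop_cubes[THEN subsetD])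

lemma cz_cubes_cav: "q : cz_cubes ==> ennreal l < cav (%x. enorm (f x)) q" by (simp add: cz_cubes_def stop_def)

context
 assumes f: "f : bcs" and l: "0 < l"
begin

lemma f_meas [measurable]: "f : lmeas" using f by (rule bcs_measurable)

lemma cz_cubes_ex:
 assumes "en l < cav (%x. enorm (f x)) (dq k x)"
 shows "\<exists>q\<in>cz_cubes. x : cub q"
proof -
 obtain j0 where "\<forall>j\<le>j0. \<forall>x. cav (%x. enorm (f x)) (dq j x) <= en l" using cav_small[OF bcs_fin[OF f] l] by blast
 hence "!!j. j <= j0 ==> \<not> en l < cav (%x. enorm (f x)) (dq j x)" by (simp add: not_less)
 from stop_ex[where P = "%q. en l < cav (%x. enorm (f x)) q", OF assms this]
 show ?thesis by (auto simp: cz_cubes_def)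
qed

lemma cmean_le_cav:
 assumes q: "q : cubes"
 shows "enorm (cmean q) <= cav (%x. enorm (f x)) q"
proof -
 have i: "lintegrable (%y. f y * indicator (cub q) y)" by (intro bcs_integrable bcs_indicator f) simp
 have "enorm (LINT y. f y * indicator (cub q) y) <= (\<integral>y. enorm (f y * indicator (cub q) y))" using integral_norm_bound_ennreal[OF i] .
 also have "... = (\<integral>x\<in>cub q. enorm (f x))" by (intro nn_integral_cong) (auto split: split_indicator)
 finally have *: "enorm (LINT y. f y * indicator (cub q) y) <= (\<integral>x\<in>cub q. enorm (f x))" .
 have "cmod (cmean q) = 1 / vol q * cmod (LINT y. f y * indicator (cub q) y)"
  using vol_pos[of q] unfolding cmean_def by (simp add: norm_divide del: vol_pos)
 hence "enorm (cmean q) = en (1 / vol q) * enorm (LINT y. f y * indicator (cub q) y)" by (simp only: ennreal_mult'' norm_ge_zero)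
 also have "... <= cav (%x. enorm (f x)) q" unfolding cav_def by (intro mult_left_mono *) auto
 finally show ?thesis .
qed

text \<open>The parent of a selected cube fails the selection criterion, and its volume is 2^d times
  as large.\<close>

lemma cav_cz_le:
 assumes "q : cz_cubes"
 shows "cav (%x. enorm (f x)) q <= en (2 ^ DIM('a) * l)"
proof -
 let ?F = "%x. enorm (f x)"
 obtain x where x: "q = dq (fst q) x" using cubes_ex[OF subsetD[OF cz_cubes_cubes assms]] by blast
 define k where "k = fst q"
 have "\<not> en l < cav ?F (dq (k - 1) x)"
 proof -
  have "x : cub q" by (subst x) simp
  thus ?thesis using assms unfolding cz_cubes_def stop_def k_def by auto
 qed
 hence "(\<integral>x\<in>cub (dq (k - 1) x). ?F x) <= en (vol (dq (k - 1) x)) * en l" by (simp add: cav_le_iff[symmetric] not_less)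
 moreover have "(\<integral>x\<in>cub q. ?F x) <= (\<integral>x\<in>cub (dq (k - 1) x). ?F x)" using cub_mono[of "k - 1" k x] x unfolding k_def
  by (intro nn_integral_mono) (auto split: split_indicator)
 moreover have "en (vol (dq (k - 1) x)) * en l = en (vol q) * en (2 ^ DIM('a) * l)" using vol_dq_coarsen[of k x] x l unfolding k_def
  by (simp add: ennreal_mult'[symmetric] less_imp_le mult_ac)
 ultimately show ?thesis unfolding cav_le_iff by simp
qed

lemma cmean_cz_le: "q : cz_cubes ==> cmod (cmean q) <= 2 ^ DIM('a) * l"
proof -
 assume q: "q : cz_cubes"
 have "enorm (cmean q) <= en (2 ^ DIM('a) * l)" by (rule order_trans[OF cmean_le_cav[OF subsetD[OF cz_cubes_cubes q]] cav_cz_le[OF q]])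
 thus ?thesis using l by (simp add: ennreal_le_iff)
qed

text \<open>A selected cube meets the support of f and has volume at most the integral of |f|
  divided by l. This makes the good part compactly supported.\<close>

lemma cz_cubes_bounded: "\<exists>R. \<forall>q\<in>cz_cubes. cub q <= ball 0 R"
proof -
 obtain M R where MR: "!!x. cmod (f x) <= M" "0 <= M" "!!x. f x ~= 0 ==> x : ball 0 R" "0 < R" by (rule bcsE[OF f]) (rule that)
 let ?F = "%x. enorm (f x)"
 obtain r where r: "(\<integral>x. ?F x) = en r" "0 <= r" using bcs_fin[OF f] by (cases "\<integral>\<^sup>+x. ?F x \<partial>lebesgue") auto
 define s where "s = max 1 (r / l)"
 have "cub q <= ball 0 (R + real DIM('a) * s)" if q: "q : cz_cubes" for q
 proof
  fix x assume x: "x : cub q"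
  have lt: "en (vol q) * en l < (\<integral>x\<in>cub q. ?F x)" using cz_cubes_cav[OF q] by (simp add: less_cav_iff)
  have "\<exists>y\<in>cub q. f y ~= 0"
  proof (rule ccontr)
   assume "\<not> ?thesis"
   hence "(\<integral>x\<in>cub q. ?F x) = (\<integral>\<^sup>+x. 0 \<partial>(lebesgue :: 'a measure))"
    by (intro nn_integral_cong) (auto split: split_indicator)
   thus False using lt by simp
  qed
  then obtain y where y: "y : cub q" "f y ~= 0" by blast
  have "(\<integral>x\<in>cub q. ?F x) <= (\<integral>x. ?F x)" by (intro nn_integral_mono) (auto split: split_indicator)
  with lt have "en (vol q) * en l < en r" unfolding r by (rule less_le_trans)
  hence "vol q * l < r" using l r(2) by (simp add: ennreal_mult'[symmetric] ennreal_less_iff less_imp_le)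
  hence "vol q < r / l" using l by (simp add: field_simps)
  \<comment> \<open>\<open>vol q\<close> bounds the side only where the side is at least 1, hence
    the maximum in \<open>s\<close>.\<close>
  hence "side q <= s" using vol_ge_side[of q] unfolding s_def by linarith
  hence "real DIM('a) * side q <= real DIM('a) * s" by (intro mult_left_mono) auto
  hence "dist x y <= real DIM('a) * s" using dist_cub_le[OF x y(1)] by linarith
  moreover have "norm y < R" using MR(3)[OF y(2)] by simp
  moreover have "norm x <= norm y + dist x y" using norm_triangle_sub[of x y] by (simp add: dist_norm)
  ultimately have "norm x < R + real DIM('a) * s" by linarith
  thus "x : ball 0 (R + real DIM('a) * s)" by simp
 qed
 thus ?thesis by blast
qed

lemma cz_good_measurable: "cz_good : lmeas"
proof -
 let ?O = "\<Union>q\<in>cz_cubes. cub q"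
 have "(%x. if x : ?O then cmean (cell cz_cubes x) else 0) : borel_measurable borel" by (rule measurable_cell) (auto simp: disjoint_cz_cubes)
 hence m1[measurable]: "(%x. if x : ?O then cmean (cell cz_cubes x) else 0) : lmeas" by (intro measurable_completion) simp
 have O[measurable]: "- ?O : sets lebesgue"
 proof -
  have "?O : sets lebesgue" by (intro sets.countable_UN'') auto
  from sets.compl_sets[OF this] show ?thesis by (simp add: Compl_eq_Diff_UNIV)
 qed
 have "cz_good = (%x. (if x : ?O then cmean (cell cz_cubes x) else 0) + f x * indicator (- ?O) x)" by (auto simp: cz_good_def fun_eq_iff)
 also have "... : lmeas" by measurable
 finally show ?thesis .
qed

lemma cz_good_bcs: "cz_good : bcs"
proof -
 obtain M R where MR: "!!x. cmod (f x) <= M" "0 <= M" "!!x. f x ~= 0 ==> x : ball 0 R" "0 < R" by (rule bcsE[OF f]) (rule that)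
 obtain R' where R': "\<forall>q\<in>cz_cubes. cub q <= ball 0 R'" using cz_cubes_bounded by blast
 show ?thesis
 proof (rule bcsI[where M = "max M (2 ^ DIM('a) * l)" and S = "ball 0 R Un ball 0 R'"])
  show "cz_good : lmeas" by (rule cz_good_measurable)
  show "cmod (cz_good x) <= max M (2 ^ DIM('a) * l)" for x
  proof (cases "x : (\<Union>q\<in>cz_cubes. cub q)")
   case True
   then obtain q where q: "q : cz_cubes" "x : cub q" by blast
   thus ?thesis using True cmean_cz_le[OF q(1)] cell_eq[OF disjoint_cz_cubes q] by (simp add: cz_good_def le_max_iff_disj)
  qed (use MR(1)[of x] in \<open>simp add: cz_good_def le_max_iff_disj\<close>)
  show "x : ball 0 R Un ball 0 R'" if "cz_good x ~= 0" for x
  proof (cases "x : (\<Union>q\<in>cz_cubes. cub q)")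
   case True
   thus ?thesis using R' by blast
  next
   case False
   hence "f x ~= 0" using that by (simp add: cz_good_def)
   thus ?thesis using MR(3) by blast
  qed
 qed simp
qed

text \<open>On selected cubes the good part is a mean; elsewhere no dyadic average exceeds l, and
  \<open>dyadic_lebesgue\<close> passes from averages to values.\<close>

lemma cz_good_le: "AE x. cmod (cz_good x) <= 2 ^ DIM('a) * l"
proof -
 let ?O = "\<Union>q\<in>cz_cubes. cub q"
 have "AE x. x : - ?O --> cmod (f x) <= l"
 proof (rule dyadic_lebesgue)
  fix x assume "x : - ?O"
  hence "cav (%x. enorm (f x)) (dq k x) <= en l" for k using cz_cubes_ex[of k x] by (intro leI) blast
  thus "\<exists>k0. \<forall>k\<ge>k0. cav (%x. enorm (f x)) (dq k x) <= en l" by blast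
 qed (use bcs_fin[OF f] l in auto)
 thus ?thesis
 proof eventually_elim
  fix x assume *: "x : - ?O --> cmod (f x) <= l"
  show "cmod (cz_good x) <= 2 ^ DIM('a) * l"
  proof (cases "x : ?O")
   case True
   then obtain q where q: "q : cz_cubes" "x : cub q" by blast
   thus ?thesis using True cmean_cz_le[OF q(1)] cell_eq[OF disjoint_cz_cubes q] by (simp add: cz_good_def)
  next
   case False
   hence "cmod (cz_good x) <= 1 * l" using * by (simp add: cz_good_def)
   also have "... <= 2 ^ DIM('a) * l" using l by (intro mult_right_mono) auto
   finally show ?thesis .
  qed
 qed
qed

lemma cz_atom_bcs: "cz_atom q : bcs"
proof -
 have "(%x. f x * indicator (cub q) x) : bcs" by (intro bcs_indicator f) simp
 moreover have "bounded (cub q)"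
 proof (cases "cub q = {}")
  case False
  then obtain x where "x : cub q" by blast
  thus ?thesis using dist_cub_le unfolding bounded_def by blast
 qed simp
 hence "(%x. cmean q * indicator (cub q) x) : bcs" by (intro bcsI[where M = "cmod (cmean q)" and S = "cub q"]) (auto simp: indicator_def)
 ultimately have "(%x. f x * indicator (cub q) x - cmean q * indicator (cub q) x) : bcs" by (rule bcs_diff)
 moreover have "(%x. f x * indicator (cub q) x - cmean q * indicator (cub q) x) = cz_atom q" by (auto simp: cz_atom_def fun_eq_iff algebra_simps)
 ultimately show ?thesis by simp
qed

lemma cz_atom_integral: assumes q: "q : cubes" shows "(LINT x. cz_atom q x) = 0"
proof -
 have e: "\<mu> (cub q) = en (vol q)" by (rule emeasure_cub[OF q])
 have i1: "lintegrable (%y. f y * indicator (cub q) y)" by (intro bcs_integrable bcs_indicator f) simp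
 have i2: "lintegrable (%y. cmean q * indicator (cub q) y)"
 proof -
  have "lintegrable (%y. of_real (indicator (cub q) y) :: complex)" using e by (intro integrable_of_real integrable_real_indicator) auto
  thus ?thesis by (intro integrable_mult_right) (simp add: of_real_indicator)
 qed
 have "(LINT x. cz_atom q x) = (LINT x. f x * indicator (cub q) x - cmean q * indicator (cub q) x)"
  by (intro Bochner_Integration.integral_cong) (auto simp: cz_atom_def algebra_simps)
 also have "... = (LINT x. f x * indicator (cub q) x) - cmean q * (LINT x. indicator (cub q) x)" using i1 i2 by simp
 also have "(LINT x. (indicator (cub q) x :: complex)) = of_real (vol q)"
 proof -
  have "(LINT x. (indicator (cub q) x :: complex)) = (LINT x. of_real (indicator (cub q) x))" by (simp add: of_real_indicator)
  also have "... = of_real (LINT x. indicator (cub q) x)" by (rule integral_of_real) (use e in \<open>auto intro!: integrable_real_indicator\<close>)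
  also have "(LINT x. indicator (cub q) x) = vol q" using e less_imp_le[OF vol_pos[of q]] by (simp add: measure_def del: emeasure_completion)
  finally show ?thesis .
 qed
 also have "(LINT x. f x * indicator (cub q) x) - cmean q * of_real (vol q) = 0" using vol_pos[of q] unfolding cmean_def by (simp del: vol_pos)
 finally show ?thesis .
qed

lemma cz_atom_norm:
 assumes q: "q : cubes"
 shows "(\<integral>x. enorm (cz_atom q x)) <= 2 * (\<integral>x\<in>cub q. enorm (f x))"
proof -
 let ?F = "%x. enorm (f x)"
 have "(\<integral>x. enorm (cz_atom q x)) <=
  (\<integral>x. ?F x * indicator (cub q) x + enorm (cmean q) * indicator (cub q) x)" by (intro nn_integral_mono)
    (auto simp: cz_atom_def ennreal_plus[symmetric] simp del: ennreal_plus split: split_indicator intro!: ennreal_leI norm_triangle_ineq4)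
 also have "... = (\<integral>x\<in>cub q. ?F x) + enorm (cmean q) * en (vol q)"
  by (subst nn_integral_add) (auto simp: nn_integral_cmult_indicator emeasure_cub[OF q] simp del: emeasure_completion)
 also have "... <= (\<integral>x\<in>cub q. ?F x) + cav ?F q * en (vol q)" by (intro add_left_mono mult_right_mono cmean_le_cav q) auto
 also have "cav ?F q * en (vol q) = (\<integral>x\<in>cub q. ?F x)" unfolding cav_def by (subst mult.commute) (rule ennreal_cancel(1)[OF vol_pos])
 finally show ?thesis by (simp add: mult_2)
qed

end

end

declare f_meas [measurable del]

context cz_op
begin

definition tailC :: real where
 "tailC = CK * real DIM('a) * (2 ^ DIM('a) / (1 - 2 powr (- \<gamma>)))"

lemma tailC_nonneg: "0 <= tailC"
proof -
 have "2 powr (- \<gamma>) < (1::real)" using \<gamma> by (simp add: powr_less_one)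
 thus ?thesis unfolding tailC_def using CK by simp
qed

lemma smooth_cub:
 assumes "z : cub q" "y : cub q" "x ~: nb q"
 shows "cmod (K x y - K x z) <= CK * real DIM('a) * (side q powr \<gamma> / dist z x powr (real DIM('a) + \<gamma>))" (is ?t1)
  and "cmod (K y x - K z x) <= CK * real DIM('a) * (side q powr \<gamma> / dist z x powr (real DIM('a) + \<gamma>))" (is ?t2)
proof -
 have d: "2 * real DIM('a) * side q <= dist z x" by (rule dist_not_nb_ge[OF assms(1,3)])
 have dy: "dist z y <= real DIM('a) * side q" by (rule dist_cub_le[OF assms(1,2)])
 have "0 < 2 * real DIM('a) * side q" by simp
 hence "0 < dist z x" using d by linarith
 hence ne: "z ~= x" by simp
 have two: "2 * dist z y <= dist z x" using d dy by linarith
 have "dist z y powr \<gamma> <= (real DIM('a) * side q) powr \<gamma>" using dy \<gamma> by (intro powr_mono2) auto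
 also have "... = real DIM('a) powr \<gamma> * side q powr \<gamma>" by (simp add: powr_mult)
 \<comment> \<open>As \<gamma> <= 1, the factor d^\<gamma> is absorbed into d.\<close>
 also have "... <= real DIM('a) powr 1 * side q powr \<gamma>" using \<gamma> DIM_ge1[where 'a='a] by (intro mult_right_mono powr_mono) auto
 finally have pw: "dist z y powr \<gamma> <= real DIM('a) * side q powr \<gamma>" by simp
 have le: "CK * dist z y powr \<gamma> / dist z x powr (real DIM('a) + \<gamma>)
   <= CK * real DIM('a) * (side q powr \<gamma> / dist z x powr (real DIM('a) + \<gamma>))"
  using mult_left_mono[OF pw CK] by (simp add: divide_right_mono mult.assoc)
 show ?t1 using smooth2[OF ne two] le by (simp add: norm_minus_commute)
 show ?t2 using smooth1[OF ne two] le by (simp add: norm_minus_commute)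
qed

text \<open>The vanishing integral of b allows K x z to be subtracted from K x y under the integral.
  The point z is free in the cube, so that \<open>B\<close> may later be taken as the maximal weight
  at any point of it.\<close>

lemma atom_tail:
 assumes b: "b : bcs" and q: "q : cubes" and supp: "!!x. b x ~= 0 ==> x : cub q"
  and b0: "(LINT x. b x) = 0" and v[measurable]: "v : lmeas"
  and z: "z : cub q" and B: "!!j. j <= fst q ==> mns v (dq j z) <= B"
 shows "(\<integral>x\<in>- nb q. enorm (T b x) * v x)
  <= en tailC * (\<integral>x. enorm (b x)) * B"
proof -
 define I where "I = (\<integral>x. enorm (b x))"
 define h where "h x = side q powr \<gamma> / dist z x powr (real DIM('a) + \<gamma>)" for x
 have h0: "0 <= h x" for x by (simp add: h_def)
 have fs: "fun_support b <= closure (cub q)" unfolding fun_support_def using supp by (intro closure_mono) auto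
 have hm[measurable]: "h : lmeas"
 proof -
  have "(%y. dist z y) : lmeas" by (intro measurable_completion) (simp add: borel_measurable_dist)
  thus ?thesis unfolding h_def[abs_def] by (intro borel_measurable_divide powr_real_measurable borel_measurable_const)
 qed
 have "AE x. x ~: nb q --> enorm (T b x) <= en (CK * real DIM('a) * h x) * I" using rep[OF b]
 proof eventually_elim
  fix x
  assume r: "x ~: fun_support b --> lintegrable (%y. K x y * b y) & T b x = (LINT y. K x y * b y)"
  show "x ~: nb q --> enorm (T b x) <= en (CK * real DIM('a) * h x) * I"
  proof
   assume x: "x ~: nb q"
   hence "x ~: fun_support b" using fs not_nb_not_closure by blast
   hence i: "lintegrable (%y. K x y * b y)" and Tb: "T b x = (LINT y. K x y * b y)" using r by auto
   have i2: "lintegrable (%y. K x z * b y)" by (intro integrable_mult_right bcs_integrable b)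
   have i3: "lintegrable (%y. K x y * b y - K x z * b y)" using i i2 by simp
   have "T b x = (LINT y. K x y * b y) - (LINT y. K x z * b y)" using b0 by (simp add: Tb)
   also have "... = (LINT y. K x y * b y - K x z * b y)" using i i2 by simp
   finally have "enorm (T b x) <= (\<integral>y. enorm (K x y * b y - K x z * b y))" using integral_norm_bound_ennreal[OF i3] by simp
   also have "... <= (\<integral>y. en (CK * real DIM('a) * h x) * enorm (b y))"
   proof (rule nn_integral_mono)
    fix y
    show "enorm (K x y * b y - K x z * b y) <= en (CK * real DIM('a) * h x) * enorm (b y)"
    proof (cases "b y = 0")
     case False
     have "cmod (K x y * b y - K x z * b y) = cmod (K x y - K x z) * cmod (b y)" by (simp add: norm_mult[symmetric] algebra_simps)
     also have "... <= (CK * real DIM('a) * h x) * cmod (b y)"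
      using smooth_cub(1)[OF z supp[OF False] x] unfolding h_def by (intro mult_right_mono) auto
     finally have "enorm (K x y * b y - K x z * b y) <= en ((CK * real DIM('a) * h x) * cmod (b y))" by (rule ennreal_leI)
     thus ?thesis by (simp add: ennreal_mult'')
    qed auto
   qed
   also have "... = en (CK * real DIM('a) * h x) * I"
    unfolding I_def by (intro nn_integral_cmult measurable_compose[OF bcs_measurable[OF b]]) measurable
   finally show "enorm (T b x) <= en (CK * real DIM('a) * h x) * I" .
  qed
 qed
 hence "(\<integral>x\<in>- nb q. enorm (T b x) * v x)
  <= (\<integral>x. (en (CK * real DIM('a)) * I) * (en (h x) * v x * indicator (- nb q) x))"
 proof (intro nn_integral_mono_AE, eventually_elim)
  fix x assume *: "x ~: nb q --> enorm (T b x) <= en (CK * real DIM('a) * h x) * I"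
  show "enorm (T b x) * v x * indicator (- nb q) x
   <= (en (CK * real DIM('a)) * I) * (en (h x) * v x * indicator (- nb q) x)"
  proof (cases "x : nb q")
   case False
   hence "enorm (T b x) * v x <= (en (CK * real DIM('a) * h x) * I) * v x" using * by (intro mult_right_mono) auto
   also have "en (CK * real DIM('a) * h x) = en (CK * real DIM('a)) * en (h x)" using h0[of x] by (rule ennreal_mult'')
   finally show ?thesis using False by (simp add: mult_ac)
  qed auto
 qed
 also have "... = (en (CK * real DIM('a)) * I) * (\<integral>x. en (h x) * v x * indicator (- nb q) x)"
 proof (rule nn_integral_cmult)
  have [measurable]: "- nb q : sets lebesgue" using sets.compl_sets[OF nb_lebesgue[of q]] by (simp add: Compl_eq_Diff_UNIV)
  show "(%x. en (h x) * v x * indicator (- nb q) x) : lmeas" by measurable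
 qed
 also have "... <= (en (CK * real DIM('a)) * I) * (en (2 ^ DIM('a) / (1 - 2 powr (- \<gamma>))) * B)"
  unfolding h_def by (intro mult_left_mono kernel_tail v \<gamma> z B) auto
 also have "... = en tailC * I * B"
 proof -
  have "en (CK * real DIM('a)) * en (2 ^ DIM('a) / (1 - 2 powr (- \<gamma>))) = en tailC"
   unfolding tailC_def using CK by (intro ennreal_mult'[symmetric]) simp
  thus ?thesis by (metis mult.assoc mult.commute)
 qed
 finally show ?thesis unfolding I_def .
qed

end

lemma nn_integral_cz_cubes_le:
 assumes f: "f : bcs" and W: "W : lmeas"
  and le: "!!q. q : cz_cubes f l ==> g q <= c * (\<integral>x\<in>cub q. enorm (f x) * W x)"
 shows "(\<Sum>\<^sup>+q\<in>(cz_cubes f l). g q) <= c * (\<integral>x. enorm (f x) * W x)"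
proof -
 note [measurable] = bcs_measurable[OF f] W
 have "(\<Sum>\<^sup>+q\<in>(cz_cubes f l). g q) <=
  (\<Sum>\<^sup>+q\<in>(cz_cubes f l). c * (\<integral>x\<in>cub q. enorm (f x) * W x))" using le by (intro nn_integral_mono) auto
 also have "... = c * (\<Sum>\<^sup>+q\<in>(cz_cubes f l). (\<integral>x\<in>cub q. enorm (f x) * W x))" by (simp add: nn_integral_cmult)
 also have "(\<Sum>\<^sup>+q\<in>(cz_cubes f l). (\<integral>x\<in>cub q. enorm (f x) * W x))
   = (\<integral>x\<in>(\<Union>q\<in>cz_cubes f l. cub q). enorm (f x) * W x)" by (intro nn_integral_UN_cub[symmetric] disjoint_cz_cubes) auto
 also have "... <= (\<integral>x. enorm (f x) * W x)" by (intro nn_integral_mono) (auto split: split_indicator)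
 finally show ?thesis by (simp add: mult_left_mono)
qed

text \<open>On a selected cube l times the volume is less than the integral of |f|, and
  \<open>mns v q\<close> is bounded by c1 W at every point of the cube, hence can be moved inside
  that integral.\<close>

lemma cz_exceptional:
 fixes v W :: "'a::euclidean_space => ennreal"
 assumes f: "f : bcs" and l: "0 < l"
  and v[measurable]: "v : lmeas" and W[measurable]: "W : lmeas"
  and a: "!!q x. q : cubes ==> x : cub q ==> mns v q <= c1 * W x"
 shows "en l * (\<integral>x\<in>(\<Union>q\<in>cz_cubes f l. nb q). v x) <= c1 * (\<integral>x. enorm (f x) * W x)"
proof -
 note [measurable] = bcs_measurable[OF f]
 let ?F = "%x. enorm (f x)"
 have "en l * (\<integral>x\<in>(\<Union>q\<in>cz_cubes f l. nb q). v x) <=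
   en l * (\<Sum>\<^sup>+q\<in>(cz_cubes f l). (\<integral>x\<in>nb q. v x))" by (intro mult_left_mono nn_integral_UN_le) auto
 also have "... = (\<Sum>\<^sup>+q\<in>(cz_cubes f l). en l * (\<integral>x\<in>nb q. v x))" by (simp add: nn_integral_cmult)
 also have "... <= c1 * (\<integral>x. ?F x * W x)"
 proof (rule nn_integral_cz_cubes_le[OF f W])
  fix q assume q: "q : cz_cubes f l"
  hence qc: "q : cubes" using cz_cubes_cubes by blast
  have "(\<integral>x\<in>nb q. v x) = en (vol q) * mns v q" unfolding mns_def by (rule ennreal_cancel(1)[OF vol_pos, symmetric])
  hence "en l * (\<integral>x\<in>nb q. v x) = (en (vol q) * en l) * mns v q" by (simp add: mult_ac)
  also have "... <= (\<integral>x\<in>cub q. ?F x) * mns v q"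
   using cz_cubes_cav[OF q] by (intro mult_right_mono) (auto simp: less_cav_iff intro: less_imp_le)
  also have "... = (\<integral>x. ?F x * indicator (cub q) x * mns v q)" by (rule nn_integral_multc[symmetric]) measurable
  also have "... <= (\<integral>x. c1 * (?F x * W x * indicator (cub q) x))"
  proof (rule nn_integral_mono)
   fix x
   show "?F x * indicator (cub q) x * mns v q <= c1 * (?F x * W x * indicator (cub q) x)"
   proof (cases "x : cub q")
    case True
    have "?F x * mns v q <= ?F x * (c1 * W x)" by (intro mult_left_mono a[OF qc True]) simp
    thus ?thesis using True by (simp add: mult_ac)
   qed simp
  qed
  also have "... = c1 * (\<integral>x\<in>cub q. ?F x * W x)" by (rule nn_integral_cmult) measurable
  finally show "en l * (\<integral>x\<in>nb q. v x) <= c1 * (\<integral>x\<in>cub q. ?F x * W x)" .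
 qed
 finally show ?thesis .
qed

text \<open>Replacing f by its mean on a cube is harmless if W1 is nearly constant there: by
  hypothesis \<open>d\<close> the integral of W1 over the cube is at most c3 |q| W y for every y in
  it, and this is averaged against |f y|.\<close>

lemma cz_good_weighted:
 fixes W W1 :: "'a::euclidean_space => ennreal"
 assumes f: "f : bcs" and l: "0 < l"
  and W[measurable]: "W : lmeas" and W1[measurable]: "W1 : lmeas"
  and c: "!!x. W1 x <= W x"
  and d: "!!q x y. q : cz_cubes f l ==> x : cub q ==> y : cub q ==> W1 x <= c3 * W y"
 shows "(\<integral>x. enorm (cz_good f l x) * W1 x) <= (1 + c3) * (\<integral>x. enorm (f x) * W x)"
proof -
 note [measurable] = bcs_measurable[OF f] cz_good_measurable[OF f l]
 let ?F = "%x. enorm (f x)" and ?g = "cz_good f l" and ?O = "\<Union>q\<in>cz_cubes f l. cub q"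
 have O[measurable]: "?O : sets lebesgue" by (intro sets.countable_UN'') auto
 have "(\<integral>x. enorm (?g x) * W1 x) <=
   (\<integral>x. ?F x * W x + enorm (?g x) * W1 x * indicator ?O x)"
  using c by (intro nn_integral_mono) (auto simp: cz_good_def split: split_indicator intro!: mult_left_mono)
 also have "... = (\<integral>x. ?F x * W x) + (\<integral>x\<in>?O. enorm (?g x) * W1 x)" by (rule nn_integral_add) measurable
 also have "(\<integral>x\<in>?O. enorm (?g x) * W1 x)
   = (\<Sum>\<^sup>+q\<in>(cz_cubes f l). (\<integral>x\<in>cub q. enorm (?g x) * W1 x))" by (intro nn_integral_UN_cub disjoint_cz_cubes) auto
 also have "... <= c3 * (\<integral>x. ?F x * W x)"
 proof (rule nn_integral_cz_cubes_le[OF f W])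
  fix q assume q: "q : cz_cubes f l"
  hence qc: "q : cubes" using cz_cubes_cubes by blast
  have g: "?g x = cmean f q" if "x : cub q" for x using that q cell_eq[OF disjoint_cz_cubes q that] by (auto simp: cz_good_def)
  have I1: "(\<integral>x\<in>cub q. W1 x) <= en (vol q) * (c3 * W y)" if y: "y : cub q" for y
  proof -
   have "(\<integral>x\<in>cub q. W1 x) <= (\<integral>x. (c3 * W y) * indicator (cub q) x)"
    using d[OF q _ y] by (intro nn_integral_mono) (auto split: split_indicator)
   also have "... = (c3 * W y) * en (vol q)" by (simp add: nn_integral_cmult_indicator emeasure_cub[OF qc] del: emeasure_completion)
   finally show ?thesis by (simp add: mult.commute)
  qed
  have "(\<integral>x\<in>cub q. enorm (?g x) * W1 x)
   = (\<integral>x. enorm (cmean f q) * (W1 x * indicator (cub q) x))" by (intro nn_integral_cong) (auto split: split_indicator simp: g)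
  also have "... = enorm (cmean f q) * (\<integral>x\<in>cub q. W1 x)" by (rule nn_integral_cmult) measurable
  also have "... <= cav ?F q * (\<integral>x\<in>cub q. W1 x)" by (intro mult_right_mono cmean_le_cav[OF f l qc]) auto
  also have "... = en (1 / vol q) * ((\<integral>x\<in>cub q. ?F x) * (\<integral>x\<in>cub q. W1 x))" unfolding cav_def by (simp add: mult_ac)
  also have "(\<integral>x\<in>cub q. ?F x) * (\<integral>x\<in>cub q. W1 x)
   = (\<integral>y. ?F y * indicator (cub q) y * (\<integral>x\<in>cub q. W1 x))" by (rule nn_integral_multc[symmetric]) measurable
  also have "... <= (\<integral>y. (en (vol q) * c3) * (?F y * W y * indicator (cub q) y))"
  proof (rule nn_integral_mono)
   fix y
   show "?F y * indicator (cub q) y * (\<integral>x\<in>cub q. W1 x)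
    <= (en (vol q) * c3) * (?F y * W y * indicator (cub q) y)"
   proof (cases "y : cub q")
    case True
    have "?F y * (\<integral>x\<in>cub q. W1 x) <= ?F y * (en (vol q) * (c3 * W y))" by (intro mult_left_mono I1 True) auto
    thus ?thesis using True by (simp add: mult_ac)
   qed simp
  qed
  also have "... = (en (vol q) * c3) * (\<integral>x\<in>cub q. ?F x * W x)" by (rule nn_integral_cmult) measurable
  also have "en (1 / vol q) * ... = c3 * (\<integral>x\<in>cub q. ?F x * W x)" unfolding mult.assoc by (rule ennreal_cancel(2)[OF vol_pos])
  finally show "(\<integral>x\<in>cub q. enorm (?g x) * W1 x) <= c3 * (\<integral>x\<in>cub q. ?F x * W x)" by (simp add: mult_left_mono)
 qed
 finally show ?thesis by (simp add: distrib_right add_left_mono)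
qed

context cz_op
begin

lemma cz_bad:
 fixes v W :: "'a => ennreal"
 assumes f: "f : bcs" and l: "0 < l"
  and v[measurable]: "v : lmeas" and W[measurable]: "W : lmeas"
  and a: "!!q x. q : cubes ==> x : cub q ==> mns v q <= c1 * W x"
 shows "(\<integral>x\<in>- (\<Union>q\<in>cz_cubes f l. nb q). enorm (T (%x. f x - cz_good f l x) x) * v x)
  <= en (2 * tailC) * c1 * (\<integral>x. enorm (f x) * W x)"
proof -
 note fm[measurable] = bcs_measurable[OF f] and gm[measurable] = cz_good_measurable[OF f l]
 let ?F = "%x. enorm (f x)" and ?S = "cz_cubes f l"
 define b where "b x = f x - cz_good f l x" for x
 define A where "A = - (\<Union>q\<in>?S. nb q)"
 have b: "b : bcs" unfolding b_def[abs_def] by (intro bcs_diff f cz_good_bcs[OF f l])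
 have Am[measurable]: "A : sets lebesgue"
 proof -
  have "(\<Union>q\<in>?S. nb q) : sets lebesgue" by (intro sets.countable_UN'') auto
  from sets.compl_sets[OF this] show ?thesis by (simp add: A_def Compl_eq_Diff_UNIV)
 qed
 have atom: "(\<integral>x\<in>A. enorm (T (cz_atom f q) x) * v x)
   <= en (2 * tailC) * c1 * (\<integral>x\<in>cub q. ?F x * W x)" if q: "q : ?S" for q
 proof -
  have qc: "q : cubes" using q cz_cubes_cubes by blast
  note atm[measurable] = bcs_measurable[OF cz_atom_bcs[OF f l, of q]]
  define J where "J = (\<integral>x\<in>A. enorm (T (cz_atom f q) x) * v x)"
  define I where "I = (\<integral>x\<in>cub q. ?F x)"
  \<comment> \<open>The left side does not depend on z, so the estimate holds with W at every point
    of the cube.\<close>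
  have Jle: "J <= en (2 * tailC) * I * (c1 * W z)" if z: "z : cub q" for z
  proof -
   have "J <= (\<integral>x\<in>- nb q. enorm (T (cz_atom f q) x) * v x)"
    unfolding J_def A_def using q by (intro nn_integral_mono) (auto split: split_indicator)
   also have "... <= en tailC * (\<integral>x. enorm (cz_atom f q x)) * (c1 * W z)"
    by (rule atom_tail[OF cz_atom_bcs[OF f l] qc _ cz_atom_integral[OF f l qc] v z])
      (auto simp: cz_atom_def indicator_def split: if_splits intro!: a)
   also have "... <= en tailC * (2 * I) * (c1 * W z)" unfolding I_def by (intro mult_left_mono mult_right_mono cz_atom_norm[OF f l qc]) auto
   also have "... = en (2 * tailC) * I * (c1 * W z)" using tailC_nonneg by (simp add: ennreal_mult' mult_ac)
   finally show ?thesis .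
  qed
  have I: "0 < I" "I < \<infinity>"
  proof -
   show "0 < I" using cz_cubes_cav[OF q] unfolding less_cav_iff I_def by (rule le_less_trans[rotated]) simp
   have "I <= (\<integral>x. ?F x)" unfolding I_def by (intro nn_integral_mono) (auto split: split_indicator)
   thus "I < \<infinity>" using bcs_fin[OF f] by (rule le_less_trans)
  qed
  \<comment> \<open>\<open>Jle\<close> is averaged over the cube against |f|, in place of an infimum
    over z; dividing by I afterwards needs 0 < I < \<infinity>.\<close>
  have "I * J = (\<integral>x. ?F x * indicator (cub q) x * J)" unfolding I_def by (rule nn_integral_multc[symmetric]) measurable
  also have "... <= (\<integral>x. (en (2 * tailC) * I * c1) * (?F x * W x * indicator (cub q) x))"
  proof (rule nn_integral_mono)
   fix x
   show "?F x * indicator (cub q) x * J <= (en (2 * tailC) * I * c1) * (?F x * W x * indicator (cub q) x)"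
   proof (cases "x : cub q")
    case True
    have "?F x * J <= ?F x * (en (2 * tailC) * I * (c1 * W x))" by (intro mult_left_mono Jle True) auto
    thus ?thesis using True by (simp add: mult_ac)
   qed simp
  qed
  also have "... = (en (2 * tailC) * I * c1) * (\<integral>x\<in>cub q. ?F x * W x)" by (rule nn_integral_cmult) measurable
  also have "... = I * (en (2 * tailC) * c1 * (\<integral>x\<in>cub q. ?F x * W x))" by (simp only: mult_ac)
  finally have "I * J <= I * (en (2 * tailC) * c1 * (\<integral>x\<in>cub q. ?F x * W x))" .
  thus ?thesis using I unfolding J_def[symmetric] by (subst (asm) ennreal_mult_le_mult_iff) auto
 qed
 show ?thesis
 proof (cases "?S = {}")
  case True
  hence "b = (%x. 0)" by (auto simp: b_def cz_good_def)
  hence "AE x. T b x = 0" using T_null[OF b] by simp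
  hence "(\<integral>x\<in>A. enorm (T b x) * v x) = (\<integral>\<^sup>+x. 0 \<partial>(lebesgue :: 'a measure))" by (intro nn_integral_cong_AE) auto
  thus ?thesis unfolding A_def b_def[abs_def] by simp
 next
  case False
  \<comment> \<open>Finite stages of the possibly infinite sum of atoms. On them T is additive, and
    each stage equals b or 0 at every point, so |b|^2 dominates the squared errors.\<close>
  define Fn where "Fn n = from_nat_into ?S ` {..<n}" for n :: nat
  have Fn: "finite (Fn n)" "Fn n <= ?S" for n using from_nat_into[OF False] by (auto simp: Fn_def)
  have FnU: "\<exists>n0. \<forall>n\<ge>n0. q : Fn n" if qS: "q : ?S" for q
  proof -
   obtain m where "q = from_nat_into ?S m" using from_nat_into_surj[OF countable_cz_cubes qS] by metis
   thus ?thesis by (intro exI[of _ "Suc m"]) (auto simp: Fn_def)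
  qed
  define bn where "bn n x = (\<Sum>q\<in>Fn n. cz_atom f q x)" for n x
  have bn: "bn n : bcs" for n unfolding bn_def[abs_def] by (intro bcs_sum Fn cz_atom_bcs[OF f l])
  have bnx: "bn n x = (if x : (\<Union>q\<in>Fn n. cub q) then b x else 0)" for n x
  proof (cases "x : (\<Union>q\<in>Fn n. cub q)")
   case True
   then obtain q where q: "q : Fn n" "x : cub q" by blast
   have qS: "q : ?S" using q Fn by blast
   have "bn n x = (\<Sum>q'\<in>{q}. cz_atom f q' x)" unfolding bn_def
   proof (rule sum.mono_neutral_right)
    show "\<forall>i\<in>Fn n - {q}. cz_atom f i x = 0"
    proof
     fix i assume i: "i : Fn n - {q}"
     hence "x ~: cub i" using disjoint_family_onD[OF disjoint_cz_cubes[of f l] qS, of i] Fn q(2) by blast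
     thus "cz_atom f i x = 0" by (simp add: cz_atom_def)
    qed
   qed (use q Fn in auto)
   also have "... = b x" using q(2) qS cell_eq[OF disjoint_cz_cubes qS q(2)] by (auto simp: b_def cz_good_def cz_atom_def)
   finally show ?thesis using True by simp
  next
   case False
   hence "\<forall>q\<in>Fn n. cz_atom f q x = 0" by (auto simp: cz_atom_def)
   thus ?thesis using False by (simp add: bn_def)
  qed
  have bn_lim: "\<exists>n0. \<forall>n\<ge>n0. bn n x = b x" for x
  proof (cases "x : (\<Union>q\<in>?S. cub q)")
   case True
   then obtain q where q: "q : ?S" "x : cub q" by blast
   then obtain n0 where "\<forall>n\<ge>n0. q : Fn n" using FnU by blast
   thus ?thesis using q unfolding bnx by (intro exI[of _ n0]) auto
  next
   case False
   hence "b x = 0" by (simp add: b_def cz_good_def)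
   thus ?thesis by (simp add: bnx)
  qed
  have lim: "(%n. \<integral>\<^sup>+x. en ((cmod (bn n x - b x))\<^sup>2) \<partial>lebesgue) \<longlonglongrightarrow> 0"
  proof -
   have bm[measurable]: "b : lmeas" "!!n. bn n : lmeas" by (rule bcs_measurable[OF b]) (rule bcs_measurable[OF bn])
   have "(%n. \<integral>\<^sup>+x. en ((cmod (bn n x - b x))\<^sup>2) \<partial>lebesgue) \<longlonglongrightarrow> (\<integral>\<^sup>+x. 0 \<partial>(lebesgue :: 'a measure))"
   proof (rule nn_integral_dominated_convergence[where w = "%x. en ((cmod (b x))\<^sup>2)"])
    show "AE x. en ((cmod (bn j x - b x))\<^sup>2) <= en ((cmod (b x))\<^sup>2)" for j by (auto simp: bnx)
    show "AE x. (%n. en ((cmod (bn n x - b x))\<^sup>2)) \<longlonglongrightarrow> 0"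
    proof (intro AE_I2)
     fix x
     obtain n0 where "\<forall>n\<ge>n0. bn n x = b x" using bn_lim by blast
     hence "\<forall>\<^sub>F n in sequentially. en ((cmod (bn n x - b x))\<^sup>2) = 0" by (intro eventually_sequentiallyI[of n0]) simp
     thus "(%n. en ((cmod (bn n x - b x))\<^sup>2)) \<longlonglongrightarrow> 0" by (rule tendsto_eventually)
    qed
    show "(\<integral>x. en ((cmod (b x))\<^sup>2)) < \<infinity>" by (rule bcs_sq_fin[OF b])
   qed (auto intro: bm)
   thus ?thesis by simp
  qed
  obtain r where r: "strict_mono r" "AE x. (%n. T (bn (r n)) x) \<longlonglongrightarrow> T b x" using T_l2_subseq[OF b bn lim] by blast
  have each: "(\<integral>x\<in>A. enorm (T (bn n) x) * v x) <=
    en (2 * tailC) * c1 * (\<integral>x. ?F x * W x)" for n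
  proof -
   have Tat[measurable]: "T (cz_atom f q) : lmeas" for q by (rule T_measurable[OF cz_atom_bcs[OF f l]])
   have "AE x. T (bn n) x = (\<Sum>q\<in>Fn n. T (cz_atom f q) x)" unfolding bn_def[abs_def] by (intro T_sum Fn cz_atom_bcs[OF f l])
   hence "(\<integral>x\<in>A. enorm (T (bn n) x) * v x) <=
     (\<integral>x. (\<Sum>q\<in>Fn n. enorm (T (cz_atom f q) x) * v x * indicator A x))"
   proof (intro nn_integral_mono_AE, eventually_elim)
    fix x assume e: "T (bn n) x = (\<Sum>q\<in>Fn n. T (cz_atom f q) x)"
    have "enorm (T (bn n) x) <= en (\<Sum>q\<in>Fn n. cmod (T (cz_atom f q) x))" unfolding e by (intro ennreal_leI norm_sum)
    also have "... = (\<Sum>q\<in>Fn n. enorm (T (cz_atom f q) x))" by (simp add: sum_ennreal)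
    finally show "enorm (T (bn n) x) * v x * indicator A x <= (\<Sum>q\<in>Fn n. enorm (T (cz_atom f q) x) * v x * indicator A x)"
     by (simp add: sum_distrib_right[symmetric] mult_right_mono)
   qed
   also have "... = (\<Sum>q\<in>Fn n. (\<integral>x\<in>A. enorm (T (cz_atom f q) x) * v x))" by (rule nn_integral_sum) measurable
   also have "... <= (\<Sum>q\<in>Fn n. en (2 * tailC) * c1 * (\<integral>x\<in>cub q. ?F x * W x))"
    by (rule sum_mono, rule atom, rule subsetD[OF Fn(2)])
   also have "... = en (2 * tailC) * c1 * (\<integral>x. (\<Sum>q\<in>Fn n. ?F x * W x * indicator (cub q) x))"
   proof -
    have "(\<integral>x. (\<Sum>q\<in>Fn n. ?F x * W x * indicator (cub q) x))
      = (\<Sum>q\<in>Fn n. (\<integral>x\<in>cub q. ?F x * W x))" by (rule nn_integral_sum) measurable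
    thus ?thesis by (simp only: sum_distrib_left)
   qed
   also have "... <= en (2 * tailC) * c1 * (\<integral>x. ?F x * W x)"
   proof (intro mult_left_mono nn_integral_mono)
    fix x
    have "disjoint_family_on cub (Fn n)" by (rule disjoint_family_on_mono[OF Fn(2) disjoint_cz_cubes])
    hence "(\<Sum>q\<in>Fn n. indicator (cub q) x) = (indicator (\<Union>q\<in>Fn n. cub q) x :: ennreal)"
     using Fn by (intro indicator_UN_disjoint[symmetric]) auto
    hence "(\<Sum>q\<in>Fn n. ?F x * W x * indicator (cub q) x) = ?F x * W x * indicator (\<Union>q\<in>Fn n. cub q) x"
     by (simp add: sum_distrib_left[symmetric])
    also have "... <= ?F x * W x" by (auto split: split_indicator)
    finally show "(\<Sum>q\<in>Fn n. ?F x * W x * indicator (cub q) x) <= ?F x * W x" .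
   qed simp
   finally show ?thesis .
  qed
  have Tbn[measurable]: "T (bn n) : lmeas" for n by (rule T_measurable[OF bn])
  \<comment> \<open>Fatou's lemma along the subsequence transfers the bound, uniform in n, to the
    limit.\<close>
  have "(\<integral>x\<in>A. enorm (T b x) * v x)
   <= (\<integral>x. liminf (%n. enorm (T (bn (r n)) x) * (v x * indicator A x)))" using r(2)
  proof (intro nn_integral_mono_AE, eventually_elim)
   fix x assume c: "(%n. T (bn (r n)) x) \<longlonglongrightarrow> T b x"
   have "enorm (T b x) = liminf (%n. enorm (T (bn (r n)) x))" by (rule lim_imp_Liminf[symmetric]) (auto intro!: tendsto_ennrealI tendsto_norm c)
   hence "enorm (T b x) * (v x * indicator A x) = liminf (%n. enorm (T (bn (r n)) x)) * (v x * indicator A x)" by simp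
   also have "... <= liminf (%n. enorm (T (bn (r n)) x) * (v x * indicator A x))" unfolding liminf_SUP_INF SUP_mult_right_ennreal
    by (intro SUP_mono bexI[of _ _ UNIV] INF_greatest mult_right_mono) (auto intro: INF_lower2)
   finally show "enorm (T b x) * v x * indicator A x
     <= liminf (%n. enorm (T (bn (r n)) x) * (v x * indicator A x))" by (simp add: mult.assoc)
  qed
  also have "... <= liminf (%n. (\<integral>x. enorm (T (bn (r n)) x) * (v x * indicator A x)))" by (rule nn_integral_liminf) measurable
  also have "... <= limsup (%n. (\<integral>x. enorm (T (bn (r n)) x) * (v x * indicator A x)))" by (rule Liminf_le_Limsup) simp
  also have "... <= en (2 * tailC) * c1 * (\<integral>x. ?F x * W x)" using each by (intro Limsup_bounded) (auto simp: mult.assoc)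
  finally show ?thesis unfolding A_def b_def[abs_def] .
 qed
qed

text \<open>Serves twice: with all weights equal to 1 and p = 2 it gives the classical weak bound
  \<open>weak_1_1\<close>, and in \<open>weak_bounded_weight\<close> it turns the weighted L^p bound
  into the weak one. The weight W1 of the L^p bound is kept apart from W because near constancy on
  the selected cubes is asked of W1.\<close>

lemma cz_weak:
 fixes v W W1 :: "'a => ennreal"
 assumes f: "f : bcs" and l: "0 < l" and p: "1 <= p" and c3: "0 <= c3" and c12: "0 <= c1" "0 <= c2"
  and v[measurable]: "v : lmeas" and W[measurable]: "W : lmeas"
  and W1[measurable]: "W1 : lmeas"
  and a: "!!q x. q : cubes ==> x : cub q ==> mns v q <= en c1 * W x"
  and b: "!!g. g : bcs ==>
   (\<integral>x\<in>- (\<Union>q\<in>cz_cubes f l. nb q). en (cmod (T g x) powr p) * v x)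
    <= en c2 * (\<integral>x. en (cmod (g x) powr p) * W1 x)"
  and c: "!!x. W1 x <= W x"
  and d: "!!q x y. q : cz_cubes f l ==> x : cub q ==> y : cub q ==> W1 x <= en c3 * W y"
 shows "(\<integral>x\<in>{x. l < cmod (T f x)}. v x) <=
  en ((c1 + 2 powr p * c2 * (2 ^ DIM('a)) powr (p - 1) * (1 + c3) + 4 * tailC * c1) / l)
   * (\<integral>x. enorm (f x) * W x)"
proof -
 define g where "g = cz_good f l"
 define bb where "bb x = f x - g x" for x
 define Om where "Om = (\<Union>q\<in>cz_cubes f l. nb q)"
 define I where "I = (\<integral>x. enorm (f x) * W x)"
 define D where "D = (2::real) ^ DIM('a)"
 have D: "0 < D" by (simp add: D_def)
 have g: "g : bcs" unfolding g_def by (rule cz_good_bcs[OF f l])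
 have bb: "bb : bcs" unfolding bb_def[abs_def] by (intro bcs_diff f g)
 note [measurable] = bcs_measurable[OF f] bcs_measurable[OF g] T_measurable[OF f] T_measurable[OF g] T_measurable[OF bb]
 have Om[measurable]: "Om : sets lebesgue" unfolding Om_def by (intro sets.countable_UN'') auto
 have Omc[measurable]: "- Om : sets lebesgue" using sets.compl_sets[OF Om] by (simp add: Compl_eq_Diff_UNIV)
 have lev: "{x. l / 2 < cmod (T h x)} : sets lebesgue" if "h : bcs" for h
 proof -
  note [measurable] = T_measurable[OF that]
  have "{x\<in>space lebesgue. l / 2 < cmod (T h x)} : sets lebesgue" by measurable
  thus ?thesis by simp
 qed
 note [measurable] = lev[OF g] lev[OF bb]
 have "AE x. T f x = T g x + T bb x" using T_add[OF g bb] by (simp add: bb_def[abs_def])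
 hence "(\<integral>x\<in>{x. l < cmod (T f x)}. v x) <=
  (\<integral>x. (v x * indicator Om x + v x * indicator {x. l / 2 < cmod (T g x)} x * indicator (- Om) x)
    + v x * indicator {x. l / 2 < cmod (T bb x)} x * indicator (- Om) x)"
 proof (intro nn_integral_mono_AE, eventually_elim)
  fix x assume e: "T f x = T g x + T bb x"
  have "l / 2 < cmod (T g x) \<or> l / 2 < cmod (T bb x)" if "l < cmod (T f x)"
   using that norm_triangle_ineq[of "T g x" "T bb x"] unfolding e by linarith
  thus "v x * indicator {x. l < cmod (T f x)} x <= (v x * indicator Om x + v x * indicator {x. l / 2 < cmod (T g x)} x * indicator (- Om) x)
    + v x * indicator {x. l / 2 < cmod (T bb x)} x * indicator (- Om) x" by (auto split: split_indicator)
 qed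
 also have "... = ((\<integral>x\<in>Om. v x) + (\<integral>x. v x * indicator {x. l / 2 < cmod (T g x)} x * indicator (- Om) x))
   + (\<integral>x. v x * indicator {x. l / 2 < cmod (T bb x)} x * indicator (- Om) x)"
  by (subst nn_integral_add, measurable, subst nn_integral_add, measurable)
 also have "... <= (en (c1 / l) * I + en (2 powr p * c2 * D powr (p - 1) * (1 + c3) / l) * I) + en (4 * tailC * c1 / l) * I"
 proof (intro add_mono)
  have "en l * (\<integral>x\<in>Om. v x) <= en c1 * I" unfolding Om_def I_def by (rule cz_exceptional[OF f l v W a])
  hence "(\<integral>x\<in>Om. v x) <= en (1 / l) * (en c1 * I)" by (simp add: ennreal_le_inv[OF l])
  thus "(\<integral>x\<in>Om. v x) <= en (c1 / l) * I" using c12 l by (simp add: mult.assoc[symmetric] ennreal_mult'[symmetric])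
 next
  have "(\<integral>x. v x * indicator {x. l / 2 < cmod (T g x)} x * indicator (- Om) x)
   <= (\<integral>x. en ((2 / l) powr p) * (en (cmod (T g x) powr p) * v x * indicator (- Om) x))"
  proof (rule nn_integral_mono)
   fix x
   show "v x * indicator {x. l / 2 < cmod (T g x)} x * indicator (- Om) x
     <= en ((2 / l) powr p) * (en (cmod (T g x) powr p) * v x * indicator (- Om) x)"
   proof (cases "l / 2 < cmod (T g x)")
    case True
    hence "1 <= 2 / l * cmod (T g x)" using l by (simp add: field_simps)
    hence "1 powr p <= (2 / l * cmod (T g x)) powr p" using p by (intro powr_mono2) auto
    also have "... = (2 / l) powr p * cmod (T g x) powr p" by (rule powr_mult)
    finally have "en 1 <= en ((2 / l) powr p * cmod (T g x) powr p)" by (intro ennreal_leI) simp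
    hence "1 <= en ((2 / l) powr p) * en (cmod (T g x) powr p)" by (simp add: ennreal_mult'')
    from mult_right_mono[OF this, of "v x * indicator (- Om) x"] show ?thesis using True by (simp add: mult_ac)
   qed simp
  qed
  also have "... = en ((2 / l) powr p) * (\<integral>x\<in>- Om. en (cmod (T g x) powr p) * v x)" by (rule nn_integral_cmult) measurable
  also have "... <= en ((2 / l) powr p) * (en c2 * (\<integral>x. en (cmod (g x) powr p) * W1 x))" unfolding Om_def by (intro mult_left_mono b g) auto
  also have "... <= en ((2 / l) powr p) * (en c2 * (en ((D * l) powr (p - 1)) * (en (1 + c3) * I)))"
  proof (intro mult_left_mono)
   \<comment> \<open>The good part is bounded by D l, so |g|^p <= (D l)^(p - 1) |g|; together with
     (2 / l)^p from Chebyshev's inequality this leaves the factor 1 / l.\<close>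
   have "AE x. cmod (g x) <= D * l" unfolding g_def D_def by (rule cz_good_le[OF f l])
   hence "(\<integral>x. en (cmod (g x) powr p) * W1 x) <=
     (\<integral>x. en ((D * l) powr (p - 1)) * (enorm (g x) * W1 x))"
   proof (intro nn_integral_mono_AE, eventually_elim)
    fix x assume gx: "cmod (g x) <= D * l"
    have "cmod (g x) powr p = cmod (g x) powr (p - 1) * cmod (g x)" using powr_add[of "cmod (g x)" "p - 1" 1] by (cases "g x = 0") simp_all
    also have "... <= (D * l) powr (p - 1) * cmod (g x)" using gx p by (intro mult_right_mono powr_mono2) auto
    finally have "en (cmod (g x) powr p) <= en ((D * l) powr (p - 1)) * enorm (g x)" by (simp add: ennreal_mult''[symmetric] ennreal_leI)
    from mult_right_mono[OF this, of "W1 x"]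
    show "en (cmod (g x) powr p) * W1 x <= en ((D * l) powr (p - 1)) * (enorm (g x) * W1 x)" by (simp add: mult.assoc)
   qed
   also have "... = en ((D * l) powr (p - 1)) * (\<integral>x. enorm (g x) * W1 x)" by (rule nn_integral_cmult) measurable
   also have "... <= en ((D * l) powr (p - 1)) * ((1 + en c3) * I)"
    unfolding I_def g_def by (intro mult_left_mono cz_good_weighted[OF f l W W1 c d]) auto
   also have "1 + en c3 = en (1 + c3)" using c3 by (simp add: ennreal_plus[symmetric] del: ennreal_plus flip: ennreal_1)
   finally show "(\<integral>x. en (cmod (g x) powr p) * W1 x) <= en ((D * l) powr (p - 1)) * (en (1 + c3) * I)" .
  qed auto
  also have "... = en ((2 / l) powr p * c2 * (D * l) powr (p - 1) * (1 + c3)) * I" using c12 c3 by (simp add: ennreal_mult mult.assoc)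
  also have "(2 / l) powr p * c2 * (D * l) powr (p - 1) * (1 + c3) = 2 powr p * c2 * D powr (p - 1) * (1 + c3) / l"
  proof -
   have "l powr p = l powr (p - 1) * l" using powr_add[of l "p - 1" 1] l by simp
   thus ?thesis using l D by (simp add: powr_divide powr_mult)
  qed
  finally show "(\<integral>x. v x * indicator {x. l / 2 < cmod (T g x)} x * indicator (- Om) x)
   <= en (2 powr p * c2 * D powr (p - 1) * (1 + c3) / l) * I" .
 next
  have "(\<integral>x. v x * indicator {x. l / 2 < cmod (T bb x)} x * indicator (- Om) x)
   <= (\<integral>x. en (2 / l) * (enorm (T bb x) * v x * indicator (- Om) x))"
  proof (rule nn_integral_mono)
   fix x
   show "v x * indicator {x. l / 2 < cmod (T bb x)} x * indicator (- Om) x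
     <= en (2 / l) * (enorm (T bb x) * v x * indicator (- Om) x)"
   proof (cases "l / 2 < cmod (T bb x)")
    case True
    hence "1 <= 2 / l * cmod (T bb x)" using l by (simp add: field_simps)
    hence "en 1 <= en (2 / l * cmod (T bb x))" by (rule ennreal_leI)
    hence "1 <= en (2 / l) * enorm (T bb x)" by (simp only: ennreal_mult'' norm_ge_zero ennreal_1)
    from mult_right_mono[OF this, of "v x * indicator (- Om) x"] show ?thesis using True by (simp add: mult_ac)
   qed simp
  qed
  also have "... = en (2 / l) * (\<integral>x\<in>- Om. enorm (T bb x) * v x)" by (rule nn_integral_cmult) measurable
  also have "... <= en (2 / l) * (en (2 * tailC) * en c1 * I)"
   unfolding Om_def bb_def[abs_def] g_def I_def by (intro mult_left_mono cz_bad[OF f l v W a]) auto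
  also have "... = en (2 / l * (2 * tailC) * c1) * I" using c12 tailC_nonneg l by (simp add: ennreal_mult'[symmetric] mult.assoc[symmetric])
  also have "2 / l * (2 * tailC) * c1 = 4 * tailC * c1 / l" by simp
  finally show "(\<integral>x. v x * indicator {x. l / 2 < cmod (T bb x)} x * indicator (- Om) x)
   <= en (4 * tailC * c1 / l) * I" .
 qed
 also have "... = en (c1 / l + 2 powr p * c2 * D powr (p - 1) * (1 + c3) / l + 4 * tailC * c1 / l) * I"
 proof -
  have "0 <= c1 / l" "0 <= 2 powr p * c2 * D powr (p - 1) * (1 + c3) / l" "0 <= 4 * tailC * c1 / l" using c12 c3 l tailC_nonneg by simp_all
  thus ?thesis by (simp add: distrib_right)
 qed
 finally show ?thesis unfolding I_def D_def by (simp add: add_divide_distrib)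
qed

text \<open>The constant of \<open>cz_weak\<close> for p = 2, c1 = \<open>nnb\<close>, c2 = C2 and
  c3 = 1.\<close>

definition weakC :: real where
 "weakC = nnb TYPE('a) + 2 powr 2 * C2 * (2 ^ DIM('a)) powr (2 - 1) * (1 + 1) + 4 * tailC * nnb TYPE('a)"

lemma weakC_nonneg: "0 <= weakC" unfolding weakC_def using C2 tailC_nonneg nnb_ge1[where 'a='a] by simp

lemma weak_1_1:
 assumes f: "f : bcs" and l: "0 < l"
 shows "\<mu> {x. l < cmod (T f x)} <= en (weakC / l) * (\<integral>x. enorm (f x))"
proof -
 have N: "0 <= nnb TYPE('a)" using nnb_ge1[where 'a='a] by simp
 have mn1: "mns (%_. 1) q <= en (nnb TYPE('a)) * 1" if "q : cubes" for q :: "int \<times> 'a" using emeasure_nb_le[OF that] N unfolding mns_le_iff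
  by (simp add: ennreal_mult' mult.commute del: emeasure_completion)
 have sq: "cmod z powr 2 = (cmod z)\<^sup>2" for z by (cases "z = 0") (simp_all add: powr_numeral)
 have "(\<integral>x\<in>{x. l < cmod (T f x)}. 1) <= en (weakC / l) * (\<integral>x. enorm (f x) * 1)" unfolding weakC_def
 proof (rule cz_weak[OF f l, of 2 1 "nnb TYPE('a)" C2 "%_. 1" "%_. 1" "%_. 1"])
  fix g :: "'a => complex" assume g: "g : bcs"
  have "(\<integral>x\<in>- (\<Union>q\<in>cz_cubes f l. nb q). en (cmod (T g x) powr 2) * 1) <= (\<integral>x. en ((cmod (T g x))\<^sup>2))"
   by (intro nn_integral_mono) (auto simp: sq split: split_indicator)
  also have "... <= en C2 * (\<integral>x. en (cmod (g x) powr 2) * 1)" using l2[OF g] by (simp add: sq)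
  finally show "(\<integral>x\<in>- (\<Union>q\<in>cz_cubes f l. nb q). en (cmod (T g x) powr 2) * 1) <= ..." .
 qed (use C2 N mn1 in auto)
 moreover have "{x. l < cmod (T f x)} : sets lebesgue"
 proof -
  note [measurable] = T_measurable[OF f]
  have "{x\<in>space lebesgue. l < cmod (T f x)} : sets lebesgue" by measurable
  thus ?thesis by simp
 qed
 ultimately show ?thesis by (simp del: emeasure_completion)
qed

end

subsection \<open>Sparse domination\<close>

definition amean :: "('a::euclidean_space => complex) => int \<times> 'a => real" where
 "amean f q = enn2real (mns (%x. enorm (f x)) q)"

lemma amean_nonneg [simp]: "0 <= amean f q" by (simp add: amean_def)

lemma mns_finite:
 assumes "(\<integral>x. F x) < \<infinity>"
 shows "mns F q < \<infinity>"
proof -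
 have "(\<integral>x\<in>nb q. F x) <= (\<integral>x. F x)" by (intro nn_integral_mono) (auto split: split_indicator)
 hence "(\<integral>x\<in>nb q. F x) < \<infinity>" using assms by (rule le_less_trans)
 thus ?thesis unfolding mns_def by (simp add: ennreal_mult_less_top)
qed

lemma ennreal_amean: "f : bcs ==> ennreal (amean f q) = mns (%x. enorm (f x)) q"
 unfolding amean_def by (rule ennreal_enn2real) (use mns_finite[OF bcs_fin] in simp)

definition rst :: "('a::euclidean_space => complex) => int \<times> 'a => 'a => complex" where
 "rst f q x = f x * indicator (nb q) x"

lemma rst_bcs: "f : bcs ==> rst f q : bcs" unfolding rst_def[abs_def] by (rule bcs_indicator) simp_all

lemma rst_integral:
 assumes "f : bcs"
 shows "(\<integral>x. enorm (rst f q x)) = en (vol q) * en (amean f q)"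
proof -
 have "(\<integral>x. enorm (rst f q x)) = (\<integral>x\<in>nb q. enorm (f x))"
  by (intro nn_integral_cong) (auto simp: rst_def split: split_indicator)
 also have "... = en (vol q) * mns (%x. enorm (f x)) q" unfolding mns_def by (rule ennreal_cancel(1)[OF vol_pos, symmetric])
 finally show ?thesis by (simp add: ennreal_amean[OF assms])
qed

lemma mns_le_MN: "z : cub q ==> mns F q <= MN F z"
proof -
 assume "z : cub q"
 hence e: "q = dq (fst q) z" by (rule cub_eq_dq)
 show ?thesis unfolding MN_def by (subst e) (rule SUP_upper, simp)
qed

lemma cub_subset_iff:
 assumes "q : cubes" "q' : cubes" "cub q' <= cub q" "fst q <= fst q'"
 shows "nb q' <= nb q"
proof -
 obtain x where x: "x : cub q'" using cub_ne[OF assms(2)] by blast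
 have e: "q' = dq (fst q') x" "q = dq (fst q) x" using x assms(3) cub_eq_dq by blast+
 show ?thesis by (subst e(1), subst e(2)) (rule nb_mono[OF assms(4)])
qed

context cz_op
begin

text \<open>Chosen such that the exceptional set in \<open>sparse_step\<close> fills at most
  2^(-(d+2)) of a cube. With the selection threshold 2^(-(d+1)) the children then have total volume
  at most half of the cube, and at most half of each child is exceptional.\<close>

definition sparseL :: real where
 "sparseL = (weakC + (nnb TYPE('a))\<^sup>2) * 2 ^ (DIM('a) + 2)"

lemma sparseL_pos: "0 < sparseL"
proof -
 have "0 < (nnb TYPE('a))\<^sup>2" using nnb_ge1[where 'a='a] by simp
 hence "0 < weakC + (nnb TYPE('a))\<^sup>2" using weakC_nonneg by linarith
 thus ?thesis unfolding sparseL_def by simp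
qed

lemma sparseL_weak: "(weakC + (nnb TYPE('a))\<^sup>2) / sparseL = 1 / 2 ^ (DIM('a) + 2)"
proof -
 have "weakC + (nnb TYPE('a))\<^sup>2 ~= 0" using sparseL_pos unfolding sparseL_def by auto
 thus ?thesis unfolding sparseL_def by simp
qed

text \<open>The three terms bound, at a point z of a child outside the exceptional sets, T of f on
  the parent neighbourhood, T of f on the child neighbourhood, and the oscillation between z and x
  of T applied to their difference.\<close>

definition sparseC :: real where
 "sparseC = sparseL + sparseL\<^sup>2 + tailC * sparseL"

lemma sparseC_nonneg: "0 <= sparseC" unfolding sparseC_def using sparseL_pos tailC_nonneg by simp

lemma T_level_measurable:
 assumes "f : bcs"
 shows "{x. l < cmod (T f x)} : sets lebesgue"
proof -
 note [measurable] = T_measurable[OF assms]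
 have "{x\<in>space lebesgue. l < cmod (T f x)} : sets lebesgue" by measurable
 thus ?thesis by simp
qed

text \<open>At mean zero the level is 0, which \<open>weak_1_1\<close> excludes, but then f vanishes
  almost everywhere on \<open>nb q\<close>.\<close>

lemma rst_level:
 assumes f: "f : bcs"
 shows "\<mu> {x. sparseL * amean f q < cmod (T (rst f q) x)} <= en (weakC / sparseL * vol q)"
proof (cases "amean f q = 0")
 case True
 have "(\<integral>x. enorm (rst f q x)) = 0" using rst_integral[OF f, of q] True by simp
 moreover have "rst f q : lmeas" by (rule bcs_measurable[OF rst_bcs[OF f]])
 ultimately have "AE x. rst f q x = 0" by (subst (asm) nn_integral_0_iff_AE) (auto simp: ennreal_eq_0_iff)
 hence "AE x. T (rst f q) x = 0" by (rule T_null[OF rst_bcs[OF f]])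
 hence "AE x. \<not> sparseL * amean f q < cmod (T (rst f q) x)" by eventually_elim (simp add: True)
 hence "\<mu> {x : space lebesgue. \<not> \<not> sparseL * amean f q < cmod (T (rst f q) x)} = 0"
  using T_level_measurable[OF rst_bcs[OF f], of "sparseL * amean f q" q] by (intro AE_iff_measurable[THEN iffD1]) auto
 thus ?thesis by simp
next
 case False
 hence a: "0 < amean f q" using amean_nonneg[of f q] by linarith
 have "\<mu> {x. sparseL * amean f q < cmod (T (rst f q) x)}
  <= en (weakC / (sparseL * amean f q)) * (\<integral>x. enorm (rst f q x))" using a sparseL_pos by (intro weak_1_1 rst_bcs f) simp
 also have "... = en (weakC / (sparseL * amean f q) * (vol q * amean f q))"
  unfolding rst_integral[OF f] using weakC_nonneg sparseL_pos a less_imp_le[OF vol_pos[of q]] by (simp add: ennreal_mult'[symmetric] del: vol_pos)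
 also have "weakC / (sparseL * amean f q) * (vol q * amean f q) = weakC / sparseL * vol q" using a by simp
 finally show ?thesis .
qed

text \<open>As G vanishes on \<open>nb q\<close>, both values are kernel integrals. Smoothness in
  the first variable and \<open>kernel_tail\<close>, with |G| as the weight, bound their difference
  by the maximal function at z.\<close>

lemma T_osc:
 assumes G: "G : bcs" and supp: "!!y. y : nb q ==> G y = 0" and x: "x : cub q" and z: "z : cub q"
  and rx: "lintegrable (%y. K x y * G y)" "T G x = (LINT y. K x y * G y)"
  and rz: "lintegrable (%y. K z y * G y)" "T G z = (LINT y. K z y * G y)"
 shows "enorm (T G x - T G z) <= en tailC * MN (%y. enorm (G y)) z"
proof -
 note [measurable] = bcs_measurable[OF G]
 have i: "lintegrable (%y. K x y * G y - K z y * G y)" using rx rz by simp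
 have "T G x - T G z = (LINT y. K x y * G y - K z y * G y)" using rx rz by simp
 hence "enorm (T G x - T G z) <= (\<integral>y. enorm (K x y * G y - K z y * G y))" using integral_norm_bound_ennreal[OF i] by simp
 also have "... <= (\<integral>y. en (CK * real DIM('a)) * (en (side q powr \<gamma> / dist z y powr (real DIM('a) + \<gamma>)) * enorm (G y) * indicator (- nb q) y))"
 proof (rule nn_integral_mono)
  fix y
  show "enorm (K x y * G y - K z y * G y) <= en (CK * real DIM('a)) * (en (side q powr \<gamma> / dist z y powr (real DIM('a) + \<gamma>)) * enorm (G y) * indicator (- nb q) y)"
  proof (cases "y : nb q")
   case False
   have "cmod (K x y * G y - K z y * G y) = cmod (K x y - K z y) * cmod (G y)" by (simp add: norm_mult[symmetric] algebra_simps)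
   also have "... <= (CK * real DIM('a) * (side q powr \<gamma> / dist z y powr (real DIM('a) + \<gamma>))) * cmod (G y)"
    using smooth_cub(2)[OF z x False] by (intro mult_right_mono) auto
   finally have "enorm (K x y * G y - K z y * G y) <= en ((CK * real DIM('a) * (side q powr \<gamma> / dist z y powr (real DIM('a) + \<gamma>))) * cmod (G y))"
    by (rule ennreal_leI)
   also have "... = en (CK * real DIM('a)) * (en (side q powr \<gamma> / dist z y powr (real DIM('a) + \<gamma>)) * enorm (G y))"
   proof -
    have h0: "0 <= side q powr \<gamma> / dist z y powr (real DIM('a) + \<gamma>)" by simp
    show ?thesis by (subst ennreal_mult''[OF norm_ge_zero], subst ennreal_mult''[OF h0]) (simp only: mult.assoc)
   qed
   finally show ?thesis using False by simp
  qed (simp add: supp)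
 qed
 also have "... = en (CK * real DIM('a)) * (\<integral>y. en (side q powr \<gamma> / dist z y powr (real DIM('a) + \<gamma>)) * enorm (G y) * indicator (- nb q) y)"
 proof (rule nn_integral_cmult)
  have [measurable]: "- nb q : sets lebesgue" using sets.compl_sets[OF nb_lebesgue[of q]] by (simp add: Compl_eq_Diff_UNIV)
  define h where "h y = side q powr \<gamma> / dist z y powr (real DIM('a) + \<gamma>)" for y
  have "(%y. dist z y) : lmeas" by (intro measurable_completion) (simp add: borel_measurable_dist)
  hence [measurable]: "h : lmeas" unfolding h_def[abs_def] by (intro borel_measurable_divide powr_real_measurable borel_measurable_const)
  show "(%y. en (side q powr \<gamma> / dist z y powr (real DIM('a) + \<gamma>)) * enorm (G y) * indicator (- nb q) y) : lmeas"
   unfolding h_def[symmetric] by measurable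
 qed
 also have "... <= en (CK * real DIM('a)) * (en (2 ^ DIM('a) / (1 - 2 powr (- \<gamma>))) * MN (%y. enorm (G y)) z)"
 proof (intro mult_left_mono)
  have m: "(%y. enorm (G y)) : lmeas" by measurable
  have M: "mns (%y. enorm (G y)) (dq j z) <= MN (%y. enorm (G y)) z" for j unfolding MN_def by (rule SUP_upper) simp
  show "(\<integral>y. en (side q powr \<gamma> / dist z y powr (real DIM('a) + \<gamma>)) * enorm (G y) * indicator (- nb q) y)
    <= en (2 ^ DIM('a) / (1 - 2 powr (- \<gamma>))) * MN (%y. enorm (G y)) z" by (rule kernel_tail[OF m \<gamma>(1) z M])
 qed simp
 also have "... = en tailC * MN (%y. enorm (G y)) z" unfolding tailC_def using CK by (simp add: mult.assoc[symmetric] ennreal_mult'[symmetric])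
 finally show ?thesis .
qed

(* The points of E are those where T (rst f q) or the maximal function of rst f q is large; the
  children of q are the maximal subcubes more than a fixed fraction of which lies in E. *)
lemma sparse_step:
 assumes f: "f : bcs" and q: "q : cubes"
 shows "\<exists>P. P <= cubes & disjoint_family_on cub P & (\<forall>q'\<in>P. cub q' <= cub q & fst q < fst q') &
  (\<Sum>\<^sup>+q'\<in>P. en (vol q')) <= en (vol q / 2) &
  (AE x. x : cub q -->
    (x ~: (\<Union>q'\<in>P. cub q') --> cmod (T (rst f q) x) <= sparseC * amean f q) &
    (\<forall>q'\<in>P. x : cub q' --> cmod (T (rst f q) x) <= sparseC * amean f q + cmod (T (rst f q') x)))"
proof -
 define L where "L = sparseL"
 define \<tau> where "\<tau> = amean f q"
 define N where "N = nnb TYPE('a)"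
 define F where "F x = enorm (rst f q x)" for x
 define th where "th = 1 / (2::real) ^ (DIM('a) + 1)"
 have L: "0 < L" unfolding L_def by (rule sparseL_pos)
 have \<tau>: "0 <= \<tau>" by (simp add: \<tau>_def)
 have th: "0 < th" "th < 1"
 proof -
  have "1 < (2::real) ^ (DIM('a) + 1)" by (rule one_less_power) auto
  thus "0 < th" "th < 1" by (auto simp: th_def)
 qed
 have r: "rst f q : bcs" by (rule rst_bcs[OF f])
 have rm[measurable]: "rst f q : lmeas" by (rule bcs_measurable[OF r])
 have Fm[measurable]: "F : lmeas" unfolding F_def[abs_def] by measurable
 have FI: "(\<integral>x. F x) = en (vol q) * en \<tau>" unfolding F_def \<tau>_def by (rule rst_integral[OF f])
 define E1 where "E1 = {x. L * \<tau> < cmod (T (rst f q) x)}"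
 define E2 where "E2 = {x. en (L * \<tau>) < MN F x}"
 define E where "E = cub q Int (E1 Un E2)"
 have E1[measurable]: "E1 : sets lebesgue" unfolding E1_def by (rule T_level_measurable[OF r])
 have E2[measurable]: "E2 : sets lebesgue"
 proof -
  have "{x\<in>space borel. en (L * \<tau>) < MN F x} : sets borel" by measurable
  thus ?thesis by (simp add: E2_def)
 qed
 have E[measurable]: "E : sets lebesgue" unfolding E_def by measurable
 have volq: "0 <= vol q" using less_imp_le[OF vol_pos[of q]] .
 have e2: "\<mu> E2 <= en (N\<^sup>2 / L * vol q)"
 proof (cases "\<tau> = 0")
  case True
  have Z: "(\<integral>x\<in>A. F x) = 0" for A
  proof -
   have "(\<integral>x\<in>A. F x) <= (\<integral>x. F x)" by (intro nn_integral_mono) (auto split: split_indicator)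
   thus ?thesis using FI True by simp
  qed
  have "E2 = {}" by (auto simp: E2_def MN_def mns_def Z True less_SUP_iff)
  thus ?thesis by simp
 next
  case False
  hence t: "0 < L * \<tau>" using L \<tau> by simp
  have "\<mu> E2 <= en (N\<^sup>2 / (L * \<tau>)) * (en (vol q) * en \<tau>)" unfolding E2_def N_def FI[symmetric] by (rule MN_weak[OF Fm t])
  also have "... = en (N\<^sup>2 / (L * \<tau>) * (vol q * \<tau>))" using t volq \<tau> L by (simp add: ennreal_mult'[symmetric])
  also have "N\<^sup>2 / (L * \<tau>) * (vol q * \<tau>) = N\<^sup>2 / L * vol q" using False by simp
  finally show ?thesis .
 qed
 have eE: "\<mu> E <= en (vol q * (th / 2))"
 proof -
  have "\<mu> E <= \<mu> (E1 Un E2)" by (intro emeasure_mono) (auto simp: E_def)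
  also have "... <= \<mu> E1 + \<mu> E2" by (intro emeasure_subadditive) auto
  also have "... <= en (weakC / L * vol q) + en (N\<^sup>2 / L * vol q)"
   unfolding E1_def L_def \<tau>_def by (intro add_mono rst_level f e2[unfolded L_def])
  also have "... = en ((weakC + N\<^sup>2) / L * vol q)"
   using weakC_nonneg L volq by (simp add: ennreal_plus[symmetric] add_divide_distrib distrib_right del: ennreal_plus)
  also have "(weakC + N\<^sup>2) / L * vol q = vol q * (th / 2)" using sparseL_weak unfolding L_def N_def th_def by simp
  finally show ?thesis .
 qed
 define iE where "iE x = (indicator E x :: ennreal)" for x
 have iEm[measurable]: "iE : lmeas" unfolding iE_def[abs_def] by measurable
 have iE_int: "(\<integral>x\<in>A. iE x) = \<mu> (E Int A)" if "A : sets lebesgue" for A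
 proof -
  have "(\<integral>x\<in>A. iE x) = (\<integral>x. indicator (E Int A) x)"
   by (intro nn_integral_cong) (auto simp: iE_def split: split_indicator)
  thus ?thesis using that by (simp del: emeasure_completion)
 qed
 define R where "R q' \<longleftrightarrow> (cub q' <= cub q & fst q <= fst q') & en th < cav iE q'" for q' :: "int \<times> 'a"
 define P where "P = stop R"
 have Pc: "P <= cubes" "countable P" "disjoint_family_on cub P" unfolding P_def by (auto simp: disjoint_family_stop stop_cubes[THEN subsetD])
 have PR: "R q'" if "q' : P" for q' using that by (simp add: P_def stop_def)
 have Rlevel: "fst q < fst q'" if Rq': "R q'" and q'c: "q' : cubes" for q'
 proof (rule ccontr)
  assume "\<not> fst q < fst q'"
  hence e: "fst q' = fst q" using Rq' by (simp add: R_def)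
  obtain x where x: "x : cub q'" using cub_ne[OF q'c] by blast
  hence "x : cub q" using Rq' by (auto simp: R_def)
  hence "dq (fst q) x = q" by (rule cub_eq_dq[symmetric])
  moreover have "dq (fst q') x = q'" by (rule cub_eq_dq[OF x, symmetric])
  ultimately have "q' = q" using e by simp
  hence "en (vol q) * en th < \<mu> (E Int cub q)" using Rq' by (simp add: R_def less_cav_iff iE_int del: emeasure_completion)
  also have "... <= \<mu> E" by (intro emeasure_mono) auto
  also have "... <= en (vol q * (th / 2))" by (rule eE)
  also have "... <= en (vol q * th)" using volq th by (intro ennreal_leI mult_left_mono) auto
  finally show False using th by (simp add: ennreal_mult'')
 qed
 have sumP: "(\<Sum>\<^sup>+q'\<in>P. en (vol q')) <= en (vol q / 2)"
 proof -
  have "en th * (\<Sum>\<^sup>+q'\<in>P. en (vol q')) <= (\<integral>x\<in>(\<Union>q'\<in>P. cub q'). iE x)"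
   using PR Pc by (intro sum_stop_le th) (auto simp: R_def)
  also have "... <= (\<integral>x\<in>UNIV. iE x)" by (intro nn_integral_mono) (auto split: split_indicator)
  also have "... = \<mu> E" by (subst iE_int) auto
  also have "... <= en (vol q * (th / 2))" by (rule eE)
  also have "... = en th * en (vol q / 2)" using volq th by (simp add: ennreal_mult'[symmetric] mult.commute)
  finally show ?thesis using th by (subst (asm) ennreal_mult_le_mult_iff) auto
 qed
 have half: "\<mu> (E Int cub q') <= en (vol q' / 2)" if q': "q' : P" for q'
 proof -
  have qc: "q' : cubes" using q' Pc by blast
  obtain x where x: "x : cub q'" using cub_ne[OF qc] by blast
  define k where "k = fst q'"
  have qk: "q' = dq k x" using x cub_eq_dq k_def by blast
  have lv: "fst q < k" using Rlevel[OF PR[OF q'] qc] by (simp add: k_def)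
  have "x : cub q" using PR[OF q'] x by (auto simp: R_def)
  hence "cub (dq (fst q) x) = cub q" using cub_eq_dq by metis
  hence "cub (dq (k - 1) x) <= cub q" using cub_mono[of "fst q" "k - 1" x] lv by simp
  moreover have "\<not> R (dq (k - 1) x)" using q' x unfolding P_def stop_def k_def by auto
  ultimately have "\<not> en th < cav iE (dq (k - 1) x)" using lv by (auto simp: R_def)
  hence "\<mu> (E Int cub (dq (k - 1) x)) <= en (vol (dq (k - 1) x)) * en th" by (simp add: not_less cav_le_iff iE_int del: emeasure_completion)
  moreover have "\<mu> (E Int cub q') <= \<mu> (E Int cub (dq (k - 1) x))" using cub_mono[of "k - 1" k x] qk by (intro emeasure_mono) auto
  moreover have "en (vol (dq (k - 1) x)) * en th = en (vol q' / 2)"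
  proof -
   have "vol (dq (k - 1) x) * th = vol q' / 2" unfolding vol_dq_coarsen qk th_def by simp
   thus ?thesis by (subst ennreal_mult''[OF less_imp_le[OF th(1)], symmetric]) (simp only:)
  qed
  ultimately show ?thesis by simp
 qed
 have outside: "AE x. x : cub q - (\<Union>q'\<in>P. cub q') --> indicator E x <= th"
 proof (rule dyadic_lebesgue)
  show "(%x. indicator E x :: real) : lmeas" by measurable
  show "(\<integral>x. en (indicator E x)) < \<infinity>"
  proof -
   have "(\<integral>x. en (indicator E x)) = \<mu> E" by (simp add: ennreal_indicator del: emeasure_completion)
   also have "... < \<infinity>" using eE by (rule le_less_trans) simp
   finally show ?thesis .
  qed
  fix x assume x: "x : cub q - (\<Union>q'\<in>P. cub q')"
  show "\<exists>k0. \<forall>k\<ge>k0. cav (%x. en (indicator E x)) (dq k x) <= en th"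
  proof (intro exI[of _ "fst q"] allI impI)
   fix k assume k: "fst q <= k"
   have "x : cub q" using x by blast
   hence qd: "cub (dq (fst q) x) = cub q" using cub_eq_dq by metis
   have "\<not> R (dq k x)"
   proof
    assume "R (dq k x)"
    moreover have "!!j. j <= fst q - 1 ==> \<not> R (dq j x)" by (simp add: R_def)
    ultimately have "\<exists>q'\<in>stop R. x : cub q' & fst q' <= k" by (rule stop_ex)
    thus False using x by (auto simp: P_def)
   qed
   moreover have "cub (dq k x) <= cub q" using cub_mono[OF k, of x] qd by simp
   ultimately have "\<not> en th < cav iE (dq k x)" using k by (auto simp: R_def)
   thus "cav (%x. en (indicator E x)) (dq k x) <= en th" by (simp add: iE_def[abs_def] ennreal_indicator not_less)
  qed
 qed (use th in auto)
 have AEout: "AE x. x : cub q --> x ~: (\<Union>q'\<in>P. cub q') --> cmod (T (rst f q) x) <= sparseC * \<tau>" using outside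
 proof eventually_elim
  fix x assume *: "x : cub q - (\<Union>q'\<in>P. cub q') --> indicator E x <= th"
  show "x : cub q --> x ~: (\<Union>q'\<in>P. cub q') --> cmod (T (rst f q) x) <= sparseC * \<tau>"
  proof (intro impI)
   assume x: "x : cub q" "x ~: (\<Union>q'\<in>P. cub q')"
   hence "x ~: E" using * th by (auto simp: indicator_def split: if_splits)
   hence "cmod (T (rst f q) x) <= L * \<tau>" using x by (auto simp: E_def E1_def)
   also have "... <= sparseC * \<tau>" unfolding sparseC_def L_def using \<tau> tailC_nonneg sparseL_pos by (intro mult_right_mono) auto
   finally show "cmod (T (rst f q) x) <= sparseC * \<tau>" .
  qed
 qed
 have AEin: "AE x. x : cub q' --> cmod (T (rst f q) x) <= sparseC * \<tau> + cmod (T (rst f q') x)"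
  if q': "q' : P" for q'
 proof -
  have qc: "q' : cubes" using q' Pc by blast
  have Rq: "cub q' <= cub q" "fst q <= fst q'" using PR[OF q'] by (auto simp: R_def)
  have nbs: "nb q' <= nb q" by (rule cub_subset_iff[OF q qc Rq])
  define H where "H = rst f q'"
  \<comment> \<open>The far part: it vanishes on \<open>nb q'\<close>, so on the child T G is given
    by the kernel.\<close>
  define G where "G x = rst f q x - H x" for x
  have H: "H : bcs" unfolding H_def by (rule rst_bcs[OF f])
  have G: "G : bcs" unfolding G_def[abs_def] by (rule bcs_diff[OF r H])
  have G0: "G y = 0" if "y : nb q'" for y using that nbs by (auto simp: G_def H_def rst_def)
  have Gle: "cmod (G y) <= cmod (rst f q y)" for y using nbs by (auto simp: G_def H_def rst_def indicator_def)
  have fs: "x ~: fun_support G" if "x : cub q'" for x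
  proof -
   have "{x. G x ~= 0} Int nb q' = {}" using G0 by auto
   thus ?thesis using cub_not_closure[OF that] unfolding fun_support_def by blast
  qed
  define good where "good x \<longleftrightarrow> T (rst f q) x = T G x + T H x &
    (x : cub q' --> lintegrable (%y. K x y * G y) & T G x = (LINT y. K x y * G y))" for x
  have "AE x. T (%z. G z + H z) x = T G x + T H x" by (rule T_add[OF G H])
  hence AEgood: "AE x. good x" using rep[OF G] by eventually_elim (use fs in \<open>auto simp: good_def G_def\<close>)
  define B where "B = {x. L * amean f q' < cmod (T H x)}"
  have Bm[measurable]: "B : sets lebesgue" unfolding B_def by (rule T_level_measurable[OF H])
  have eB: "\<mu> B <= en (vol q' / 4)"
  proof -
   have "\<mu> B <= en (weakC / L * vol q')" unfolding B_def H_def L_def by (rule rst_level[OF f])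
   also have "... <= en (vol q' / 4)"
   proof (rule ennreal_leI)
    have "weakC / L <= (weakC + N\<^sup>2) / L" using L by (simp add: divide_right_mono)
    also have "... = 1 / 2 ^ (DIM('a) + 2)" unfolding L_def N_def by (rule sparseL_weak)
    also have "... <= 1 / 4" by (simp add: field_simps)
    finally show "weakC / L * vol q' <= vol q' / 4" using mult_right_mono[of "weakC / L" "1/4" "vol q'"] less_imp_le[OF vol_pos[of q']] by simp
   qed
   finally show ?thesis .
  qed
  \<comment> \<open>E takes at most half and B at most a quarter of the child, so points outside
    both remain.\<close>
  have "\<exists>z. z : cub q' & z ~: E & z ~: B & good z"
  proof (rule ccontr)
   assume contr: "\<not> ?thesis"
   have "AE x. x : cub q' --> x : (E Int cub q') Un B" using AEgood by eventually_elim (use contr in auto)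
   hence "\<mu> (cub q') <= \<mu> ((E Int cub q') Un B)" by (intro emeasure_mono_AE) auto
   also have "... <= \<mu> (E Int cub q') + \<mu> B" by (intro emeasure_subadditive) auto
   also have "... <= en (vol q' / 2) + en (vol q' / 4)" by (intro add_mono half q' eB)
   finally have "en (vol q') <= en (vol q' / 2 + vol q' / 4)"
    using less_imp_le[OF vol_pos[of q']] unfolding emeasure_cub[OF qc] by (simp add: ennreal_plus[symmetric] del: ennreal_plus)
   hence "vol q' <= vol q' / 2 + vol q' / 4" using less_imp_le[OF vol_pos[of q']] by (subst (asm) ennreal_le_iff) auto
   thus False using vol_pos[of q'] by linarith
  qed
  then obtain z where z: "z : cub q'" "z ~: E" "z ~: B" "good z" by blast
  have zq: "z : cub q" using z(1) Rq by blast
  have z1: "cmod (T (rst f q) z) <= L * \<tau>" and z2: "MN F z <= en (L * \<tau>)" using z(2) zq by (auto simp: E_def E1_def E2_def not_less)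
  have aq: "amean f q' <= L * \<tau>"
  proof -
   have "en (amean f q') = mns F q'"
   proof -
    have "(\<integral>x\<in>nb q'. enorm (f x)) = (\<integral>x\<in>nb q'. F x)"
     using nbs by (intro nn_integral_cong) (auto simp: F_def rst_def split: split_indicator)
    thus ?thesis unfolding ennreal_amean[OF f] mns_def by simp
   qed
   also have "... <= MN F z" by (rule mns_le_MN[OF z(1)])
   also have "... <= en (L * \<tau>)" by (rule z2)
   finally show ?thesis using L \<tau> by (subst (asm) ennreal_le_iff) auto
  qed
  have z3: "cmod (T H z) <= L * (L * \<tau>)"
  proof -
   have "cmod (T H z) <= L * amean f q'" using z(3) by (simp add: B_def not_less)
   also have "... <= L * (L * \<tau>)" using aq L by (intro mult_left_mono) auto
   finally show ?thesis .
  qed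
  have TGz: "cmod (T G z) <= L * \<tau> + L * (L * \<tau>)"
  proof -
   have "T G z = T (rst f q) z - T H z" using z(4) by (simp add: good_def)
   hence "cmod (T G z) <= cmod (T (rst f q) z) + cmod (T H z)" by (metis norm_triangle_ineq4)
   thus ?thesis using z1 z3 by linarith
  qed
  have MNG: "MN (%y. enorm (G y)) z <= en (L * \<tau>)"
  proof -
   have "MN (%y. enorm (G y)) z <= MN F z" unfolding MN_def mns_def F_def using Gle
    by (intro SUP_mono' mult_left_mono nn_integral_mono mult_right_mono ennreal_leI) auto
   thus ?thesis using z2 by simp
  qed
  show ?thesis using AEgood
  proof eventually_elim
   fix x assume g: "good x"
   show "x : cub q' --> cmod (T (rst f q) x) <= sparseC * \<tau> + cmod (T (rst f q') x)"
   proof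
    assume x: "x : cub q'"
    have "enorm (T G x - T G z) <= en tailC * MN (%y. enorm (G y)) z" using g z(1,4) x G0 by (intro T_osc[OF G _ x z(1)]) (auto simp: good_def)
    also have "... <= en tailC * en (L * \<tau>)" by (intro mult_left_mono MNG) auto
    also have "... = en (tailC * (L * \<tau>))" using tailC_nonneg by (simp add: ennreal_mult')
    finally have o: "cmod (T G x - T G z) <= tailC * (L * \<tau>)" using tailC_nonneg L \<tau> by (subst (asm) ennreal_le_iff) auto
    \<comment> \<open>T G is compared with its value at z, where it is controlled; T H is the term
      left for the next generation.\<close>
    have "T (rst f q) x = (T G x - T G z) + T G z + T H x" using g by (simp add: good_def)
    hence "cmod (T (rst f q) x) <= cmod (T G x - T G z) + cmod (T G z) + cmod (T H x)"
     by (metis norm_triangle_ineq norm_triangle_le add_mono order_refl)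
    also have "... <= tailC * (L * \<tau>) + (L * \<tau> + L * (L * \<tau>)) + cmod (T H x)" using o TGz by linarith
    also have "... = sparseC * \<tau> + cmod (T (rst f q') x)" unfolding sparseC_def L_def H_def by (simp add: algebra_simps power2_eq_square)
    finally show "cmod (T (rst f q) x) <= sparseC * \<tau> + cmod (T (rst f q') x)" .
   qed
  qed
 qed
 have "AE x. \<forall>q'\<in>P. x : cub q' --> cmod (T (rst f q) x) <= sparseC * \<tau> + cmod (T (rst f q') x)"
  using AEin Pc(2) by (subst AE_ball_countable) auto
 with AEout have "AE x. x : cub q -->
    (x ~: (\<Union>q'\<in>P. cub q') --> cmod (T (rst f q) x) <= sparseC * \<tau>) &
    (\<forall>q'\<in>P. x : cub q' --> cmod (T (rst f q) x) <= sparseC * \<tau> + cmod (T (rst f q') x))" by eventually_elim auto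
 moreover have "\<forall>q'\<in>P. cub q' <= cub q & fst q < fst q'"
 proof
  fix q' assume q': "q' : P"
  have "q' : cubes" using q' Pc by blast
  thus "cub q' <= cub q & fst q < fst q'" using PR[OF q'] Rlevel by (auto simp: R_def)
 qed
 ultimately show ?thesis using Pc sumP unfolding \<tau>_def by (intro exI[of _ P]) simp
qed

end

subsection \<open>Young functions and Luxemburg norms\<close>

lemma young_nonneg: "young_function A ==> 0 <= t ==> 0 <= A t" by (simp add: young_function_def)

lemma young_mono: "young_function A ==> 0 <= s ==> s <= t ==> A s <= A t" by (auto simp: young_function_def mono_on_def)

lemma young_scale:
 assumes "young_function A" "0 <= t" "0 <= c" "c <= 1"
 shows "A (c * t) <= c * A t"
proof -
 have "convex_on {0..} A" "A 0 = 0" using assms(1) by (auto simp: young_function_def)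
 hence "A ((1 - c) *\<^sub>R 0 + c *\<^sub>R t) <= (1 - c) * A 0 + c * A t" using assms by (intro convex_onD) auto
 thus ?thesis using \<open>A 0 = 0\<close> by simp
qed

lemma young_ratio_mono:
 assumes "young_function A" "0 < s" "s <= t"
 shows "A s * t <= A t * s"
proof -
 have "A ((s / t) * t) <= (s / t) * A t" using assms by (intro young_scale) auto
 thus ?thesis using assms by (simp add: field_simps)
qed

lemma young_measurable:
 assumes A: "young_function A" and v: "v : borel_measurable M" "!!x. 0 <= v x"
 shows "(%x. A (v x)) : borel_measurable M"
proof -
 have "continuous_on {0..} A" using A by (simp add: young_function_def)
 hence "A : borel_measurable (restrict_space borel {0..})" by (rule borel_measurable_continuous_on_restrict)
 moreover have "v : measurable M (restrict_space borel {0..})" using v by (intro measurable_restrict_space2) auto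
 ultimately show ?thesis by (rule measurable_compose[rotated])
qed

lemma D_class_young: "A : D_class p ==> young_function A" by (simp add: D_class_def)

text \<open>If A vanished at some t > c it would vanish on [c, t], where the quotient taken in
  \<open>ennreal\<close> is infinite, against the finiteness of the integral. So beyond c the
  condition can be stated with real quotients; its exponent p' - 1 is 1 / (p - 1).\<close>

lemma D_classE:
 assumes "A : D_class p" and p: "1 < p"
 obtains c I where "0 < c" "!!t. c < t ==> 0 < A t" "0 <= I"
  "(\<integral>t\<in>{c<..}. en ((t / A t) powr (1 / (p - 1)) / t)) <= en I"
proof -
 define e where "e = 1 / (p - 1)"
 have e: "conj_exp p - 1 = e" "0 < e" using p by (auto simp: conj_exp_def e_def field_simps)
 define g where "g t = epowr (en t / en (A t)) e * en (1 / t)" for t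
 obtain c where c: "0 < c" "(\<integral>t\<in>{c..}. g t) < \<infinity>" using assms e by (auto simp: D_class_def g_def)
 have Y: "young_function A" using assms(1) by (rule D_class_young)
 have pos: "0 < A t" if t: "c < t" for t
 proof (rule ccontr)
  assume "\<not> 0 < A t"
  hence A0: "A t = 0" using young_nonneg[OF Y, of t] t c by simp
  have gi: "g u = \<infinity>" if "u : {c..t}" for u
  proof -
   have "A u = 0" using young_mono[OF Y, of u t] young_nonneg[OF Y, of u] A0 that c by auto
   moreover have "0 < u" using that c by auto
   ultimately show ?thesis by (simp add: g_def epowr_def ennreal_top_mult)
  qed
  have "(\<integral>u. \<infinity> * indicator {c..t} u) <= (\<integral>t\<in>{c..}. g t)"
   using gi by (intro nn_integral_mono) (auto split: split_indicator)
  moreover have "(\<integral>u. \<infinity> * indicator {c..t} u) = \<infinity> * \<mu> {c..t}" by (rule nn_integral_cmult_indicator) simp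
  moreover have "\<mu> {c..t} = en (t - c)" using t by simp
  ultimately have "\<infinity> * en (t - c) < \<infinity>" using c(2) by simp
  thus False using t by (simp add: ennreal_top_mult)
 qed
 define I where "I = enn2real (\<integral>t\<in>{c..}. g t)"
 have I: "en I = (\<integral>t\<in>{c..}. g t)" unfolding I_def using c(2) by simp
 have "(\<integral>t\<in>{c<..}. en ((t / A t) powr e / t)) <= en I" unfolding I
 proof (rule nn_integral_mono)
  fix t
  show "en ((t / A t) powr e / t) * indicator {c<..} t <= g t * indicator {c..} t"
  proof (cases "c < t")
   case True
   hence "en t / en (A t) = en (t / A t)" using pos[OF True] c by (intro divide_ennreal) auto
   moreover have "0 <= t / A t" using pos[OF True] True c by simp
   ultimately have "g t = en ((t / A t) powr e) * en (1 / t)" by (simp add: g_def epowr_def)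
   also have "... = en ((t / A t) powr e / t)" using True c by (simp add: ennreal_mult'[symmetric])
   finally show ?thesis using True by simp
  qed simp
 qed
 thus ?thesis using that[of c I] c(1) pos unfolding e_def I_def by simp
qed

lemma geometric_int_sum:
 fixes M :: "int set"
 assumes "finite M" "0 <= z" "z < 1" "0 <= B" "!!m. m : M ==> base <= m & h m <= B * z ^ nat (m - base)"
 shows "(\<Sum>m\<in>M. h m) <= B / (1 - z :: real)"
proof -
 have "(\<Sum>m\<in>M. h m) <= (\<Sum>m\<in>M. B * z ^ nat (m - base))" by (intro sum_mono) (use assms in auto)
 also have "... = B * (\<Sum>m\<in>M. z ^ nat (m - base))" by (simp add: sum_distrib_left)
 also have "(\<Sum>m\<in>M. z ^ nat (m - base)) = (\<Sum>j\<in>(%m. nat (m - base)) ` M. z ^ j)"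
 proof (subst sum.reindex)
  show "inj_on (%m. nat (m - base)) M"
  proof (rule inj_onI)
   fix x y assume "x : M" "y : M" "nat (x - base) = nat (y - base)"
   thus "x = y" using assms(5)[of x] assms(5)[of y] by linarith
  qed
 qed simp
 also have "... <= (\<Sum>j. z ^ j)" using assms by (intro sum_le_suminf summable_geometric) auto
 also have "... = 1 / (1 - z)" using assms by (intro suminf_geometric) auto
 finally show ?thesis using assms(4) by (simp add: mult_left_mono)
qed

lemma divide_half_le: "2 ^ 1 <= x ==> 0 < a ==> a / x <= a / (2::real)" by (intro divide_left_mono) auto

text \<open>The D_p integral, discretised along s_m = t / 2^m with a bound free of t. For s_m <= 2 c
  the quotient is at most s_m and the terms decay geometrically in m. For s_m > 2 c a term is
  compared with the integral over (s_m / 2, s_m], where u / A u is at least s_m / A s_m; these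
  intervals are disjoint and lie beyond c. The summand 1 keeps the quotient meaningful where A
  vanishes.\<close>

lemma D_class_sum:
 assumes A: "A : D_class p" and p: "1 < p"
 obtains C0 where "0 < C0" "!!t M. 0 < t ==> finite M ==>
  (\<Sum>m\<in>M. ((t / 2 powi m) / (1 + A (t / 2 powi m))) powr (1 / (p - 1))) <= C0"
proof -
 define e where "e = 1 / (p - 1)"
 have e: "0 < e" using p by (simp add: e_def)
 have Y: "young_function A" using A by (rule D_class_young)
 obtain c I where c: "0 < c" "!!t. c < t ==> 0 < A t" "0 <= I"
  "(\<integral>t\<in>{c<..}. en ((t / A t) powr (1 / (p - 1)) / t)) <= en I" by (rule D_classE[OF A p]) (rule that)
 define z where "z = 2 powr (- e)"
 have z: "0 < z" "z < 1" using e by (auto simp: z_def powr_less_one)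
 define C0 where "C0 = (2 * c) powr e / (1 - z) + 2 * I"
 have "(\<Sum>m\<in>M. ((t / 2 powi m) / (1 + A (t / 2 powi m))) powr e) <= C0" if t: "0 < t" and M: "finite M" for t and M :: "int set"
 proof -
  define s where "s m = t / 2 powi m" for m :: int
  have s: "0 < s m" for m using t by (simp add: s_def)
  have sshift: "s m = s m0 / 2 ^ nat (m - m0)" if "m0 <= m" for m m0
  proof -
   have "(2::real) powi m = 2 powi m0 * 2 powi (m - m0)" by (simp flip: power_int_add)
   also have "(2::real) powi (m - m0) = 2 ^ nat (m - m0)" using that by (simp add: power_int_def)
   finally show ?thesis by (simp add: s_def)
  qed
  define h where "h m = (s m / (1 + A (s m))) powr e" for m
  have Ann: "0 <= A (s m)" for m using young_nonneg[OF Y less_imp_le[OF s]] .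
  define M1 where "M1 = {m\<in>M. s m <= 2 * c}"
  define M2 where "M2 = {m\<in>M. \<not> s m <= 2 * c}"
  have "sum h M1 <= (2 * c) powr e / (1 - z)"
  proof (cases "M1 = {}")
   case False
   have fin: "finite M1" using M by (simp add: M1_def)
   define m0 where "m0 = Min M1"
   have m0: "m0 : M1" "!!m. m : M1 ==> m0 <= m" using fin False by (auto simp: m0_def)
   show ?thesis
   proof (rule geometric_int_sum[where base = m0])
    fix m assume m: "m : M1"
    have "h m <= s m powr e" unfolding h_def using s[of m] Ann[of m] e by (intro powr_mono2) (auto simp: divide_le_eq mult_le_cancel_left1)
    also have "s m powr e = s m0 powr e * z ^ nat (m - m0)"
    proof -
     define n where "n = nat (m - m0)"
     have e1: "((2::real) ^ n) powr e = 2 powr (real n * e)" using powr_realpow[of 2 n] by (simp add: powr_powr[symmetric])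
     have e2: "z ^ n = 2 powr (- e * real n)" unfolding z_def by (simp add: powr_power mult.commute)
     have "s m powr e = s m0 powr e / ((2::real) ^ n) powr e" unfolding sshift[OF m0(2)[OF m]] n_def using s[of m0] by (simp add: powr_divide)
     also have "... = s m0 powr e * z ^ n" unfolding e1 e2 by (simp add: powr_minus divide_inverse mult.commute)
     finally show ?thesis by (simp add: n_def)
    qed
    also have "... <= (2 * c) powr e * z ^ nat (m - m0)" using m0(1) s[of m0] e z by (intro mult_right_mono powr_mono2) (auto simp: M1_def)
    finally show "m0 <= m & h m <= (2 * c) powr e * z ^ nat (m - m0)" using m0(2)[OF m] by simp
   qed (use fin z c in auto)
  qed (use z in simp)
  moreover have "sum h M2 <= 2 * I"
  proof -
   have fin: "finite M2" using M by (simp add: M2_def)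
   define k where "k m = (s m / A (s m)) powr e / s m" for m
   have sc: "2 * c < s m" if "m : M2" for m using that by (simp add: M2_def)
   have kp: "0 <= k m" for m using s[of m] by (simp add: k_def)
   have "en (\<Sum>m\<in>M2. k m * (s m / 2)) = (\<Sum>m\<in>M2. en (k m) * en (s m / 2))"
    using kp s by (subst sum_ennreal[symmetric]) (auto simp: ennreal_mult'[symmetric] less_imp_le)
   also have "... = (\<Sum>m\<in>M2. \<integral>\<^sup>+u. en (k m) * indicator {s m / 2<..s m} u \<partial>lebesgue)"
    using s by (intro sum.cong refl) (simp add: nn_integral_cmult_indicator less_imp_le)
   also have "... = (\<integral>u. (\<Sum>m\<in>M2. en (k m) * indicator {s m / 2<..s m} u))"
    by (intro nn_integral_sum[symmetric] borel_measurable_times_ennreal borel_measurable_const borel_measurable_indicator) simp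
   also have "... <= (\<integral>t\<in>{c<..}. en ((t / A t) powr e / t))"
   proof (rule nn_integral_mono)
    fix u
    show "(\<Sum>m\<in>M2. en (k m) * indicator {s m / 2<..s m} u) <= en ((u / A u) powr e / u) * indicator {c<..} u"
    proof (cases "\<exists>m\<in>M2. u : {s m / 2<..s m}")
     case True
     then obtain m where m: "m : M2" "u : {s m / 2<..s m}" by blast
     have other: "u ~: {s i / 2<..s i}" if "i ~= m" for i
     proof (cases "i < m")
      case True
      have "2 ^ 1 <= (2::real) ^ nat (m - i)" using True by (intro power_increasing) auto
      moreover have "s m = s i / 2 ^ nat (m - i)" using True by (intro sshift) auto
      ultimately have "s m <= s i / 2" using divide_half_le[OF _ s[of i]] by metis
      thus ?thesis using m by auto
     next
      case False
      hence im: "m < i" using that by auto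
      have "2 ^ 1 <= (2::real) ^ nat (i - m)" using im by (intro power_increasing) auto
      moreover have "s i = s m / 2 ^ nat (i - m)" using im by (intro sshift) auto
      ultimately have "s i <= s m / 2" using divide_half_le[OF _ s[of m]] by metis
      thus ?thesis using m by auto
     qed
     have "(\<Sum>m\<in>M2. en (k m) * indicator {s m / 2<..s m} u) = (\<Sum>i\<in>{m}. en (k i) * indicator {s i / 2<..s i} u)"
      using other m fin by (intro sum.mono_neutral_right) auto
     also have "... = en (k m)" using m by simp
     also have "... <= en ((u / A u) powr e / u)"
     proof (rule ennreal_leI)
      have cu: "c < u" using m sc[OF m(1)] by auto
      have up: "0 < u" using cu c by simp
      have Au: "0 < A u" "0 < A (s m)" using c(2)[OF cu] c(2)[of "s m"] sc[OF m(1)] c(1) by auto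
      have us: "u <= s m" using m by auto
      have "s m / A (s m) <= u / A u" using young_ratio_mono[OF Y up us] Au by (simp add: field_simps)
      hence "(s m / A (s m)) powr e <= (u / A u) powr e" using e s[of m] Au by (intro powr_mono2) auto
      thus "k m <= (u / A u) powr e / u" unfolding k_def using us up by (intro frac_le) auto
     qed
     also have "... = en ((u / A u) powr e / u) * indicator {c<..} u" using m sc[OF m(1)] by auto
     finally show ?thesis .
    next
     case False
     hence "(\<Sum>m\<in>M2. en (k m) * indicator {s m / 2<..s m} u) = 0" by (intro sum.neutral) auto
     thus ?thesis by simp
    qed
   qed
   also have "... <= en I" by (rule c(4)[folded e_def])
   finally have le: "(\<Sum>m\<in>M2. k m * (s m / 2)) <= I" using c(3) by (subst (asm) ennreal_le_iff) auto
   have "sum h M2 <= (\<Sum>m\<in>M2. 2 * (k m * (s m / 2)))"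
   proof (rule sum_mono)
    fix m assume m: "m : M2"
    have "0 < A (s m)" using c(2)[of "s m"] sc[OF m] c(1) by auto
    hence "h m <= (s m / A (s m)) powr e" unfolding h_def using s[of m] e by (intro powr_mono2 frac_le) auto
    thus "h m <= 2 * (k m * (s m / 2))" unfolding k_def using less_imp_neq[OF s[of m]] by simp
   qed
   also have "... = 2 * (\<Sum>m\<in>M2. k m * (s m / 2))" by (simp only: sum_distrib_left)
   finally show ?thesis using le by linarith
  qed
  moreover have "sum h M = sum h M1 + sum h M2" using M by (subst sum.union_disjoint[symmetric]) (auto simp: M1_def M2_def intro!: sum.cong)
  ultimately show ?thesis unfolding C0_def h_def s_def by linarith
 qed
 moreover have "0 < C0" unfolding C0_def using z c by (intro add_pos_nonneg) auto
 ultimately show ?thesis using that[of C0] unfolding e_def by blast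
qed

section \<open>Luxemburg norms\<close>

definition lux_adm :: "(real => real) => 'a::euclidean_space set => ('a => real) => real => bool" where
 "lux_adm A E f l \<longleftrightarrow> 0 < l & (\<integral>x\<in>E. en (A (\<bar>f x\<bar> / l))) <= \<mu> E"

lemma ennreal_divide_le_1:
 fixes x y :: ennreal
 assumes "0 < y" "y < \<infinity>"
 shows "x / y <= 1 \<longleftrightarrow> x <= y"
proof (cases "x = \<infinity>")
 case True
 thus ?thesis using assms by (auto simp: ennreal_top_divide top_unique)
next
 case False
 then obtain a where a: "x = en a" "0 <= a" by (cases x) auto
 obtain b where b: "y = en b" "0 < b" using assms by (cases y) auto
 have "x / y = en (a / b)" unfolding a(1) b(1) using a b by (intro divide_ennreal) auto
 also have "... <= 1 \<longleftrightarrow> a / b <= 1" by (simp add: ennreal_le_1)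
 also have "... \<longleftrightarrow> a <= b" using b by simp
 also have "... \<longleftrightarrow> x <= y" using a b by simp
 finally show ?thesis .
qed

lemma luxemburg_eq:
 assumes "0 < \<mu> E" "\<mu> E < \<infinity>"
 shows "luxemburg A E f = Inf (ennreal ` {l. lux_adm A E f l})"
proof -
 have "{en l | l::real. 0 < l & (\<integral>x\<in>E. en (A (\<bar>f x\<bar> / l))) / \<mu> E <= 1}
   = ennreal ` {l. lux_adm A E f l}" unfolding lux_adm_def using ennreal_divide_le_1[OF assms] by auto
 thus ?thesis by (simp add: luxemburg_def)
qed

lemma lux_le_adm:
 assumes "0 < \<mu> E" "\<mu> E < \<infinity>" "lux_adm A E f l"
 shows "luxemburg A E f <= en l" unfolding luxemburg_eq[OF assms(1,2)] using assms(3) by (intro Inf_lower) auto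

lemma lux_ge:
 assumes "0 < \<mu> E" "\<mu> E < \<infinity>" "!!l. lux_adm A E f l ==> b <= en l"
 shows "b <= luxemburg A E f" unfolding luxemburg_eq[OF assms(1,2)] using assms(3) by (intro Inf_greatest) auto

lemma lux_adm_mono:
 assumes A: "young_function A" and "lux_adm A E f l" "l <= m"
 shows "lux_adm A E f m"
proof -
 have l: "0 < l" using assms(2) by (simp add: lux_adm_def)
 have "(\<integral>x\<in>E. en (A (\<bar>f x\<bar> / m))) <= (\<integral>x\<in>E. en (A (\<bar>f x\<bar> / l)))"
 proof (rule nn_integral_mono)
  fix x
  have "\<bar>f x\<bar> / m <= \<bar>f x\<bar> / l" using l assms(3) by (intro divide_left_mono) auto
  hence "A (\<bar>f x\<bar> / m) <= A (\<bar>f x\<bar> / l)" using l assms(3) by (intro young_mono[OF A]) auto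
  thus "en (A (\<bar>f x\<bar> / m)) * indicator E x <= en (A (\<bar>f x\<bar> / l)) * indicator E x" by (intro mult_right_mono ennreal_leI) auto
 qed
 thus ?thesis using assms l by (simp add: lux_adm_def)
qed

lemma lux_less_adm:
 assumes A: "young_function A" and E: "0 < \<mu> E" "\<mu> E < \<infinity>"
  and less: "luxemburg A E f < en m"
 shows "lux_adm A E f m"
proof -
 obtain l where l: "lux_adm A E f l" "en l < en m" using less unfolding luxemburg_eq[OF E] by (auto simp: Inf_less_iff)
 have "0 < l" using l(1) by (simp add: lux_adm_def)
 hence "l <= m" using l(2) by (simp add: ennreal_less_iff)
 thus ?thesis using lux_adm_mono[OF A l(1)] by simp
qed

text \<open>Convexity gives A (t / k) <= A t / k, so passing to a set of at most k times the measure
  costs at most the factor k.\<close>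

lemma lux_compare:
 fixes f g :: "'a::euclidean_space => real"
 assumes A: "young_function A" and E: "0 < \<mu> E" "\<mu> E < \<infinity>"
  and F: "0 < \<mu> F" "\<mu> F < \<infinity>"
  and k: "1 <= k" "\<mu> F <= en k * \<mu> E"
  and le: "!!x. x : E ==> f x ~= 0 ==> x : F & \<bar>f x\<bar> <= \<bar>g x\<bar>"
  and m: "g : lmeas" "F : sets lebesgue"
 shows "luxemburg A E f <= en k * luxemburg A F g"
proof -
 have "en (1 / k) * luxemburg A E f <= luxemburg A F g"
 proof (rule lux_ge[OF F])
  fix l assume l: "lux_adm A F g l"
  have l0: "0 < l" using l by (simp add: lux_adm_def)
  have gm: "(%x. A (\<bar>g x\<bar> / l)) : lmeas" using m(1) l0 by (intro young_measurable[OF A]) auto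
  have "(\<integral>x\<in>E. en (A (\<bar>f x\<bar> / (k * l)))) <= (\<integral>x. en (1 / k) * (en (A (\<bar>g x\<bar> / l)) * indicator F x))"
  proof (rule nn_integral_mono)
   fix x
   show "en (A (\<bar>f x\<bar> / (k * l))) * indicator E x <= en (1 / k) * (en (A (\<bar>g x\<bar> / l)) * indicator F x)"
   proof (cases "x : E & f x ~= 0")
    case True
    hence x: "x : F" "\<bar>f x\<bar> <= \<bar>g x\<bar>" using le by auto
    have "A (\<bar>f x\<bar> / (k * l)) = A ((1 / k) * (\<bar>f x\<bar> / l))" by simp
    also have "... <= (1 / k) * A (\<bar>f x\<bar> / l)" using k l0 by (intro young_scale[OF A]) auto
    also have "... <= (1 / k) * A (\<bar>g x\<bar> / l)" using k l0 x by (intro mult_left_mono young_mono[OF A]) (auto simp: divide_right_mono)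
    finally have "en (A (\<bar>f x\<bar> / (k * l))) <= en ((1 / k) * A (\<bar>g x\<bar> / l))" by (rule ennreal_leI)
    also have "... = en (1 / k) * en (A (\<bar>g x\<bar> / l))" using k by (intro ennreal_mult') simp
    finally show ?thesis using x True by simp
   next
    case False
    have "A 0 = 0" using A by (simp add: young_function_def)
    thus ?thesis using False by (auto simp: indicator_def)
   qed
  qed
  also have "... = en (1 / k) * (\<integral>x\<in>F. en (A (\<bar>g x\<bar> / l)))"
  proof (rule nn_integral_cmult)
   note [measurable] = gm m(2)
   show "(%x. en (A (\<bar>g x\<bar> / l)) * indicator F x) : lmeas" by measurable
  qed
  also have "... <= en (1 / k) * \<mu> F" using l by (intro mult_left_mono) (auto simp: lux_adm_def)
  also have "... <= \<mu> E" using k by (subst ennreal_inv_le) auto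
  finally have "lux_adm A E f (k * l)" using k l0 by (simp add: lux_adm_def)
  from lux_le_adm[OF E this] have "luxemburg A E f <= en k * en l" using k by (simp add: ennreal_mult')
  thus "en (1 / k) * luxemburg A E f <= en l" using k by (subst ennreal_inv_le) auto
 qed
 thus ?thesis using k by (subst (asm) ennreal_inv_le) auto
qed

text \<open>Where |f| / l <= t one has |f| <= l t; elsewhere A u / u is at least A t / t at u = |f|
  / l, so |f| is at most l (t / A t) A u. Any t with A t > 0 thus bounds L1 averages by Luxemburg
  norms.\<close>

lemma lux_avg:
 fixes f :: "'a::euclidean_space => real"
 assumes A: "young_function A" and t: "0 < t" "0 < A t"
  and E: "0 < \<mu> E" "\<mu> E < \<infinity>" "E : sets lebesgue"
  and f[measurable]: "f : lmeas"
 shows "(\<integral>x\<in>E. en \<bar>f x\<bar>) <= en (t + t / A t) * (\<mu> E * luxemburg A E f)"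
proof -
 note [measurable] = E(3)
 define k where "k = t + t / A t"
 have k: "0 < k" unfolding k_def using t by (intro add_pos_pos) auto
 obtain e where e: "\<mu> E = en e" "0 < e" using E by (cases "\<mu> E") auto
 define b where "b = en (1 / (k * e)) * (\<integral>x\<in>E. en \<bar>f x\<bar>)"
 have "b <= luxemburg A E f"
 proof (rule lux_ge[OF E(1,2)])
  fix l assume l: "lux_adm A E f l"
  have l0: "0 < l" using l by (simp add: lux_adm_def)
  have [measurable]: "(%x. A (\<bar>f x\<bar> / l)) : lmeas" using l0 by (intro young_measurable[OF A]) auto
  have "(\<integral>x\<in>E. en \<bar>f x\<bar>) <= (\<integral>x. en (l * t) * indicator E x + en (l * (t / A t)) * (en (A (\<bar>f x\<bar> / l)) * indicator E x))"
  proof (rule nn_integral_mono)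
   fix x
   have "\<bar>f x\<bar> <= l * t + l * (t / A t) * A (\<bar>f x\<bar> / l)"
   proof (cases "\<bar>f x\<bar> / l <= t")
    case True
    hence "\<bar>f x\<bar> <= l * t" using l0 by (simp add: field_simps)
    moreover have "0 <= l * (t / A t) * A (\<bar>f x\<bar> / l)" using l0 t young_nonneg[OF A, of "\<bar>f x\<bar> / l"] by simp
    ultimately show ?thesis by linarith
   next
    case False
    have "A t * (\<bar>f x\<bar> / l) <= A (\<bar>f x\<bar> / l) * t" using False t by (intro young_ratio_mono[OF A]) auto
    hence "\<bar>f x\<bar> <= l * (t / A t) * A (\<bar>f x\<bar> / l)" using l0 t by (simp add: field_simps)
    thus ?thesis using l0 t by (simp add: add_increasing)
   qed
   hence "en \<bar>f x\<bar> <= en (l * t + l * (t / A t) * A (\<bar>f x\<bar> / l))" by (rule ennreal_leI)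
   also have "... = en (l * t) + en (l * (t / A t) * A (\<bar>f x\<bar> / l))"
    using l0 t young_nonneg[OF A, of "\<bar>f x\<bar> / l"] by (intro ennreal_plus) auto
   also have "en (l * (t / A t) * A (\<bar>f x\<bar> / l)) = en (l * (t / A t)) * en (A (\<bar>f x\<bar> / l))"
    using l0 young_nonneg[OF A, of "\<bar>f x\<bar> / l"] by (intro ennreal_mult'') auto
   finally show "en \<bar>f x\<bar> * indicator E x <= en (l * t) * indicator E x + en (l * (t / A t)) * (en (A (\<bar>f x\<bar> / l)) * indicator E x)"
    by (auto split: split_indicator)
  qed
  also have "... = en (l * t) * \<mu> E + en (l * (t / A t)) * (\<integral>x\<in>E. en (A (\<bar>f x\<bar> / l)))"
   by (subst nn_integral_add) (measurable, simp add: nn_integral_cmult nn_integral_cmult_indicator del: emeasure_completion)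
  also have "... <= en (l * t) * \<mu> E + en (l * (t / A t)) * \<mu> E" using l by (intro add_left_mono mult_left_mono) (auto simp: lux_adm_def)
  also have "... = en (k * e * l)"
   unfolding e(1) k_def using l0 t e(2) by (simp add: ennreal_mult'[symmetric] ennreal_plus[symmetric] algebra_simps del: ennreal_plus)
  also have "... = en (k * e) * en l" using l0 by (intro ennreal_mult'') auto
  finally show "b <= en l" unfolding b_def using k e by (subst ennreal_inv_le) auto
 qed
 hence "(\<integral>x\<in>E. en \<bar>f x\<bar>) <= en (k * e) * luxemburg A E f" unfolding b_def using k e by (subst (asm) ennreal_inv_le) auto
 also have "en (k * e) = en k * \<mu> E" unfolding e(1) using k by (intro ennreal_mult') auto
 finally show ?thesis unfolding k_def by (simp add: mult.assoc)
qed

text \<open>Convexity brings A (1 / (1 + A 1)) below 1, so the constant involves no inverse of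
  A.\<close>

lemma lux_bounded:
 fixes f :: "'a::euclidean_space => real"
 assumes A: "young_function A" and b: "!!x. \<bar>f x\<bar> <= M"
  and E: "0 < \<mu> E" "\<mu> E < \<infinity>" "E : sets lebesgue"
 shows "luxemburg A E f <= en ((M + 1) * (1 + A 1))"
proof (rule lux_le_adm[OF E(1,2)])
 define l where "l = (M + 1) * (1 + A 1)"
 have A1: "0 <= A 1" by (rule young_nonneg[OF A]) simp
 have M: "0 <= M" using b[of undefined] by linarith
 have l0: "0 < l" unfolding l_def using A1 M by (intro mult_pos_pos) auto
 have "A (\<bar>f x\<bar> / l) <= 1" for x
 proof -
  have "\<bar>f x\<bar> / l <= (M + 1) / l" using b[of x] l0 by (intro divide_right_mono) auto
  also have "(M + 1) / l = 1 / (1 + A 1) * 1" using M by (simp add: l_def)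
  finally have "A (\<bar>f x\<bar> / l) <= A (1 / (1 + A 1) * 1)" using l0 by (intro young_mono[OF A]) auto
  also have "... <= 1 / (1 + A 1) * A 1" using A1 by (intro young_scale[OF A]) auto
  also have "... <= 1" using A1 by (simp add: field_simps)
  finally show ?thesis .
 qed
 hence "(\<integral>x\<in>E. en (A (\<bar>f x\<bar> / l))) <= (\<integral>x. indicator E x)"
  by (intro nn_integral_mono) (auto split: split_indicator simp: ennreal_le_1)
 also have "... = \<mu> E" using E(3) by (rule nn_integral_indicator)
 finally show "lux_adm A E f ((M + 1) * (1 + A 1))" using l0 unfolding l_def[symmetric] by (simp add: lux_adm_def)
qed

subsection \<open>Weighted sums along a chain of cubes\<close>

text \<open>Jensen's inequality for t^p with the normalised weights c^(-1 / (p - 1)).\<close>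

lemma Hoelder_sum_powr:
 fixes a c :: "'i => real"
 assumes I: "finite I" and p: "1 < p" and a: "!!i. i : I ==> 0 <= a i" and c: "!!i. i : I ==> 0 < c i"
 shows "(\<Sum>i\<in>I. a i) powr p <= (\<Sum>i\<in>I. c i powr (- (1 / (p - 1)))) powr (p - 1) * (\<Sum>i\<in>I. a i powr p * c i)"
proof -
 \<comment> \<open>Jensen's inequality is applied on the open half-line, where vanishing terms have
   to be dropped.\<close>
 define J where "J = {i\<in>I. 0 < a i}"
 define S where "S = (\<Sum>i\<in>J. c i powr (- (1 / (p - 1))))"
 have J: "finite J" "J <= I" using I by (auto simp: J_def)
 have cJ: "0 < c i" and aJ: "0 < a i" if "i : J" for i using that c by (auto simp: J_def)
 have sumJ: "(\<Sum>i\<in>I. a i) = (\<Sum>i\<in>J. a i)" using I a by (intro sum.mono_neutral_right) (auto simp: J_def less_le)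
 show ?thesis
 proof (cases "J = {}")
  case True
  have "0 <= (\<Sum>i\<in>I. c i powr (- (1 / (p - 1)))) powr (p - 1) * (\<Sum>i\<in>I. a i powr p * c i)"
   by (intro mult_nonneg_nonneg sum_nonneg powr_ge_zero less_imp_le[OF c])
  thus ?thesis using sumJ True by simp
 next
  case False
  have S0: "0 < S" unfolding S_def
  proof (rule sum_pos[OF J(1) False])
   fix i assume "i : J"
   thus "0 < c i powr (- (1 / (p - 1)))" using cJ[of i] by simp
  qed
  define w where "w i = c i powr (- (1 / (p - 1))) / S" for i
  have w0: "0 < w i" if "i : J" for i using cJ[OF that] S0 by (simp add: w_def)
  have w1: "(\<Sum>i\<in>J. w i) = 1" unfolding w_def using S0 by (simp add: sum_divide_distrib[symmetric] S_def[symmetric])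
  have "(\<Sum>i\<in>J. w i *\<^sub>R (a i / w i)) powr p <= (\<Sum>i\<in>J. w i * (a i / w i) powr p)"
  proof (rule convex_on_sum[OF J(1) False])
   show "convex_on {0<..} (%x::real. x powr p)" using p by (intro powr_convex) simp
  qed (use w0 w1 aJ in \<open>auto intro: less_imp_le divide_pos_pos\<close>)
  also have "(\<Sum>i\<in>J. w i *\<^sub>R (a i / w i)) = (\<Sum>i\<in>J. a i)" using less_imp_neq[OF w0] by (intro sum.cong refl) auto
  also have "(\<Sum>i\<in>J. w i * (a i / w i) powr p) = (\<Sum>i\<in>J. S powr (p - 1) * (a i powr p * c i))"
  proof (rule sum.cong[OF refl])
   fix i assume i: "i : J"
   have "w i * (a i / w i) powr p = a i powr p * (w i powr 1 * w i powr (- p))"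
   proof -
    have "(a i / w i) powr p = a i powr p / w i powr p" using w0[OF i] aJ[OF i] by (simp add: powr_divide)
    thus ?thesis using w0[OF i] by (simp add: powr_minus divide_inverse)
   qed
   also have "w i powr 1 * w i powr (- p) = w i powr (1 - p)" using powr_add[of "w i" 1 "- p"] by simp
   also have "w i powr (1 - p) = (c i powr (- (1 / (p - 1)))) powr (1 - p) / S powr (1 - p)" unfolding w_def using S0 by (simp add: powr_divide)
   also have "(c i powr (- (1 / (p - 1)))) powr (1 - p) = c i"
   proof -
    have "- (1 / (p - 1)) * (1 - p) = 1" using p by (simp add: field_simps)
    thus ?thesis using cJ[OF i] by (simp only: powr_powr powr_one)
   qed
   also have "c i / S powr (1 - p) = S powr (p - 1) * c i" using powr_minus[of S "p - 1"] S0 by (simp add: divide_inverse)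
   finally show "w i * (a i / w i) powr p = S powr (p - 1) * (a i powr p * c i)" by simp
  qed
  also have "... = S powr (p - 1) * (\<Sum>i\<in>J. a i powr p * c i)" by (simp add: sum_distrib_left)
  also have "... <= (\<Sum>i\<in>I. c i powr (- (1 / (p - 1)))) powr (p - 1) * (\<Sum>i\<in>I. a i powr p * c i)"
  proof (intro mult_mono powr_mono2)
   show "S <= (\<Sum>i\<in>I. c i powr (- (1 / (p - 1))))" unfolding S_def using I J by (intro sum_mono2) auto
   show "(\<Sum>i\<in>J. a i powr p * c i) <= (\<Sum>i\<in>I. a i powr p * c i)"
    using I J by (intro sum_mono2 mult_nonneg_nonneg powr_ge_zero less_imp_le[OF c]) auto
   show "0 <= (\<Sum>i\<in>J. a i powr p * c i)" by (intro sum_nonneg mult_nonneg_nonneg powr_ge_zero less_imp_le[OF cJ])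
  qed (use p S0 in auto)
  finally show ?thesis unfolding sumJ .
 qed
qed

text \<open>Distinct indices have different numbers of successors in I, so the exponents are
  distinct.\<close>

lemma sum_power_rank_le:
 fixes z :: real and I :: "nat set"
 assumes "finite I" "0 <= z" "z < 1"
 shows "(\<Sum>n\<in>I. z ^ card {j\<in>I. n < j}) <= 1 / (1 - z)"
proof -
 have inj: "inj_on (%n. card {j\<in>I. n < j}) I"
 proof (rule linorder_inj_onI')
  fix i j assume ij: "i : I" "j : I" "i < j"
  have "{l\<in>I. j < l} \<subset> {l\<in>I. i < l}" using ij by auto
  hence "card {l\<in>I. j < l} < card {l\<in>I. i < l}" using assms(1) by (intro psubset_card_mono) auto
  thus "card {l\<in>I. i < l} ~= card {l\<in>I. j < l}" by simp
 qed
 have "(\<Sum>n\<in>I. z ^ card {j\<in>I. n < j}) = (\<Sum>r\<in>(%n. card {j\<in>I. n < j}) ` I. z ^ r)" by (subst sum.reindex[OF inj]) simp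
 also have "... <= (\<Sum>r. z ^ r)" using assms by (intro sum_le_suminf summable_geometric) auto
 also have "... = 1 / (1 - z)" using assms by (intro suminf_geometric) auto
 finally show ?thesis .
qed

(* Hoelder's inequality with weights combining the level m n and the number of later
  indices on the same level; the latter makes the dual sum on each level geometric. *)
lemma chain_sum:
 fixes a :: "nat => real" and m :: "nat => int"
 assumes A: "young_function A" and p: "1 < p" and V: "0 < V" and a: "!!n. 0 <= a n"
  and C0: "!!M. finite M ==> (\<Sum>m\<in>M. ((V / 2 powi m) / (1 + A (V / 2 powi m))) powr (1 / (p - 1))) <= C0"
  and b: "1 < b"
 shows "V * (\<Sum>n\<le>\<nu>. a n) powr p <= (C0 / (1 - b powr (- (1 / (p - 1))))) powr (p - 1) *
   (\<Sum>n\<le>\<nu>. a n powr p * 2 powi m n * (1 + A (V / 2 powi m n)) * (\<Sum>j | n + j <= \<nu> & m (n + j) = m n. b ^ j))"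
proof -
 define e where "e = 1 / (p - 1)"
 have e: "0 < e" using p by (simp add: e_def)
 \<comment> \<open>The number of later indices on the level of n. Within one level these ranks are
   distinct, so the powers of z sum geometrically.\<close>
 define R where "R n = card {j\<in>{..\<nu>}. n < j & m j = m n}" for n
 define \<phi> where "\<phi> k = (V / 2 powi k) / (1 + A (V / 2 powi k))" for k :: int
 have A0: "0 <= A (V / 2 powi k)" for k using V by (intro young_nonneg[OF A]) simp
 have \<phi>: "0 < \<phi> k" for k unfolding \<phi>_def using A0[of k] V by (intro divide_pos_pos) auto
 \<comment> \<open>The factor 1 / \<phi> puts \<phi> to the power 1 / (p - 1) into the dual sum,
   where the D_p condition applies; in the primal sum it makes V c n equal to 2^(m n) (1 + A (V /
   2^(m n))) b^(R n), with V left only in the argument of A.\<close>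
 define c where "c n = b ^ R n / \<phi> (m n)" for n
 have c: "0 < c n" for n unfolding c_def using \<phi> b by simp
 define z where "z = b powr (- e)"
 have z: "0 <= z" "z < 1" unfolding z_def using b e by (auto simp: powr_less_one)
 have "(\<Sum>n\<le>\<nu>. c n powr (- e)) = (\<Sum>n\<le>\<nu>. \<phi> (m n) powr e * z ^ R n)"
 proof (intro sum.cong refl)
  fix n
  have "c n powr (- e) = (b ^ R n) powr (- e) / \<phi> (m n) powr (- e)" unfolding c_def using b \<phi>[of "m n"] by (simp add: powr_divide)
  also have "(b ^ R n) powr (- e) = z ^ R n"
   unfolding z_def using b powr_realpow[of b "R n"] by (simp add: powr_powr powr_power mult.commute flip: powr_realpow)
  also have "z ^ R n / \<phi> (m n) powr (- e) = \<phi> (m n) powr e * z ^ R n" by (simp add: powr_minus divide_inverse)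
  finally show "c n powr (- e) = \<phi> (m n) powr e * z ^ R n" .
 qed
 also have "... = (\<Sum>k\<in>m ` {..\<nu>}. \<Sum>n\<in>{n\<in>{..\<nu>}. m n = k}. \<phi> (m n) powr e * z ^ R n)" by (rule sum.image_gen) simp
 also have "... = (\<Sum>k\<in>m ` {..\<nu>}. \<phi> k powr e * (\<Sum>n\<in>{n\<in>{..\<nu>}. m n = k}. z ^ R n))" by (simp add: sum_distrib_left)
 also have "... <= (\<Sum>k\<in>m ` {..\<nu>}. \<phi> k powr e * (1 / (1 - z)))"
 proof (intro sum_mono mult_left_mono)
  fix k
  let ?I = "{n\<in>{..\<nu>}. m n = k}"
  have "(\<Sum>n\<in>?I. z ^ R n) = (\<Sum>n\<in>?I. z ^ card {j\<in>?I. n < j})"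
  proof (intro sum.cong refl)
   fix n assume "n : ?I"
   hence "{j\<in>{..\<nu>}. n < j & m j = m n} = {j\<in>?I. n < j}" by auto
   thus "z ^ R n = z ^ card {j\<in>?I. n < j}" unfolding R_def by simp
  qed
  also have "... <= 1 / (1 - z)" by (intro sum_power_rank_le z) simp
  finally show "(\<Sum>n\<in>?I. z ^ R n) <= 1 / (1 - z)" .
 qed simp
 also have "... = (\<Sum>k\<in>m ` {..\<nu>}. \<phi> k powr e) * (1 / (1 - z))" by (simp only: sum_distrib_right)
 also have "... <= C0 * (1 / (1 - z))" using C0[of "m ` {..\<nu>}"] z unfolding \<phi>_def e_def by (intro mult_right_mono) auto
 finally have dual: "(\<Sum>n\<le>\<nu>. c n powr (- e)) <= C0 / (1 - z)" by simp
 have "V * (\<Sum>n\<le>\<nu>. a n) powr p <= V * ((\<Sum>n\<le>\<nu>. c n powr (- e)) powr (p - 1) * (\<Sum>n\<le>\<nu>. a n powr p * c n))"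
  unfolding e_def using V by (intro mult_left_mono Hoelder_sum_powr p a c) auto
 also have "... <= V * ((C0 / (1 - z)) powr (p - 1) * (\<Sum>n\<le>\<nu>. a n powr p * c n))"
  using V p dual less_imp_le[OF c] by (intro mult_left_mono mult_right_mono powr_mono2 sum_nonneg) auto
 also have "... = (C0 / (1 - z)) powr (p - 1) * (\<Sum>n\<le>\<nu>. a n powr p * (V * c n))" by (simp add: sum_distrib_left mult_ac)
 also have "... <= (C0 / (1 - z)) powr (p - 1) *
   (\<Sum>n\<le>\<nu>. a n powr p * 2 powi m n * (1 + A (V / 2 powi m n)) * (\<Sum>j | n + j <= \<nu> & m (n + j) = m n. b ^ j))"
 proof (intro mult_left_mono sum_mono)
  fix n assume n: "n : {..\<nu>}"
  have Vc: "V * c n = 2 powi m n * (1 + A (V / 2 powi m n)) * b ^ R n" unfolding c_def \<phi>_def using V A0[of "m n"] by (simp add: field_simps)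
  \<comment> \<open>There are at most j later indices on the level, j being the largest offset to
    one of them. The cruder sum over all offsets can be integrated term by term.\<close>
  have "b ^ R n <= (\<Sum>j | n + j <= \<nu> & m (n + j) = m n. b ^ j)"
  proof -
   define J where "J = {j. n + j <= \<nu> & m (n + j) = m n}"
   have J: "finite J" "0 : J" using n by (auto simp: J_def intro: finite_subset[of _ "{..\<nu>}"])
   define j where "j = Max J"
   have j: "j : J" "!!i. i : J ==> i <= j" using J unfolding j_def by (auto intro: Max_in)
   have "{i\<in>{..\<nu>}. n < i & m i = m n} <= (%i. n + i) ` {1..j}"
   proof
    fix i assume i: "i : {i\<in>{..\<nu>}. n < i & m i = m n}"
    hence "i - n : J" by (auto simp: J_def)
    hence "i - n <= j" by (rule j(2))
    thus "i : (%i. n + i) ` {1..j}" using i by (intro image_eqI[of _ _ "i - n"]) auto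
   qed
   hence "R n <= card ((%i. n + i) ` {1..j})" unfolding R_def by (intro card_mono) auto
   also have "... <= j" using card_image_le[of "{1..j}" "%i. n + i"] by simp
   finally have "b ^ R n <= b ^ j" using b by (intro power_increasing) auto
   also have "... = sum (%j. b ^ j) {j}" by simp
   also have "... <= sum (%j. b ^ j) J" using J j b by (intro sum_mono2) auto
   finally show ?thesis unfolding J_def .
  qed
  hence "a n powr p * (V * c n) <= a n powr p * (2 powi m n * (1 + A (V / 2 powi m n)) * (\<Sum>j | n + j <= \<nu> & m (n + j) = m n. b ^ j))"
   unfolding Vc using A0[of "m n"] by (intro mult_left_mono) auto
  thus "a n powr p * (V * c n) <= a n powr p * 2 powi m n * (1 + A (V / 2 powi m n)) * (\<Sum>j | n + j <= \<nu> & m (n + j) = m n. b ^ j)"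
   by (simp only: mult.assoc)
 qed auto
 finally show ?thesis unfolding z_def e_def .
qed

lemma nn_integral_count_space_UN_le:
 fixes g :: "'b => ennreal"
 assumes "countable I"
 shows "(\<Sum>\<^sup>+x\<in>(\<Union>i\<in>I. B i). g x) <= (\<Sum>\<^sup>+i\<in>I. (\<Sum>\<^sup>+x\<in>(B i). g x))"
proof -
 have "(\<Sum>\<^sup>+x\<in>(\<Union>i\<in>I. B i). g x) = (\<integral>\<^sup>+x\<in>(\<Union>i\<in>I. B i). g x \<partial>count_space UNIV)"
  by (simp add: nn_integral_count_space_indicator)
 also have "... <= (\<Sum>\<^sup>+i\<in>I. (\<integral>\<^sup>+x\<in>B i. g x \<partial>count_space UNIV))"
  using assms by (intro nn_integral_UN_le) auto
 also have "... = (\<Sum>\<^sup>+i\<in>I. (\<Sum>\<^sup>+x\<in>(B i). g x))" by (simp add: nn_integral_count_space_indicator)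
 finally show ?thesis .
qed

lemma borel_measurable_nn_integral_count_space:
 fixes h :: "'i => 'b => ennreal"
 assumes I: "countable I" and h: "!!i. i : I ==> h i : borel_measurable M"
 shows "(%x. \<integral>\<^sup>+i. h i x \<partial>count_space I) : borel_measurable M"
proof (cases "finite I")
 case True
 thus ?thesis using h by (simp add: nn_integral_count_space_finite)
next
 case False
 have b: "bij_betw (from_nat_into I) UNIV I" using I False by (rule bij_betw_from_nat_into)
 have "(\<Sum>\<^sup>+i\<in>I. h i x) = (\<Sum>n. h (from_nat_into I n) x)" for x
  using nn_integral_bij_count_space[OF b, of "%i. h i x"] by (simp add: nn_integral_count_space_nat)
 moreover have "(%x. \<Sum>n. h (from_nat_into I n) x) : borel_measurable M"
 proof (rule borel_measurable_suminf_order)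
  fix n
  have "I ~= {}" using False by auto
  thus "(%x. h (from_nat_into I n) x) : borel_measurable M" by (intro h from_nat_into)
 qed
 ultimately show ?thesis by simp
qed

section \<open>Generations of a tree of cubes\<close>

context
 fixes ch :: "int \<times> 'a::euclidean_space => (int \<times> 'a) set"
begin

primrec tr :: "(int \<times> 'a) set => nat => (int \<times> 'a) set" where
 "tr X 0 = X"
| "tr X (Suc n) = (\<Union>q\<in>tr X n. ch q)"

context
 assumes ch_cubes: "!!q. q : cubes ==> ch q <= cubes"
  and ch_disj: "!!q. q : cubes ==> disjoint_family_on cub (ch q)"
  and ch_sub: "!!q q'. q : cubes ==> q' : ch q ==> cub q' <= cub q"
  and ch_vol: "!!q. q : cubes ==> (\<Sum>\<^sup>+q'\<in>(ch q). en (vol q')) <= en (vol q / 2)"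
begin

lemma tr_cubes: "X <= cubes ==> tr X n <= cubes"
proof (induction n)
 case (Suc n)
 hence IH: "tr X n <= cubes" by blast
 show ?case
 proof
  fix q assume "q : tr X (Suc n)"
  then obtain q' where q': "q' : tr X n" "q : ch q'" by auto
  show "q : cubes" by (rule subsetD[OF ch_cubes[OF subsetD[OF IH q'(1)]] q'(2)])
 qed
qed simp

lemma countable_tr: "X <= cubes ==> countable (tr X n)" by (rule countable_subset[OF tr_cubes countable_cubes])

lemma tr_parent:
 assumes "X <= cubes" "q : tr X (Suc n)" "x : cub q"
 obtains q' where "q' : tr X n" "q : ch q'" "x : cub q'"
proof -
 obtain q' where q': "q' : tr X n" "q : ch q'" using assms(2) by auto
 have "cub q <= cub q'" by (rule ch_sub[OF subsetD[OF tr_cubes[OF assms(1)] q'(1)] q'(2)])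
 thus ?thesis using that[OF q'] assms(3) by blast
qed

lemma tr_unique:
 assumes X: "X <= cubes" "disjoint_family_on cub X"
 shows "q : tr X n ==> q' : tr X n ==> x : cub q ==> x : cub q' ==> q = q'"
proof (induction n arbitrary: q q')
 case 0
 thus ?case using X(2) by (auto simp: disjoint_family_on_def)
next
 case (Suc n)
 obtain r where r: "r : tr X n" "q : ch r" "x : cub r" by (rule tr_parent[OF X(1) Suc.prems(1,3)])
 obtain r' where r': "r' : tr X n" "q' : ch r'" "x : cub r'" by (rule tr_parent[OF X(1) Suc.prems(2,4)])
 have "r = r'" by (rule Suc.IH[OF r(1) r'(1) r(3) r'(3)])
 moreover have "disjoint_family_on cub (ch r)" by (rule ch_disj[OF subsetD[OF tr_cubes[OF X(1)] r(1)]])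
 ultimately show ?case using r(2) r'(2) Suc.prems(3,4) by (auto simp: disjoint_family_on_def)
qed

lemma tr_disjoint: "X <= cubes ==> disjoint_family_on cub X ==> disjoint_family_on cub (tr X n)"
 unfolding disjoint_family_on_def[of cub "tr X n"] using tr_unique[of X] by blast

lemma tr_vol:
 assumes "X <= cubes"
 shows "(\<Sum>\<^sup>+q\<in>(tr X n). en (vol q)) <= en ((1 / 2) ^ n) * (\<Sum>\<^sup>+q\<in>X. en (vol q))"
proof (induction n)
 case (Suc n)
 have "(\<Sum>\<^sup>+q\<in>(tr X (Suc n)). en (vol q)) <=
   (\<Sum>\<^sup>+q\<in>(tr X n). (\<Sum>\<^sup>+q'\<in>(ch q). en (vol q')))"
  unfolding tr.simps by (rule nn_integral_count_space_UN_le[OF countable_tr[OF assms]])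
 also have "... <= (\<Sum>\<^sup>+q\<in>(tr X n). en (1 / 2) * en (vol q))"
 proof (rule nn_integral_mono)
  fix q assume "q : space (count_space (tr X n))"
  hence "q : cubes" using tr_cubes[OF assms] by auto
  note ch_vol[OF this]
  also have "en (vol q / 2) = en (1 / 2) * en (vol q)" by (subst ennreal_mult'[symmetric]) auto
  finally show "(\<Sum>\<^sup>+q'\<in>(ch q). en (vol q')) <= en (1 / 2) * en (vol q)" .
 qed
 also have "... = en (1 / 2) * (\<Sum>\<^sup>+q\<in>(tr X n). en (vol q))" by (simp add: nn_integral_cmult)
 also have "... <= en (1 / 2) * (en ((1 / 2) ^ n) * (\<Sum>\<^sup>+q\<in>X. en (vol q)))" by (intro mult_left_mono Suc) simp
 also have "... = en ((1 / 2) ^ Suc n) * (\<Sum>\<^sup>+q\<in>X. en (vol q))"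
 proof -
  have "en (1 / 2) * en ((1 / 2) ^ n) = en ((1 / 2) ^ Suc n)" by (subst ennreal_mult'[symmetric]) auto
  thus ?thesis by (simp only: mult.assoc[symmetric])
 qed
 finally show ?case .
qed simp

text \<open>Generations are disjoint families, so the cubes around x in consecutive generations are
  linked by parenthood.\<close>

lemma tr_descend:
 assumes X: "X <= cubes" "disjoint_family_on cub X" and q: "q : tr X n" "x : cub q"
 shows "q' : tr X (n + j) ==> x : cub q' ==> q' : tr {q} j"
proof (induction j arbitrary: q')
 case 0
 hence "q' = q" using tr_unique[OF X _ q(1) _ q(2), of q'] by simp
 thus ?case by simp
next
 case (Suc j)
 have "q' : tr X (Suc (n + j))" using Suc.prems(1) by simp
 then obtain r where r: "r : tr X (n + j)" "q' : ch r" "x : cub r" using tr_parent[OF X(1) _ Suc.prems(2)] by blast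
 have "r : tr {q} j" by (rule Suc.IH[OF r(1,3)])
 thus ?case using r(2) by auto
qed

lemma tr_UN_anti:
 assumes "X <= cubes" "m <= n"
 shows "(\<Union>q\<in>tr X n. cub q) <= (\<Union>q\<in>tr X m. cub q)" using assms(2)
proof (induction n rule: dec_induct)
 case (step n)
 have "(\<Union>q\<in>tr X (Suc n). cub q) <= (\<Union>q\<in>tr X n. cub q)"
 proof
  fix x assume "x : (\<Union>q\<in>tr X (Suc n). cub q)"
  then obtain q where q: "q : tr X (Suc n)" "x : cub q" by blast
  obtain q' where "q' : tr X n" "q : ch q'" "x : cub q'" by (rule tr_parent[OF assms(1) q])
  thus "x : (\<Union>q\<in>tr X n. cub q)" by blast
 qed
 thus ?case using step.IH by (rule subset_trans)
qed simp

text \<open>The n-th generation has total volume at most 2^(-n) |Q|.\<close>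

lemma AE_tr_finite:
 assumes Q: "Q : cubes"
 shows "AE x. \<exists>n. x ~: (\<Union>q\<in>tr {Q} n. cub q)"
proof -
 define Om where "Om n = (\<Union>q\<in>tr {Q} n. cub q)" for n
 have Xc: "{Q} <= cubes" using Q by simp
 have Om[measurable]: "Om n : sets lebesgue" for n unfolding Om_def by (intro sets.countable_UN'' countable_tr[OF Xc]) auto
 have le: "\<mu> (Om n) <= en ((1 / 2) ^ n * vol Q)" for n
 proof -
  have "\<mu> (Om n) <= (\<Sum>\<^sup>+q\<in>(tr {Q} n). \<mu> (cub q))" unfolding Om_def by (intro emeasure_UN_le countable_tr[OF Xc]) auto
  also have "... = (\<Sum>\<^sup>+q\<in>(tr {Q} n). en (vol q))"
   using tr_cubes[OF Xc, of n] by (intro nn_integral_cong) (auto intro!: emeasure_cub simp del: emeasure_completion)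
  also have "... <= en ((1 / 2) ^ n) * (\<Sum>\<^sup>+q\<in>{Q}. en (vol q))" by (rule tr_vol[OF Xc])
  also have "... = en ((1 / 2) ^ n * vol Q)" by (simp add: nn_integral_count_space_finite ennreal_mult'[symmetric])
  finally show ?thesis .
 qed
 have "(\<Inter>n. Om n) : null_sets lebesgue"
 proof -
  have m: "(\<Inter>n. Om n) : sets lebesgue" by measurable
  have le2: "\<mu> (\<Inter>n. Om n) <= en ((1 / 2) ^ n * vol Q)" for n by (rule order_trans[OF emeasure_mono le[of n]]) auto
  have "(%n. en ((1 / 2) ^ n * vol Q)) \<longlonglongrightarrow> en (0 * vol Q)" by (intro tendsto_ennrealI tendsto_mult LIMSEQ_power_zero tendsto_const) auto
  hence "\<mu> (\<Inter>n. Om n) <= en (0 * vol Q)" by (rule Lim_bounded2) (use le2 in auto)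
  thus ?thesis using m by (simp add: null_sets_def del: emeasure_completion)
 qed
 hence "AE x. x ~: (\<Inter>n. Om n)" by (rule AE_not_in)
 thus ?thesis by eventually_elim (auto simp: Om_def)
qed

end

end

section \<open>Levels of the Luxemburg norm and the square function\<close>

lemma emeasure_cub_pos:
 assumes "q : cubes"
 shows "0 < \<mu> (cub q)" "\<mu> (cub q) < \<infinity>" unfolding emeasure_cub[OF assms] by (simp_all add: ennreal_zero_less_top)

text \<open>The k with 2^(k-1) <= norm < 2^k. The strict upper bound makes 2^k admissible in the
  definition of the norm (\<open>lux_less_adm\<close>).\<close>

definition lux_level :: "(real => real) => ('a::euclidean_space => real) => int \<times> 'a => int" where
 "lux_level A v q = \<lfloor>log 2 (enn2real (luxemburg A (cub q) v))\<rfloor> + 1"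

lemma lux_level:
 assumes "0 < luxemburg A (cub q) v" "luxemburg A (cub q) v < \<infinity>"
 shows "luxemburg A (cub q) v < en (2 powi lux_level A v q)"
  and "en (2 powi lux_level A v q) <= 2 * luxemburg A (cub q) v"
proof -
 define n where "n = enn2real (luxemburg A (cub q) v)"
 have n: "luxemburg A (cub q) v = en n" "0 < n" using assms unfolding n_def by (auto simp: enn2real_positive_iff)
 have pw: "2 powi lux_level A v q = 2 powr real_of_int (lux_level A v q)" by (simp add: powr_real_of_int')
 have nl: "n = 2 powr (log 2 n)" using n by simp
 have fl: "real_of_int (lux_level A v q) = real_of_int \<lfloor>log 2 n\<rfloor> + 1" by (simp add: lux_level_def n_def)
 have "2 powr (log 2 n) < (2::real) powr (real_of_int \<lfloor>log 2 n\<rfloor> + 1)" by (rule powr_less_mono) linarith+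
 hence "n < 2 powi lux_level A v q" unfolding pw fl nl[symmetric] .
 thus "luxemburg A (cub q) v < en (2 powi lux_level A v q)" unfolding n(1) using n(2) by (simp add: ennreal_less_iff)
 have "2 powi lux_level A v q <= 2 powr (log 2 n + 1)" unfolding pw fl by (subst powr_le_cancel_iff) auto
 also have "... = 2 * n" using n(2) by (simp add: powr_add)
 finally have "en (2 powi lux_level A v q) <= en (2 * n)" by (rule ennreal_leI)
 thus "en (2 powi lux_level A v q) <= 2 * luxemburg A (cub q) v" unfolding n(1) using n(2) by (simp add: ennreal_mult')
qed

lemma lux_zero_AE:
 assumes A: "young_function A" and t: "0 < t" "0 < A t" and q: "q : cubes"
  and v: "v : lmeas" and 0: "luxemburg A (cub q) v = 0"
 shows "AE x. x : cub q --> v x = 0"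
proof -
 note [measurable] = v
 have "(\<integral>x\<in>cub q. en \<bar>v x\<bar>) <= 0" using lux_avg[OF A t emeasure_cub_pos[OF q] cub_lebesgue v] 0 by simp
 hence "(\<integral>x\<in>cub q. en \<bar>v x\<bar>) = 0" by simp
 moreover have "(%x. en \<bar>v x\<bar> * indicator (cub q) x) : lmeas" by measurable
 ultimately have "AE x. en \<bar>v x\<bar> * indicator (cub q) x = 0" by (simp add: nn_integral_0_iff_AE)
 thus ?thesis by eventually_elim (auto simp: indicator_def ennreal_eq_0_iff split: if_splits)
qed

(* The square function Phi collects the terms of chain_sum over all chains of cubes. *)
context
 fixes ch :: "int \<times> 'a::euclidean_space => (int \<times> 'a) set"
  and A :: "real => real" and v :: "'a => real" and a :: "int \<times> 'a => real" and p M :: real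
begin

text \<open>Positive norms are required because \<open>lux_level\<close> carries no information at
  norm 0.\<close>

definition lev_set :: "int \<times> 'a => nat => (int \<times> 'a) set" where
 "lev_set q j = {q'\<in>tr ch {q} j. lux_level A v q' = lux_level A v q & 0 < luxemburg A (cub q') v & 0 < luxemburg A (cub q) v}"

text \<open>The base 3 / 2 lies strictly between 1 and 2: above 1 for \<open>chain_sum\<close>,
  below 2 so that the volume decay 2^(-j) of the generations beats it.\<close>

definition chain_term :: "int \<times> 'a => nat => 'a => ennreal" where
 "chain_term q j x = en (a q powr p * 2 powi lux_level A v q * (3 / 2) ^ j) *
   (en (1 + A (v x / 2 powi lux_level A v q)) * indicator (\<Union>q'\<in>lev_set q j. cub q') x)"

definition chain_fun :: "int \<times> 'a => 'a => ennreal" where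
 "chain_fun Q x = (\<Sum>n. \<integral>\<^sup>+q. (\<Sum>j. chain_term q j x) \<partial>count_space (tr ch {Q} n))"

context
 assumes ch_cubes: "!!q. q : cubes ==> ch q <= cubes"
  and ch_disj: "!!q. q : cubes ==> disjoint_family_on cub (ch q)"
  and ch_sub: "!!q q'. q : cubes ==> q' : ch q ==> cub q' <= cub q"
  and ch_vol: "!!q. q : cubes ==> (\<Sum>\<^sup>+q'\<in>(ch q). en (vol q')) <= en (vol q / 2)"
  and A: "young_function A" and v[measurable]: "v : lmeas" and v0: "!!x. 0 <= v x"
  and vM: "!!x. v x <= M" and p: "1 < p"
begin

lemma lev_set_countable: "q : cubes ==> countable (lev_set q j)" unfolding lev_set_def
 by (rule countable_subset[OF _ countable_tr[of ch "{q}" j, OF ch_cubes ch_disj ch_sub ch_vol]]) auto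

lemma lev_set_cubes: "q : cubes ==> lev_set q j <= cubes"
proof -
 assume "q : cubes"
 hence "tr ch {q} j <= cubes" by (intro tr_cubes[OF ch_cubes ch_disj ch_sub ch_vol]) auto
 thus ?thesis unfolding lev_set_def by blast
qed

lemma lev_UN_meas: "q : cubes ==> (\<Union>q'\<in>lev_set q j. cub q') : sets lebesgue" by (intro sets.countable_UN'' lev_set_countable) auto

lemma A_meas: "(%x. A (v x / 2 powi k)) : lmeas" using v0 by (intro young_measurable[OF A]) auto

lemma chain_term_meas: "q : cubes ==> chain_term q j : lmeas"
proof -
 assume q: "q : cubes"
 note [measurable] = lev_UN_meas[OF q] A_meas
 show ?thesis unfolding chain_term_def[abs_def] by measurable
qed

lemma lux_finite: "q : cubes ==> luxemburg A (cub q) v < \<infinity>"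
proof -
 assume q: "q : cubes"
 have "luxemburg A (cub q) v <= en ((M + 1) * (1 + A 1))" using v0 vM by (intro lux_bounded[OF A _ emeasure_cub_pos[OF q]]) auto
 thus ?thesis by (rule le_less_trans) simp
qed

text \<open>On a cube q' of \<open>lev_set q j\<close> the number 2^k is admissible, so 1 + A (v /
  2^k) integrates to at most 2 |q'|. The total volume of these cubes is at most 2^(-j) |q|, which
  turns (3 / 2)^j into (3 / 4)^j; finally 2^k is at most twice the norm on q.\<close>

lemma chain_term_integral:
 assumes q: "q : cubes"
 shows "(\<integral>x. chain_term q j x) <= en ((3 / 4) ^ j) * (en (4 * a q powr p * vol q) * luxemburg A (cub q) v)"
proof (cases "luxemburg A (cub q) v = 0")
 case True
 thus ?thesis by (simp add: chain_term_def[abs_def] lev_set_def)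
next
 case False
 hence pos: "0 < luxemburg A (cub q) v" by (simp add: zero_less_iff_neq_zero)
 define k where "k = lux_level A v q"
 define c where "c = a q powr p * 2 powi k * (3 / 2) ^ j"
 have c: "0 <= c" by (simp add: c_def)
 note [measurable] = lev_UN_meas[OF q, of j] A_meas
 have "(\<integral>x. chain_term q j x) = en c * (\<integral>x\<in>(\<Union>q'\<in>lev_set q j. cub q'). en (1 + A (v x / 2 powi k)))"
  unfolding chain_term_def k_def[symmetric] c_def[symmetric] by (rule nn_integral_cmult) measurable
 also have "... <= en c * (\<Sum>\<^sup>+q'\<in>(lev_set q j). (\<integral>x\<in>cub q'. en (1 + A (v x / 2 powi k))))"
  by (intro mult_left_mono nn_integral_UN_le lev_set_countable q) (simp_all, measurable)
 also have "... <= en c * (\<Sum>\<^sup>+q'\<in>(lev_set q j). 2 * en (vol q'))"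
 proof (intro mult_left_mono, rule nn_integral_mono)
  fix q' assume "q' : space (count_space (lev_set q j))"
  hence q': "q' : lev_set q j" by simp
  have qc: "q' : cubes" using lev_set_cubes[OF q] q' by blast
  have k': "k = lux_level A v q'" "0 < luxemburg A (cub q') v" using q' by (auto simp: lev_set_def k_def)
  have "lux_adm A (cub q') v (2 powi k)" unfolding k'(1) by (intro lux_less_adm[OF A emeasure_cub_pos[OF qc]] lux_level(1) k'(2) lux_finite qc)
  hence adm: "(\<integral>x\<in>cub q'. en (A (v x / 2 powi k))) <= en (vol q')"
   using v0 by (simp add: lux_adm_def emeasure_cub[OF qc] del: emeasure_completion)
  have "(\<integral>x\<in>cub q'. en (1 + A (v x / 2 powi k)))
   = (\<integral>x. indicator (cub q') x + en (A (v x / 2 powi k)) * indicator (cub q') x)"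
   using v0 young_nonneg[OF A] by (intro nn_integral_cong) (auto split: split_indicator)
  also have "... = en (vol q') + (\<integral>x\<in>cub q'. en (A (v x / 2 powi k)))"
   by (subst nn_integral_add) (auto simp: emeasure_cub[OF qc] simp del: emeasure_completion)
  also have "... <= en (vol q') + en (vol q')" by (intro add_left_mono adm)
  finally show "(\<integral>x\<in>cub q'. en (1 + A (v x / 2 powi k))) <= 2 * en (vol q')" by (simp add: mult_2)
 qed simp
 also have "... = en c * (2 * (\<Sum>\<^sup>+q'\<in>(lev_set q j). en (vol q')))" by (simp add: nn_integral_cmult)
 also have "... <= en c * (2 * (\<Sum>\<^sup>+q'\<in>(tr ch {q} j). en (vol q')))"
  by (intro mult_left_mono) (auto simp: lev_set_def nn_integral_count_space_indicator intro!: nn_integral_mono split: split_indicator)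
 also have "... <= en c * (2 * (en ((1 / 2) ^ j) * (\<Sum>\<^sup>+q'\<in>{q}. en (vol q'))))"
  using q by (intro mult_left_mono tr_vol[OF ch_cubes ch_disj ch_sub ch_vol]) auto
 also have "... = en (c * (2 * ((1 / 2) ^ j * vol q)))"
  using c less_imp_le[OF vol_pos[of q]] by (simp add: nn_integral_count_space_finite ennreal_mult')
 also have "c * (2 * ((1 / 2) ^ j * vol q)) = ((3 / 4) ^ j * (2 * a q powr p * vol q)) * 2 powi k"
 proof -
  have "(3 / 2) ^ j * (1 / 2) ^ j = ((3 / 4) ^ j :: real)" by (simp add: power_mult_distrib[symmetric])
  thus ?thesis unfolding c_def by (simp add: mult_ac)
 qed
 also have "ennreal ... = en ((3 / 4) ^ j * (2 * a q powr p * vol q)) * en (2 powi k)" by (rule ennreal_mult'') simp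
 also have "... <= en ((3 / 4) ^ j * (2 * a q powr p * vol q)) * (2 * luxemburg A (cub q) v)"
  unfolding k_def by (intro mult_left_mono lux_level(2) pos lux_finite q) simp
 also have "... = en ((3 / 4) ^ j) * (en (4 * a q powr p * vol q) * luxemburg A (cub q) v)"
 proof -
  have "en (4 * a q powr p * vol q) = en (2 * a q powr p * vol q) * 2" using ennreal_mult''[of 2 "2 * a q powr p * vol q"] by (simp add: mult.assoc)
  thus ?thesis using less_imp_le[OF vol_pos[of q]] by (simp add: ennreal_mult' mult_ac)
 qed
 finally show ?thesis .
qed

lemma chain_fun_integral:
 assumes Q: "Q : cubes"
 shows "(\<integral>x. chain_fun Q x) <=
  (\<Sum>n. \<integral>\<^sup>+q. en (16 * a q powr p * vol q) * luxemburg A (cub q) v \<partial>count_space (tr ch {Q} n))"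
proof -
 have Xc: "{Q} <= cubes" using Q by simp
 note trc = tr_cubes[OF ch_cubes ch_disj ch_sub ch_vol Xc]
 note trk = countable_tr[OF ch_cubes ch_disj ch_sub ch_vol Xc]
 have m2: "(%x. \<Sum>j. chain_term q j x) : lmeas" if "q : tr ch {Q} n" for q n
  using chain_term_meas[OF subsetD[OF trc that]] by (intro borel_measurable_suminf_order) auto
 have m3: "(%x. \<integral>\<^sup>+q. (\<Sum>j. chain_term q j x) \<partial>count_space (tr ch {Q} n)) : lmeas" for n
  by (rule borel_measurable_nn_integral_count_space[OF trk m2])
 have "(\<integral>x. chain_fun Q x) = (\<Sum>n. \<integral>\<^sup>+x. (\<Sum>\<^sup>+q\<in>(tr ch {Q} n). (\<Sum>j. chain_term q j x)) \<partial>lebesgue)"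
  unfolding chain_fun_def by (rule nn_integral_suminf[OF m3])
 also have "... = (\<Sum>n. \<integral>\<^sup>+q. (\<integral>x. (\<Sum>j. chain_term q j x)) \<partial>count_space (tr ch {Q} n))"
  using m2 trk by (intro suminf_cong nn_integral_count_space_nn_integral) auto
 also have "... <= (\<Sum>n. \<integral>\<^sup>+q. en (16 * a q powr p * vol q) * luxemburg A (cub q) v \<partial>count_space (tr ch {Q} n))"
 proof (intro suminf_le nn_integral_mono)
  fix n q assume "q : space (count_space (tr ch {Q} n))"
  hence q: "q : cubes" using trc by auto
  have "(\<integral>x. (\<Sum>j. chain_term q j x)) = (\<Sum>j. \<integral>\<^sup>+x. chain_term q j x \<partial>lebesgue)"
   by (rule nn_integral_suminf[OF chain_term_meas[OF q]])
  also have "... <= (\<Sum>j. en ((3 / 4) ^ j) * (en (4 * a q powr p * vol q) * luxemburg A (cub q) v))"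
   by (intro suminf_le chain_term_integral q) auto
  also have "... = (\<Sum>j. en ((3 / 4) ^ j)) * (en (4 * a q powr p * vol q) * luxemburg A (cub q) v)" by simp
  also have "(\<Sum>j. en ((3 / 4) ^ j)) = en (1 / (1 - 3 / 4))" by (intro suminf_ennreal_eq geometric_sums) auto
  also have "en (1 / (1 - 3 / 4)) * (en (4 * a q powr p * vol q) * luxemburg A (cub q) v)
    = en (16 * a q powr p * vol q) * luxemburg A (cub q) v"
   using less_imp_le[OF vol_pos[of q]] by (simp add: mult.assoc[symmetric] ennreal_mult'[symmetric] del: ennreal_numeral)
  finally show "(\<integral>x. (\<Sum>j. chain_term q j x)) <= en (16 * a q powr p * vol q) * luxemburg A (cub q) v" .
 qed auto
 finally show ?thesis .
qed

end

end

lemma nn_integral_UN_disjoint: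
 assumes "countable S" "disjoint_family_on E S" "!!q. q : S ==> E q : sets M" "F : borel_measurable M"
 shows "(\<Sum>\<^sup>+q\<in>S. (\<integral>\<^sup>+x\<in>E q. F x \<partial>M)) = (\<integral>\<^sup>+x\<in>(\<Union>q\<in>S. E q). F x \<partial>M)"
proof -
 have "emeasure (density M F) (\<Union>q\<in>S. E q) = (\<Sum>\<^sup>+q\<in>S. emeasure (density M F) (E q))"
  using assms by (intro emeasure_UN_countable) auto
 moreover have "(\<Union>q\<in>S. E q) : sets M" using assms(1,3) by (intro sets.countable_UN'') auto
 moreover have "(\<Sum>\<^sup>+q\<in>S. emeasure (density M F) (E q)) = (\<Sum>\<^sup>+q\<in>S. (\<integral>\<^sup>+x\<in>E q. F x \<partial>M))"
  using assms by (intro nn_integral_cong) (simp add: emeasure_density)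
 ultimately show ?thesis using assms by (simp add: emeasure_density)
qed

lemma nn_integral_ball_limit:
 assumes "F : lmeas" "!!n::nat. (\<integral>x\<in>ball (0::'a::euclidean_space) (real n). F x) <= B"
 shows "(\<integral>x. F x) <= B"
proof -
 have "(SUP n. F x * indicator (ball 0 (real n)) x) = F x" for x :: 'a
 proof (rule antisym)
  show "(SUP n. F x * indicator (ball 0 (real n)) x) <= F x" by (intro SUP_least) (auto split: split_indicator)
  obtain n where "norm x < real n" using reals_Archimedean2 by blast
  thus "F x <= (SUP n. F x * indicator (ball 0 (real n)) x)" by (intro SUP_upper2[of n]) auto
 qed
 hence "(\<integral>x. F x) = (\<integral>x. (SUP n. F x * indicator (ball 0 (real n)) x))" by simp
 also have "... = (SUP n. \<integral>\<^sup>+x. F x * indicator (ball 0 (real n)) x \<partial>lebesgue)" using assms(1)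
  by (intro nn_integral_monotone_convergence_SUP borel_measurable_times_ennreal borel_measurable_indicator)
    (auto simp: incseq_def le_fun_def split: split_indicator)
 also have "... <= B" using assms(2) by (intro SUP_least) auto
 finally show ?thesis .
qed

context cz_op
begin

text \<open>\<open>sparse_step\<close> is iterated along the cubes of the tree around x. The
  iteration ends in the last generation that covers x, whose cube around x has no child around
  x.\<close>

lemma chain_domination:
 assumes Q: "Q : cubes" and x: "x : cub Q"
  and ch_cubes: "!!q. q : cubes ==> ch q <= cubes"
  and ch_disj: "!!q. q : cubes ==> disjoint_family_on cub (ch q)"
  and ch_sub: "!!q q'. q : cubes ==> q' : ch q ==> cub q' <= cub q"
  and ch_vol: "!!q. q : cubes ==> (\<Sum>\<^sup>+q'\<in>(ch q). en (vol q')) <= en (vol q / 2)"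
  and out: "!!q. q : cubes ==> x : cub q ==> x ~: (\<Union>q'\<in>ch q. cub q') ==> cmod (T (rst f q) x) <= sparseC * amean f q"
  and into: "!!q q'. q : cubes ==> x : cub q ==> q' : ch q ==> x : cub q' ==>
    cmod (T (rst f q) x) <= sparseC * amean f q + cmod (T (rst f q') x)"
  and fin: "\<exists>n. x ~: (\<Union>q\<in>tr ch {Q} n. cub q)"
 obtains \<nu> c where "!!n. n <= \<nu> ==> c n : tr ch {Q} n" "!!n. n <= \<nu> ==> x : cub (c n)"
  "cmod (T (rst f Q) x) <= sparseC * (\<Sum>n\<le>\<nu>. amean f (c n))"
proof -
 have Xc: "{Q} <= cubes" "disjoint_family_on cub {Q}" using Q by (auto simp: disjoint_family_on_def)
 define Om where "Om n = (\<Union>q\<in>tr ch {Q} n. cub q)" for n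
 define N where "N = (LEAST n. x ~: Om n)"
 have "\<exists>n. x ~: Om n" using fin unfolding Om_def .
 hence N: "x ~: Om N" "!!n. n < N ==> x : Om n" unfolding N_def by (rule LeastI_ex) (use not_less_Least in blast)
 have "N ~= 0" using N(1) x by (auto simp: Om_def intro!: Nat.gr0I)
 then obtain \<nu> where \<nu>: "N = Suc \<nu>" using not0_implies_Suc by blast
 define c where "c n = (SOME q. q : tr ch {Q} n & x : cub q)" for n
 have c: "c n : tr ch {Q} n & x : cub (c n)" if "n <= \<nu>" for n
 proof -
  have "\<exists>q. q : tr ch {Q} n & x : cub q" using N(2)[of n] that \<nu> by (auto simp: Om_def)
  thus ?thesis unfolding c_def by (rule someI_ex)
 qed
 note trc = tr_cubes[OF ch_cubes ch_disj ch_sub ch_vol Xc(1)]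
 have cc: "c n : cubes" if "n <= \<nu>" for n using c[OF that] trc by blast
 have succ: "c (Suc n) : ch (c n)" if n: "n < \<nu>" for n
 proof -
  have c1: "c (Suc n) : tr ch {Q} (Suc n)" "x : cub (c (Suc n))" using c[of "Suc n"] n by auto
  obtain q' where q': "q' : tr ch {Q} n" "c (Suc n) : ch q'" "x : cub q'" by (rule tr_parent[OF ch_cubes ch_disj ch_sub ch_vol Xc(1) c1])
  have "q' = c n" by (rule tr_unique[OF ch_cubes ch_disj ch_sub ch_vol Xc q'(1) _ q'(3)]) (use c[of n] n in auto)
  thus ?thesis using q' by simp
 qed
 have last: "x ~: (\<Union>q'\<in>ch (c \<nu>). cub q')"
 proof
  assume "x : (\<Union>q'\<in>ch (c \<nu>). cub q')"
  hence "x : Om (Suc \<nu>)" using c[of \<nu>] by (auto simp: Om_def)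
  thus False using N(1) \<nu> by simp
 qed
 have chain: "cmod (T (rst f (c n)) x) <= sparseC * (\<Sum>i=n..\<nu>. amean f (c i))" if "n <= \<nu>" for n using that
 proof (induction n rule: inc_induct)
  case base
  show ?case using out[OF cc[of \<nu>] _ last] c[of \<nu>] by simp
 next
  case (step n)
  have n: "n <= \<nu>" using step by simp
  have "cmod (T (rst f (c n)) x) <= sparseC * amean f (c n) + cmod (T (rst f (c (Suc n))) x)"
   using step c[of n] c[of "Suc n"] by (intro into cc n succ) auto
  also have "... <= sparseC * amean f (c n) + sparseC * (\<Sum>i=Suc n..\<nu>. amean f (c i))" using step.IH by simp
  also have "... = sparseC * (\<Sum>i=n..\<nu>. amean f (c i))" using n by (simp add: sum.atLeast_Suc_atMost distrib_left)
  finally show ?case .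
 qed
 have "c 0 = Q" using c[of 0] by simp
 moreover have "{0..\<nu>} = {..\<nu>}" by auto
 ultimately have "cmod (T (rst f Q) x) <= sparseC * (\<Sum>n\<le>\<nu>. amean f (c n))" using chain[of 0] by simp
 thus ?thesis using that[of \<nu> c] c by blast
qed

text \<open>This is \<open>chain_sum\<close> with V = v x. A later cube of the chain on the level of
  c n, j generations below it, lies in \<open>lev_set\<close> of c n by \<open>tr_descend\<close>,
  so each summand is a value of \<open>chain_term\<close> at x.\<close>

lemma chain_pointwise:
 assumes A: "young_function A" and v0: "0 <= v x" and p: "1 < p"
  and C0: "!!t M. 0 < t ==> finite M ==> (\<Sum>m\<in>M. ((t / 2 powi m) / (1 + A (t / 2 powi m))) powr (1 / (p - 1))) <= C0"
  and Q: "Q : cubes" and x: "x : cub Q"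
  and ch_cubes: "!!q. q : cubes ==> ch q <= cubes"
  and ch_disj: "!!q. q : cubes ==> disjoint_family_on cub (ch q)"
  and ch_sub: "!!q q'. q : cubes ==> q' : ch q ==> cub q' <= cub q"
  and ch_vol: "!!q. q : cubes ==> (\<Sum>\<^sup>+q'\<in>(ch q). en (vol q')) <= en (vol q / 2)"
  and out: "!!q. q : cubes ==> x : cub q ==> x ~: (\<Union>q'\<in>ch q. cub q') ==> cmod (T (rst f q) x) <= sparseC * amean f q"
  and into: "!!q q'. q : cubes ==> x : cub q ==> q' : ch q ==> x : cub q' ==>
    cmod (T (rst f q) x) <= sparseC * amean f q + cmod (T (rst f q') x)"
  and fin: "\<exists>n. x ~: (\<Union>q\<in>tr ch {Q} n. cub q)"
  and luxp: "!!q. q : cubes ==> x : cub q ==> v x ~= 0 ==> 0 < luxemburg A (cub q) v"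
 shows "en (cmod (T (rst f Q) x) powr p) * en (v x) <=
  en (sparseC powr p * (C0 / (1 - (3 / 2) powr (- (1 / (p - 1))))) powr (p - 1)) * chain_fun ch A v (amean f) p Q x"
proof (cases "v x = 0")
 case False
 hence V: "0 < v x" using v0 by simp
 have Xc: "{Q} <= cubes" "disjoint_family_on cub {Q}" using Q by (auto simp: disjoint_family_on_def)
 obtain \<nu> c where c: "!!n. n <= \<nu> ==> c n : tr ch {Q} n" "!!n. n <= \<nu> ==> x : cub (c n)"
  and dom: "cmod (T (rst f Q) x) <= sparseC * (\<Sum>n\<le>\<nu>. amean f (c n))"
  by (rule chain_domination[OF Q x ch_cubes ch_disj ch_sub ch_vol out into fin]; (assumption | (rule that; assumption)))
 note trc = tr_cubes[OF ch_cubes ch_disj ch_sub ch_vol Xc(1)]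
 have cc: "c n : cubes" if "n <= \<nu>" for n using c[OF that] trc by blast
 define m where "m n = lux_level A v (c n)" for n
 define D where "D = (C0 / (1 - (3 / 2) powr (- (1 / (p - 1))))) powr (p - 1)"
 define S where "S = (\<Sum>n\<le>\<nu>. amean f (c n) powr p * 2 powi m n * (1 + A (v x / 2 powi m n)) * (\<Sum>j | n + j <= \<nu> & m (n + j) = m n. (3 / 2) ^ j))"
 have A0: "0 <= A (v x / 2 powi k)" for k using V by (intro young_nonneg[OF A]) simp
 have "v x * (\<Sum>n\<le>\<nu>. amean f (c n)) powr p <= D * S" unfolding D_def S_def by (rule chain_sum[OF A p V _ C0]) (use V in auto)
 moreover have "cmod (T (rst f Q) x) powr p <= sparseC powr p * (\<Sum>n\<le>\<nu>. amean f (c n)) powr p"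
 proof -
  have "cmod (T (rst f Q) x) powr p <= (sparseC * (\<Sum>n\<le>\<nu>. amean f (c n))) powr p" using dom p by (intro powr_mono2) auto
  also have "... = sparseC powr p * (\<Sum>n\<le>\<nu>. amean f (c n)) powr p" using sparseC_nonneg by (intro powr_mult)
  finally show ?thesis .
 qed
 ultimately have le: "cmod (T (rst f Q) x) powr p * v x <= sparseC powr p * D * S"
 proof -
  assume a1: "v x * (\<Sum>n\<le>\<nu>. amean f (c n)) powr p <= D * S"
   and a2: "cmod (T (rst f Q) x) powr p <= sparseC powr p * (\<Sum>n\<le>\<nu>. amean f (c n)) powr p"
  have "cmod (T (rst f Q) x) powr p * v x <= sparseC powr p * (\<Sum>n\<le>\<nu>. amean f (c n)) powr p * v x"
   using a2 V by (intro mult_right_mono) auto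
  also have "... = sparseC powr p * (v x * (\<Sum>n\<le>\<nu>. amean f (c n)) powr p)" by simp
  also have "... <= sparseC powr p * (D * S)" by (intro mult_left_mono a1) simp
  finally show ?thesis by (simp add: mult.assoc)
 qed
 have S: "en S <= chain_fun ch A v (amean f) p Q x"
 proof -
  have "en S <= (\<Sum>n\<le>\<nu>. \<Sum>j. chain_term ch A v (amean f) p (c n) j x)"
  proof -
   have "en S = (\<Sum>n\<le>\<nu>. en (amean f (c n) powr p * 2 powi m n * (1 + A (v x / 2 powi m n)) * (\<Sum>j | n + j <= \<nu> & m (n + j) = m n. (3 / 2) ^ j)))"
    unfolding S_def using A0 by (intro sum_ennreal[symmetric]) (auto intro!: mult_nonneg_nonneg sum_nonneg add_nonneg_nonneg)
   also have "... <= (\<Sum>n\<le>\<nu>. \<Sum>j. chain_term ch A v (amean f) p (c n) j x)"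
   proof (rule sum_mono)
    fix n assume n: "n : {..\<nu>}"
    define J where "J = {j. n + j <= \<nu> & m (n + j) = m n}"
    have J: "finite J" by (rule finite_subset[of _ "{..\<nu>}"]) (auto simp: J_def)
    have ct: "chain_term ch A v (amean f) p (c n) j x = en (amean f (c n) powr p * 2 powi m n * (3 / 2) ^ j * (1 + A (v x / 2 powi m n)))"
     if j: "j : J" for j
    proof -
     have nj: "n + j <= \<nu>" "m (n + j) = m n" using j by (auto simp: J_def)
     have t1: "c n : tr ch {Q} n" "x : cub (c n)" using c[of n] n by auto
     have t2: "c (n + j) : tr ch {Q} (n + j)" "x : cub (c (n + j))" using c[OF nj(1)] by auto
     have "c (n + j) : tr ch {c n} j" by (rule tr_descend[OF ch_cubes ch_disj ch_sub ch_vol Xc t1 t2])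
     moreover have "0 < luxemburg A (cub (c (n + j))) v" "0 < luxemburg A (cub (c n)) v"
      using t1 t2 cc[OF nj(1)] cc[of n] n False by (auto intro!: luxp)
     ultimately have "c (n + j) : lev_set ch A v (c n) j" using nj(2) by (simp add: lev_set_def m_def)
     hence "x : (\<Union>q'\<in>lev_set ch A v (c n) j. cub q')" using t2(2) by blast
     thus ?thesis using A0[of "m n"] unfolding chain_term_def m_def by (simp add: ennreal_mult'')
    qed
    have "en (amean f (c n) powr p * 2 powi m n * (1 + A (v x / 2 powi m n)) * (\<Sum>j\<in>J. (3 / 2) ^ j))
     = en (\<Sum>j\<in>J. amean f (c n) powr p * 2 powi m n * (3 / 2) ^ j * (1 + A (v x / 2 powi m n)))"
     by (subst sum_distrib_left, intro arg_cong[where f = ennreal] sum.cong refl) (simp add: mult_ac)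
    also have "... = (\<Sum>j\<in>J. chain_term ch A v (amean f) p (c n) j x)"
     using A0[of "m n"] by (subst sum_ennreal[symmetric]) (auto simp: ct intro!: mult_nonneg_nonneg add_nonneg_nonneg)
    also have "... <= (\<Sum>j. chain_term ch A v (amean f) p (c n) j x)" using J by (intro sum_le_suminf) auto
    finally show "en (amean f (c n) powr p * 2 powi m n * (1 + A (v x / 2 powi m n)) * (\<Sum>j | n + j <= \<nu> & m (n + j) = m n. (3 / 2) ^ j))
      <= (\<Sum>j. chain_term ch A v (amean f) p (c n) j x)" unfolding J_def .
   qed
   finally show ?thesis .
  qed
  also have "... <= (\<Sum>n\<le>\<nu>. \<integral>\<^sup>+q. (\<Sum>j. chain_term ch A v (amean f) p q j x) \<partial>count_space (tr ch {Q} n))"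
   using c(1) by (intro sum_mono nn_integral_ge_point) auto
  also have "... <= chain_fun ch A v (amean f) p Q x" unfolding chain_fun_def by (intro sum_le_suminf) auto
  finally show ?thesis .
 qed
 have "en (cmod (T (rst f Q) x) powr p) * en (v x) = en (cmod (T (rst f Q) x) powr p * v x)" using V by (simp add: ennreal_mult'')
 also have "... <= en (sparseC powr p * D * S)" by (intro ennreal_leI le)
 also have "... = en (sparseC powr p * D) * en S" unfolding D_def by (intro ennreal_mult') simp
 also have "... <= en (sparseC powr p * D) * chain_fun ch A v (amean f) p Q x" by (intro mult_left_mono S) simp
 finally show ?thesis unfolding D_def .
qed simp

end

lemma MN_le_bound:
 fixes F :: "'a::euclidean_space => ennreal"
 assumes "!!x. F x <= en M" "0 <= M"
 shows "MN F x <= en (nnb TYPE('a) * M)" unfolding MN_def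
proof (rule SUP_least)
 fix k
 have "(\<integral>y\<in>nb (dq k x). F y) <= (\<integral>y. en M * indicator (nb (dq k x)) y)"
  using assms(1) by (intro nn_integral_mono mult_right_mono) auto
 also have "... = en M * \<mu> (nb (dq k x))" by (rule nn_integral_cmult_indicator) simp
 also have "... <= en M * en (nnb TYPE('a) * vol (dq k x))" by (intro mult_left_mono emeasure_nb_le) auto
 also have "... = en (vol (dq k x)) * en (nnb TYPE('a) * M)"
  using assms(2) nnb_ge1[where 'a='a] less_imp_le[OF vol_pos[of "dq k x"]] by (simp add: ennreal_mult'[symmetric] mult_ac)
 finally show "mns F (dq k x) <= en (nnb TYPE('a) * M)" unfolding mns_le_iff .
qed

(* Carleson embedding: half of each cube of the tree is not covered by its children, and these
  uncovered parts are pairwise disjoint. *)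
lemma tree_carleson:
 fixes g :: "'a::euclidean_space => ennreal"
 assumes Q: "Q : cubes"
  and ch_cubes: "!!q. q : cubes ==> ch q <= cubes"
  and ch_disj: "!!q. q : cubes ==> disjoint_family_on cub (ch q)"
  and ch_sub: "!!q q'. q : cubes ==> q' : ch q ==> cub q' <= cub q"
  and ch_vol: "!!q. q : cubes ==> (\<Sum>\<^sup>+q'\<in>(ch q). en (vol q')) <= en (vol q / 2)"
  and g[measurable]: "g : lmeas"
  and h: "!!q x. q : cubes ==> x : cub q ==> h q <= g x"
 shows "(\<Sum>n. \<integral>\<^sup>+q. en (vol q) * h q \<partial>count_space (tr ch {Q} n)) <= 2 * (\<integral>x. g x)"
proof -
 have Xc: "{Q} <= cubes" "disjoint_family_on cub {Q}" using Q by (auto simp: disjoint_family_on_def)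
 note trc = tr_cubes[OF ch_cubes ch_disj ch_sub ch_vol Xc(1)]
 note trk = countable_tr[OF ch_cubes ch_disj ch_sub ch_vol Xc(1)]
 define U where "U q = (\<Union>q'\<in>ch q. cub q')" for q
 define E where "E q = cub q - U q" for q
 define Om where "Om n = (\<Union>q\<in>tr ch {Q} n. cub q)" for n
 have chk: "countable (ch q)" if "q : cubes" for q by (rule countable_subset[OF ch_cubes[OF that] countable_cubes])
 have Um: "U q : sets lebesgue" if "q : cubes" for q unfolding U_def by (intro sets.countable_UN'' chk that) simp
 have Em: "E q : sets lebesgue" if "q : cubes" for q unfolding E_def by (intro sets.Diff Um that) simp
 have Omm[measurable]: "Om n : sets lebesgue" for n unfolding Om_def by (intro sets.countable_UN'' trk cub_lebesgue)
 have half: "en (vol q) <= 2 * \<mu> (E q)" if q: "q : cubes" for q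
 proof -
  have "\<mu> (U q) <= (\<Sum>\<^sup>+q'\<in>(ch q). \<mu> (cub q'))" unfolding U_def by (intro emeasure_UN_le chk q) simp
  also have "... = (\<Sum>\<^sup>+q'\<in>(ch q). en (vol q'))"
  proof (rule nn_integral_cong)
   fix q' assume "q' : space (count_space (ch q))"
   hence "q' : cubes" using ch_cubes[OF q] by auto
   thus "\<mu> (cub q') = en (vol q')" by (rule emeasure_cub)
  qed
  also have "... <= en (vol q / 2)" by (rule ch_vol[OF q])
  finally have u: "\<mu> (U q) <= en (vol q / 2)" .
  have "en (vol q) = \<mu> (cub q)" by (rule emeasure_cub[OF q, symmetric])
  also have "... <= \<mu> (E q Un U q)" using Em[OF q] Um[OF q] by (intro emeasure_mono) (auto simp: E_def)
  also have "... <= \<mu> (E q) + \<mu> (U q)" using Em[OF q] Um[OF q] by (rule emeasure_subadditive)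
  also have "... <= \<mu> (E q) + en (vol q / 2)" by (intro add_left_mono u)
  finally have le: "en (vol q) <= \<mu> (E q) + en (vol q / 2)" .
  show ?thesis
  proof (cases "\<mu> (E q)")
   case (real e)
   hence "vol q <= e + vol q / 2" using le less_imp_le[OF vol_pos[of q]] by (simp add: ennreal_plus[symmetric] del: ennreal_plus)
   hence "vol q <= 2 * e" by simp
   thus ?thesis using real by (simp add: ennreal_leI ennreal_mult'[symmetric] flip: ennreal_numeral)
  qed (simp add: ennreal_mult_top)
 qed
 have "(\<Sum>n. \<integral>\<^sup>+q. en (vol q) * h q \<partial>count_space (tr ch {Q} n)) <= (\<Sum>n. 2 * (\<integral>x\<in>Om n - Om (Suc n). g x))"
 proof (intro suminf_le)
  fix n
  have "(\<Sum>\<^sup>+q\<in>(tr ch {Q} n). en (vol q) * h q) <= (\<Sum>\<^sup>+q\<in>(tr ch {Q} n). 2 * (\<integral>x\<in>E q. g x))"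
  proof (rule nn_integral_mono)
   fix q assume "q : space (count_space (tr ch {Q} n))"
   hence q: "q : cubes" using trc by auto
   have "en (vol q) * h q <= (2 * \<mu> (E q)) * h q" by (intro mult_right_mono half q) simp
   also have "... = 2 * (\<integral>x. h q * indicator (E q) x)"
    using Em[OF q] by (simp add: nn_integral_cmult_indicator mult_ac del: emeasure_completion)
   also have "... <= 2 * (\<integral>x\<in>E q. g x)"
    using h[OF q] by (intro mult_left_mono nn_integral_mono) (auto simp: E_def split: split_indicator)
   finally show "en (vol q) * h q <= 2 * (\<integral>x\<in>E q. g x)" .
  qed
  also have "... = 2 * (\<Sum>\<^sup>+q\<in>(tr ch {Q} n). (\<integral>x\<in>E q. g x))" by (simp add: nn_integral_cmult)
  also have "(\<Sum>\<^sup>+q\<in>(tr ch {Q} n). (\<integral>x\<in>E q. g x)) = (\<integral>x\<in>(\<Union>q\<in>tr ch {Q} n. E q). g x)"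
  proof (rule nn_integral_UN_disjoint[OF trk])
   have "disjoint_family_on cub (tr ch {Q} n)" by (rule tr_disjoint[OF ch_cubes ch_disj ch_sub ch_vol Xc])
   thus "disjoint_family_on E (tr ch {Q} n)" unfolding disjoint_family_on_def E_def by blast
   show "E q : sets lebesgue" if "q : tr ch {Q} n" for q by (rule Em[OF subsetD[OF trc that]])
  qed (assumption | rule g)+
  also have "... <= (\<integral>x\<in>Om n - Om (Suc n). g x)"
  proof -
   have "(\<Union>q\<in>tr ch {Q} n. E q) <= Om n - Om (Suc n)"
   proof
    fix x assume "x : (\<Union>q\<in>tr ch {Q} n. E q)"
    then obtain q where q: "q : tr ch {Q} n" "x : cub q" "x ~: U q" by (auto simp: E_def)
    have "x ~: Om (Suc n)"
    proof
     assume "x : Om (Suc n)"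
     then obtain r where r: "r : tr ch {Q} (Suc n)" "x : cub r" unfolding Om_def by blast
     obtain q' where q': "q' : tr ch {Q} n" "r : ch q'" "x : cub q'" by (rule tr_parent[OF ch_cubes ch_disj ch_sub ch_vol Xc(1) r])
     have "q' = q" by (rule tr_unique[OF ch_cubes ch_disj ch_sub ch_vol Xc q'(1) q(1) q'(3) q(2)])
     thus False using q(3) q'(2) r(2) by (auto simp: U_def)
    qed
    thus "x : Om n - Om (Suc n)" using q by (auto simp: Om_def)
   qed
   thus ?thesis by (intro nn_integral_mono) (auto split: split_indicator)
  qed
  finally show "(\<Sum>\<^sup>+q\<in>(tr ch {Q} n). en (vol q) * h q) <= 2 * (\<integral>x\<in>Om n - Om (Suc n). g x)" by (simp add: mult_left_mono)
 qed auto
 also have "... = 2 * (\<Sum>n. \<integral>\<^sup>+x\<in>Om n - Om (Suc n). g x \<partial>lebesgue)" by simp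
 also have "(\<Sum>n. \<integral>\<^sup>+x\<in>Om n - Om (Suc n). g x \<partial>lebesgue) = (\<Sum>\<^sup>+n\<in>UNIV. (\<integral>x\<in>Om n - Om (Suc n). g x))"
  by (simp add: nn_integral_count_space_nat)
 also have "... = (\<integral>x\<in>(\<Union>n\<in>UNIV. Om n - Om (Suc n)). g x)"
 proof (rule nn_integral_UN_disjoint)
  have anti: "Om n <= Om m" if "m <= n" for m n unfolding Om_def by (rule tr_UN_anti[OF ch_cubes ch_disj ch_sub ch_vol Xc(1) that])
  show "disjoint_family (%n. Om n - Om (Suc n))" unfolding disjoint_family_on_def
  proof (intro ballI impI)
   fix m n :: nat assume "m ~= n"
   then consider "Suc m <= n" | "Suc n <= m" by linarith
   thus "(Om m - Om (Suc m)) Int (Om n - Om (Suc n)) = {}" using anti[of "Suc m" n] anti[of "Suc n" m] by cases blast+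
  qed
 qed simp_all
 also have "... <= (\<integral>x. g x)" by (intro nn_integral_mono) (auto split: split_indicator)
 finally show ?thesis by (simp add: mult_left_mono)
qed

context cz_op
begin

text \<open>\<open>W\<close> dominates the Luxemburg norm on q at every point of
  \<open>nb q\<close>, so the p-th root of the norm can be moved inside the average of |f|: the
  product is at most the dyadic maximal function of |f| W^(1/p). The Carleson embedding and the L^p
  bound of that maximal function finish the proof. The bounds M and M' keep everything real-valued;
  H is independent of them.\<close>

lemma strong_local:
 assumes AD: "A : D_class p" and p: "1 < p"
 shows "\<exists>H\<ge>0. \<forall>f v W Q M M'. f : bcs --> Q : cubes --> v : lmeas --> (\<forall>x. 0 <= v x & v x <= M) -->
   W : lmeas --> (\<forall>x. 0 <= W x & W x <= M') -->
   (\<forall>q\<in>cubes. \<forall>y\<in>nb q. luxemburg A (cub q) v <= en (W y)) -->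
   (\<integral>x\<in>cub Q. en (cmod (T (rst f Q) x) powr p) * en (v x))
    <= en H * (\<integral>x. en (cmod (f x) powr p) * en (W x))"
proof -
 have Y: "young_function A" using AD by (rule D_class_young)
 obtain c I where cI: "0 < c" "!!t. c < t ==> 0 < A t" "0 <= I"
  "(\<integral>t\<in>{c<..}. en ((t / A t) powr (1 / (p - 1)) / t)) <= en I" by (rule D_classE[OF AD p]) (rule that)
 have t: "0 < c + 1" "0 < A (c + 1)" using cI by auto
 obtain C0 where C0: "0 < C0" "!!t M. 0 < t ==> finite M ==>
  (\<Sum>m\<in>M. ((t / 2 powi m) / (1 + A (t / 2 powi m))) powr (1 / (p - 1))) <= C0" by (rule D_class_sum[OF AD p]) (rule that)
 define H1 where "H1 = sparseC powr p * (C0 / (1 - (3 / 2) powr (- (1 / (p - 1))))) powr (p - 1)"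
 define H2 where "H2 = p / (p - 1) * (2 * nnb TYPE('a)) powr (p + 1)"
 have H1: "0 <= H1" and H2: "0 <= H2" using p by (auto simp: H1_def H2_def)
 have main: "(\<integral>x\<in>cub Q. en (cmod (T (rst f Q) x) powr p) * en (v x))
    <= en (H1 * 32 * H2) * (\<integral>x. en (cmod (f x) powr p) * en (W x))"
  if f: "f : bcs" and Q: "Q : cubes" and v: "v : lmeas" and vM: "\<forall>x. 0 <= v x & v x <= M"
   and W: "W : lmeas" and WM: "\<forall>x. 0 <= W x & W x <= M'"
   and lux: "\<forall>q\<in>cubes. \<forall>y\<in>nb q. luxemburg A (cub q) v <= en (W y)" for f v W Q M M'
 proof -
  define good where "good q P \<longleftrightarrow> P <= cubes & disjoint_family_on cub P & (\<forall>q'\<in>P. cub q' <= cub q & fst q < fst q') &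
  (\<Sum>\<^sup>+q'\<in>P. en (vol q')) <= en (vol q / 2) &
  (AE x. x : cub q -->
    (x ~: (\<Union>q'\<in>P. cub q') --> cmod (T (rst f q) x) <= sparseC * amean f q) &
    (\<forall>q'\<in>P. x : cub q' --> cmod (T (rst f q) x) <= sparseC * amean f q + cmod (T (rst f q') x)))" for q P
  define ch where "ch q = (SOME P. good q P)" for q
  have good: "good q (ch q)" if "q : cubes" for q unfolding ch_def using sparse_step[OF f that] unfolding good_def by (rule someI_ex)
  have ch: "ch q <= cubes" "disjoint_family_on cub (ch q)" "q' : ch q ==> cub q' <= cub q"
   "(\<Sum>\<^sup>+q'\<in>(ch q). en (vol q')) <= en (vol q / 2)" if "q : cubes" for q q' using good[OF that] unfolding good_def by blast+
  have AE1: "AE x. \<forall>q\<in>cubes. x : cub q -->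
    (x ~: (\<Union>q'\<in>ch q. cub q') --> cmod (T (rst f q) x) <= sparseC * amean f q) &
    (\<forall>q'\<in>ch q. x : cub q' --> cmod (T (rst f q) x) <= sparseC * amean f q + cmod (T (rst f q') x))"
   using good unfolding good_def by (subst AE_ball_countable[OF countable_cubes]) blast
  have AE2: "AE x. \<forall>q\<in>cubes. luxemburg A (cub q) v = 0 --> x : cub q --> v x = 0"
  proof (subst AE_ball_countable[OF countable_cubes], intro ballI)
   fix q :: "int \<times> 'a" assume q: "q : cubes"
   show "AE x. luxemburg A (cub q) v = 0 --> x : cub q --> v x = 0" using lux_zero_AE[OF Y t q v] by (cases "luxemburg A (cub q) v = 0") auto
  qed
  have AE3: "AE x. \<exists>n. x ~: (\<Union>q\<in>tr ch {Q} n. cub q)" by (rule AE_tr_finite[OF ch Q])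
  have pw: "AE x. x : cub Q --> en (cmod (T (rst f Q) x) powr p) * en (v x) <= en H1 * chain_fun ch A v (amean f) p Q x" using AE1 AE2 AE3
  proof eventually_elim
   fix x
   assume a1: "\<forall>q\<in>cubes. x : cub q -->
     (x ~: (\<Union>q'\<in>ch q. cub q') --> cmod (T (rst f q) x) <= sparseC * amean f q) &
     (\<forall>q'\<in>ch q. x : cub q' --> cmod (T (rst f q) x) <= sparseC * amean f q + cmod (T (rst f q') x))"
    and a2: "\<forall>q\<in>cubes. luxemburg A (cub q) v = 0 --> x : cub q --> v x = 0"
    and a3: "\<exists>n. x ~: (\<Union>q\<in>tr ch {Q} n. cub q)"
   have o: "cmod (T (rst f q) x) <= sparseC * amean f q"
    if "q : cubes" "x : cub q" "x ~: (\<Union>q'\<in>ch q. cub q')" for q using a1 that by blast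
   have i: "cmod (T (rst f q) x) <= sparseC * amean f q + cmod (T (rst f q') x)"
    if "q : cubes" "x : cub q" "q' : ch q" "x : cub q'" for q q' using a1 that by blast
   have l: "0 < luxemburg A (cub q) v" if "q : cubes" "x : cub q" "v x ~= 0" for q using a2 that by (auto simp: zero_less_iff_neq_zero)
   show "x : cub Q --> en (cmod (T (rst f Q) x) powr p) * en (v x) <= en H1 * chain_fun ch A v (amean f) p Q x" unfolding H1_def using vM
    by (intro impI chain_pointwise[OF Y _ p C0(2) Q _ ch o i a3 l]) auto
  qed
  have v0: "0 <= v x" and vle: "v x <= M" for x using vM by auto
  define F where "F x = cmod (f x) * W x powr (1 / p)" for x
  note [measurable] = bcs_measurable[OF f] v W
  have Fm[measurable]: "F : lmeas"
   unfolding F_def[abs_def] by (intro borel_measurable_times powr_real_measurable borel_measurable_const) measurable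
  have F0: "0 <= F x" for x by (simp add: F_def)
  obtain Mf R where Mf: "!!x. cmod (f x) <= Mf" "0 <= Mf" "!!x. f x ~= 0 ==> x : ball 0 R" "0 < R" by (rule bcsE[OF f]) (rule that)
  define B where "B = Mf * M' powr (1 / p)"
  have B: "0 <= B" using Mf(2) by (simp add: B_def)
  have FB: "F x <= B" for x unfolding F_def B_def using Mf WM p by (intro mult_mono powr_mono2) auto
  define G where "G x = enn2real (MN (%x. en (F x)) x)" for x
  have MNfin: "MN (%x. en (F x)) x < \<infinity>" for x
  proof -
   have "MN (%x. en (F x)) x <= en (nnb TYPE('a) * B)" using FB B by (intro MN_le_bound) (auto intro: ennreal_leI)
   thus ?thesis by (rule le_less_trans) simp
  qed
  have G: "en (G x) = MN (%x. en (F x)) x" for x unfolding G_def using MNfin by (intro ennreal_enn2real) simp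
  have G0: "0 <= G x" for x by (simp add: G_def)
  have Gm[measurable]: "G : lmeas" unfolding G_def[abs_def] by (intro borel_measurable_enn2real measurable_completion) simp
  have Gp[measurable]: "(%x. en (G x powr p)) : lmeas" by (intro bm_ennreal powr_real_measurable borel_measurable_const Gm)
  have h: "en (amean f q powr p) * luxemburg A (cub q) v <= en (G x powr p)" if q: "q : cubes" and x: "x : cub q" for q x
  proof -
   have "luxemburg A (cub q) v <= en (W x)" using lux q x cub_subset_nb by blast
   then obtain n where n: "luxemburg A (cub q) v = en n" "0 <= n" by (cases "luxemburg A (cub q) v") (auto simp: top_unique)
   have nW: "n <= W y" if "y : nb q" for y
   proof -
    have "en n <= en (W y)" using lux q that n(1) by auto
    thus ?thesis using WM by (subst (asm) ennreal_le_iff) auto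
   qed
   have "en (n powr (1 / p)) * mns (%x. enorm (f x)) q <= mns (%x. en (F x)) q"
   proof -
    have "en (n powr (1 / p)) * (\<integral>y\<in>nb q. enorm (f y)) = (\<integral>y. en (n powr (1 / p)) * (enorm (f y) * indicator (nb q) y))"
     by (rule nn_integral_cmult[symmetric]) measurable
    also have "... <= (\<integral>y\<in>nb q. en (F y))"
    proof (rule nn_integral_mono)
     fix y
     show "en (n powr (1 / p)) * (enorm (f y) * indicator (nb q) y) <= en (F y) * indicator (nb q) y"
     proof (cases "y : nb q")
      case True
      have "n powr (1 / p) * cmod (f y) <= F y"
       unfolding F_def using nW[OF True] n(2) p by (subst mult.commute) (intro mult_left_mono powr_mono2, auto)
      hence "en (n powr (1 / p) * cmod (f y)) <= en (F y)" by (rule ennreal_leI)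
      thus ?thesis using True by (simp add: ennreal_mult'')
     qed simp
    qed
    finally have "en (1 / vol q) * (en (n powr (1 / p)) * (\<integral>y\<in>nb q. enorm (f y))) <= mns (%x. en (F x)) q"
     unfolding mns_def by (intro mult_left_mono) auto
    thus ?thesis unfolding mns_def by (simp add: mult_ac)
   qed
   also have "... <= en (G x)" unfolding G by (rule mns_le_MN[OF x])
   finally have "en (n powr (1 / p) * amean f q) <= en (G x)" unfolding ennreal_amean[OF f, symmetric] by (simp add: ennreal_mult'')
   hence "n powr (1 / p) * amean f q <= G x" using G0 by (subst (asm) ennreal_le_iff) auto
   hence "(n powr (1 / p) * amean f q) powr p <= G x powr p" using p by (intro powr_mono2) auto
   moreover have "(n powr (1 / p) * amean f q) powr p = amean f q powr p * n"
   proof -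
    have "(n powr (1 / p) * amean f q) powr p = (n powr (1 / p)) powr p * amean f q powr p" by (rule powr_mult)
    moreover have "(n powr (1 / p)) powr p = n" using p n(2) by (simp add: powr_powr)
    ultimately show ?thesis by simp
   qed
   ultimately have "en (amean f q powr p * n) <= en (G x powr p)" by (intro ennreal_leI) simp
   thus ?thesis unfolding n(1) using n(2) by (simp add: ennreal_mult'')
  qed
  have "(\<integral>x\<in>cub Q. en (cmod (T (rst f Q) x) powr p) * en (v x)) <= (\<integral>x. en H1 * chain_fun ch A v (amean f) p Q x)"
   using pw by (intro nn_integral_mono_AE, eventually_elim) (auto split: split_indicator)
  also have "... = en H1 * (\<integral>x. chain_fun ch A v (amean f) p Q x)"
  proof (rule nn_integral_cmult)
   have "chain_term ch A v (amean f) p q j : lmeas" if "q : cubes" for q j by (rule chain_term_meas[OF ch Y v v0 vle p that])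
   moreover have "tr ch {Q} n <= cubes" for n using Q by (intro tr_cubes[OF ch]) auto
   moreover have "countable (tr ch {Q} n)" for n using Q by (intro countable_tr[OF ch]) auto
   ultimately show "chain_fun ch A v (amean f) p Q : lmeas" unfolding chain_fun_def[abs_def]
    by (intro borel_measurable_suminf_order borel_measurable_nn_integral_count_space) blast+
  qed
  also have "... <= en H1 * (\<Sum>n. \<integral>\<^sup>+q. en (16 * amean f q powr p * vol q) * luxemburg A (cub q) v \<partial>count_space (tr ch {Q} n))"
   by (intro mult_left_mono chain_fun_integral[OF ch Y v v0 vle p Q]) auto
  also have "... = en H1 * (\<Sum>n. 16 * (\<Sum>\<^sup>+q\<in>(tr ch {Q} n). en (vol q) * (en (amean f q powr p) * luxemburg A (cub q) v)))"
  proof -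
   have "en (16 * amean f q powr p * vol q) * l = 16 * (en (vol q) * (en (amean f q powr p) * l))" for q l
    using less_imp_le[OF vol_pos[of q]] by (simp add: ennreal_mult' ennreal_mult'' mult_ac)
   thus ?thesis by (simp add: nn_integral_cmult)
  qed
  also have "... = en H1 * (16 * (\<Sum>n. (\<Sum>\<^sup>+q\<in>(tr ch {Q} n). en (vol q) * (en (amean f q powr p) * luxemburg A (cub q) v))))"
   by simp
  also have "... <= en H1 * (16 * (2 * (\<integral>x. en (G x powr p))))" by (intro mult_left_mono tree_carleson[OF Q ch Gp h]) auto
  also have "... <= en H1 * (16 * (2 * (en H2 * (\<integral>x. en (F x powr p)))))"
   unfolding H2_def by (intro mult_left_mono MN_strong[OF Fm F0 Gm G0 _ p]) (auto simp: G)
  also have "(\<integral>x. en (F x powr p)) = (\<integral>x. en (cmod (f x) powr p) * en (W x))"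
  proof (rule nn_integral_cong)
   fix x
   have "F x powr p = cmod (f x) powr p * (W x powr (1 / p)) powr p" unfolding F_def by (rule powr_mult)
   also have "(W x powr (1 / p)) powr p = W x" using p WM by (simp add: powr_powr)
   finally show "en (F x powr p) = en (cmod (f x) powr p) * en (W x)" using WM by (simp add: ennreal_mult'')
  qed
  also have "en H1 * (16 * (2 * (en H2 * X))) = en (H1 * 32 * H2) * X" for X
  proof -
   have "en (H1 * 32 * H2) = en H1 * 32 * en H2" using H1 H2 by (simp add: ennreal_mult'')
   thus ?thesis by (simp add: mult.assoc[symmetric])
  qed
  finally show ?thesis .
 qed
 have "0 <= H1 * 32 * H2" using H1 H2 by simp
 thus ?thesis using main by blast
qed

end

subsection \<open>Weighted weak-type estimate with an Orlicz maximal function\<close>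

text \<open>Such a supremum is lower semicontinuous, whatever the values c; this makes maximal
  functions over open balls Borel.\<close>

lemma borel_measurable_SUP_open:
 fixes U :: "'i => 'b::topological_space set" and c :: "'i => ennreal"
 assumes "!!i. i : I ==> open (U i)"
 shows "(%x. SUP i\<in>{i\<in>I. x : U i}. c i) : borel_measurable borel"
proof (rule borel_measurableI_greater)
 fix t
 have "{x : space borel. t < (SUP i\<in>{i\<in>I. x : U i}. c i)} = (\<Union>i\<in>{i\<in>I. t < c i}. U i)" by (auto simp: less_SUP_iff)
 moreover have "open (\<Union>i\<in>{i\<in>I. t < c i}. U i)" using assms by (intro open_UN) auto
 ultimately show "{x : space borel. t < (SUP i\<in>{i\<in>I. x : U i}. c i)} : sets borel" by simp
qed

section \<open>Balls, cubes and the Orlicz maximal function\<close>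

definition bvol :: "'a::euclidean_space itself => real => real" where
 "bvol _ r = unit_ball_vol (real DIM('a)) * r ^ DIM('a)"

lemma emeasure_ball_bvol: "0 <= r ==> \<mu> (ball (x::'a::euclidean_space) r) = en (bvol TYPE('a) r)" by (simp add: emeasure_ball bvol_def)

lemma bvol_pos: "0 < r ==> 0 < bvol TYPE('a::euclidean_space) r" by (simp add: bvol_def)

lemma bvol_scale: "bvol TYPE('a::euclidean_space) (c * r) = c ^ DIM('a) * bvol TYPE('a) r" by (simp add: bvol_def power_mult_distrib)

lemma emeasure_ball_pos:
 assumes "0 < r"
 shows "0 < \<mu> (ball (x::'a::euclidean_space) r)" "\<mu> (ball x r) < \<infinity>"
 using assms bvol_pos[OF assms, where 'a='a] unfolding emeasure_ball_bvol[OF less_imp_le[OF assms]] by simp_all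

definition MA :: "(real => real) => ('a::euclidean_space => real) => 'a => ennreal" where
 "MA A v x = (SUP (x0, r)\<in>{(x0, r). 0 < r & x : ball x0 r}. luxemburg A (ball x0 r) v)"

lemma MA_measurable: "MA A v : borel_measurable borel"
proof -
 have "MA A v = (%x. SUP i\<in>{i\<in>{(x0, r). 0 < r}. x : (case i of (x0, r) => ball x0 r)}. (case i of (x0, r) => luxemburg A (ball x0 r) v))"
  unfolding MA_def[abs_def] by (intro ext SUP_cong) auto
 also have "... : borel_measurable borel" by (rule borel_measurable_SUP_open) auto
 finally show ?thesis .
qed

lemma MA_lebesgue [measurable]: "MA A v : lmeas" using MA_measurable by (intro measurable_completion) simp

lemma lux_le_MA: "0 < r ==> x : ball x0 r ==> luxemburg A (ball x0 r) v <= MA A v x" unfolding MA_def by (rule SUP_upper2[of "(x0, r)"]) auto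

lemma MA_leI: "(!!x0 r. 0 < r ==> x : ball x0 r ==> luxemburg A (ball x0 r) v <= B) ==> MA A v x <= B" unfolding MA_def by (rule SUP_least) auto

lemma MA_mono:
 assumes A: "young_function A" and v: "v : lmeas" "!!x. \<bar>u x\<bar> <= \<bar>v x\<bar>"
 shows "MA A u x <= MA A v x"
proof (rule MA_leI)
 fix x0 r assume r: "0 < r" "x : ball x0 r"
 have "luxemburg A (ball x0 r) u <= en 1 * luxemburg A (ball x0 r) v"
  by (rule lux_compare[OF A emeasure_ball_pos[OF r(1)] emeasure_ball_pos[OF r(1)]]) (use v in auto)
 also have "... <= MA A v x" using lux_le_MA[OF r] by simp
 finally show "luxemburg A (ball x0 r) u <= MA A v x" .
qed

lemma lux_zero:
 fixes f :: "'a::euclidean_space => real"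
 assumes A: "young_function A" and E: "0 < \<mu> E" "\<mu> E < \<infinity>"
  and z: "!!x. x : E ==> f x = 0"
 shows "luxemburg A E f = 0"
proof (rule ccontr)
 assume "luxemburg A E f ~= 0"
 hence "0 < luxemburg A E f" by (simp add: zero_less_iff_neq_zero)
 then obtain e where e: "0 < e" "e < luxemburg A E f" using dense by blast
 then obtain l where l: "e = en l" "0 < l" by (cases e) auto
 have "A 0 = 0" using A by (simp add: young_function_def)
 hence "(\<integral>x\<in>E. en (A (\<bar>f x\<bar> / l))) = (\<integral>\<^sup>+x. 0 \<partial>(lebesgue :: 'a measure))"
  using z by (intro nn_integral_cong) (auto split: split_indicator)
 hence "lux_adm A E f l" using l by (simp add: lux_adm_def)
 from lux_le_adm[OF E this] e l show False by simp
qed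

text \<open>One side more than the distance bound in \<open>dist_nb_le\<close>: the open ball of
  this radius around a point of \<open>cub q\<close> contains \<open>nb q\<close>, and around a
  point of \<open>nb q\<close> it contains \<open>cub q\<close>.\<close>

definition nbr :: "int \<times> 'a::euclidean_space => real" where
 "nbr q = (real DIM('a) * (2 * real DIM('a) + 1) + 1) * side q"

text \<open>The volume ratio of such a ball to the cube, with 1 added so that it can serve as the
  factor k >= 1 in \<open>lux_compare\<close>.\<close>

definition ballC :: "'a::euclidean_space itself => real" where
 "ballC _ = 1 + unit_ball_vol (real DIM('a)) * (real DIM('a) * (2 * real DIM('a) + 1) + 1) ^ DIM('a)"

lemma nbr_pos: "0 < nbr q" unfolding nbr_def by (intro mult_pos_pos add_nonneg_pos) auto

lemma ballC_ge1: "1 <= ballC TYPE('a::euclidean_space)" unfolding ballC_def using less_imp_le[OF unit_ball_vol_pos[of "real DIM('a)"]] by simp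

lemma emeasure_ball_nbr:
 fixes q :: "int \<times> 'a::euclidean_space" and y :: 'a
 shows "\<mu> (ball y (nbr q)) <= en (ballC TYPE('a) * vol q)" unfolding emeasure_ball_bvol[OF less_imp_le[OF nbr_pos]]
proof (rule ennreal_leI)
 have "bvol TYPE('a) (nbr q) = (ballC TYPE('a) - 1) * vol q" by (simp add: bvol_def nbr_def ballC_def vol_def power_mult_distrib)
 also have "... <= ballC TYPE('a) * vol q" by (intro mult_right_mono) (auto intro: less_imp_le)
 finally show "bvol TYPE('a) (nbr q) <= ballC TYPE('a) * vol q" .
qed

lemma nbr_ball:
 fixes x y :: "'a::euclidean_space"
 assumes "x : cub q" "y : nb q"
 shows "y : ball x (nbr q)" "x : ball y (nbr q)"
proof -
 have "dist x y <= real DIM('a) * (2 * real DIM('a) + 1) * side q" by (rule dist_nb_le[OF assms])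
 also have "... < nbr q" unfolding nbr_def by (simp add: algebra_simps)
 finally show "y : ball x (nbr q)" "x : ball y (nbr q)" by (auto simp: dist_commute)
qed

lemma lux_cub_le_MA:
 fixes q :: "int \<times> 'a::euclidean_space"
 assumes A: "young_function A" and q: "q : cubes" and v: "v : lmeas" and y: "y : nb q"
 shows "luxemburg A (cub q) v <= en (ballC TYPE('a)) * MA A v y"
proof -
 have "luxemburg A (cub q) v <= en (ballC TYPE('a)) * luxemburg A (ball y (nbr q)) v"
 proof (rule lux_compare[OF A emeasure_cub_pos[OF q] emeasure_ball_pos[OF nbr_pos] ballC_ge1])
  have "\<mu> (ball y (nbr q)) <= en (ballC TYPE('a) * vol q)" by (rule emeasure_ball_nbr)
  also have "... = en (ballC TYPE('a)) * \<mu> (cub q)" unfolding emeasure_cub[OF q] using ballC_ge1[where 'a='a] by (intro ennreal_mult') simp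
  finally show "\<mu> (ball y (nbr q)) <= en (ballC TYPE('a)) * \<mu> (cub q)" .
  show "x : ball y (nbr q) & \<bar>v x\<bar> <= \<bar>v x\<bar>" if "x : cub q" for x using nbr_ball[OF that y] by simp
 qed (use v in auto)
 also have "... <= en (ballC TYPE('a)) * MA A v y" by (intro mult_left_mono lux_le_MA nbr_pos) (use nbr_pos[of q] in auto)
 finally show ?thesis .
qed

lemma mns_le_MA:
 fixes q :: "int \<times> 'a::euclidean_space"
 assumes A: "young_function A" and t: "0 < t" "0 < A t" and v: "v : lmeas" "!!x. 0 <= v x" and y: "y : cub q"
 shows "mns (%x. en (v x)) q <= en ((t + t / A t) * ballC TYPE('a)) * MA A v y" unfolding mns_le_iff
proof -
 define B where "B = ball y (nbr q)"
 have t0: "0 <= t + t / A t" using t by simp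
 have "(\<integral>x\<in>nb q. en (v x)) <= (\<integral>x\<in>B. en \<bar>v x\<bar>)"
  using nbr_ball[OF y] v(2) unfolding B_def by (intro nn_integral_mono) (auto split: split_indicator)
 also have "... <= en (t + t / A t) * (\<mu> B * luxemburg A B v)" unfolding B_def by (rule lux_avg[OF A t emeasure_ball_pos[OF nbr_pos] _ v(1)]) simp
 also have "... <= en (t + t / A t) * (en (ballC TYPE('a) * vol q) * MA A v y)"
  unfolding B_def by (intro mult_left_mono mult_mono emeasure_ball_nbr lux_le_MA nbr_pos) (use nbr_pos[of q] in auto)
 also have "... = en (vol q) * (en ((t + t / A t) * ballC TYPE('a)) * MA A v y)"
  using t0 ballC_ge1[where 'a='a] less_imp_le[OF vol_pos[of q]] by (simp add: ennreal_mult mult_ac del: ennreal_plus)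
 finally show "(\<integral>x\<in>nb q. en (v x)) <= en (vol q) * (en ((t + t / A t) * ballC TYPE('a)) * MA A v y)" .
qed

lemma MA_bounded:
 fixes v :: "'a::euclidean_space => real"
 assumes A: "young_function A" and b: "!!x. \<bar>v x\<bar> <= M"
 shows "MA A v x <= en ((M + 1) * (1 + A 1))"
proof (rule MA_leI)
 fix x0 r assume r: "0 < r" "x : ball x0 r"
 show "luxemburg A (ball x0 r) v <= en ((M + 1) * (1 + A 1))" by (rule lux_bounded[OF A b emeasure_ball_pos[OF r(1)]]) simp
qed

text \<open>No dyadic cube contains a neighbourhood of the origin. The codes with entries 0 and -1
  are those of the 2^d cubes of a level that touch it; together they cover a ball around 0, and the
  neighbourhood of each contains that ball.\<close>

definition orth :: "'a::euclidean_space set" where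
 "orth = {n. \<forall>i\<in>Basis. n \<bullet> i = 0 \<or> n \<bullet> i = - 1}"

lemma orth_finite: "finite (orth :: 'a::euclidean_space set)" and orth_zvec: "orth <= (zvec :: 'a set)"
proof -
 show z: "orth <= (zvec :: 'a set)" by (force simp: orth_def zvec_def)
 have "orth <= {u::'a. u : zvec & (\<forall>i\<in>Basis. \<bar>u \<bullet> i\<bar> <= 1)}" using z by (fastforce simp: orth_def)
 thus "finite (orth :: 'a set)" using finite_zvec_bounded finite_subset by blast
qed

lemma idx_orth:
 fixes x :: "'a::euclidean_space"
 assumes "norm x < 2 powi (- k)"
 shows "idx k x : orth" unfolding orth_def
proof (intro CollectI ballI)
 fix i :: 'a assume i: "i : Basis"
 have "\<bar>x \<bullet> i\<bar> < 2 powi (- k)" using Basis_le_norm[OF i, of x] assms by linarith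
 hence "\<bar>x \<bullet> i\<bar> * 2 powi k < 1" by (simp add: power_int_minus field_simps)
 hence "\<bar>2 powi k * (x \<bullet> i)\<bar> < 1" by (simp add: abs_mult mult.commute)
 hence "\<lfloor>2 powi k * (x \<bullet> i)\<rfloor> = 0 \<or> \<lfloor>2 powi k * (x \<bullet> i)\<rfloor> = -1" by linarith
 thus "idx k x \<bullet> i = 0 \<or> idx k x \<bullet> i = - 1" using i by auto
qed

lemma orth_nb:
 assumes "n : orth" "norm x < 2 powi (- k)"
 shows "x : nb (k, n)"
proof -
 have "idx k x : orth" by (rule idx_orth[OF assms(2)])
 hence "\<bar>idx k x \<bullet> i - n \<bullet> i\<bar> <= 1" if "i : Basis" for i
  using assms(1) that by (fastforce simp: orth_def simp del: idx_inner)
 moreover have "1 <= 2 * real DIM('a)" using DIM_ge1[where 'a='a] by linarith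
 ultimately show ?thesis unfolding nb_def fst_conv snd_conv by (auto simp del: idx_inner intro: order_trans)
qed

lemma borel_measurable_powr_times:
 fixes f :: "'b => complex"
 assumes "f : borel_measurable M" "v : borel_measurable M"
 shows "(%x. en (cmod (f x) powr p) * v x) : borel_measurable M"
proof -
 have "(%x. cmod (f x) powr p) : borel_measurable M" by (intro powr_real_measurable borel_measurable_const bm_cmod[OF assms(1)])
 from bm_ennreal[OF this] assms(2) show ?thesis by (rule borel_measurable_times_ennreal)
qed

context cz_op
begin

text \<open>At a level coarse enough, the cubes with codes in \<open>orth\<close> cover a given ball
  and their neighbourhoods contain the support of g. Restriction of g to them changes nothing, and
  \<open>strong_local\<close> applies with W = b MA A v. Then the ball exhausts the space.\<close>

lemma strong_global:
 assumes AD: "A : D_class p" and p: "1 < p"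
 shows "\<exists>H\<ge>0. \<forall>g v M. g : bcs --> v : lmeas --> (\<forall>x. 0 <= v x & v x <= M) -->
   (\<integral>x. en (cmod (T g x) powr p) * en (v x))
    <= en H * (\<integral>x. en (cmod (g x) powr p) * MA A v x)"
proof -
 have Y: "young_function A" using AD by (rule D_class_young)
 define b where "b = ballC TYPE('a)"
 have b: "1 <= b" unfolding b_def by (rule ballC_ge1)
 obtain H where H: "0 <= H" "!!f v W Q M M'. f : bcs ==> Q : cubes ==> v : lmeas ==> (\<forall>x. 0 <= v x & v x <= M) ==>
   W : lmeas ==> (\<forall>x. 0 <= W x & W x <= M') ==>
   (\<forall>q\<in>cubes. \<forall>y\<in>nb q. luxemburg A (cub q) v <= en (W y)) ==>
   (\<integral>x\<in>cub Q. en (cmod (T (rst f Q) x) powr p) * en (v x))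
    <= en H * (\<integral>x. en (cmod (f x) powr p) * en (W x))" using strong_local[OF AD p] by blast
 define H' where "H' = real (card (orth :: 'a set)) * (H * b)"
 have main: "(\<integral>x. en (cmod (T g x) powr p) * en (v x))
    <= en H' * (\<integral>x. en (cmod (g x) powr p) * MA A v x)"
  if g: "g : bcs" and v: "v : lmeas" and vM: "\<forall>x. 0 <= v x & v x <= M" for g v M
 proof -
  note [measurable] = bcs_measurable[OF g] T_measurable[OF g] v
  have TVm: "(%x. en (cmod (T g x) powr p) * en (v x)) : lmeas" by (rule borel_measurable_powr_times[OF T_measurable[OF g]]) measurable
  define I where "I = (\<integral>x. en (cmod (g x) powr p) * MA A v x)"
  define MB where "MB = (M + 1) * (1 + A 1)"
  have MA_b: "MA A v x <= en MB" for x unfolding MB_def using vM by (intro MA_bounded Y) auto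
  define W where "W x = b * enn2real (MA A v x)" for x
  have eMA: "en (enn2real (MA A v x)) = MA A v x" for x using MA_b[of x] by (intro ennreal_enn2real) (auto simp: top_unique less_top[symmetric])
  have W: "en (W x) = en b * MA A v x" for x unfolding W_def using eMA[of x] by (simp add: ennreal_mult'')
  have Wm: "W : lmeas" unfolding W_def[abs_def] by measurable
  have "0 <= M" using vM[rule_format, of undefined] by linarith
  hence MB0: "0 <= MB" unfolding MB_def using young_nonneg[OF Y, of 1] by simp
  have Wb: "\<forall>x. 0 <= W x & W x <= b * MB" unfolding W_def using b MB0 enn2real_mono[OF MA_b] by (auto intro!: mult_left_mono)
  have lux: "\<forall>q\<in>cubes. \<forall>y\<in>nb q. luxemburg A (cub q) v <= en (W y)" unfolding W b_def using lux_cub_le_MA[OF Y _ v] by blast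
  obtain Mg Rg where Rg: "!!x. cmod (g x) <= Mg" "0 <= Mg" "!!x. g x ~= 0 ==> x : ball 0 Rg" "0 < Rg" by (rule bcsE[OF g]) (rule that)
  have "(\<integral>x\<in>ball 0 (real n). en (cmod (T g x) powr p) * en (v x)) <= en H' * I" for n
  proof -
   obtain k0 where k0: "\<forall>k\<le>k0. \<forall>x::'a. side (dq k x) > real n + Rg" using side_unbounded by blast
   hence k: "real n + Rg < 2 powi (- k0)" by (force simp: side_dq)
   have rg: "rst g (k0, u) = g" if "u : orth" for u
   proof
    fix x
    show "rst g (k0, u) x = g x"
    proof (cases "g x = 0")
     case False
     hence "norm x < 2 powi (- k0)" using Rg(3)[of x] k by auto
     thus ?thesis using orth_nb[OF that] by (simp add: rst_def)
    qed (simp add: rst_def)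
   qed
   have sub: "ball 0 (real n) <= (\<Union>u\<in>orth. cub (k0, u :: 'a))"
   proof
    fix x :: 'a assume "x : ball 0 (real n)"
    hence "norm x < 2 powi (- k0)" using k Rg(4) by auto
    from idx_orth[OF this] have "x : cub (k0, idx k0 x)" "idx k0 x : orth" by (auto simp: cub_def)
    thus "x : (\<Union>u\<in>orth. cub (k0, u))" by blast
   qed
   have "(\<integral>x\<in>ball 0 (real n). en (cmod (T g x) powr p) * en (v x))
    <= (\<integral>x\<in>(\<Union>u\<in>orth. cub (k0, u)). en (cmod (T g x) powr p) * en (v x))"
    using sub by (intro nn_integral_mono) (auto split: split_indicator)
   also have "... <= (\<Sum>\<^sup>+u\<in>orth. (\<integral>x\<in>cub (k0, u). en (cmod (T g x) powr p) * en (v x)))"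
   proof (rule nn_integral_UN_le)
    show "(%x. en (cmod (T g x) powr p) * en (v x)) : lmeas" by (rule TVm)
   qed (auto simp: orth_finite countable_finite)
   also have "... <= (\<Sum>\<^sup>+u\<in>(orth :: 'a set). en (H * b) * I)"
   proof (rule nn_integral_mono)
    fix u :: 'a assume "u : space (count_space orth)"
    hence u: "u : orth" by simp
    have uc: "(k0, u) : cubes" using orth_zvec u by (auto simp: cubes_def)
    have "(\<integral>x\<in>cub (k0, u). en (cmod (T g x) powr p) * en (v x))
     <= en H * (\<integral>x. en (cmod (g x) powr p) * en (W x))" using H(2)[OF g uc v vM Wm Wb lux] unfolding rg[OF u] .
    also have "(\<integral>x. en (cmod (g x) powr p) * en (W x)) = en b * I"
    proof -
     have "(%x. en (cmod (g x) powr p) * MA A v x) : lmeas" by (rule borel_measurable_powr_times[OF bcs_measurable[OF g] MA_lebesgue])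
     from nn_integral_cmult[OF this, of "en b"] show ?thesis unfolding I_def W by (simp add: mult_ac)
    qed
    finally show "(\<integral>x\<in>cub (k0, u). en (cmod (T g x) powr p) * en (v x)) <= en (H * b) * I"
     using H(1) by (simp add: ennreal_mult' mult.assoc)
   qed
   also have "... = en H' * I" using H(1) b by (simp add: H'_def orth_finite ennreal_mult' ennreal_of_nat_eq_real_of_nat mult_ac)
   finally show ?thesis .
  qed
  thus ?thesis unfolding I_def by (rule nn_integral_ball_limit[OF TVm])
 qed
 have "0 <= H'" unfolding H'_def using H(1) b by simp
 thus ?thesis using main by blast
qed

end

(* A weight vanishing on nb q has almost constant maximal function on cub q: a ball meeting both
  cub q and the support of the weight has radius at least d times the side of q. *)
lemma MA_vanishing_nb:
 fixes v :: "'a::euclidean_space => real"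
 assumes A: "young_function A" and v: "v : lmeas" and z: "!!x. x : nb q ==> v x = 0"
  and x: "x : cub q" and y: "y : cub q"
 shows "MA A v x <= en (2 ^ DIM('a)) * MA A v y"
proof (rule MA_leI)
 fix x0 r assume r: "0 < r" "x : ball x0 r"
 show "luxemburg A (ball x0 r) v <= en (2 ^ DIM('a)) * MA A v y"
 proof (cases "\<forall>u\<in>ball x0 r. v u = 0")
  case True
  thus ?thesis using lux_zero[OF A emeasure_ball_pos[OF r(1)], of x0 v] by simp
 next
  case False
  then obtain u where u: "u : ball x0 r" "v u ~= 0" by blast
  have "u ~: nb q" using z u by blast
  hence "2 * real DIM('a) * side q <= dist x u" by (rule dist_not_nb_ge[OF x])
  moreover have "dist x u <= dist x0 x + dist x0 u" using dist_triangle[of x u x0] by (simp add: dist_commute)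
  ultimately have "real DIM('a) * side q < r" using r u by auto
  moreover have "dist x y <= real DIM('a) * side q" by (rule dist_cub_le[OF x y])
  moreover have "dist x0 y <= dist x0 x + dist x y" by (rule dist_triangle)
  ultimately have y2: "y : ball x0 (2 * r)" using r by auto
  have r2: "0 < 2 * r" using r by simp
  have "luxemburg A (ball x0 r) v <= en (2 ^ DIM('a)) * luxemburg A (ball x0 (2 * r)) v"
  proof (rule lux_compare[OF A emeasure_ball_pos[OF r(1)] emeasure_ball_pos[OF r2]])
   have "bvol TYPE('a) (2 * r) = 2 ^ DIM('a) * bvol TYPE('a) r" by (rule bvol_scale)
   thus "\<mu> (ball x0 (2 * r)) <= en (2 ^ DIM('a)) * \<mu> (ball x0 r)"
    unfolding emeasure_ball_bvol[OF less_imp_le[OF r2]] emeasure_ball_bvol[OF less_imp_le[OF r(1)]] by (simp add: ennreal_mult')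
  qed (use v r in auto)
  also have "... <= en (2 ^ DIM('a)) * MA A v y" by (intro mult_left_mono lux_le_MA r2 y2) simp
  finally show ?thesis .
 qed
qed

definition weak_bound ::
 "(('a::euclidean_space => complex) => 'a => complex) => (('a => real) => 'a => ennreal) => bool" where
 "weak_bound T M \<longleftrightarrow> (\<exists>C\<ge>0. \<forall>v f t. v : lmeas --> (\<forall>x. 0 <= v x) --> f : bcs --> 0 < t -->
   (\<integral>x\<in>{x. t < cmod (T f x)}. en (v x)) <= en (C / t) * (\<integral>x. enorm (f x) * M v x))"

context cz_op
begin

text \<open>The L^p bound is used with v1, the weight cut off on the neighbourhoods of all selected
  cubes. Nothing is lost, since the good part is estimated outside them, and by
  \<open>MA_vanishing_nb\<close> the maximal function of v1 is nearly constant on each selected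
  cube, which that of v need not be.\<close>

lemma weak_bounded_weight:
 assumes AD: "A : D_class p" and p: "1 < p"
 shows "\<exists>C\<ge>0. \<forall>f v M l. f : bcs --> v : lmeas --> (\<forall>x. 0 <= v x & v x <= M) --> 0 < l -->
   (\<integral>x\<in>{x. l < cmod (T f x)}. en (v x)) <= en (C / l) * (\<integral>x. enorm (f x) * MA A v x)"
proof -
 have Y: "young_function A" using AD by (rule D_class_young)
 obtain c I where cI: "0 < c" "!!t. c < t ==> 0 < A t" "0 <= I"
  "(\<integral>t\<in>{c<..}. en ((t / A t) powr (1 / (p - 1)) / t)) <= en I" by (rule D_classE[OF AD p]) (rule that)
 have t: "0 < c + 1" "0 < A (c + 1)" using cI by auto
 define c1 where "c1 = ((c + 1) + (c + 1) / A (c + 1)) * ballC TYPE('a)"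
 have c1: "0 <= c1" unfolding c1_def using t ballC_ge1[where 'a='a] by simp
 obtain H where H: "0 <= H" "!!g v M. g : bcs ==> v : lmeas ==> (\<forall>x. 0 <= v x & v x <= M) ==>
   (\<integral>x. en (cmod (T g x) powr p) * en (v x))
    <= en H * (\<integral>x. en (cmod (g x) powr p) * MA A v x)" using strong_global[OF AD p] by blast
 define C where "C = c1 + 2 powr p * H * (2 ^ DIM('a)) powr (p - 1) * (1 + 2 ^ DIM('a)) + 4 * tailC * c1"
 have main: "(\<integral>x\<in>{x. l < cmod (T f x)}. en (v x)) <= en (C / l) * (\<integral>x. enorm (f x) * MA A v x)"
  if f: "f : bcs" and v: "v : lmeas" and vM: "\<forall>x. 0 <= v x & v x <= M" and l: "0 < l" for f v M l
 proof -
  define Om where "Om = (\<Union>q\<in>cz_cubes f l. nb q)"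
  have Om: "Om : sets lebesgue" unfolding Om_def by (intro sets.countable_UN'') auto
  have Omc: "- Om : sets lebesgue" using sets.compl_sets[OF Om] by (simp add: Compl_eq_Diff_UNIV)
  define v1 where "v1 x = v x * indicator (- Om) x" for x
  have v1: "v1 : lmeas" unfolding v1_def[abs_def] by (intro borel_measurable_times v borel_measurable_indicator Omc)
  have v1M: "\<forall>x. 0 <= v1 x & v1 x <= M"
  proof
   fix x show "0 <= v1 x & v1 x <= M" using vM[rule_format, of x] by (auto simp: v1_def indicator_def)
  qed
  have v1v: "\<bar>v1 x\<bar> <= \<bar>v x\<bar>" for x by (simp add: v1_def indicator_def)
  have v0: "0 <= v x" for x using vM by auto
  have vm: "(%x. en (v x)) : lmeas" using v by (rule measurable_compose) (rule measurable_ennreal)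
  have h1: "mns (%x. en (v x)) q <= en c1 * MA A v x" if "q : cubes" "x : cub q" for q x
   unfolding c1_def by (rule mns_le_MA[OF Y t v v0 that(2)])
  have h2: "(\<integral>x\<in>- (\<Union>q\<in>cz_cubes f l. nb q). en (cmod (T g x) powr p) * en (v x))
    <= en H * (\<integral>x. en (cmod (g x) powr p) * MA A v1 x)" if g: "g : bcs" for g
  proof -
   have "(\<integral>x\<in>- (\<Union>q\<in>cz_cubes f l. nb q). en (cmod (T g x) powr p) * en (v x))
     = (\<integral>x. en (cmod (T g x) powr p) * en (v1 x))"
    unfolding Om_def[symmetric] by (intro nn_integral_cong) (auto simp: v1_def split: split_indicator)
   thus ?thesis using H(2)[OF g v1 v1M] by simp
  qed
  have h3: "MA A v1 x <= MA A v x" for x by (rule MA_mono[OF Y v v1v])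
  have h4: "MA A v1 x <= en (2 ^ DIM('a)) * MA A v y" if q: "q : cz_cubes f l" "x : cub q" "y : cub q" for q x y
  proof -
   have z: "v1 u = 0" if "u : nb q" for u using that q(1) unfolding v1_def Om_def by (auto simp del: Compl_UN split: split_indicator)
   have "MA A v1 x <= en (2 ^ DIM('a)) * MA A v1 y" by (rule MA_vanishing_nb[OF Y v1 z q(2,3)])
   also have "... <= en (2 ^ DIM('a)) * MA A v y" by (intro mult_left_mono h3) simp
   finally show ?thesis .
  qed
  show ?thesis unfolding C_def by (rule cz_weak[OF f l less_imp_le[OF p] _ c1 H(1) vm MA_lebesgue MA_lebesgue h1 h2 h3 h4]) simp_all
 qed
 have "0 <= C" unfolding C_def using c1 H(1) tailC_nonneg by simp
 thus ?thesis using main by blast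
qed

text \<open>Truncation of the weight and monotone convergence; the constant for bounded weights does
  not depend on the bound.\<close>

theorem weak_type_MA:
 assumes AD: "A : D_class p" and p: "1 < p"
 shows "weak_bound T (MA A)"
proof -
 have Y: "young_function A" using AD by (rule D_class_young)
 obtain C where C: "0 <= C" "!!f v M l. f : bcs ==> v : lmeas ==> (\<forall>x. 0 <= v x & v x <= M) ==> 0 < l ==>
   (\<integral>x\<in>{x. l < cmod (T f x)}. en (v x)) <= en (C / l) * (\<integral>x. enorm (f x) * MA A v x)"
  using weak_bounded_weight[OF AD p] by blast
 have main: "(\<integral>x\<in>{x. l < cmod (T f x)}. en (v x)) <= en (C / l) * (\<integral>x. enorm (f x) * MA A v x)"
  if f: "f : bcs" and v: "v : lmeas" and v0: "\<forall>x. 0 <= v x" and l: "0 < l" for f v l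
 proof -
  define vn where "vn n x = min (v x) (real n)" for n x
  have vnm[measurable]: "vn n : lmeas" for n unfolding vn_def[abs_def] using v by (intro borel_measurable_min borel_measurable_const)
  have lev[measurable]: "{x. l < cmod (T f x)} : sets lebesgue" by (rule T_level_measurable[OF f])
  have sup: "(SUP n. en (vn n x) * indicator {x. l < cmod (T f x)} x) = en (v x) * indicator {x. l < cmod (T f x)} x" for x
  proof (rule antisym)
   show "(SUP n. en (vn n x) * indicator {x. l < cmod (T f x)} x) <= en (v x) * indicator {x. l < cmod (T f x)} x"
    by (intro SUP_least mult_right_mono ennreal_leI) (auto simp: vn_def)
   obtain n where "v x <= real n" using real_arch_simple by blast
   hence "vn n x = v x" by (simp add: vn_def)
   thus "en (v x) * indicator {x. l < cmod (T f x)} x <= (SUP n. en (vn n x) * indicator {x. l < cmod (T f x)} x)" by (intro SUP_upper2[of n]) auto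
  qed
  have "(\<integral>x\<in>{x. l < cmod (T f x)}. en (v x)) = (\<integral>x. (SUP n. en (vn n x) * indicator {x. l < cmod (T f x)} x))"
   unfolding sup ..
  also have "... = (SUP n. \<integral>\<^sup>+x\<in>{x. l < cmod (T f x)}. en (vn n x) \<partial>lebesgue)"
  proof (rule nn_integral_monotone_convergence_SUP)
   show "incseq (%n x. en (vn n x) * indicator {x. l < cmod (T f x)} x)"
    by (auto simp: incseq_def le_fun_def vn_def intro!: mult_right_mono ennreal_leI)
   show "(%x. en (vn n x) * indicator {x. l < cmod (T f x)} x) : lmeas" for n by measurable
  qed
  also have "... <= en (C / l) * (\<integral>x. enorm (f x) * MA A v x)"
  proof (rule SUP_least)
   fix n
   have "\<forall>x. 0 <= vn n x & vn n x <= real n" using v0 by (auto simp: vn_def)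
   hence "(\<integral>x\<in>{x. l < cmod (T f x)}. en (vn n x)) <= en (C / l) * (\<integral>x. enorm (f x) * MA A (vn n) x)" by (intro C(2) f vnm l)
   also have "... <= en (C / l) * (\<integral>x. enorm (f x) * MA A v x)"
   proof (intro mult_left_mono nn_integral_mono)
    fix x
    have "\<bar>vn n u\<bar> <= \<bar>v u\<bar>" for u using v0 by (auto simp: vn_def)
    thus "MA A (vn n) x <= MA A v x" by (rule MA_mono[OF Y v])
   qed auto
   finally show "(\<integral>x\<in>{x. l < cmod (T f x)}. en (vn n x)) <= en (C / l) * (\<integral>x. enorm (f x) * MA A v x)" .
  qed
  finally show ?thesis .
 qed
 thus ?thesis using C(1) unfolding weak_bound_def by blast
qed

end

subsection \<open>Critical cubes\<close>

lemma cubes_packing: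
 fixes z :: "'a::euclidean_space"
 assumes S: "S <= cubes" "disjoint_family_on cub S" and sub: "!!q. q : S ==> cub q <= ball z R"
  and c: "0 < c" "!!q. q : S ==> c <= vol q" and R: "0 <= R"
 shows "finite S & card S <= nat \<lfloor>bvol TYPE('a) R / c\<rfloor>"
proof (rule finite_if_finite_subsets_card_bdd)
 fix G assume G: "G <= S" "finite G"
 have "en (real (card G) * c) <= (\<Sum>q\<in>G. en (vol q))"
  using sum_mono[of G "%_. c" vol] c G by (auto simp: sum_ennreal less_imp_le intro!: ennreal_leI)
 also have "... = (\<Sum>q\<in>G. \<mu> (cub q))" using G S(1) by (intro sum.cong refl emeasure_cub[symmetric]) auto
 also have "... = \<mu> (\<Union>q\<in>G. cub q)" by (rule sum_emeasure) (use G S in \<open>auto intro: disjoint_family_on_mono\<close>)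
 also have "... <= \<mu> (ball z R)" by (rule emeasure_mono) (use sub G in auto)
 also have "... = en (bvol TYPE('a) R)" using R by (rule emeasure_ball_bvol)
 finally have "real (card G) * c <= bvol TYPE('a) R" using R by (subst (asm) ennreal_le_iff) (auto simp: bvol_def)
 hence "real (card G) <= bvol TYPE('a) R / c" using c by (simp add: field_simps)
 thus "card G <= nat \<lfloor>bvol TYPE('a) R / c\<rfloor>" by (simp add: le_nat_floor)
qed

locale critical =
 fixes \<rho> :: "'a::euclidean_space => real" and C0 N0 :: real
 assumes \<rho>_pos: "0 < \<rho> x" and C0: "1 <= C0" and N0: "1 <= N0"
  and \<rho>_lower: "inverse C0 * \<rho> x * (1 + dist x y / \<rho> x) powr (- N0) <= \<rho> y"
  and \<rho>_upper: "\<rho> y <= C0 * \<rho> x * (1 + dist x y / \<rho> x) powr (N0 / (N0 + 1))"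
begin

lemma \<rho>_le: "\<rho> y <= C0 * (\<rho> x + dist x y)"
proof -
 have b: "1 <= 1 + dist x y / \<rho> x" using \<rho>_pos[of x] by simp
 have "(1 + dist x y / \<rho> x) powr (N0 / (N0 + 1)) <= (1 + dist x y / \<rho> x) powr 1" using b N0 by (intro powr_mono) auto
 hence "C0 * \<rho> x * (1 + dist x y / \<rho> x) powr (N0 / (N0 + 1)) <= C0 * \<rho> x * (1 + dist x y / \<rho> x)"
  using b C0 \<rho>_pos[of x] by (intro mult_left_mono) auto
 also have "... = C0 * (\<rho> x + dist x y)" using \<rho>_pos[of x] by (simp add: field_simps)
 finally show ?thesis using \<rho>_upper[of y x] by linarith
qed

text \<open>Bounds \<rho> x / \<rho> y for y within critical distance of x, where 1 + dist x y /
  \<rho> x is at most 2 (\<open>\<rho>_near\<close>).\<close>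

definition E0 :: real where "E0 = C0 * 2 powr N0"

lemma E0_ge1: "1 <= E0"
proof -
 have "1 * 1 <= C0 * 2 powr N0" using C0 N0 by (intro mult_mono ge_one_powr_ge_zero) auto
 thus ?thesis by (simp add: E0_def)
qed

lemma \<rho>_near:
 assumes "dist x y <= \<rho> x"
 shows "\<rho> x <= E0 * \<rho> y"
proof -
 have q: "1 <= 1 + dist x y / \<rho> x" "1 + dist x y / \<rho> x <= 2" using assms \<rho>_pos[of x] by auto
 have "2 powr (- N0) <= (1 + dist x y / \<rho> x) powr (- N0)" using q N0 by (intro powr_mono2') auto
 hence "inverse C0 * \<rho> x * 2 powr (- N0) <= inverse C0 * \<rho> x * (1 + dist x y / \<rho> x) powr (- N0)"
  using C0 \<rho>_pos[of x] by (intro mult_left_mono) auto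
 also have "... <= \<rho> y" by (rule \<rho>_lower)
 finally show ?thesis using C0 unfolding E0_def by (simp add: powr_minus field_simps)
qed

(* Chosen so that balls of radius up to nbr q around points of a critical cube q are of at most
  critical radius; see MA_le_M_loc. *)
definition kap :: real where "kap = E0 + real DIM('a) * (2 * real DIM('a) + 1) + 1"

definition crit :: "(int \<times> 'a) set" where
 "crit = stop (%q. \<forall>x\<in>cub q. kap * side q <= \<rho> x)"

definition critC :: real where "critC = C0 * (2 * kap + 2 * real DIM('a))"

lemma kap_pos: "0 < kap" unfolding kap_def using E0_ge1 by (intro add_nonneg_pos) auto

lemma critC_pos: "0 < critC" unfolding critC_def using C0 kap_pos by (simp add: add_pos_nonneg)

lemma crit_cubes: "q : crit ==> q : cubes" unfolding crit_def using stop_cubes by blast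

lemma crit_disjoint: "q : crit ==> q' : crit ==> x : cub q ==> x : cub q' ==> q = q'" unfolding crit_def by (rule stop_disjoint)

lemma crit_le:
 assumes "q : crit" "y : cub q"
 shows "nbr q <= \<rho> y" "E0 * side q <= \<rho> y"
proof -
 have k: "kap * side q <= \<rho> y" using assms unfolding crit_def stop_def by auto
 have "0 <= E0 * side q" "0 <= (real DIM('a) * (2 * real DIM('a) + 1) + 1) * side q" using E0_ge1 less_imp_le[OF side_pos[of q]] by auto
 moreover have "kap * side q = E0 * side q + (real DIM('a) * (2 * real DIM('a) + 1) + 1) * side q" by (simp add: kap_def algebra_simps)
 ultimately show "nbr q <= \<rho> y" "E0 * side q <= \<rho> y" using k unfolding nbr_def by linarith+
qed

text \<open>The parent violates the selection criterion at some point z of it, and the linear growth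
  \<open>\<rho>_le\<close> carries the bound at z over to y.\<close>

lemma crit_ge:
 assumes q: "q : crit" and y: "y : cub q"
 shows "\<rho> y <= critC * side q"
proof -
 let ?p = "dq (fst q - 1) y"
 have "\<not> (\<forall>x\<in>cub ?p. kap * side ?p <= \<rho> x)" using q y unfolding crit_def stop_def by auto
 then obtain z where z: "z : cub ?p" "\<rho> z < kap * side ?p" by force
 have sp: "side ?p = 2 * side q" by (simp add: side_def power_int_diff power_int_minus field_simps)
 have "dist z y <= real DIM('a) * side ?p" by (rule dist_cub_le[OF z(1)]) simp
 hence "\<rho> z + dist z y <= (2 * kap + 2 * real DIM('a)) * side q" using z(2) unfolding sp by (simp add: algebra_simps)
 hence "C0 * (\<rho> z + dist z y) <= C0 * ((2 * kap + 2 * real DIM('a)) * side q)" using C0 by (intro mult_left_mono) auto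
 thus ?thesis using \<rho>_le[of y z] by (simp add: critC_def algebra_simps)
qed

text \<open>Small cubes around x qualify because \<rho> is bounded below by a multiple of \<rho> x
  near x, and large ones fail at x itself.\<close>

lemma crit_cover: "\<exists>q\<in>crit. x : cub q"
proof -
 have k: "0 < kap" by (rule kap_pos)
 \<comment> \<open>The first entry keeps the cube within critical distance of x; the second leaves
   room for the loss E0 in \<open>\<rho>_near\<close>.\<close>
 define c where "c = min (\<rho> x / real DIM('a)) (\<rho> x / (E0 * kap))"
 have c: "0 < c" unfolding c_def using \<rho>_pos[of x] E0_ge1 k by simp
 obtain k1 where k1: "\<forall>k\<ge>k1. \<forall>x::'a. side (dq k x) < c" using side_small[OF c] by blast
 obtain k0 where k0: "\<forall>k\<le>k0. \<forall>z::'a. side (dq k z) > \<rho> x / kap" using side_unbounded by blast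
 have s: "side (dq k1 x) <= \<rho> x / real DIM('a)" "side (dq k1 x) <= \<rho> x / (E0 * kap)"
  using k1 by (auto simp: c_def dest!: spec[of _ k1] spec[of _ x])
 have "\<forall>z\<in>cub (dq k1 x). kap * side (dq k1 x) <= \<rho> z"
 proof
  fix z assume z: "z : cub (dq k1 x)"
  have "dist x z <= real DIM('a) * side (dq k1 x)" by (rule dist_cub_le[OF _ z]) simp
  also have "... <= \<rho> x" using s(1) by (simp add: field_simps)
  finally have "\<rho> x <= E0 * \<rho> z" by (rule \<rho>_near)
  moreover have "E0 * (kap * side (dq k1 x)) <= \<rho> x" using s(2) E0_ge1 k by (simp add: field_simps)
  ultimately have "E0 * (kap * side (dq k1 x)) <= E0 * \<rho> z" by linarith
  thus "kap * side (dq k1 x) <= \<rho> z" using E0_ge1 by simp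
 qed
 moreover have "\<not> (\<forall>z\<in>cub (dq j x). kap * side (dq j x) <= \<rho> z)" if "j <= k0" for j
 proof -
  have "\<rho> x < kap * side (dq j x)" using k0 that k by (simp add: field_simps)
  thus ?thesis by (meson mem_cub_dq not_less)
 qed
 ultimately show ?thesis unfolding crit_def using stop_ex[of "%q. \<forall>x\<in>cub q. kap * side q <= \<rho> x" k1 x k0] by blast
qed

lemma crit_near:
 assumes q: "q : crit" and y: "y : cub q" and x: "x : nb q"
 shows "dist y x < \<rho> y" "\<rho> x <= 2 * C0 * \<rho> y" "\<rho> y <= E0 * \<rho> x"
proof -
 have "dist y x < nbr q" using nbr_ball[OF y x] by simp
 thus d: "dist y x < \<rho> y" using crit_le[OF q y] by linarith
 have "C0 * (\<rho> y + dist y x) <= C0 * (2 * \<rho> y)" using d C0 by (intro mult_left_mono) auto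
 thus "\<rho> x <= 2 * C0 * \<rho> y" using \<rho>_le[of x y] by simp
 show "\<rho> y <= E0 * \<rho> x" using d by (intro \<rho>_near) simp
qed

definition overC :: nat where
 "overC = nat \<lfloor>unit_ball_vol (real DIM('a)) * (2 * C0 * critC * E0) ^ DIM('a)\<rfloor>"

text \<open>The critical cubes in question are disjoint, have side at least a fixed multiple of
  \<rho> x and lie in a ball of radius E0 \<rho> x, so a volume count bounds their number.\<close>

lemma crit_overlap:
 "finite {q : crit. x : nb q} & card {q : crit. x : nb q} <= overC"
proof -
 define s where "s = \<rho> x / (2 * C0 * critC)"
 have pos: "0 < 2 * C0 * critC" using C0 critC_pos by simp
 have s: "0 < s" unfolding s_def using \<rho>_pos[of x] pos by simp
 have R: "E0 * \<rho> x = (2 * C0 * critC * E0) * s" using C0 critC_pos by (simp add: s_def)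
 have "finite {q : crit. x : nb q} & card {q : crit. x : nb q} <= nat \<lfloor>bvol TYPE('a) (E0 * \<rho> x) / s ^ DIM('a)\<rfloor>"
 proof (rule cubes_packing)
  show "{q : crit. x : nb q} <= cubes" using crit_cubes by blast
  show "disjoint_family_on cub {q : crit. x : nb q}"
   using disjoint_family_stop unfolding crit_def by (rule disjoint_family_on_mono[rotated]) auto
  show "0 < s ^ DIM('a)" using s by simp
  show "0 <= E0 * \<rho> x" using E0_ge1 \<rho>_pos[of x] by simp
  fix q assume q: "q : {q : crit. x : nb q}"
  hence qc: "q : crit" and xq: "x : nb q" by auto
  show "cub q <= ball x (E0 * \<rho> x)"
  proof
   fix y assume y: "y : cub q"
   show "y : ball x (E0 * \<rho> x)" using crit_near[OF qc y xq] by (simp add: dist_commute)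
  qed
  obtain y where y: "y : cub q" using cub_ne[OF crit_cubes[OF qc]] by blast
  have "\<rho> x <= 2 * C0 * \<rho> y" by (rule crit_near[OF qc y xq])
  also have "... <= 2 * C0 * (critC * side q)" using crit_ge[OF qc y] C0 by (intro mult_left_mono) auto
  finally have "s <= side q" unfolding s_def using pos by (subst pos_divide_le_eq) (auto simp: mult_ac)
  thus "s ^ DIM('a) <= vol q" unfolding vol_def using s by (intro power_mono) auto
 qed
 moreover have "bvol TYPE('a) (E0 * \<rho> x) / s ^ DIM('a) = unit_ball_vol (real DIM('a)) * (2 * C0 * critC * E0) ^ DIM('a)"
  unfolding R using s by (simp add: bvol_def power_mult_distrib)
 ultimately show ?thesis unfolding overC_def by simp
qed

lemma \<rho>_ball_ge:
 assumes "0 < R"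
 shows "\<exists>m>0. \<forall>y\<in>ball 0 R. m <= \<rho> y"
proof -
 define m where "m = inverse C0 * \<rho> 0 * (1 + R / \<rho> 0) powr (- N0)"
 have "0 < 1 + R / \<rho> 0" using assms \<rho>_pos[of 0] by (simp add: add_pos_pos)
 hence m: "0 < m" unfolding m_def using C0 \<rho>_pos[of 0] by (intro mult_pos_pos) auto
 have "m <= \<rho> y" if "y : ball 0 R" for y
 proof -
  have "(1 + R / \<rho> 0) powr (- N0) <= (1 + dist 0 y / \<rho> 0) powr (- N0)"
   using that N0 \<rho>_pos[of 0] by (intro powr_mono2') (auto intro!: divide_right_mono add_pos_nonneg)
  hence "m <= inverse C0 * \<rho> 0 * (1 + dist 0 y / \<rho> 0) powr (- N0)" unfolding m_def using C0 \<rho>_pos[of 0] by (intro mult_left_mono) auto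
  thus "m <= \<rho> y" using \<rho>_lower[of 0 y] by linarith
 qed
 thus ?thesis using m by blast
qed

text \<open>Makes the decomposition of f along critical cubes a finite sum, on which linearity of T
  suffices. On a ball \<rho> is bounded above and below, so volumes can be counted again.\<close>

lemma crit_finite: "finite {q : crit. cub q Int ball 0 R ~= {}}"
proof (cases "0 < R")
 case False
 hence "ball (0::'a) R = {}" by simp
 hence e: "{q : crit. cub q Int ball 0 R ~= {}} = {}" by (simp only: Int_empty_right simp_thms Collect_conj_eq) simp
 show ?thesis unfolding e by simp
next
 case R: True
 obtain m where m: "0 < m" "!!y. y : ball 0 R ==> m <= \<rho> y" using \<rho>_ball_ge[OF R] by blast
 define L where "L = C0 * (\<rho> 0 + R)"
 have y: "\<rho> y <= L" if "y : ball 0 R" for y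
 proof -
  have "C0 * (\<rho> 0 + dist 0 y) <= L" unfolding L_def using that C0 by (intro mult_left_mono) auto
  thus "\<rho> y <= L" using \<rho>_le[of y 0] by linarith
 qed
 have "finite {q : crit. cub q Int ball 0 R ~= {}} &
   card {q : crit. cub q Int ball 0 R ~= {}} <= nat \<lfloor>bvol TYPE('a) (R + L) / (m / critC) ^ DIM('a)\<rfloor>"
 proof (rule cubes_packing)
  show "{q : crit. cub q Int ball 0 R ~= {}} <= cubes" using crit_cubes by blast
  show "disjoint_family_on cub {q : crit. cub q Int ball 0 R ~= {}}"
   using disjoint_family_stop unfolding crit_def by (rule disjoint_family_on_mono[rotated]) auto
  show "0 < (m / critC) ^ DIM('a)" using m(1) critC_pos by simp
  show "0 <= R + L" unfolding L_def using R C0 \<rho>_pos[of 0] by simp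
  fix q assume "q : {q : crit. cub q Int ball 0 R ~= {}}"
  then obtain y0 where q: "q : crit" and y0: "y0 : cub q" "y0 : ball 0 R" by blast
  show "cub q <= ball 0 (R + L)"
  proof
   fix u assume u: "u : cub q"
   have "dist y0 u < \<rho> y0" by (rule crit_near(1)[OF q y0(1)]) (use u cub_subset_nb in blast)
   hence "dist 0 u < R + L" using y[OF y0(2)] y0(2) dist_triangle[of 0 u y0] by simp
   thus "u : ball 0 (R + L)" by simp
  qed
  have "m <= critC * side q" using m(2)[OF y0(2)] crit_ge[OF q y0(1)] by linarith
  hence "m / critC <= side q" using critC_pos by (simp add: field_simps)
  thus "(m / critC) ^ DIM('a) <= vol q" unfolding vol_def using m(1) critC_pos by (intro power_mono) auto
 qed
 thus ?thesis by blast
qed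

text \<open>A ball around x0 of radius r <= side q that contains y has at most critical radius,
  since E0 side q <= \<rho> y <= E0 \<rho> x0. For a larger ball only the weight on
  \<open>nb q\<close> counts, and the ball around y of radius \<open>nbr q\<close>, at most critical
  by the choice of \<open>kap\<close>, contains \<open>nb q\<close> at a bounded ratio of
  volumes.\<close>

lemma MA_le_M_loc:
 assumes A: "young_function A" and w: "w : lmeas" and q: "q : crit" and y: "y : cub q"
 shows "MA A (%x. w x * indicator (nb q) x) y
  <= en ((real DIM('a) * (2 * real DIM('a) + 1) + 1) ^ DIM('a)) * M_loc \<rho> A w y"
proof (rule MA_leI)
 define m where "m = real DIM('a) * (2 * real DIM('a) + 1) + 1"
 have m1: "1 <= m" unfolding m_def by simp
 have m: "1 <= m ^ DIM('a)" using m1 by simp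
 have mle: "B <= en (m ^ DIM('a)) * B" for B using mult_right_mono[of 1 "en (m ^ DIM('a))" B] m by simp
 fix x0 r assume r: "0 < r" "y : ball x0 r"
 have wz: "\<bar>w x * indicator (nb q) x\<bar> <= \<bar>w x\<bar>" for x by (simp add: indicator_def)
 have "luxemburg A (ball x0 r) (%x. w x * indicator (nb q) x) <= en (m ^ DIM('a)) * M_loc \<rho> A w y"
 proof (cases "r <= side q")
  case True
  have "side q <= \<rho> y" using crit_le(2)[OF q y] mult_right_mono[OF E0_ge1 less_imp_le[OF side_pos[of q]]] by linarith
  hence "\<rho> y <= E0 * \<rho> x0" using r(2) True by (intro \<rho>_near) (simp add: dist_commute)
  hence "E0 * side q <= E0 * \<rho> x0" using crit_le(2)[OF q y] by linarith
  hence "r <= \<rho> x0" using True E0_ge1 by simp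
  have "luxemburg A (ball x0 r) (%x. w x * indicator (nb q) x) <= en 1 * luxemburg A (ball x0 r) w"
   by (rule lux_compare[OF A emeasure_ball_pos[OF r(1)] emeasure_ball_pos[OF r(1)]]) (use w wz in auto)
  also have "... <= M_loc \<rho> A w y" unfolding M_loc_def using r \<open>r <= \<rho> x0\<close> by (simp, intro SUP_upper2[of "(x0, r)"]) auto
  also have "... <= en (m ^ DIM('a)) * M_loc \<rho> A w y" by (rule mle)
  finally show ?thesis .
 next
  case False
  have "nbr q = m * side q" by (simp add: nbr_def m_def)
  also have "... <= m * r" using False m1 by (intro mult_left_mono) auto
  finally have nr: "nbr q <= m * r" .
  have le: "\<mu> (ball y (nbr q)) <= en (m ^ DIM('a)) * \<mu> (ball x0 r)"
  proof -
   have "\<mu> (ball y (nbr q)) <= \<mu> (ball y (m * r))" using nr by (intro emeasure_mono) auto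
   also have "... = en (m ^ DIM('a)) * \<mu> (ball x0 r)" using r(1) m1 m unfolding emeasure_ball_bvol[OF less_imp_le[OF r(1)]]
    by (subst emeasure_ball_bvol) (auto simp: bvol_scale ennreal_mult')
   finally show ?thesis .
  qed
  have "luxemburg A (ball x0 r) (%x. w x * indicator (nb q) x) <= en (m ^ DIM('a)) * luxemburg A (ball y (nbr q)) w"
  proof (rule lux_compare[OF A emeasure_ball_pos[OF r(1)] emeasure_ball_pos[OF nbr_pos] m le])
   show "x : ball y (nbr q) & \<bar>w x * indicator (nb q) x\<bar> <= \<bar>w x\<bar>" if "w x * indicator (nb q) x ~= 0" for x
    using that nbr_ball(1)[OF y, of x] wz[of x] by (auto split: split_indicator_asm)
  qed (use w in auto)
  also have "... <= en (m ^ DIM('a)) * M_loc \<rho> A w y" unfolding M_loc_def using crit_le(1)[OF q y] nbr_pos[of q]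
   by (intro mult_left_mono SUP_upper2[of "(y, nbr q)"]) auto
  finally show ?thesis .
 qed
 thus "luxemburg A (ball x0 r) (%x. w x * indicator (nb q) x)
   <= en ((real DIM('a) * (2 * real DIM('a) + 1) + 1) ^ DIM('a)) * M_loc \<rho> A w y" unfolding m_def .
qed

end

subsection \<open>Kernel operators\<close>

lemma AE_lborel_sections:
 fixes P :: "'a::euclidean_space \<times> 'b::euclidean_space => bool"
 assumes "AE z in lborel. P z"
 shows "AE x. AE y. P (x, y)" "AE y. AE x. P (x, y)"
proof -
 obtain N where N: "{z : space lborel. \<not> P z} <= N" "N : sets lborel" "emeasure lborel N = 0"
  by (rule AE_E[OF assms]) (rule that)
 have "AE z in lborel. z ~: N" by (rule AE_I[of _ _ N]) (use N in auto)
 hence "AE z in (lborel :: 'a measure) \<Otimes>\<^sub>M (lborel :: 'b measure). z ~: N" unfolding lborel_prod .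
 from lborel_pair.AE_pair[OF this] have a: "AE x in lborel. AE y in lborel. (x, y) ~: N" .
 have "{z : space (lborel \<Otimes>\<^sub>M lborel). (fst z, snd z) ~: N} : sets (lborel \<Otimes>\<^sub>M lborel)"
 proof -
  have "{z : space ((lborel :: 'a measure) \<Otimes>\<^sub>M (lborel :: 'b measure)). (fst z, snd z) ~: N} = - N"
   unfolding lborel_prod by auto
  moreover have "- N : sets lborel" using sets.compl_sets[OF N(2)] by (simp add: Compl_eq_Diff_UNIV)
  ultimately show ?thesis unfolding lborel_prod by simp
 qed
 with lborel_pair.AE_commute[of "%x y. (x, y) ~: N"] a have b: "AE y in lborel. AE x in lborel. (x, y) ~: N" by blast
 have e: "P z" if "z ~: N" for z using that N(1) by auto
 have "AE x in lborel. AE y. P (x, y)" using a by eventually_elim (rule AE_completion, use e in auto)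
 thus "AE x. AE y. P (x, y)" by (rule AE_completion)
 have "AE y in lborel. AE x. P (x, y)" using b by eventually_elim (rule AE_completion, use e in auto)
 thus "AE y. AE x. P (x, y)" by (rule AE_completion)
qed

text \<open>Lebesgue measure on the product type is the completion of the product of the Borel
  measures, not the product of the completed factors, so the usual Fubini theorems do not apply to a
  Lebesgue measurable kernel. They are applied to a Borel version, which agrees with the kernel
  almost everywhere on almost every section.\<close>

lemma borel_version:
 fixes H :: "'a::euclidean_space \<times> 'b::euclidean_space => ennreal"
 assumes "H : lmeas"
 obtains H' where "H' : borel_measurable borel"
  "AE x. AE y. H (x, y) = H' (x, y)" "AE y. AE x. H (x, y) = H' (x, y)"
proof -
 obtain H' where H': "H' : borel_measurable lborel" "AE z in lborel. H z = H' z" using completion_ex_borel_measurable[OF assms] by blast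
 show thesis by (rule that[OF _ AE_lborel_sections[OF H'(2)]]) (use H'(1) in simp)
qed

lemma lebesgue_measurable_AE:
 fixes f :: "'a::euclidean_space => 'b::topological_space"
 assumes f: "f : lmeas" and ae: "AE x. f x = g x"
 shows "g : lmeas"
proof (rule measurableI)
 fix A :: "'b set" assume A: "A : sets borel"
 obtain N where N: "N : null_sets lebesgue" "!!x. x ~: N ==> f x = g x" using ae unfolding completion.AE_iff_null_sets by auto
 have "f -` A : sets lebesgue" using measurable_sets[OF f A] by simp
 moreover have "g -` A Int N : sets lebesgue" by (rule completion.complete[OF _ N(1)]) auto
 moreover have "g -` A Int space lebesgue = (f -` A - N) Un (g -` A Int N)" using N(2) by auto
 ultimately show "g -` A Int space lebesgue : sets lebesgue" using null_setsD2[OF N(1)] by (metis sets.Diff sets.Un)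
qed simp

lemma section_measurable:
 fixes H :: "'a::euclidean_space \<times> 'b::euclidean_space => ennreal"
 assumes "H : lmeas"
 shows "AE y. (%x. H (x, y)) : lmeas"
proof -
 obtain H' where H': "H' : borel_measurable borel" "AE y. AE x. H (x, y) = H' (x, y)" by (rule borel_version[OF assms]) (rule that)
 from H'(2) show ?thesis
 proof eventually_elim
  fix y assume ae: "AE x. H (x, y) = H' (x, y)"
  have "(%x. (x, y)) : borel \<rightarrow>\<^sub>M borel" by (intro borel_measurable_continuous_onI continuous_intros)
  hence "(%x. H' (x, y)) : borel_measurable borel" using H'(1) by (rule measurable_compose)
  hence m: "(%x. H' (x, y)) : lmeas" by (simp add: measurable_completion)
  show "(%x. H (x, y)) : lmeas" by (rule lebesgue_measurable_AE[OF m]) (use ae in \<open>eventually_elim, simp\<close>)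
 qed
qed

lemma nn_integral_lebesgue_commute:
 fixes H :: "'a::euclidean_space \<times> 'b::euclidean_space => ennreal"
 assumes H: "H : lmeas" and u: "u : lmeas" and v: "v : lmeas"
 shows "(\<integral>x. (\<integral>y. H (x, y) * v y) * u x) = (\<integral>y. v y * (\<integral>x. H (x, y) * u x))"
proof -
 obtain H' where H'[measurable]: "H' : borel_measurable borel"
  and ae: "AE x. AE y. H (x, y) = H' (x, y)" "AE y. AE x. H (x, y) = H' (x, y)" by (rule borel_version[OF H]) (rule that)
 obtain u' where u'[measurable]: "u' : borel_measurable lborel" and "AE x in lborel. u x = u' x"
  using completion_ex_borel_measurable[OF u] by blast
 hence aeu: "AE x. u x = u' x" by (intro AE_completion)
 obtain v' where v'[measurable]: "v' : borel_measurable lborel" and "AE x in lborel. v x = v' x"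
  using completion_ex_borel_measurable[OF v] by blast
 hence aev: "AE x. v x = v' x" by (intro AE_completion)
 have H'p: "H' : borel_measurable (lborel \<Otimes>\<^sub>M lborel)" by (simp add: lborel_prod)
 have sec: "(%x. H' (x, y)) : borel_measurable lborel" "(%y. H' (x, y)) : borel_measurable lborel" for x y
  by (auto intro!: measurable_compose[OF _ H'] borel_measurable_continuous_onI continuous_intros)
 have "(\<integral>x. (\<integral>y. H (x, y) * v y) * u x)
   = (\<integral>x. (\<integral>y. H' (x, y) * v' y) * u' x)"
 proof (rule nn_integral_cong_AE, use ae(1) aeu in eventually_elim)
  fix x assume x: "AE y. H (x, y) = H' (x, y)" "u x = u' x"
  have "(\<integral>y. H (x, y) * v y) = (\<integral>y. H' (x, y) * v' y)" by (rule nn_integral_cong_AE, use x(1) aev in eventually_elim) simp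
  thus "(\<integral>y. H (x, y) * v y) * u x = (\<integral>y. H' (x, y) * v' y) * u' x" using x(2) by simp
 qed
 also have "... = (\<integral>\<^sup>+x. (\<integral>\<^sup>+y. H' (x, y) * v' y * u' x \<partial>lborel) \<partial>lborel)"
  unfolding nn_integral_completion by (subst nn_integral_multc[OF borel_measurable_times_ennreal[OF sec(2) v']]) (rule refl)
 also have "... = (\<integral>\<^sup>+y. (\<integral>\<^sup>+x. H' (x, y) * v' y * u' x \<partial>lborel) \<partial>lborel)"
 proof (rule lborel_pair.Fubini'[symmetric])
  have "(%z. H' z * v' (snd z) * u' (fst z)) : borel_measurable (lborel \<Otimes>\<^sub>M lborel)"
   by (intro borel_measurable_times_ennreal H'p measurable_compose[OF measurable_snd v'] measurable_compose[OF measurable_fst u'])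
  thus "(%(x, y). H' (x, y) * v' y * u' x) : borel_measurable (lborel \<Otimes>\<^sub>M lborel)" by (simp add: case_prod_beta')
 qed
 also have "... = (\<integral>y. v' y * (\<integral>x. H' (x, y) * u' x))" unfolding nn_integral_completion
  by (subst nn_integral_cmult[OF borel_measurable_times_ennreal[OF sec(1) u'], symmetric]) (simp only: mult_ac)
 also have "... = (\<integral>y. v y * (\<integral>x. H (x, y) * u x))"
 proof (rule nn_integral_cong_AE, use ae(2) aev in eventually_elim)
  fix y assume y: "AE x. H (x, y) = H' (x, y)" "v y = v' y"
  have "(\<integral>x. H' (x, y) * u' x) = (\<integral>x. H (x, y) * u x)" by (rule nn_integral_cong_AE, use y(1) aeu in eventually_elim) simp
  thus "v' y * (\<integral>x. H' (x, y) * u' x) = v y * (\<integral>x. H (x, y) * u x)" using y(2) by simp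
 qed
 finally show ?thesis .
qed

text \<open>Exchanging the integrations collects kernel and weight in one integral over x for fixed
  y. Hypothesis \<open>G\<close> may presuppose that the section at y is measurable, as almost every
  section is.\<close>

lemma kernel_operator_bound:
 fixes k :: "'a::euclidean_space => 'a => complex" and w :: "'a => real"
 assumes k: "(%(x, y). k x y) : lmeas" and g: "g : lmeas"
  and S: "S : sets lebesgue" and w: "w : lmeas" "!!x. 0 <= w x"
  and F: "AE x. x : S --> lintegrable (%y. k x y * g y) & F x = (LINT y. k x y * g y)"
  and G: "!!y. g y ~= 0 ==> (%x. cmod (k x y)) : lmeas ==>
    (\<integral>x\<in>S. en (cmod (k x y) * w x)) <= en C * G y"
  and Gm: "G : lmeas"
 shows "(\<integral>x\<in>S. en (cmod (F x) * w x)) <= en C * (\<integral>y. enorm (g y) * G y)"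
proof -
 define H where "H z = enorm (case z of (x, y) => k x y)" for z
 have H: "H : lmeas"     using bm_enorm[OF k] unfolding H_def[abs_def] .
 define u where "u x = en (w x) * indicator S x" for x
 have u: "u : lmeas" unfolding u_def[abs_def] by (rule bm_on[OF bm_ennreal[OF w(1)] S])
 have gm: "(%y. enorm (g y)) : lmeas" by (rule bm_enorm[OF g])
 have "(\<integral>x\<in>S. en (cmod (F x) * w x)) <= (\<integral>x. (\<integral>y. H (x, y) * enorm (g y)) * u x)"
 proof (rule nn_integral_mono_AE, use F in eventually_elim)
  fix x assume Fx: "x : S --> lintegrable (%y. k x y * g y) & F x = (LINT y. k x y * g y)"
  show "en (cmod (F x) * w x) * indicator S x <= (\<integral>y. H (x, y) * enorm (g y)) * u x"
  proof (cases "x : S")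
   case True
   hence i: "lintegrable (%y. k x y * g y)" and e: "F x = (LINT y. k x y * g y)" using Fx by auto
   have "enorm (F x) <= (\<integral>y. H (x, y) * enorm (g y))"
    unfolding e using integral_norm_bound_ennreal[OF i] by (simp add: H_def norm_mult ennreal_mult)
   thus ?thesis using True w(2)[of x] by (simp add: u_def ennreal_mult mult_right_mono)
  qed (simp add: u_def)
 qed
 also have "... = (\<integral>y. enorm (g y) * (\<integral>x. H (x, y) * u x))" by (rule nn_integral_lebesgue_commute[OF H u gm])
 also have "... <= (\<integral>y. en C * (enorm (g y) * G y))"
 proof (rule nn_integral_mono_AE, use section_measurable[OF H] in eventually_elim)
  fix y assume m: "(%x. H (x, y)) : lmeas"
  have "(%x. enn2real (H (x, y))) : lmeas" by (rule borel_measurable_enn2real[OF m])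
  hence m': "(%x. cmod (k x y)) : lmeas" by (simp add: H_def)
  show "enorm (g y) * (\<integral>x. H (x, y) * u x) <= en C * (enorm (g y) * G y)"
  proof (cases "g y = 0")
   case False
   have "(\<integral>x. H (x, y) * u x) = (\<integral>x\<in>S. en (cmod (k x y) * w x))"
    using w(2) by (intro nn_integral_cong) (auto simp: H_def u_def ennreal_mult mult_ac)
   also have "... <= en C * G y" by (rule G[OF False m'])
   finally show ?thesis by (subst mult.left_commute) (rule mult_left_mono, simp_all)
  qed simp
 qed
 also have "... = en C * (\<integral>y. enorm (g y) * G y)" by (rule nn_integral_cmult) (intro borel_measurable_times_ennreal gm Gm)
 finally show ?thesis .
qed

text \<open>The annuli may overlap, as only an upper bound by the sum is wanted. Their common centre
  y escapes them but is a null set.\<close>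

lemma annuli_geometric:
 fixes F :: "'a::euclidean_space => ennreal"
 assumes F: "F : lmeas" and S: "!!x. x : S ==> x ~= y ==> \<exists>j. x : annulus y (R j)"
  and le: "!!j. (\<integral>x\<in>annulus y (R j). F x) <= en (c * z ^ j) * M"
  and c: "0 <= c" and z: "0 <= z" "z < 1"
 shows "(\<integral>x\<in>S. F x) <= en (c / (1 - z)) * M"
proof -
 have am: "annulus y r : sets lebesgue" for r
 proof -
  have "annulus y r = ball y (2 * r) - cball y r" by (auto simp: annulus_def)
  thus ?thesis by auto
 qed
 have "AE x. x ~= y" by (rule AE_I[of _ _ "{y}"]) auto
 hence "(\<integral>x\<in>S. F x) <= (\<integral>x. (\<Sum>j. F x * indicator (annulus y (R j)) x))"
 proof (intro nn_integral_mono_AE, eventually_elim)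
  fix x assume "x ~= y"
  show "F x * indicator S x <= (\<Sum>j. F x * indicator (annulus y (R j)) x)"
  proof (cases "x : S")
   case True
   then obtain j where "x : annulus y (R j)" using S \<open>x ~= y\<close> by blast
   hence "F x * indicator S x <= (\<Sum>i\<in>{j}. F x * indicator (annulus y (R i)) x)" using True by simp
   also have "... <= (\<Sum>j. F x * indicator (annulus y (R j)) x)" by (rule sum_le_suminf) auto
   finally show ?thesis .
  qed simp
 qed
 also have "... = (\<Sum>j. \<integral>\<^sup>+x\<in>annulus y (R j). F x \<partial>lebesgue)"
  by (rule nn_integral_suminf) (use F am in \<open>intro borel_measurable_times_ennreal borel_measurable_indicator; simp\<close>)
 also have "... <= (\<Sum>j. en (c * z ^ j) * M)" by (intro suminf_le le) auto
 also have "... = (\<Sum>j. en (c * z ^ j)) * M" by simp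
 also have "(\<Sum>j. en (c * z ^ j)) = en (c / (1 - z))"
 proof (rule suminf_ennreal_eq)
  have "(%j. c * z ^ j) sums (c * (1 / (1 - z)))" by (intro sums_mult geometric_sums) (use z in auto)
  thus "(%j. c * z ^ j) sums (c / (1 - z))" by simp
 qed (use c z in auto)
 finally show ?thesis .
qed

text \<open>The annuli are open with ratio 2 of the radii; a step of 3 / 2 instead of 2 makes
  consecutive ones overlap, so that no sphere is missed.\<close>

lemma annuli_cover_out:
 assumes "0 < r" "r < dist y x"
 shows "\<exists>j. x : annulus y (r * (3 / 2) ^ j)"
proof -
 have "\<exists>n. dist y x / r < (3 / 2) ^ n" by (rule real_arch_pow) simp
 hence ex: "\<exists>n. dist y x <= r * (3 / 2) ^ n" using assms by (auto simp: field_simps intro: less_imp_le)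
 define n where "n = (LEAST n. dist y x <= r * (3 / 2) ^ n)"
 have n: "dist y x <= r * (3 / 2) ^ n" unfolding n_def using ex by (rule LeastI_ex)
 with assms have "n ~= 0" by (intro notI) simp
 then obtain j where j: "n = Suc j" using not0_implies_Suc by blast
 have "r * (3 / 2) ^ j < dist y x" using not_less_Least[of j "%n. dist y x <= r * (3 / 2) ^ n"] j by (simp add: n_def[symmetric])
 moreover have "0 < r * (3 / 2) ^ j" using assms by simp
 ultimately show ?thesis using n unfolding j annulus_def by (intro exI[of _ j]) simp
qed

lemma annuli_cover_in:
 assumes "x ~= y" "dist y x < 2 * r"
 shows "\<exists>j. x : annulus y (r * (2 / 3) ^ j)"
proof -
 have "0 < dist y x" using assms(1) by simp
 hence r: "0 < r" using assms(2) by linarith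
 have "\<exists>n. (2 / 3) ^ n < dist y x / r" by (rule real_arch_pow_inv) (use assms r in auto)
 hence ex: "\<exists>n. r * (2 / 3) ^ n < dist y x" using r by (auto simp: field_simps)
 define n where "n = (LEAST n. r * (2 / 3) ^ n < dist y x)"
 have n: "r * (2 / 3) ^ n < dist y x" unfolding n_def using ex by (rule LeastI_ex)
 have "dist y x < 2 * (r * (2 / 3) ^ n)"
 proof (cases n)
  case 0
  thus ?thesis using assms by simp
 next
  case (Suc j)
  hence "dist y x <= r * (2 / 3) ^ j" using not_less_Least[of j "%n. r * (2 / 3) ^ n < dist y x"] by (simp add: n_def[symmetric])
  moreover have "0 < r * (2 / 3) ^ j" using r by simp
  ultimately show ?thesis unfolding Suc by simp
 qed
 thus ?thesis using n by (auto simp: annulus_def)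
qed

lemma linear_operator_sum:
 assumes lin: "linear_operator_on bcs T" and "finite I" "!!i. i : I ==> f i : bcs"
 shows "AE x. T (%z. \<Sum>i\<in>I. f i z) x = (\<Sum>i\<in>I. T (f i) x)" using assms(2,3)
proof (induction I rule: finite_induct)
 case empty
 have "AE x. T (%z. c * f z) x = c * T f x" if "f : bcs" for c f using lin that unfolding linear_operator_on_def by blast
 from this[OF bcs_zero, of 0] show ?case by simp
next
 case (insert i I)
 have "AE x. T (%z. f i z + (\<Sum>i\<in>I. f i z)) x = T (f i) x + T (%z. \<Sum>i\<in>I. f i z) x"
 proof -
  have "f i : bcs" "(%x. \<Sum>i\<in>I. f i x) : bcs" using insert.prems by (auto intro!: bcs_sum insert.hyps)
  moreover have "AE x. T (%z. f z + g z) x = T f x + T g x"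
   if "f : bcs" "g : bcs" for f g using lin that unfolding linear_operator_on_def by blast
  ultimately show ?thesis by simp
 qed
 moreover have "AE x. T (%z. \<Sum>i\<in>I. f i z) x = (\<Sum>i\<in>I. T (f i) x)" using insert by auto
 ultimately show ?case by eventually_elim (use insert.hyps in simp)
qed

(* The common form of the kernel hypotheses: t^s' for B in (i), by Hoelder's inequality, and B(t) = t
  in (ii). *)
definition annular :: "(real => real) => ('a::euclidean_space => 'a => complex) => 'a => real => real => bool" where
 "annular B k y R c \<longleftrightarrow> (\<forall>w. (%x. cmod (k x y)) : lmeas --> w : lmeas --> (\<forall>x. 0 <= w x) -->
   (\<integral>x\<in>annulus y R. en (cmod (k x y) * w x)) <= en c * luxemburg B (ball y (2 * R)) w)"

context critical
begin

lemma M_theta_lebesgue: "M_theta \<rho> \<theta> B w : lmeas"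
proof -
 have "M_theta \<rho> \<theta> B w = (%x. SUP i\<in>{i\<in>{(x0, r). 0 < r}. x : (case i of (x0, r) => ball x0 r)}.
   (case i of (x0, r0) => ennreal ((1 + r0 / \<rho> x0) powr (- \<theta>)) * luxemburg B (ball x0 r0) w))"
  unfolding M_theta_def[abs_def] by (intro ext SUP_cong) auto
 also have "... : borel_measurable borel" by (rule borel_measurable_SUP_open) auto
 finally show ?thesis by (intro measurable_completion) simp
qed

lemma M_loc_lebesgue: "M_loc \<rho> B w : lmeas"
proof -
 have "M_loc \<rho> B w = (%x. SUP i\<in>{i\<in>{(x0, r). 0 < r & r <= \<rho> x0}. x : (case i of (x0, r) => ball x0 r)}.
   (case i of (x0, r0) => luxemburg B (ball x0 r0) w))" unfolding M_loc_def[abs_def] by (intro ext SUP_cong) auto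
 also have "... : borel_measurable borel" by (rule borel_measurable_SUP_open) auto
 finally show ?thesis by (intro measurable_completion) simp
qed

lemma lux_le_M_theta:
 assumes "0 < r" "y : ball x0 r"
 shows "luxemburg B (ball x0 r) w <= en ((1 + r / \<rho> x0) powr \<theta>) * M_theta \<rho> \<theta> B w y"
proof -
 have a: "0 < 1 + r / \<rho> x0" using assms \<rho>_pos[of x0] by (simp add: add_pos_pos)
 have "luxemburg B (ball x0 r) w = en ((1 + r / \<rho> x0) powr \<theta>) * (en ((1 + r / \<rho> x0) powr (- \<theta>)) * luxemburg B (ball x0 r) w)"
  unfolding mult.assoc[symmetric] using a by (subst ennreal_mult'[symmetric]) (auto simp: powr_minus)
 also have "... <= en ((1 + r / \<rho> x0) powr \<theta>) * M_theta \<rho> \<theta> B w y"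
  unfolding M_theta_def using assms by (intro mult_left_mono SUP_upper2[of "(x0, r)"]) auto
 finally show ?thesis .
qed

lemma annular_M_theta:
 assumes an: "annular B k y R c" and R: "0 < R" and c: "0 <= c"
  and m: "(%x. cmod (k x y)) : lmeas" "w : lmeas" "\<forall>x. 0 <= w x"
  and le: "c * (1 + 2 * R / \<rho> y) powr \<theta> <= c'"
 shows "(\<integral>x\<in>annulus y R. en (cmod (k x y) * w x)) <= en c' * M_theta \<rho> \<theta> B w y"
proof -
 have "(\<integral>x\<in>annulus y R. en (cmod (k x y) * w x)) <= en c * luxemburg B (ball y (2 * R)) w" using an m unfolding annular_def by blast
 also have "... <= en c * (en ((1 + 2 * R / \<rho> y) powr \<theta>) * M_theta \<rho> \<theta> B w y)"
  using R by (intro mult_left_mono lux_le_M_theta) auto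
 also have "... = en (c * (1 + 2 * R / \<rho> y) powr \<theta>) * M_theta \<rho> \<theta> B w y" using c by (simp add: ennreal_mult mult.assoc)
 also have "... <= en c' * M_theta \<rho> \<theta> B w y" by (intro mult_right_mono ennreal_leI le) simp
 finally show ?thesis .
qed

text \<open>Of the decay exponent \<theta> + 1, the part \<theta> compensates the weight in
  \<open>M_theta\<close>, and the remaining 1 gives the geometric factor, because \<rho> y / R <=
  critC (2 / 3)^j on the j-th annulus.\<close>

lemma kernel_size_sum:
 assumes C: "0 <= C" and \<theta>: "0 <= \<theta>" and q: "q : crit" and y: "y : cub q"
  and k: "(%x. cmod (k x y)) : lmeas" and w: "w : lmeas" "\<forall>x. 0 <= w x"
  and size: "!!R. 0 < R ==> annular B k y R (C * (1 + R / \<rho> y) powr (- (\<theta> + 1)))"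
 shows "(\<integral>x\<in>- nb q. en (cmod (k x y) * w x)) <= en (3 * (C * 2 powr \<theta> * critC)) * M_theta \<rho> \<theta> B w y"
proof -
 define s where "s = side q"
 have s: "0 < s" by (simp add: s_def)
 have ry: "0 < \<rho> y" by (rule \<rho>_pos)
 have "(\<integral>x\<in>- nb q. en (cmod (k x y) * w x)) <= en ((C * 2 powr \<theta> * critC) / (1 - 2 / 3)) * M_theta \<rho> \<theta> B w y"
 proof (rule annuli_geometric[OF bm_ennreal[OF borel_measurable_times[OF k w(1)]]])
  fix x assume "x : - nb q"
  hence "2 * real DIM('a) * s <= dist y x" unfolding s_def by (intro dist_not_nb_ge[OF y]) simp
  moreover have "2 * s <= 2 * real DIM('a) * s" using s DIM_ge1[where 'a='a] by (intro mult_right_mono) auto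
  ultimately have "s < dist y x" using s by linarith
  thus "\<exists>j. x : annulus y (s * (3 / 2) ^ j)" using s by (intro annuli_cover_out) auto
 next
  fix j :: nat
  define R where "R = s * (3 / 2) ^ j"
  have R: "0 < R" unfolding R_def using s by simp
  define b where "b = 1 + R / \<rho> y"
  have b: "1 <= b" "R / \<rho> y <= b" unfolding b_def using R ry by auto
  have "\<rho> y / R <= critC * (2 / 3) ^ j" using crit_ge[OF q y] s R by (simp add: R_def s_def field_simps power_divide)
  moreover have "1 / b <= \<rho> y / R" using b R ry by (simp add: field_simps)
  ultimately have bj: "1 / b <= critC * (2 / 3) ^ j" by linarith
  have "(1 + 2 * R / \<rho> y) powr \<theta> <= (2 * b) powr \<theta>" using R ry \<theta> by (intro powr_mono2) (auto simp: b_def)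
  hence p: "(1 + 2 * R / \<rho> y) powr \<theta> <= 2 powr \<theta> * b powr \<theta>" by (simp add: powr_mult)
  have "b powr (- (\<theta> + 1)) * b powr \<theta> = b powr (- 1)" unfolding powr_add[symmetric] by simp
  hence e: "b powr (- (\<theta> + 1)) * b powr \<theta> = 1 / b" using b by (simp add: powr_minus divide_inverse)
  have "C * b powr (- (\<theta> + 1)) * (1 + 2 * R / \<rho> y) powr \<theta> <= C * b powr (- (\<theta> + 1)) * (2 powr \<theta> * b powr \<theta>)"
   using C by (intro mult_left_mono p) auto
  also have "... = C * 2 powr \<theta> * (b powr (- (\<theta> + 1)) * b powr \<theta>)" by (simp only: mult_ac)
  also have "... <= C * 2 powr \<theta> * (critC * (2 / 3) ^ j)" unfolding e using C bj by (intro mult_left_mono) auto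
  finally have le: "C * b powr (- (\<theta> + 1)) * (1 + 2 * R / \<rho> y) powr \<theta> <= C * 2 powr \<theta> * critC * (2 / 3) ^ j"
   by (simp only: mult.assoc)
  show "(\<integral>x\<in>annulus y (s * (3 / 2) ^ j). en (cmod (k x y) * w x))
    <= en (C * 2 powr \<theta> * critC * (2 / 3) ^ j) * M_theta \<rho> \<theta> B w y"
   using annular_M_theta[OF size[OF R, folded b_def] R _ k w le] C unfolding R_def by simp
 qed (use C critC_pos in auto)
 thus ?thesis by (simp add: mult_ac)
qed

text \<open>All radii are at most \<open>nbr q\<close> <= \<rho> y, so for balls of radius 2 R the
  weight in \<open>M_theta\<close> costs at most 3^\<theta>, and the factor (R / \<rho> y)^\<delta>
  is geometric in j.\<close>

lemma kernel_diff_sum: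
 assumes C: "0 <= C" and \<theta>: "0 <= \<theta>" and \<delta>: "0 < \<delta>" and q: "q : crit" and y: "y : cub q"
  and k: "(%x. cmod (k x y)) : lmeas" and w: "w : lmeas" "\<forall>x. 0 <= w x"
  and size: "!!R. 0 < R ==> R <= \<rho> y ==> annular B k y R (C * (R / \<rho> y) powr \<delta>)"
 shows "(\<integral>x\<in>nb q. en (cmod (k x y) * w x)) <= en (C * 3 powr \<theta> / (1 - (2 / 3) powr \<delta>)) * M_theta \<rho> \<theta> B w y"
proof -
 define s where "s = nbr q"
 have s: "0 < s" "s <= \<rho> y" unfolding s_def by (rule nbr_pos, rule crit_le(1)[OF q y])
 have ry: "0 < \<rho> y" by (rule \<rho>_pos)
 show ?thesis
 proof (rule annuli_geometric[OF bm_ennreal[OF borel_measurable_times[OF k w(1)]]])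
  fix x assume x: "x : nb q" "x ~= y"
  have "dist y x < 2 * s" using nbr_ball(1)[OF y x(1)] s(1) unfolding s_def by simp
  thus "\<exists>j. x : annulus y (s * (2 / 3) ^ j)" by (rule annuli_cover_in[OF x(2)])
 next
  fix j :: nat
  define R where "R = s * (2 / 3) ^ j"
  have "(2 / 3) ^ j <= (1::real)" by (rule power_le_one) auto
  hence R: "0 < R" "R <= s" unfolding R_def using s(1) by (auto intro: mult_left_le)
  have R2: "R <= \<rho> y" using R s by linarith
  have "(1 + 2 * R / \<rho> y) powr \<theta> <= 3 powr \<theta>" using R(1) R2 ry \<theta> by (intro powr_mono2) (auto simp: field_simps)
  moreover have "(R / \<rho> y) powr \<delta> <= ((2 / 3) powr \<delta>) ^ j"
  proof -
   have "R / \<rho> y <= (2 / 3) ^ j" unfolding R_def using s ry by (simp add: field_simps)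
   hence "(R / \<rho> y) powr \<delta> <= ((2 / 3) ^ j) powr \<delta>" using R(1) ry \<delta> by (intro powr_mono2) auto
   also have "... = ((2 / 3) powr \<delta>) ^ j" by (simp add: powr_realpow[symmetric] powr_powr mult.commute)
   finally show ?thesis .
  qed
  ultimately have "C * (R / \<rho> y) powr \<delta> * (1 + 2 * R / \<rho> y) powr \<theta> <= C * ((2 / 3) powr \<delta>) ^ j * 3 powr \<theta>"
   using C by (intro mult_mono) auto
  from annular_M_theta[OF size[OF R(1) R2] R(1) _ k w this]
  show "(\<integral>x\<in>annulus y (s * (2 / 3) ^ j). en (cmod (k x y) * w x))
    <= en (C * 3 powr \<theta> * ((2 / 3) powr \<delta>) ^ j) * M_theta \<rho> \<theta> B w y" using C unfolding R_def by (simp add: mult_ac)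
 next
  have "(2 / 3) powr \<delta> < (2 / 3) powr 0" using \<delta> by (intro powr_less_mono') auto
  thus "(2 / 3) powr \<delta> < 1" by simp
 qed (use C in auto)
qed

end

subsection \<open>From T0 to T\<close>

context critical
begin

lemma crit_partition:
 assumes "z : ball 0 R"
 shows "(\<Sum>q\<in>{q : crit. cub q Int ball 0 R ~= {}}. c * indicator (cub q) z) = (c :: 'b::semiring_1)"
proof -
 let ?Q = "{q : crit. cub q Int ball 0 R ~= {}}"
 obtain q where q: "q : crit" "z : cub q" using crit_cover by blast
 have qQ: "q : ?Q" using q assms by blast
 have "(\<Sum>q'\<in>?Q. c * indicator (cub q') z) = (\<Sum>q'\<in>?Q. if q' = q then c else 0)"
 proof (rule sum.cong[OF refl])
  fix q' assume "q' : ?Q"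
  hence "z : cub q' ==> q' = q" using crit_disjoint[OF _ q(1) _ q(2)] by blast
  thus "c * indicator (cub q') z = (if q' = q then c else 0)" using q(2) by (cases "q' = q") (auto simp: indicator_def)
 qed
 thus ?thesis using qQ crit_finite[of R] by (simp add: sum.delta)
qed

text \<open>Weak-type bounds cannot be added over the pieces \<open>fq q\<close>, but at a given
  point T0 is involved only for the at most n pieces whose neighbourhood contains it. If |T f| > t
  there, then either T0 of such a piece exceeds t / (3 n), or the remaining contributions, which
  have integrable bounds, add up to at least t / 3.\<close>

lemma weak_type_assembly:
 fixes T T0 :: "('a => complex) => ('a => complex)" and K K0 :: "'a => 'a => complex"
 assumes lin: "linear_operator_on bcs T" and ker: "has_kernel T K"
  and cz: "cz_op T0 K0 C2 CK \<gamma>" and K0m: "(%(x, y). K0 x y) : lmeas"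
  and diff: "diff_integral_operator T K T0 K0"
  and AD: "A : D_class p" and p: "1 < p" and \<theta>: "0 <= \<theta>"
  and size: "!!N. 0 < N ==> \<exists>C\<ge>0. \<forall>y R. 0 < R --> annular B K y R (C * (1 + R / \<rho> y) powr (- N))"
  and kdiff: "\<exists>C\<ge>0. \<exists>\<delta>>0. \<forall>y R. 0 < R --> R <= \<rho> y --> annular B (%x y. K x y - K0 x y) y R (C * (R / \<rho> y) powr \<delta>)"
 shows "weak_bound T (%w x. M_loc \<rho> A w x + M_theta \<rho> \<theta> B w x)"
proof -
 have Y: "young_function A" using AD by (rule D_class_young)
 interpret T0: cz_op T0 K0 C2 CK \<gamma> by (rule cz)
 have \<theta>1: "0 < \<theta> + 1" using \<theta> by simp
 obtain C1 where C1: "0 <= C1" "!!y R. 0 < R ==> annular B K y R (C1 * (1 + R / \<rho> y) powr (- (\<theta> + 1)))" using size[OF \<theta>1] by blast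
 obtain Cd \<delta> where Cd: "0 <= Cd" "0 < \<delta>"
  "!!y R. 0 < R ==> R <= \<rho> y ==> annular B (%x y. K x y - K0 x y) y R (Cd * (R / \<rho> y) powr \<delta>)" using kdiff by blast
 obtain CW where CW: "0 <= CW" "!!f v l. f : bcs ==> v : lmeas ==> (\<forall>x. 0 <= v x) ==> 0 < l ==>
   (\<integral>x\<in>{x. l < cmod (T0 f x)}. en (v x)) <= en (CW / l) * (\<integral>x. enorm (f x) * MA A v x)"
  using T0.weak_type_MA[OF AD p] unfolding weak_bound_def by blast
 define c1 where "c1 = 3 * (C1 * 2 powr \<theta> * critC)"
 define c2 where "c2 = Cd * 3 powr \<theta> / (1 - (2 / 3) powr \<delta>)"
 define mC where "mC = (real DIM('a) * (2 * real DIM('a) + 1) + 1) ^ DIM('a)"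
 define n where "n = real overC + 1"
 have c1: "0 <= c1" unfolding c1_def using C1(1) critC_pos by simp
 have "(2 / 3) powr \<delta> < (2 / 3) powr (0::real)" using Cd(2) by (intro powr_less_mono') auto
 hence c2: "0 <= c2" unfolding c2_def using Cd(1) by simp
 have mC: "0 <= mC" unfolding mC_def by simp
 have n: "0 < n" unfolding n_def by simp
 define C where "C = 3 * c1 + 3 * c2 + 3 * n * CW * mC"
 have Km: "(%(x, y). K x y) : lmeas" using ker unfolding has_kernel_def by blast
 have KKm: "(%(x, y). K x y - K0 x y) : lmeas" using borel_measurable_diff[OF Km K0m] by (simp add: case_prod_beta')
 have Tm: "T g : lmeas" if "g : bcs" for g using lin that unfolding linear_operator_on_def by blast
 have Trep: "AE x. x ~: fun_support g -->
    lintegrable (%y. K x y * g y) & T g x = (LINT y. K x y * g y)" if "g : bcs" for g using ker that unfolding has_kernel_def by blast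
 have Drep: "AE x. lintegrable (%y. (K x y - K0 x y) * g y) &
    T g x - T0 g x = (LINT y. (K x y - K0 x y) * g y)" if "g : bcs" for g using diff that unfolding diff_integral_operator_def by blast
 have main: "(\<integral>x\<in>{x. t < cmod (T f x)}. en (w x))
    <= en (C / t) * (\<integral>x. enorm (f x) * (M_loc \<rho> A w x + M_theta \<rho> \<theta> B w x))"
  if w: "w : lmeas" and w0: "\<forall>x. 0 <= w x" and f: "f : bcs" and t: "0 < t" for w f t
 proof -
  define W where "W x = M_loc \<rho> A w x + M_theta \<rho> \<theta> B w x" for x
  have Wm: "W : lmeas" unfolding W_def[abs_def] by (intro borel_measurable_add M_loc_lebesgue M_theta_lebesgue)
  obtain R where R: "!!x. f x ~= 0 ==> x : ball 0 R" by (rule bcsE[OF f]) (rule that)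
  define Q where "Q = {q : crit. cub q Int ball 0 R ~= {}}"
  have Qf: "finite Q" unfolding Q_def by (rule crit_finite)
  have Qc: "q : crit" if "q : Q" for q using that by (simp add: Q_def)
  define fq where "fq q x = f x * indicator (cub q) x" for q x
  have fq: "fq q : bcs" for q unfolding fq_def[abs_def] by (intro bcs_indicator f cub_lebesgue)
  have fqm: "(%x. enorm (fq q x)) : lmeas" for q by (rule bm_enorm[OF bcs_measurable[OF fq]])
  have fsum: "(%z. \<Sum>q\<in>Q. fq q z) = f"
  proof
   fix z show "(\<Sum>q\<in>Q. fq q z) = f z" unfolding fq_def Q_def using crit_partition[of z R "f z"] R[of z] by (cases "f z = 0") simp_all
  qed
  have fsumn: "(\<Sum>q\<in>Q. enorm (fq q z)) = enorm (f z)" for z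
  proof -
   have "enorm (fq q z) = enorm (f z) * indicator (cub q) z" for q by (simp add: fq_def indicator_def)
   moreover have "(\<Sum>q\<in>Q. enorm (f z) * indicator (cub q) z) = enorm (f z)"
    unfolding Q_def using crit_partition[of z R "enorm (f z)"] R[of z] by (cases "f z = 0") simp_all
   ultimately show ?thesis by simp
  qed
  define s where "s = t / (3 * n)"
  have s: "0 < s" unfolding s_def using t n by simp
  \<comment> \<open>The three contributions of a piece: T off the neighbourhood, governed by the
    size of K; T - T0 on it, governed by K - K0; and T0 against the weight restricted to it.\<close>
  define h1 where "h1 q x = en (cmod (T (fq q) x) * w x) * indicator (- nb q) x" for q x
  define h2 where "h2 q x = en (cmod (T (fq q) x - T0 (fq q) x) * w x) * indicator (nb q) x" for q x
  define h3 where "h3 q x = en (w x * indicator (nb q) x) * indicator {x. s < cmod (T0 (fq q) x)} x" for q x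
  have nbc: "- nb q : sets lebesgue" for q :: "int \<times> 'a" using sets.compl_sets[OF nb_lebesgue[of q]] by (simp add: Compl_eq_Diff_UNIV)
  have hm: "h1 q : lmeas" "h2 q : lmeas" "h3 q : lmeas" for q
  proof -
   note m = Tm[OF fq, of q] T0.T_measurable[OF fq, of q]
   have "(%x. en (cmod (T (fq q) x) * w x)) : lmeas" by (rule bm_ennreal[OF borel_measurable_times[OF bm_cmod[OF m(1)] w]])
   thus "h1 q : lmeas" unfolding h1_def[abs_def] by (rule borel_measurable_times_ennreal) (rule borel_measurable_indicator[OF nbc])
   have "(%x. en (cmod (T (fq q) x - T0 (fq q) x) * w x)) : lmeas"
    by (rule bm_ennreal[OF borel_measurable_times[OF bm_cmod[OF borel_measurable_diff[OF m]] w]])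
   thus "h2 q : lmeas" unfolding h2_def[abs_def] by (rule borel_measurable_times_ennreal) (rule borel_measurable_indicator[OF nb_lebesgue])
   have "(%x. en (w x * indicator (nb q) x)) : lmeas"
    by (rule bm_ennreal[OF borel_measurable_times[OF w borel_measurable_indicator[OF nb_lebesgue]]])
   thus "h3 q : lmeas" unfolding h3_def[abs_def]
    by (rule borel_measurable_times_ennreal) (rule borel_measurable_indicator[OF T0.T_level_measurable[OF fq]])
  qed
  define I where "I q = (\<integral>x. enorm (fq q x) * W x)" for q
  have i1: "(\<integral>x. h1 q x) <= en c1 * I q" if q: "q : Q" for q
  proof -
   have "(\<integral>x. h1 q x) <= en c1 * (\<integral>y. enorm (fq q y) * M_theta \<rho> \<theta> B w y)" unfolding h1_def
   proof (rule kernel_operator_bound[OF Km bcs_measurable[OF fq] nbc w w0[rule_format] _ _ M_theta_lebesgue])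
    show "AE x. x : - nb q --> lintegrable (%y. K x y * fq q y) & T (fq q) x = (LINT y. K x y * fq q y)" using Trep[OF fq[of q]]
    proof eventually_elim
     fix x assume a: "x ~: fun_support (fq q) --> lintegrable (%y. K x y * fq q y) & T (fq q) x = (LINT y. K x y * fq q y)"
     have "x ~: fun_support (fq q)" if "x : - nb q"
     proof -
      have "{x. fq q x ~= 0} <= cub q" by (auto simp: fq_def split: split_indicator_asm)
      from closure_mono[OF this] show ?thesis unfolding fun_support_def using not_nb_not_closure[of x q] that by blast
     qed
     thus "x : - nb q --> lintegrable (%y. K x y * fq q y) & T (fq q) x = (LINT y. K x y * fq q y)" using a by blast
    qed
    fix y assume y: "fq q y ~= 0" and m: "(%x. cmod (K x y)) : lmeas"
    have yq: "y : cub q" using y by (simp add: fq_def indicator_def split: if_splits)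
    show "(\<integral>x\<in>- nb q. en (cmod (K x y) * w x)) <= en c1 * M_theta \<rho> \<theta> B w y"
     unfolding c1_def by (rule kernel_size_sum[OF C1(1) \<theta> Qc[OF q] yq m w w0 C1(2)])
   qed
   also have "... <= en c1 * I q" unfolding I_def W_def by (intro mult_left_mono nn_integral_mono) auto
   finally show ?thesis .
  qed
  have i2: "(\<integral>x. h2 q x) <= en c2 * I q" if q: "q : Q" for q
  proof -
   have "(\<integral>x. h2 q x) <= en c2 * (\<integral>y. enorm (fq q y) * M_theta \<rho> \<theta> B w y)" unfolding h2_def
   proof (rule kernel_operator_bound[OF KKm bcs_measurable[OF fq] nb_lebesgue w w0[rule_format] _ _ M_theta_lebesgue])
    show "AE x. x : nb q --> lintegrable (%y. (K x y - K0 x y) * fq q y) &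
      T (fq q) x - T0 (fq q) x = (LINT y. (K x y - K0 x y) * fq q y)" using Drep[OF fq[of q]] by eventually_elim blast
    fix y assume y: "fq q y ~= 0" and m: "(%x. cmod (K x y - K0 x y)) : lmeas"
    have yq: "y : cub q" using y by (simp add: fq_def indicator_def split: if_splits)
    show "(\<integral>x\<in>nb q. en (cmod (K x y - K0 x y) * w x)) <= en c2 * M_theta \<rho> \<theta> B w y"
     unfolding c2_def by (rule kernel_diff_sum[OF Cd(1) \<theta> Cd(2) Qc[OF q] yq m w w0 Cd(3)])
   qed
   also have "... <= en c2 * I q" unfolding I_def W_def by (intro mult_left_mono nn_integral_mono) auto
   finally show ?thesis .
  qed
  have i3: "(\<integral>x. h3 q x) <= en (CW / s * mC) * I q" if q: "q : Q" for q
  proof -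
   have wi: "(%x. w x * indicator (nb q) x) : lmeas" by (rule borel_measurable_times[OF w borel_measurable_indicator[OF nb_lebesgue]])
   have wi0: "\<forall>x. 0 <= w x * indicator (nb q) x" using w0 by simp
   have "(\<integral>x. h3 q x) <= en (CW / s) * (\<integral>x. enorm (fq q x) * MA A (%x. w x * indicator (nb q) x) x)"
    unfolding h3_def by (rule CW(2)[OF fq wi wi0 s])
   also have "... <= en (CW / s) * (\<integral>x. en mC * (enorm (fq q x) * W x))"
   proof (rule mult_left_mono, rule nn_integral_mono)
    fix x
    show "enorm (fq q x) * MA A (%x. w x * indicator (nb q) x) x <= en mC * (enorm (fq q x) * W x)"
    proof (cases "x : cub q")
     case True
     have "MA A (%x. w x * indicator (nb q) x) x <= en mC * M_loc \<rho> A w x" unfolding mC_def by (rule MA_le_M_loc[OF Y w Qc[OF q] True])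
     also have "... <= en mC * W x" unfolding W_def by (intro mult_left_mono) auto
     finally show ?thesis by (subst mult.left_commute) (rule mult_left_mono, simp_all)
    qed (simp add: fq_def)
   qed simp
   also have "... = en (CW / s) * (en mC * I q)" unfolding I_def by (subst nn_integral_cmult) (auto intro!: borel_measurable_times_ennreal fqm Wm)
   also have "... = en (CW / s * mC) * I q" by (subst ennreal_mult''[OF mC]) (simp only: mult.assoc)
   finally show ?thesis .
  qed
  have "AE x. T f x = (\<Sum>q\<in>Q. T (fq q) x)" using linear_operator_sum[OF lin Qf, of fq] fq unfolding fsum by blast
  hence "(\<integral>x\<in>{x. t < cmod (T f x)}. en (w x))
    <= (\<integral>x. (\<Sum>q\<in>Q. en (3 / t) * h1 q x + en (3 / t) * h2 q x + h3 q x))"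
  proof (intro nn_integral_mono_AE, eventually_elim)
   fix x assume Tx: "T f x = (\<Sum>q\<in>Q. T (fq q) x)"
   show "en (w x) * indicator {x. t < cmod (T f x)} x <= (\<Sum>q\<in>Q. en (3 / t) * h1 q x + en (3 / t) * h2 q x + h3 q x)"
   proof (cases "t < cmod (T f x)")
    case True
    show ?thesis
    proof (cases "\<exists>q\<in>Q. x : nb q & s < cmod (T0 (fq q) x)")
     case True
     then obtain q where q: "q : Q" "x : nb q" "s < cmod (T0 (fq q) x)" by blast
     have "en (w x) * indicator {x. t < cmod (T f x)} x <= h3 q x" using q by (simp add: h3_def indicator_def)
     also have "... <= en (3 / t) * h1 q x + en (3 / t) * h2 q x + h3 q x" by simp
     also have "... <= (\<Sum>q\<in>Q. en (3 / t) * h1 q x + en (3 / t) * h2 q x + h3 q x)" by (rule member_le_sum[OF q(1) _ Qf]) simp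
     finally show ?thesis .
    next
     case False
     define a where "a q = cmod (T (fq q) x) * indicator (- nb q) x + cmod (T (fq q) x - T0 (fq q) x) * indicator (nb q) x" for q
     have "cmod (T (fq q) x) <= a q + s * indicator {q : crit. x : nb q} q" if q: "q : Q" for q
     proof (cases "x : nb q")
      case True
      have "cmod (T (fq q) x) <= cmod (T (fq q) x - T0 (fq q) x) + cmod (T0 (fq q) x)"
       using norm_triangle_ineq[of "T (fq q) x - T0 (fq q) x" "T0 (fq q) x"] by simp
      moreover have "cmod (T0 (fq q) x) <= s" using False q True by auto
      ultimately show ?thesis using True Qc[OF q] by (simp add: a_def)
     qed (simp add: a_def)
     hence "(\<Sum>q\<in>Q. cmod (T (fq q) x)) <= (\<Sum>q\<in>Q. a q + s * indicator {q : crit. x : nb q} q)" by (rule sum_mono)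
     also have "... = (\<Sum>q\<in>Q. a q) + s * (\<Sum>q\<in>Q. indicator {q : crit. x : nb q} q)"
      by (simp add: sum.distrib sum_distrib_left)
     also have "(\<Sum>q\<in>Q. indicator {q : crit. x : nb q} q) = real (card (Q Int {q : crit. x : nb q}))"
      using Qf by (simp add: indicator_def sum.If_cases Int_def)
     also have "... <= real (card {q : crit. x : nb q})" using crit_overlap[of x] by (intro of_nat_mono card_mono) auto
     also have "... <= n" using crit_overlap[of x] unfolding n_def by linarith
     finally have "(\<Sum>q\<in>Q. cmod (T (fq q) x)) <= (\<Sum>q\<in>Q. a q) + s * n" using s by simp
     moreover have "cmod (T f x) <= (\<Sum>q\<in>Q. cmod (T (fq q) x))" unfolding Tx by (rule norm_sum)
     moreover have "s * n = t / 3" unfolding s_def using n by simp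
     ultimately have "t / 3 <= (\<Sum>q\<in>Q. a q)" using \<open>t < cmod (T f x)\<close> t by linarith
     hence "1 <= 3 / t * (\<Sum>q\<in>Q. a q)" using t by (simp add: field_simps)
     hence "w x * 1 <= w x * (3 / t * (\<Sum>q\<in>Q. a q))" using w0 by (intro mult_left_mono) auto
     moreover have "w x * (3 / t * (\<Sum>q\<in>Q. a q)) = (\<Sum>q\<in>Q. 3 / t * (a q * w x))"
      unfolding sum_distrib_left by (intro sum.cong refl) simp
     ultimately have "en (w x) <= en (\<Sum>q\<in>Q. 3 / t * (a q * w x))" by (intro ennreal_leI) linarith
     also have "... = (\<Sum>q\<in>Q. en (3 / t * (a q * w x)))" using t w0 by (intro sum_ennreal[symmetric]) (simp add: a_def)
     also have "... <= (\<Sum>q\<in>Q. en (3 / t) * h1 q x + en (3 / t) * h2 q x + h3 q x)"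
     proof (rule sum_mono)
      fix q assume "q : Q"
      have "0 <= 3 / t" using t by simp
      note em = ennreal_mult'[OF this]
      have "en (3 / t * (a q * w x)) = en (3 / t) * h1 q x + en (3 / t) * h2 q x"
       unfolding em by (cases "x : nb q") (simp_all add: a_def h1_def h2_def)
      thus "en (3 / t * (a q * w x)) <= en (3 / t) * h1 q x + en (3 / t) * h2 q x + h3 q x" by simp
     qed
     finally show ?thesis using True by simp
    qed
   qed simp
  qed
  also have "... = (\<Sum>q\<in>Q. en (3 / t) * (\<integral>x. h1 q x) + en (3 / t) * (\<integral>x. h2 q x) + (\<integral>x. h3 q x))"
  proof -
   have c: "(%x. en (3 / t) * h q x) : lmeas" if "h q : lmeas" for h :: "int \<times> 'a => 'a => ennreal" and q
    by (rule borel_measurable_times_ennreal[OF borel_measurable_const that])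
   have "(\<integral>x. en (3 / t) * h1 q x + en (3 / t) * h2 q x + h3 q x) =
    en (3 / t) * (\<integral>x. h1 q x) + en (3 / t) * (\<integral>x. h2 q x) + (\<integral>x. h3 q x)" for q
    using nn_integral_add[OF borel_measurable_add[OF c[OF hm(1)] c[OF hm(2)]] hm(3)]
     nn_integral_add[OF c[OF hm(1)] c[OF hm(2)]] nn_integral_cmult[OF hm(1)] nn_integral_cmult[OF hm(2)] by simp
   moreover have "(%x. en (3 / t) * h1 q x + en (3 / t) * h2 q x + h3 q x) : lmeas" for q by (intro borel_measurable_add c hm)
   ultimately show ?thesis by (subst nn_integral_sum) auto
  qed
  also have "... <= (\<Sum>q\<in>Q. en (C / t) * I q)"
  proof (rule sum_mono)
   fix q assume q: "q : Q"
   have "en (3 / t) * (\<integral>x. h1 q x) + en (3 / t) * (\<integral>x. h2 q x) + (\<integral>x. h3 q x)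
    <= en (3 / t) * (en c1 * I q) + en (3 / t) * (en c2 * I q) + en (CW / s * mC) * I q" by (intro add_mono mult_left_mono i1 i2 i3 q) auto
   also have "... = en (3 / t * c1 + 3 / t * c2 + CW / s * mC) * I q"
   proof -
    have nn: "0 <= 3 / t" "0 <= 3 / t * c1" "0 <= 3 / t * c2" "0 <= CW / s * mC" "0 <= 3 / t * c1 + 3 / t * c2" using t c1 c2 CW(1) s mC by simp_all
    show ?thesis unfolding ennreal_plus[OF nn(5,4)] ennreal_plus[OF nn(2,3)] ennreal_mult'[OF nn(1)] distrib_right mult.assoc ..
   qed
   also have "3 / t * c1 + 3 / t * c2 + CW / s * mC = C / t" unfolding C_def s_def using t n by (simp add: field_simps)
   finally show "en (3 / t) * (\<integral>x. h1 q x) + en (3 / t) * (\<integral>x. h2 q x) + (\<integral>x. h3 q x) <= en (C / t) * I q" .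
  qed
  also have "... = en (C / t) * (\<integral>x. (\<Sum>q\<in>Q. enorm (fq q x) * W x))" unfolding sum_distrib_left[symmetric] I_def
   by (subst nn_integral_sum) (auto intro!: borel_measurable_times_ennreal fqm Wm)
  also have "... = en (C / t) * (\<integral>x. enorm (f x) * W x)" unfolding sum_distrib_right[symmetric] fsumn ..
  finally show ?thesis unfolding W_def .
 qed
 moreover have "0 <= C" unfolding C_def using c1 c2 mC n CW(1) by simp
 ultimately show ?thesis unfolding weak_bound_def by blast
qed

end

section \<open>The kernel conditions of (i) and (ii) as conditions on annuli\<close>

lemma young_powr:
 assumes p: "1 <= p"
 shows "young_function (%t. t powr p)"
proof -
 have "convex_on {0..} (%t::real. t powr p)"
 proof (rule convex_onI)
  fix t x y :: real assume t: "0 < t" "t < 1" and xy: "x : {0..}" "y : {0..}"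
  have sm: "u powr p <= u" if "0 < u" "u < 1" for u :: real using powr_mono'[of 1 p u] that p by simp
  show "((1 - t) *\<^sub>R x + t *\<^sub>R y) powr p <= (1 - t) * x powr p + t * y powr p"
  proof (cases "x = 0 \<or> y = 0")
   case True
   thus ?thesis using sm[of t] sm[of "1 - t"] t p by (auto simp: powr_mult mult_right_mono)
  next
   case False
   hence "x : {0<..}" "y : {0<..}" using xy by auto
   thus ?thesis using convex_onD[OF powr_convex[OF p], of t x y] t by simp
  qed
 qed simp
 moreover have "continuous_on {0..} (%t::real. t powr p)" using p by (intro continuous_on_powr' continuous_intros) auto
 moreover have "mono_on {0..} (%t::real. t powr p)" using p by (intro mono_onI powr_mono2) auto
 ultimately show ?thesis using p by (simp add: young_function_def)
qed

text \<open>In D_2 the exponent is 1, so the integrand reduces to t powr (-p), which is integrable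
  at infinity as p > 1.\<close>

lemma powr_D_class:
 assumes p: "1 < p"
 shows "(%t. t powr p) : D_class 2"
proof -
 have "(\<integral>t\<in>{1..}. epowr (en t / en (t powr p)) (conj_exp 2 - 1) * en (1 / t))
  = (\<integral>\<^sup>+t. en (t powr (- p)) * indicator {1..} t \<partial>lborel)" unfolding nn_integral_completion
 proof (rule nn_integral_cong)
  fix t :: real
  show "epowr (en t / en (t powr p)) (conj_exp 2 - 1) * en (1 / t) * indicator {1..} t
    = en (t powr (- p)) * indicator {1..} t"
  proof (cases "1 <= t")
   case True
   have "en t / en (t powr p) = en (t / t powr p)" using True by (simp add: divide_ennreal)
   hence "epowr (en t / en (t powr p)) (conj_exp 2 - 1) = en (t / t powr p)" using True by (simp add: epowr_def conj_exp_def)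
   hence "epowr (en t / en (t powr p)) (conj_exp 2 - 1) * en (1 / t) = en (t / t powr p * (1 / t))" using True by (subst ennreal_mult') simp_all
   also have "t / t powr p * (1 / t) = t powr (- p)" using True by (simp add: powr_minus divide_inverse)
   finally show ?thesis by simp
  qed simp
 qed
 also have "... = en (0 - (1 powr (1 - p) / (1 - p)))"
 proof (rule nn_integral_FTC_atLeast[where F = "%t. t powr (1 - p) / (1 - p)" and T = 0])
  show "((%t. t powr (1 - p) / (1 - p)) \<longlongrightarrow> 0) at_top" using tendsto_neg_powr[of "1 - p" "%t. t" at_top] p
   by (intro tendsto_divide_zero) (auto simp: filterlim_ident)
  show "((%t. t powr (1 - p) / (1 - p)) has_real_derivative x powr (- p)) (at x)" if "1 <= x" for x
   using that p by (auto intro!: derivative_eq_intros)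
 qed auto
 also have "... < \<infinity>" by simp
 finally show ?thesis unfolding D_class_def using young_powr[of p] p by (auto intro!: exI[of _ 1])
qed

lemma epowr_leD:
 assumes "epowr X (1 / s) <= en a" "0 < s" "0 <= a"
 shows "X <= en (a powr s)"
proof -
 have X: "X ~= \<infinity>" using assms(1) by (auto simp: epowr_def top_unique split: if_splits)
 hence "enn2real X powr (1 / s) <= a" using assms(1,3) by (simp add: epowr_def)
 hence "(enn2real X powr (1 / s)) powr s <= a powr s" using assms(2) by (intro powr_mono2) auto
 hence "enn2real X <= a powr s" using assms(2) by (simp add: powr_powr)
 thus ?thesis using X by (metis ennreal_enn2real_if ennreal_leI infinity_ennreal_def)
qed

text \<open>The Luxemburg norm for t^r is the normalised L^r norm, so this is Hoelder's inequality.
  It is proved at every admissible l by Young's inequality for the two normalised factors, whose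
  contributions are at most 1 / s and 1 / r.\<close>

lemma holder_luxemburg:
 fixes k w :: "'a::euclidean_space => real"
 assumes s: "1 < s" and a: "0 < a" and b: "0 < b" "\<mu> F = en b" and F: "F : sets lebesgue"
  and E: "E <= F" "E : sets lebesgue"
  and k: "k : lmeas" "!!x. 0 <= k x" and w: "w : lmeas" "!!x. 0 <= w x"
  and le: "(\<integral>x\<in>E. en (k x powr s)) <= en (a powr s)"
 shows "(\<integral>x\<in>E. en (k x * w x))
  <= en (a * b powr (1 / conj_exp s)) * luxemburg (%t. t powr conj_exp s) F w"
proof -
 define r where "r = conj_exp s"
 have r: "1 < r" "1 / s + 1 / r = 1" unfolding r_def conj_exp_def using s by (auto simp: field_simps)
 define c where "c = a * b powr (1 / r)"
 have c: "0 < c" unfolding c_def using a b by simp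
 have Fp: "0 < \<mu> F" "\<mu> F < \<infinity>" using b by auto
 have "en (1 / c) * (\<integral>x\<in>E. en (k x * w x)) <= luxemburg (%t. t powr r) F w"
 proof (rule lux_ge[OF Fp])
  fix l assume "lux_adm (%t. t powr r) F w l"
  hence l: "0 < l" and adm: "(\<integral>x\<in>F. en ((w x / l) powr r)) <= en b" unfolding lux_adm_def using b w(2) by auto
  have pw: "k x * w x <= c * l * (k x powr s / (a powr s * s) + (w x / l) powr r / (b * r))" for x
  proof -
   have "(k x / a) * ((w x / l) / b powr (1 / r)) <= (k x / a) powr s / s + ((w x / l) / b powr (1 / r)) powr r / r"
    by (rule Youngs_inequality) (use s r k w l a in auto)
   also have "... = k x powr s / (a powr s * s) + (w x / l) powr r / (b * r)"
    using k(2)[of x] w(2)[of x] l a b r by (simp add: powr_divide powr_mult powr_powr)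
   finally have "c * l * ((k x / a) * ((w x / l) / b powr (1 / r))) <= c * l * (k x powr s / (a powr s * s) + (w x / l) powr r / (b * r))"
    using c l by (intro mult_left_mono) auto
   moreover have "c * l * ((k x / a) * ((w x / l) / b powr (1 / r))) = k x * w x" unfolding c_def using a l b by simp
   ultimately show ?thesis by simp
  qed
  define k1 where "k1 x = en (k x powr s)" for x
  define w1 where "w1 x = en ((w x / l) powr r)" for x
  have k1: "k1 : lmeas" unfolding k1_def[abs_def] by (rule bm_ennreal[OF powr_real_measurable[OF k(1) borel_measurable_const]])
  have w1: "w1 : lmeas" unfolding w1_def[abs_def]
   by (rule bm_ennreal[OF powr_real_measurable[OF borel_measurable_divide[OF w(1) borel_measurable_const] borel_measurable_const]])
  have "(\<integral>x\<in>E. en (k x * w x))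
    <= (\<integral>x. en (c * l / (a powr s * s)) * (k1 x * indicator E x) + en (c * l / (b * r)) * (w1 x * indicator F x))"
  proof (rule nn_integral_mono)
   fix x
   show "en (k x * w x) * indicator E x
    <= en (c * l / (a powr s * s)) * (k1 x * indicator E x) + en (c * l / (b * r)) * (w1 x * indicator F x)"
   proof (cases "x : E")
    case True
    have nn: "0 <= c * l / (a powr s * s)" "0 <= c * l / (b * r)" using c l a b s r by auto
    have "en (k x * w x) <= en (c * l / (a powr s * s) * k x powr s + c * l / (b * r) * (w x / l) powr r)"
     using pw[of x] by (intro ennreal_leI) (simp add: algebra_simps)
    also have "... = en (c * l / (a powr s * s)) * k1 x + en (c * l / (b * r)) * w1 x"
     unfolding k1_def w1_def using nn by (subst ennreal_plus) (auto simp only: ennreal_mult powr_ge_zero intro!: mult_nonneg_nonneg)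
    finally show ?thesis using True E(1) by (simp add: indicator_def subset_iff)
   qed simp
  qed
  also have "... = en (c * l / (a powr s * s)) * (\<integral>x\<in>E. k1 x) + en (c * l / (b * r)) * (\<integral>x\<in>F. w1 x)"
  proof -
   have m: "(%x. k1 x * indicator E x) : lmeas" "(%x. w1 x * indicator F x) : lmeas" by (rule bm_on[OF k1 E(2)],
      rule bm_on[OF w1 F])
   show ?thesis
    unfolding nn_integral_add[OF borel_measurable_times_ennreal[OF borel_measurable_const m(1)] borel_measurable_times_ennreal[OF borel_measurable_const m(2)]]
     nn_integral_cmult[OF m(1)] nn_integral_cmult[OF m(2)] ..
  qed
  also have "... <= en (c * l / (a powr s * s)) * en (a powr s) + en (c * l / (b * r)) * en b"
   using le adm unfolding k1_def w1_def by (intro add_mono mult_left_mono) auto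
  also have "... = en (c * l / s + c * l / r)" using a b c l s r by (simp add: ennreal_mult'[symmetric] ennreal_plus[symmetric] del: ennreal_plus)
  also have "c * l / s + c * l / r = c * l" using r(2) by (metis (no_types) distrib_left mult.right_neutral times_divide_eq_right)
  finally have "(\<integral>x\<in>E. en (k x * w x)) <= en c * en l" using c by (simp add: ennreal_mult')
  thus "en (1 / c) * (\<integral>x\<in>E. en (k x * w x)) <= en l" by (subst ennreal_inv_le[OF c])
 qed
 thus ?thesis by (subst (asm) ennreal_inv_le[OF c]) (simp add: c_def r_def)
qed

lemma annulus_lebesgue: "annulus y R : sets lebesgue" and annulus_ball: "annulus y R <= ball y (2 * R)"
 for y :: "'a::euclidean_space"
proof -
 have "annulus y R = ball y (2 * R) - cball y R" by (auto simp: annulus_def)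
 thus "annulus y R : sets lebesgue" by auto
qed (auto simp: annulus_def)

text \<open>The power of R in the kernel bound cancels the volume factor of the ball of radius 2
  R.\<close>

lemma annulus_holder:
 fixes k :: "'a::euclidean_space => 'a => complex"
 assumes s: "1 < s" and R: "0 < R" and c: "0 < c"
  and le: "Ls_norm_on s (annulus y R) (%x. k x y) <= en (R powr (- (real DIM('a) / conj_exp s)) * c)"
 shows "annular (%t. t powr conj_exp s) k y R (bvol TYPE('a) 2 powr (1 / conj_exp s) * c)" unfolding annular_def
proof (intro allI impI)
 fix w :: "'a => real" assume h: "(%x. cmod (k x y)) : lmeas" and w: "w : lmeas" "\<forall>x. 0 <= w x"
 define a where "a = R powr (- (real DIM('a) / conj_exp s)) * c"
 have a: "0 < a" unfolding a_def using R c by simp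
 have b: "0 < bvol TYPE('a) (2 * R)" using R by (intro bvol_pos) simp
 have "(\<integral>x\<in>annulus y R. en (cmod (k x y) powr s)) <= en (a powr s)"
  using le a s unfolding Ls_norm_on_def a_def[symmetric] by (intro epowr_leD) auto
 hence "(\<integral>x\<in>annulus y R. en (cmod (k x y) * w x))
  <= en (a * bvol TYPE('a) (2 * R) powr (1 / conj_exp s)) * luxemburg (%t. t powr conj_exp s) (ball y (2 * R)) w"
  by (intro holder_luxemburg[OF s a b emeasure_ball_bvol _ annulus_ball annulus_lebesgue h _ w(1)]) (use R w(2) in auto)
 also have "a * bvol TYPE('a) (2 * R) powr (1 / conj_exp s) = bvol TYPE('a) 2 powr (1 / conj_exp s) * c"
 proof -
  have "bvol TYPE('a) (2 * R) = R ^ DIM('a) * bvol TYPE('a) 2" using bvol_scale[where 'a='a, of R 2] by (simp add: mult.commute)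
  hence "bvol TYPE('a) (2 * R) powr (1 / conj_exp s) = R powr (real DIM('a) / conj_exp s) * bvol TYPE('a) 2 powr (1 / conj_exp s)"
   using R bvol_pos[where 'a='a, of 2] by (simp add: powr_mult powr_powr flip: powr_realpow)
  thus ?thesis unfolding a_def using R by (simp add: powr_minus field_simps)
 qed
 finally show "(\<integral>x\<in>annulus y R. en (cmod (k x y) * w x))
  <= en (bvol TYPE('a) 2 powr (1 / conj_exp s) * c) * luxemburg (%t. t powr conj_exp s) (ball y (2 * R)) w" .
qed

lemma annulus_pointwise:
 fixes k :: "'a::euclidean_space => 'a => complex"
 assumes R: "0 < R" and c: "0 <= c" and le: "!!x. x : annulus y R ==> cmod (k x y) <= c / R ^ DIM('a)"
 shows "annular (%t. t powr 1) k y R (2 * bvol TYPE('a) 2 * c)" unfolding annular_def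
proof (intro allI impI)
 fix w :: "'a => real" assume w: "w : lmeas" "\<forall>x. 0 <= w x"
 have R2: "0 < 2 * R" using R by simp
 have d: "0 <= c / R ^ DIM('a)" using c R by simp
 have bv: "bvol TYPE('a) (2 * R) = R ^ DIM('a) * bvol TYPE('a) 2" using bvol_scale[where 'a='a, of R 2] by (simp add: mult.commute)
 have wm: "(%x. en \<bar>w x\<bar> * indicator (ball y (2 * R)) x) : lmeas"
  by (rule borel_measurable_times_ennreal[OF bm_ennreal[OF borel_measurable_abs[OF w(1)]] borel_measurable_indicator]) auto
 have "(\<integral>x\<in>annulus y R. en (cmod (k x y) * w x)) <= (\<integral>x. en (c / R ^ DIM('a)) * (en \<bar>w x\<bar> * indicator (ball y (2 * R)) x))"
 proof (rule nn_integral_mono)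
  fix x
  show "en (cmod (k x y) * w x) * indicator (annulus y R) x <= en (c / R ^ DIM('a)) * (en \<bar>w x\<bar> * indicator (ball y (2 * R)) x)"
  proof (cases "x : annulus y R")
   case True
   have "cmod (k x y) * w x <= c / R ^ DIM('a) * \<bar>w x\<bar>" using mult_right_mono[OF le[OF True] w(2)[rule_format, of x]] w(2)[rule_format, of x] by simp
   hence "en (cmod (k x y) * w x) <= en (c / R ^ DIM('a)) * en \<bar>w x\<bar>" by (subst ennreal_mult'[OF d, symmetric]) (rule ennreal_leI)
   thus ?thesis using True annulus_ball[of y R] by (auto simp: indicator_def)
  qed simp
 qed
 also have "... = en (c / R ^ DIM('a)) * (\<integral>x\<in>ball y (2 * R). en \<bar>w x\<bar>)" by (rule nn_integral_cmult[OF wm])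
 also have "... <= en (c / R ^ DIM('a)) * (en (1 + 1 / 1 powr 1)
   * (\<mu> (ball y (2 * R)) * luxemburg (%t. t powr 1) (ball y (2 * R)) w))"
  by (intro mult_left_mono lux_avg young_powr emeasure_ball_pos[OF R2] w(1)) auto
 also have "... = en (c / R ^ DIM('a) * (2 * bvol TYPE('a) (2 * R))) * luxemburg (%t. t powr 1) (ball y (2 * R)) w"
 proof -
  have "1 + 1 / 1 powr 1 = (2::real)" by simp
  moreover have "en (c / R ^ DIM('a) * (2 * bvol TYPE('a) (2 * R))) = en (c / R ^ DIM('a)) * (en 2 * en (bvol TYPE('a) (2 * R)))"
   using d bvol_pos[OF R2, where 'a='a] by (simp only: ennreal_mult' less_imp_le zero_le_numeral)
  ultimately show ?thesis by (simp only: emeasure_ball_bvol[OF less_imp_le[OF R2]] mult.assoc)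
 qed
 also have "c / R ^ DIM('a) * (2 * bvol TYPE('a) (2 * R)) = 2 * bvol TYPE('a) 2 * c" unfolding bv using R by simp
 finally show "(\<integral>x\<in>annulus y R. en (cmod (k x y) * w x))
  <= en (2 * bvol TYPE('a) 2 * c) * luxemburg (%t. t powr 1) (ball y (2 * R)) w" .
qed

lemma bcs_L2: "f : bcs ==> f : L2_functions"
proof -
 assume f: "f : bcs"
 have m: "f : lmeas" by (rule bcs_measurable[OF f])
 have "(%x. (cmod (f x))\<^sup>2) : lmeas" by (rule borel_measurable_power[OF bm_cmod[OF m]])
 hence "lintegrable (%x. (cmod (f x))\<^sup>2)" using bcs_sq_fin[OF f] by (intro integrableI_bounded) auto
 thus ?thesis using m by (simp add: L2_functions_def)
qed

lemma L2_nn_integral: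
 assumes "f : L2_functions"
 shows "(\<integral>x. en ((cmod (f x))\<^sup>2)) = en ((L2_fun_norm f)\<^sup>2)"
proof -
 have "lintegrable (%x. (cmod (f x))\<^sup>2)" using assms by (simp add: L2_functions_def)
 hence "(\<integral>x. en ((cmod (f x))\<^sup>2)) = en (LINT x. (cmod (f x))\<^sup>2)" by (rule nn_integral_eq_integral) simp
 thus ?thesis by (simp add: L2_fun_norm_def)
qed

lemma calderon_zygmund_cz_op:
 assumes "calderon_zygmund T K"
 shows "\<exists>C2 CK \<gamma>. cz_op T K C2 CK \<gamma>"
proof -
 obtain C where C: "!!f. f : L2_functions ==> T f : L2_functions & L2_fun_norm (T f) <= C * L2_fun_norm f"
  using assms unfolding calderon_zygmund_def by blast
 obtain D \<gamma> where \<gamma>: "0 < \<gamma>" "\<gamma> <= 1" and D: "!!x x' y. x ~= y ==> 2 * dist x x' <= dist x y ==>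
   cmod (K x y - K x' y) + cmod (K y x - K y x') <= D * dist x x' powr \<gamma> / dist x y powr (real DIM('a) + \<gamma>)"
  using assms unfolding calderon_zygmund_def cz_kernel_def by blast
 have D': "cmod (K x y - K x' y) <= \<bar>D\<bar> * dist x x' powr \<gamma> / dist x y powr (real DIM('a) + \<gamma>)"
  "cmod (K y x - K y x') <= \<bar>D\<bar> * dist x x' powr \<gamma> / dist x y powr (real DIM('a) + \<gamma>)"
  if "x ~= y" "2 * dist x x' <= dist x y" for x x' y
 proof -
  have "D * dist x x' powr \<gamma> / dist x y powr (real DIM('a) + \<gamma>) <= \<bar>D\<bar> * dist x x' powr \<gamma> / dist x y powr (real DIM('a) + \<gamma>)"
   by (intro divide_right_mono mult_right_mono) auto
  thus "cmod (K x y - K x' y) <= \<bar>D\<bar> * dist x x' powr \<gamma> / dist x y powr (real DIM('a) + \<gamma>)"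
   "cmod (K y x - K y x') <= \<bar>D\<bar> * dist x x' powr \<gamma> / dist x y powr (real DIM('a) + \<gamma>)"
   using D[OF that] norm_ge_zero[of "K x y - K x' y"] norm_ge_zero[of "K y x - K y x'"] by linarith+
 qed
 have "cz_op T K (C\<^sup>2) \<bar>D\<bar> \<gamma>"
 proof
  have "linear_operator_on L2_functions T" using assms unfolding calderon_zygmund_def by blast
  thus "linear_operator_on bcs T" unfolding linear_operator_on_def using bcs_L2 by blast
  show "(\<integral>x. en ((cmod (T f x))\<^sup>2)) <= en (C\<^sup>2) * (\<integral>x. en ((cmod (f x))\<^sup>2))"
   if "f : bcs" for f
  proof -
   have f: "f : L2_functions" by (rule bcs_L2[OF that])
   have "0 <= L2_fun_norm (T f)" by (simp add: L2_fun_norm_def)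
   hence "(L2_fun_norm (T f))\<^sup>2 <= (C * L2_fun_norm f)\<^sup>2" using C[OF f] by (intro power_mono) auto
   thus ?thesis using C[OF f] by (simp add: L2_nn_integral f ennreal_mult'[symmetric] power_mult_distrib)
  qed
  show "AE x. x ~: fun_support g --> lintegrable (%y. K x y * g y) & T g x = (LINT y. K x y * g y)"
   if "g : bcs" for g using assms that unfolding calderon_zygmund_def has_kernel_def by blast
 qed (use \<gamma> D' in auto)
 thus ?thesis by blast
qed

section \<open>Weak-type bounds under the two kinds of kernel condition\<close>

context critical
begin

text \<open>Replacing \<rho> x by \<rho> y costs at most the power N0 / (N0 + 1) of 1 + u, with u =
  dist x y / \<rho> y, so the power 1 / (N0 + 1) survives. This transfers decay measured by \<rho> x
  to decay measured by \<rho> y.\<close>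

lemma critical_switch:
 "inverse C0 * (1 + dist x y / \<rho> y) powr (1 / (N0 + 1)) <= 1 + dist x y / \<rho> x"
proof -
 define u where "u = dist x y / \<rho> y"
 define a where "a = N0 / (N0 + 1)"
 have u: "0 <= u" unfolding u_def using \<rho>_pos[of y] by simp
 have P: "1 <= (1 + u) powr a" using u N0 by (intro ge_one_powr_ge_zero) (auto simp: a_def)
 have e: "(1 + u) powr (1 / (N0 + 1)) * (1 + u) powr a = 1 + u"
 proof -
  have "1 / (N0 + 1) + N0 / (N0 + 1) = 1" using N0 by (simp add: field_simps)
  thus ?thesis unfolding powr_add[symmetric] a_def using u by simp
 qed
 hence "(1 + u) powr (1 / (N0 + 1)) = (1 + u) / (1 + u) powr a" using P by (simp add: eq_divide_eq)
 also have "... = 1 / (1 + u) powr a + u / (1 + u) powr a" by (rule add_divide_distrib)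
 also have "... <= 1 + u / (1 + u) powr a"  proof -
  have "0 < (1 + u) powr a" using P by linarith
  hence "1 / (1 + u) powr a <= 1" using P by (subst pos_divide_le_eq) simp_all
  thus ?thesis by simp
 qed
 finally have 1: "(1 + u) powr (1 / (N0 + 1)) <= 1 + u / (1 + u) powr a" .
 have "\<rho> x <= C0 * \<rho> y * (1 + u) powr a" using \<rho>_upper[of x y] by (simp add: u_def a_def dist_commute)
 hence "dist x y / (C0 * \<rho> y * (1 + u) powr a) <= dist x y / \<rho> x" using \<rho>_pos[of x] by (intro divide_left_mono) auto
 hence 2: "inverse C0 * (u / (1 + u) powr a) <= dist x y / \<rho> x" by (simp add: u_def divide_inverse mult_ac)
 have "inverse C0 <= 1" using C0 by (simp add: inverse_le_1_iff)
 moreover have "inverse C0 * (1 + u) powr (1 / (N0 + 1)) <= inverse C0 * (1 + u / (1 + u) powr a)" using 1 C0 by (intro mult_left_mono) auto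
 ultimately show ?thesis using 2 unfolding u_def[symmetric] by (simp add: distrib_left)
qed

lemma M_loc_le_M_theta: "0 <= \<theta> ==> M_loc \<rho> B w x <= en (2 powr \<theta>) * M_theta \<rho> \<theta> B w x" unfolding M_loc_def
proof (rule SUP_least)
 fix i assume \<theta>: "0 <= \<theta>" and "i : {(x0, r0). 0 < r0 & r0 <= \<rho> x0 & x : ball x0 r0}"
 then obtain x0 r0 where i: "i = (x0, r0)" "0 < r0" "r0 <= \<rho> x0" "x : ball x0 r0" by blast
 have "luxemburg B (ball x0 r0) w <= en ((1 + r0 / \<rho> x0) powr \<theta>) * M_theta \<rho> \<theta> B w x" by (rule lux_le_M_theta[OF i(2,4)])
 also have "... <= en (2 powr \<theta>) * M_theta \<rho> \<theta> B w x"
  using i \<theta> \<rho>_pos[of x0] by (intro mult_right_mono ennreal_leI powr_mono2) auto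
 finally show "(case i of (x0, r0) => luxemburg B (ball x0 r0) w) <= en (2 powr \<theta>) * M_theta \<rho> \<theta> B w x" using i by simp
qed

text \<open>With A = B = t^(s') the local maximal function is absorbed by \<open>M_theta_pow\<close>
  (\<open>M_loc_le_M_theta\<close>). The kernel conditions enter with x0 = y.\<close>

lemma weak_type_Ls:
 fixes T T0 :: "('a => complex) => ('a => complex)" and K K0 :: "'a => 'a => complex"
 assumes lin: "linear_operator_on bcs T" and ker: "has_kernel T K"
  and cz: "cz_op T0 K0 C2 CK \<gamma>" and K0m: "(%(x, y). K0 x y) : lmeas" and diff: "diff_integral_operator T K T0 K0"
  and s: "1 < s" and size: "kernel_size_Ls \<rho> s K" and kdiff: "kernel_diff_Ls \<rho> s K K0" and \<theta>: "0 <= \<theta>"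
 shows "weak_bound T (M_theta_pow \<rho> \<theta> (conj_exp s))"
proof -
 define r where "r = conj_exp s"
 have r: "1 < r" unfolding r_def conj_exp_def using s by (simp add: field_simps)
 define B where "B t = t powr r" for t :: real
 define V where "V = bvol TYPE('a) 2 powr (1 / r)"
 have V: "0 < V" unfolding V_def using bvol_pos[where 'a='a, of 2] by simp
 define e where "e = - (real DIM('a) / conj_exp s)"
 note holder = annulus_holder[where 'a='a, OF s, folded e_def r_def, folded V_def B_def[abs_def]]
 have "\<exists>C\<ge>0. \<forall>y R. 0 < R --> annular B K y R (C * (1 + R / \<rho> y) powr (- N))" if N: "0 < N" for N
 proof -
  obtain C where C: "!!x0 y R. 0 < R ==> dist y x0 < R / 2 ==>
    Ls_norm_on s (annulus x0 R) (%x. K x y) <= en (C * R powr e * (1 + R / \<rho> x0) powr (- N))"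
   using size N unfolding kernel_size_Ls_def e_def by blast
  \<comment> \<open>The constant in the size condition may have any sign, while
    \<open>annulus_holder\<close> needs a positive one.\<close>
  define C' where "C' = \<bar>C\<bar> + 1"
  have C': "0 < C'" "C <= C'" unfolding C'_def by auto
  have "annular B K y R (V * C' * (1 + R / \<rho> y) powr (- N))" if R: "0 < R" for y R
  proof -
   have "0 < 1 + R / \<rho> y" using R \<rho>_pos[of y] by (simp add: add_pos_pos)
   hence b: "0 < C' * (1 + R / \<rho> y) powr (- N)" using C'(1) by simp
   have "Ls_norm_on s (annulus y R) (%x. K x y) <= en (C * R powr e * (1 + R / \<rho> y) powr (- N))" using R by (intro C) auto
   also have "... <= en (R powr e * (C' * (1 + R / \<rho> y) powr (- N)))"
    using mult_right_mono[OF C'(2), of "R powr e * (1 + R / \<rho> y) powr (- N)"] by (intro ennreal_leI) (simp add: mult_ac)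
   finally show ?thesis using holder[OF R b] by (simp only: mult.assoc)
  qed
  thus ?thesis using V C' by (intro exI[of _ "V * C'"]) simp
 qed
 moreover have "\<exists>C\<ge>0. \<exists>\<delta>>0. \<forall>y R. 0 < R --> R <= \<rho> y --> annular B (%x y. K x y - K0 x y) y R (C * (R / \<rho> y) powr \<delta>)"
 proof -
  obtain C \<delta> where C: "0 < C" "0 < \<delta>" "!!x0 y R. 0 < R ==> dist y x0 < R / 2 ==> R <= \<rho> x0 ==>
    Ls_norm_on s (annulus x0 R) (%x. K x y - K0 x y) <= en (C * R powr e * (R / \<rho> x0) powr \<delta>)"
   using kdiff unfolding kernel_diff_Ls_def e_def by blast
  have "annular B (%x y. K x y - K0 x y) y R (V * C * (R / \<rho> y) powr \<delta>)" if R: "0 < R" "R <= \<rho> y" for y R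
  proof -
   have "0 < (R / \<rho> y) powr \<delta>" using R \<rho>_pos[of y] by simp
   hence c: "0 < C * (R / \<rho> y) powr \<delta>" by (rule mult_pos_pos[OF C(1)])
   have "Ls_norm_on s (annulus y R) (%x. K x y - K0 x y) <= en (C * R powr e * (R / \<rho> y) powr \<delta>)" using R by (intro C) auto
   thus ?thesis using holder[OF R(1) c, of y "%x y. K x y - K0 x y"] by (simp add: mult_ac)
  qed
  thus ?thesis using V C(1,2) by (intro exI[of _ "V * C"] conjI exI[of _ \<delta>]) simp_all
 qed
 moreover have BD: "B : D_class 2" unfolding B_def[abs_def] by (rule powr_D_class[OF r])
 ultimately have "weak_bound T (%w x. M_loc \<rho> B w x + M_theta \<rho> \<theta> B w x)"
  by (intro weak_type_assembly[OF lin ker cz K0m diff BD _ \<theta>]) auto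
 then obtain C where C: "0 <= C" "!!w f t. w : lmeas ==> (\<forall>x. 0 <= w x) ==> f : bcs ==> 0 < t ==>
   (\<integral>x\<in>{x. t < cmod (T f x)}. en (w x)) <= en (C / t) * (\<integral>x. enorm (f x) * (M_loc \<rho> B w x + M_theta \<rho> \<theta> B w x))"
  unfolding weak_bound_def by blast
 define D where "D = (2::real) powr \<theta> + 1"
 have D: "0 < D" unfolding D_def by (simp add: add_pos_pos)
 have "(\<integral>x\<in>{x. t < cmod (T f x)}. en (w x)) <= en (C * D / t) * (\<integral>x. enorm (f x) * M_theta_pow \<rho> \<theta> (conj_exp s) w x)"
  if w: "w : lmeas" "\<forall>x. 0 <= w x" and f: "f : bcs" and t: "0 < t" for w f t
 proof -
  let ?M = "M_theta \<rho> \<theta> B w"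
  have Mp: "M_theta_pow \<rho> \<theta> (conj_exp s) = M_theta \<rho> \<theta> B" unfolding M_theta_pow_def B_def[abs_def] r_def ..
  have m: "(%x. enorm (f x) * ?M x) : lmeas" by (rule borel_measurable_times_ennreal[OF bm_enorm[OF bcs_measurable[OF f]] M_theta_lebesgue])
  have "(\<integral>x. enorm (f x) * (M_loc \<rho> B w x + ?M x)) <= (\<integral>x. en D * (enorm (f x) * ?M x))"
  proof (rule nn_integral_mono)
   fix x
   have "M_loc \<rho> B w x + ?M x <= en (2 powr \<theta>) * ?M x + ?M x" by (intro add_right_mono M_loc_le_M_theta \<theta>)
   also have "... = en D * ?M x" unfolding D_def by (simp add: distrib_right)
   finally show "enorm (f x) * (M_loc \<rho> B w x + ?M x) <= en D * (enorm (f x) * ?M x)"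
    by (subst mult.left_commute) (rule mult_left_mono, simp_all)
  qed
  also have "... = en D * (\<integral>x. enorm (f x) * ?M x)" by (rule nn_integral_cmult[OF m])
  finally have "(\<integral>x\<in>{x. t < cmod (T f x)}. en (w x)) <= en (C / t) * (en D * (\<integral>x. enorm (f x) * ?M x))"
   using C(2)[OF w f t] mult_left_mono order_trans by fastforce
  moreover have "en (C * D / t) = en (C / t) * en D" using D by (subst ennreal_mult''[symmetric]) simp_all
  ultimately show ?thesis unfolding Mp by (simp only: mult.assoc)
 qed
 moreover have "0 <= C * D" using C(1) D by simp
 ultimately show ?thesis unfolding weak_bound_def by blast
qed

text \<open>Both conditions are stated with \<rho> y, and the difference condition for dist x y <= 2
  \<rho> y only, since this is the form that transposed kernels can be shown to satisfy; annuli of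
  radius R <= \<rho> y lie in that range.\<close>

lemma weak_type_pointwise:
 fixes T T0 :: "('a => complex) => ('a => complex)" and K K0 :: "'a => 'a => complex"
 assumes lin: "linear_operator_on bcs T" and ker: "has_kernel T K"
  and cz: "cz_op T0 K0 C2 CK \<gamma>" and K0m: "(%(x, y). K0 x y) : lmeas"
  and diff: "diff_integral_operator T K T0 K0"
  and size: "!!N. 0 < N ==> \<exists>C\<ge>0. \<forall>x y. x ~= y --> cmod (K x y) <= C / dist x y ^ DIM('a) * (1 + dist x y / \<rho> y) powr (- N)"
  and kdiff: "\<exists>C\<ge>0. \<exists>\<delta>>0. \<forall>x y. x ~= y --> dist x y <= 2 * \<rho> y -->
    cmod (K x y - K0 x y) <= C / dist x y ^ DIM('a) * (dist x y / \<rho> y) powr \<delta>"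
  and AD: "A : D_class p" and p: "1 < p" and \<theta>: "0 <= \<theta>"
 shows "weak_bound T (%w x. M_loc \<rho> A w x + M_theta_pow \<rho> \<theta> 1 w x)" unfolding M_theta_pow_def
proof (rule weak_type_assembly[OF lin ker cz K0m diff AD p \<theta>])
 define V where "V = 2 * bvol TYPE('a) 2"
 have V: "0 < V" unfolding V_def using bvol_pos[where 'a='a, of 2] by simp
 note annular = annulus_pointwise[where 'a='a, folded V_def]
 have mm: "C / dist x y ^ DIM('a) * a <= C * b / R ^ DIM('a)" if "0 <= C" "0 < R" "R < dist x y" "0 <= a" "a <= b" for C R a b and x y :: 'a
 proof -
  have "C / dist x y ^ DIM('a) * a <= C / R ^ DIM('a) * b"
   using that by (intro mult_mono divide_left_mono power_mono mult_pos_pos zero_less_power) auto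
  thus ?thesis by simp
 qed
 show "\<exists>C\<ge>0. \<forall>y R. 0 < R --> annular (%t. t powr 1) K y R (C * (1 + R / \<rho> y) powr (- N))" if N: "0 < N" for N
 proof -
  obtain C where C: "0 <= C" "!!x y. x ~= y ==> cmod (K x y) <= C / dist x y ^ DIM('a) * (1 + dist x y / \<rho> y) powr (- N)"
   using size[OF N] by blast
  have "annular (%t. t powr 1) K y R (V * (C * (1 + R / \<rho> y) powr (- N)))" if R: "0 < R" for y R
  proof (rule annular[OF R])
   fix x assume "x : annulus y R"
   hence x: "R < dist x y" "x ~= y" using R by (auto simp: annulus_def dist_commute)
   have "(1 + dist x y / \<rho> y) powr (- N) <= (1 + R / \<rho> y) powr (- N)"
    using R x N \<rho>_pos[of y] by (intro powr_mono2') (auto simp: divide_right_mono add_pos_pos)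
   from order_trans[OF C(2)[OF x(2)] mm[OF C(1) R x(1) _ this]]
   show "cmod (K x y) <= C * (1 + R / \<rho> y) powr (- N) / R ^ DIM('a)" by simp
  qed (use C in simp)
  thus ?thesis using V C(1) by (intro exI[of _ "V * C"]) (simp add: mult.assoc)
 qed
 obtain C \<delta> where C: "0 <= C" "0 < \<delta>" "!!x y. x ~= y ==> dist x y <= 2 * \<rho> y ==>
    cmod (K x y - K0 x y) <= C / dist x y ^ DIM('a) * (dist x y / \<rho> y) powr \<delta>" using kdiff by blast
 have "annular (%t. t powr 1) (%x y. K x y - K0 x y) y R (V * (C * (2 powr \<delta> * (R / \<rho> y) powr \<delta>)))" if R: "0 < R" "R <= \<rho> y" for y R
 proof (rule annular[OF R(1)])
  fix x assume "x : annulus y R"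
  hence x: "R < dist x y" "x ~= y" "dist x y < 2 * R" using R by (auto simp: annulus_def dist_commute)
  have "(dist x y / \<rho> y) powr \<delta> <= (2 * (R / \<rho> y)) powr \<delta>"
   using x R C(2) \<rho>_pos[of y] by (intro powr_mono2) (auto simp: field_simps)
  also have "... = 2 powr \<delta> * (R / \<rho> y) powr \<delta>" by (rule powr_mult)
  finally have le: "(dist x y / \<rho> y) powr \<delta> <= 2 powr \<delta> * (R / \<rho> y) powr \<delta>" .
  have "dist x y <= 2 * \<rho> y" using x R by linarith
  from order_trans[OF C(3)[OF x(2) this] mm[OF C(1) R(1) x(1) _ le]]
  show "cmod (K x y - K0 x y) <= C * (2 powr \<delta> * (R / \<rho> y) powr \<delta>) / R ^ DIM('a)" by simp
 qed (use C in simp)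
 thus "\<exists>C\<ge>0. \<exists>\<delta>>0. \<forall>y R. 0 < R --> R <= \<rho> y --> annular (%t. t powr 1) (%x y. K x y - K0 x y) y R (C * (R / \<rho> y) powr \<delta>)"
  using V C(1,2) by (intro exI[of _ "V * (C * 2 powr \<delta>)"] conjI exI[of _ \<delta>]) (simp_all add: mult.assoc)
qed

end

subsection \<open>Adjoints\<close>

lemma complex_borel_version:
 fixes g :: "'a::euclidean_space => complex"
 assumes g: "g : lmeas"
 obtains g' where "g' : borel_measurable borel" "AE x in lborel. g x = g' x"
proof -
 have "(%x. Re (g x)) : lmeas" "(%x. Im (g x)) : lmeas" by (intro measurable_compose[OF g] borel_measurable_continuous_onI continuous_intros)+
 from completion_ex_borel_measurable_real[OF this(1)] completion_ex_borel_measurable_real[OF this(2)]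
 obtain u v where u: "u : borel_measurable lborel" "AE x in lborel. Re (g x) = u x"
  and v: "v : borel_measurable lborel" "AE x in lborel. Im (g x) = v x" by blast
 have "(%x. Complex (u x) (v x)) = (%x. complex_of_real (u x) + \<i> * complex_of_real (v x))" by (simp add: complex_eq_iff fun_eq_iff)
 moreover have "(%x. complex_of_real (u x) + \<i> * complex_of_real (v x)) : borel_measurable borel"
  using u(1) v(1) by (intro borel_measurable_add borel_measurable_times borel_measurable_const borel_measurable_of_real) auto
 ultimately have "(%x. Complex (u x) (v x)) : borel_measurable borel" by simp
 moreover have "AE x in lborel. g x = Complex (u x) (v x)" using u(2) v(2) by eventually_elim (simp add: complex_eq_iff)
 ultimately show thesis by (rule that)
qed

lemma measurable_swap_lebesgue:
 fixes k :: "'a::euclidean_space => 'b::euclidean_space => complex"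
 assumes "(%(x, y). k x y) : lmeas"
 shows "(%(y, x). k x y) : lmeas"
proof -
 obtain k' where k': "k' : borel_measurable borel" "AE z in lborel. (case z of (x, y) => k x y) = k' z"
  by (rule complex_borel_version[OF assms]) (rule that)
 have sw: "(lborel :: ('a \<times> 'b) measure) = distr (lborel :: ('b \<times> 'a) measure) lborel (%(y, x). (x, y))"
  using lborel_pair.distr_pair_swap[where 'a='a and 'b='b] by (simp only: lborel_prod)
 have m: "(%(y, x). (x, y)) : (lborel :: ('b \<times> 'a) measure) \<rightarrow>\<^sub>M (lborel :: ('a \<times> 'b) measure)"
  using measurable_pair_swap'[of "lborel :: 'b measure" "lborel :: 'a measure"] by (simp only: lborel_prod)
 have "AE z in lborel. (case (case z of (y, x) => (x, y)) of (x, y) => k x y) = k' (case z of (y, x) => (x, y))"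
  using k'(2) by (subst (asm) sw) (rule AE_distrD[OF m])
 hence "AE z in lborel. k' (case z of (y, x) => (x, y)) = (case z of (y, x) => k x y)" by eventually_elim (simp split: prod.splits)
 hence ae: "AE z. k' (case z of (y, x) => (x, y)) = (case z of (y, x) => k x y)" by (rule AE_completion)
 have k'm: "k' : borel_measurable lborel" using k'(1) by simp
 have "(%z. k' (case z of (y, x) => (x, y))) : borel_measurable lborel" by (rule measurable_compose[OF m k'm])
 hence "(%z. k' (case z of (y, x) => (x, y))) : lmeas" by (rule measurable_completion)
 thus ?thesis by (rule lebesgue_measurable_AE[OF _ ae])
qed

lemma lebesgue_integral_borel_version:
 fixes f g :: "'a::euclidean_space => complex"
 assumes g: "g : borel_measurable borel" and ae: "AE x. f x = g x"
 shows "integrable lebesgue f \<longleftrightarrow> integrable lborel g" "(LINT x. f x) = (LINT x|lborel. g x)"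
proof -
 have gl: "g : borel_measurable lborel" using g by simp
 have gm: "g : lmeas" by (rule measurable_completion[OF gl])
 have fm: "f : lmeas" by (rule lebesgue_measurable_AE[OF gm]) (use ae in \<open>eventually_elim, simp\<close>)
 show "integrable lebesgue f \<longleftrightarrow> integrable lborel g" using integrable_cong_AE[OF fm gm ae] integrable_completion[OF gl] by simp
 show "(LINT x. f x) = (LINT x|lborel. g x)" using integral_cong_AE[OF fm gm ae] integral_completion[OF gl] by simp
qed

lemma kernel_sections:
 fixes k k' :: "'a::euclidean_space => 'b::euclidean_space => complex"
 assumes ae: "AE x. AE y. k x y = k' x y" and f: "AE y. f y = f' y"
  and m: "!!x. (%y. k' x y * f' y) : borel_measurable borel"
 shows "AE x. (lintegrable (%y. k x y * f y) \<longleftrightarrow> integrable lborel (%y. k' x y * f' y)) &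
  (LINT y. k x y * f y) = (LINT y|lborel. k' x y * f' y)" using ae
proof eventually_elim
 fix x assume "AE y. k x y = k' x y"
 with f have "AE y. k x y * f y = k' x y * f' y" by eventually_elim simp
 from lebesgue_integral_borel_version[OF m this]
 show "(lintegrable (%y. k x y * f y) \<longleftrightarrow> integrable lborel (%y. k' x y * f' y)) &
  (LINT y. k x y * f y) = (LINT y|lborel. k' x y * f' y)" by blast
qed

lemma kernel_operator_measurable:
 fixes k :: "'a::euclidean_space => 'b::euclidean_space => complex"
 assumes k: "(%(x, y). k x y) : lmeas" and f: "f : lmeas"
 shows "(%x. LINT y. k x y * f y) : lmeas"
proof -
 obtain k' where k': "k' : borel_measurable borel" "AE z in lborel. (case z of (x, y) => k x y) = k' z"
  by (rule complex_borel_version[OF k]) (rule that)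
 obtain f' where f': "f' : borel_measurable borel" "AE y in lborel. f y = f' y" by (rule complex_borel_version[OF f]) (rule that)
 have k'p: "k' : borel_measurable (lborel \<Otimes>\<^sub>M lborel)" using k'(1) by (simp add: lborel_prod)
 have f'l: "f' : borel_measurable lborel" using f'(1) by simp
 have kx: "(%y. k' (x, y)) : borel_measurable borel" for x
  using measurable_compose[OF _ k'(1), of "%y. (x, y)" borel] by (auto intro!: borel_measurable_continuous_onI continuous_intros)
 have m: "(%y. k' (x, y) * f' y) : borel_measurable borel" for x by (rule borel_measurable_times[OF kx f'(1)])
 have mp: "(%(x, y). k' (x, y) * f' y) : borel_measurable (lborel \<Otimes>\<^sub>M lborel)"
  using borel_measurable_times[OF k'p measurable_compose[OF measurable_snd f'l]] by (simp add: case_prod_beta')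
 have "AE x. AE y. k x y = k' (x, y)" using AE_lborel_sections(1)[OF k'(2)] by simp
 from kernel_sections[OF this AE_completion[OF f'(2)] m]
 have ae: "AE x. (LINT y|lborel. k' (x, y) * f' y) = (LINT y. k x y * f y)" by eventually_elim simp
 have "(%x. LINT y|lborel. k' (x, y) * f' y) : borel_measurable lborel" by (rule lborel.borel_measurable_lebesgue_integral[OF mp])
 hence "(%x. LINT y|lborel. k' (x, y) * f' y) : lmeas" by (rule measurable_completion)
 thus ?thesis by (rule lebesgue_measurable_AE[OF _ ae])
qed

text \<open>Hypothesis \<open>fin\<close> is one iterated absolute integral of k x y f y g x, which
  makes the product of the Borel versions integrable. In the first conclusion f y must not vanish,
  as it is divided out.\<close>

lemma kernel_fubini:
 fixes k :: "'a::euclidean_space => 'b::euclidean_space => complex"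
 assumes k: "(%(x, y). k x y) : lmeas" and f: "f : lmeas" and g: "g : lmeas"
  and fin: "(\<integral>y. enorm (f y) * (\<integral>x. enorm (k x y) * enorm (g x))) < \<infinity>"
 shows "AE y. f y ~= 0 --> lintegrable (%x. k x y * g x)"
  and "lintegrable (%x. (LINT y. k x y * f y) * g x)"
  and "lintegrable (%y. f y * (LINT x. k x y * g x))"
  and "(LINT x. (LINT y. k x y * f y) * g x) = (LINT y. f y * (LINT x. k x y * g x))"
proof -
 obtain k' where k': "k' : borel_measurable borel" "AE z in lborel. (case z of (x, y) => k x y) = k' z"
  by (rule complex_borel_version[OF k]) (rule that)
 obtain f' where f': "f' : borel_measurable borel" "AE y in lborel. f y = f' y" by (rule complex_borel_version[OF f]) (rule that)
 obtain g' where g': "g' : borel_measurable borel" "AE y in lborel. g y = g' y" by (rule complex_borel_version[OF g]) (rule that)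
 have aek: "AE x. AE y. k x y = k' (x, y)" "AE y. AE x. k x y = k' (x, y)" using AE_lborel_sections[OF k'(2)] by simp_all
 note aef = AE_completion[OF f'(2)] note aeg = AE_completion[OF g'(2)]
 have k'p: "k' : borel_measurable (lborel \<Otimes>\<^sub>M lborel)" using k'(1) by (simp add: lborel_prod)
 have f'l: "f' : borel_measurable lborel" and g'l: "g' : borel_measurable lborel" using f'(1) g'(1) by simp_all
 have kx: "(%y. k' (x, y)) : borel_measurable borel" for x
  using measurable_compose[OF _ k'(1), of "%y. (x, y)" borel] by (auto intro!: borel_measurable_continuous_onI continuous_intros)
 have ky: "(%x. k' (x, y)) : borel_measurable borel" for y
  using measurable_compose[OF _ k'(1), of "%x. (x, y)" borel] by (auto intro!: borel_measurable_continuous_onI continuous_intros)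
 have mx: "(%y. k' (x, y) * f' y) : borel_measurable borel" for x by (rule borel_measurable_times[OF kx f'(1)])
 have my: "(%x. k' (x, y) * g' x) : borel_measurable borel" for y by (rule borel_measurable_times[OF ky g'(1)])
 note sx = kernel_sections[OF aek(1) aef mx]
 note sy = kernel_sections[OF aek(2) aeg my]
 define F where "F x y = k' (x, y) * f' y * g' x" for x y
 have Fm: "case_prod F : borel_measurable (lborel \<Otimes>\<^sub>M lborel)"
  using borel_measurable_times[OF borel_measurable_times[OF k'p measurable_compose[OF measurable_snd f'l]] measurable_compose[OF measurable_fst g'l]]
  by (simp add: case_prod_beta' F_def)
 have "(\<integral>\<^sup>+y. (\<integral>\<^sup>+x. enorm (F x y) \<partial>lborel) \<partial>lborel)
  = (\<integral>y. enorm (f y) * (\<integral>x. enorm (k x y) * enorm (g x)))"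
 proof (subst nn_integral_completion[symmetric], rule nn_integral_cong_AE, use aek(2) aef in eventually_elim)
  fix y assume y: "AE x. k x y = k' (x, y)" "f y = f' y"
  have "(\<integral>\<^sup>+x. enorm (F x y) \<partial>lborel) = (\<integral>\<^sup>+x. enorm (f' y) * (enorm (k' (x, y) * g' x)) \<partial>lborel)"
   unfolding F_def by (intro nn_integral_cong) (simp add: norm_mult ennreal_mult mult_ac)
  also have "... = enorm (f' y) * (\<integral>\<^sup>+x. enorm (k' (x, y) * g' x) \<partial>lborel)"
   by (rule nn_integral_cmult[OF bm_enorm]) (use my in simp)
  also have "(\<integral>\<^sup>+x. enorm (k' (x, y) * g' x) \<partial>lborel) = (\<integral>x. enorm (k x y) * enorm (g x))"
   by (subst nn_integral_completion[symmetric], rule nn_integral_cong_AE, use y(1) aeg in eventually_elim)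
    (simp add: norm_mult ennreal_mult)
  finally show "(\<integral>\<^sup>+x. enorm (F x y) \<partial>lborel) = enorm (f y) * (\<integral>x. enorm (k x y) * enorm (g x))" using y(2) by simp
 qed
 also note fin
 finally have fin': "(\<integral>\<^sup>+y. (\<integral>\<^sup>+x. enorm (F x y) \<partial>lborel) \<partial>lborel) < \<infinity>" .
 have Fn: "(%(x, y). enorm (F x y)) : borel_measurable (lborel \<Otimes>\<^sub>M lborel)" using bm_enorm[OF Fm] by (simp add: case_prod_beta')
 have Fint: "integrable (lborel \<Otimes>\<^sub>M lborel) (case_prod F)"
 proof (rule integrableI_bounded[OF Fm])
  have "(\<integral>\<^sup>+z. enorm (case_prod F z) \<partial>(lborel \<Otimes>\<^sub>M lborel)) = (\<integral>\<^sup>+z. (case z of (x, y) => enorm (F x y)) \<partial>(lborel \<Otimes>\<^sub>M lborel))"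
   by (simp add: case_prod_beta')
  also have "... = (\<integral>\<^sup>+y. (\<integral>\<^sup>+x. enorm (F x y) \<partial>lborel) \<partial>lborel)"
   using lborel_pair.nn_integral_snd[OF Fn] by simp
  finally show "(\<integral>\<^sup>+z. enorm (case_prod F z) \<partial>(lborel \<Otimes>\<^sub>M lborel)) < \<infinity>" using fin' by simp
 qed
 have Fy: "(%x. F x y) = (%x. f' y * (k' (x, y) * g' x))" for y by (simp add: F_def mult_ac fun_eq_iff)
 have Fx: "(%y. F x y) = (%y. (k' (x, y) * f' y) * g' x)" for x by (simp add: F_def)
 show "AE y. f y ~= 0 --> lintegrable (%x. k x y * g x)" using AE_completion[OF lborel_pair.AE_integrable_snd[OF Fint]] aef sy
 proof eventually_elim
  fix y assume y: "integrable lborel (%x. F x y)" "f y = f' y"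
   "(lintegrable (%x. k x y * g x) \<longleftrightarrow> integrable lborel (%x. k' (x, y) * g' x)) &
    (LINT x. k x y * g x) = (LINT x|lborel. k' (x, y) * g' x)"
  show "f y ~= 0 --> lintegrable (%x. k x y * g x)"
  proof
   assume "f y ~= 0"
   hence "f' y ~= 0" using y(2) by simp
   have "integrable lborel (%x. f' y * (k' (x, y) * g' x))" using y(1) unfolding Fy .
   hence "integrable lborel (%x. inverse (f' y) * (f' y * (k' (x, y) * g' x)))" by (rule integrable_mult_right)
   with \<open>f' y ~= 0\<close> have "integrable lborel (%x. k' (x, y) * g' x)"
    by (simp add: mult.assoc[symmetric] del: integrable_mult_right_iff integrable_mult_left_iff)
   thus "lintegrable (%x. k x y * g x)" using y(3) by blast
  qed
 qed
 have aex: "AE x. (LINT y. k x y * f y) * g x = (LINT y|lborel. F x y)" using sx aeg by eventually_elim (simp add: Fx)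
 have aey: "AE y. f y * (LINT x. k x y * g x) = (LINT x|lborel. F x y)" using sy aef by eventually_elim (simp add: Fy)
 have ix: "integrable lborel (%x. LINT y|lborel. F x y)" by (rule lborel_pair.integrable_fst[OF Fint])
 have iy: "integrable lborel (%y. LINT x|lborel. F x y)" by (rule lborel_pair.integrable_snd[OF Fint])
 have ixm: "(%x. LINT y|lborel. F x y) : borel_measurable borel" using borel_measurable_integrable[OF ix] by simp
 have iym: "(%y. LINT x|lborel. F x y) : borel_measurable borel" using borel_measurable_integrable[OF iy] by simp
 show "lintegrable (%x. (LINT y. k x y * f y) * g x)" using lebesgue_integral_borel_version(1)[OF ixm aex] ix by blast
 show "lintegrable (%y. f y * (LINT x. k x y * g x))" using lebesgue_integral_borel_version(1)[OF iym aey] iy by blast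
 show "(LINT x. (LINT y. k x y * f y) * g x) = (LINT y. f y * (LINT x. k x y * g x))"
  using lebesgue_integral_borel_version(2)[OF ixm aex] lebesgue_integral_borel_version(2)[OF iym aey] lborel_pair.Fubini_integral[OF Fint] by simp
qed

text \<open>Since h is not known to be square integrable, it is tested against its conjugate on the
  part of a ball where it is bounded: the integral a of |h|^2 there satisfies a^2 <= D a, hence a <=
  D. Then these sets exhaust the space.\<close>

lemma L2_duality:
 fixes h :: "'a::euclidean_space => complex"
 assumes h: "h : lmeas" and D: "0 <= D"
  and dual: "!!f. f : bcs ==> ennreal ((cmod (LINT x. f x * h x))\<^sup>2) <= en D * (\<integral>x. en ((cmod (f x))\<^sup>2))"
 shows "(\<integral>x. en ((cmod (h x))\<^sup>2)) <= en D"
proof -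
 define E where "E n = {x. cmod (h x) <= real n} Int ball 0 (real n)" for n
 have E: "E n : sets lebesgue" for n
 proof -
  have "{x. cmod (h x) <= real n} = (%x. cmod (h x)) -` {..real n} Int space lebesgue" by auto
  also have "... : sets lebesgue" by (rule measurable_sets[OF bm_cmod[OF h]]) simp
  finally show ?thesis unfolding E_def by (intro sets.Int) auto
 qed
 define u where "u x = en ((cmod (h x))\<^sup>2)" for x
 have um: "u : lmeas" unfolding u_def[abs_def] by (rule bm_ennreal[OF borel_measurable_power[OF bm_cmod[OF h]]])
 have bd: "(\<integral>x. u x * indicator (E n) x) <= en D" for n
 proof -
  define f where "f x = cnj (h x) * indicator (E n) x" for x
  have fm: "f : lmeas" unfolding f_def[abs_def]
   by (intro borel_measurable_times borel_measurable_indicator E measurable_compose[OF h] borel_measurable_continuous_onI continuous_intros)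
  have fb: "f : bcs" by (rule bcsI[OF fm, of "real n" "ball 0 (real n)"]) (auto simp: f_def E_def norm_mult indicator_def)
  have L2: "f : L2_functions" by (rule bcs_L2[OF fb])
  define a where "a = (L2_fun_norm f)\<^sup>2"
  have a: "0 <= a" by (simp add: a_def)
  have nn: "(\<integral>x. en ((cmod (f x))\<^sup>2)) = en a" unfolding a_def by (rule L2_nn_integral[OF L2])
  have "f x * h x = complex_of_real ((cmod (f x))\<^sup>2)" for x
   by (cases "x : E n") (simp_all add: f_def complex_norm_square[symmetric] mult.commute[of "cnj (h x)"])
  hence "(LINT x. f x * h x) = complex_of_real (LINT x. (cmod (f x))\<^sup>2)" by (simp only: integral_complex_of_real)
  also have "(LINT x. (cmod (f x))\<^sup>2) = a" by (simp add: a_def L2_fun_norm_def)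
  finally have "cmod (LINT x. f x * h x) = a" using a by simp
  hence "en (a\<^sup>2) <= en D * en a" using dual[OF fb] nn by simp
  hence "a\<^sup>2 <= D * a" using a D by (simp add: ennreal_mult'[symmetric])
  hence "a <= D" using a D by (cases "a = 0") (auto simp: power2_eq_square)
  moreover have "u x * indicator (E n) x = en ((cmod (f x))\<^sup>2)" for x by (auto simp: u_def f_def norm_mult indicator_def)
  ultimately show ?thesis using nn by (simp add: ennreal_leI)
 qed
 have sup: "(SUP n. u x * indicator (E n) x) = u x" for x
 proof (rule antisym)
  obtain n where "max (cmod (h x)) (norm x) < real n" using reals_Archimedean2 by blast
  hence "x : E n" by (simp add: E_def)
  thus "u x <= (SUP n. u x * indicator (E n) x)" by (intro SUP_upper2[of n]) auto
 qed (auto intro!: SUP_least simp: indicator_def)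
 have "(\<integral>x. u x) = (\<integral>x. (SUP n. u x * indicator (E n) x))" unfolding sup ..
 also have "... = (SUP n. \<integral>\<^sup>+x. u x * indicator (E n) x \<partial>lebesgue)"
 proof (rule nn_integral_monotone_convergence_SUP)
  show "incseq (%n x. u x * indicator (E n) x)" by (auto simp: incseq_def le_fun_def E_def indicator_def intro!: mult_left_mono)
  show "(%x. u x * indicator (E n) x) : lmeas" for n by (rule bm_on[OF um E])
 qed
 also have "... <= en D" by (intro SUP_least bd)
 finally show ?thesis unfolding u_def .
qed

text \<open>The case D = 0 of \<open>L2_duality\<close>, for h cut off to S.\<close>

lemma AE_zero_by_duality:
 fixes h :: "'a::euclidean_space => complex"
 assumes h: "h : lmeas" and S: "S : sets lebesgue"
  and z: "!!f. f : bcs ==> (!!x. f x ~= 0 ==> x : S) ==> (LINT x. f x * h x) = 0"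
 shows "AE x. x : S --> h x = 0"
proof -
 define h' where "h' x = h x * indicator S x" for x
 have h': "h' : lmeas" unfolding h'_def[abs_def] by (rule borel_measurable_times[OF h borel_measurable_indicator[OF S]])
 have "(\<integral>x. en ((cmod (h' x))\<^sup>2)) <= en 0"
 proof (rule L2_duality[OF h'])
  fix f :: "'a => complex" assume f: "f : bcs"
  have e: "(%x. f x * h' x) = (%x. (f x * indicator S x) * h x)" by (simp add: h'_def fun_eq_iff)
  have "(LINT x. (f x * indicator S x) * h x) = 0" by (rule z[OF bcs_indicator[OF f S]]) (simp add: indicator_def split: if_splits)
  thus "en ((cmod (LINT x. f x * h' x))\<^sup>2) <= en 0 * (\<integral>x. en ((cmod (f x))\<^sup>2))" unfolding e by simp
 qed simp
 hence "(\<integral>x. en ((cmod (h' x))\<^sup>2)) = 0" by simp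
 hence "AE x. en ((cmod (h' x))\<^sup>2) = 0" by (subst (asm) nn_integral_0_iff_AE) (rule bm_ennreal[OF borel_measurable_power[OF bm_cmod[OF h']]])
 thus ?thesis by eventually_elim (auto simp: h'_def)
qed

context critical
begin

text \<open>As \<rho> is bounded below on the ball, the factor (dist x y / \<rho> y)^\<delta> makes
  the singularity integrable, uniformly in y. This justifies Fubini's theorem for the difference
  operator.\<close>

lemma kernel_diff_integral:
 assumes C: "0 <= C" and \<delta>: "0 < \<delta>" and R: "0 < R"
  and k: "!!x y. x ~= y ==> cmod (k x y) <= C / dist x y ^ DIM('a) * (dist x y / \<rho> y) powr \<delta>"
 shows "\<exists>D\<ge>0. \<forall>y\<in>ball 0 R. (%x. cmod (k x y)) : lmeas -->
  (\<integral>x\<in>ball 0 R. enorm (k x y)) <= en D"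
proof -
 obtain m where m: "0 < m" "!!y. y : ball 0 R ==> m <= \<rho> y" using \<rho>_ball_ge[OF R] by blast
 define z where "z = (2 / 3 :: real) powr \<delta>"
 have z0: "0 <= z" unfolding z_def by simp
 have "(2 / 3) powr \<delta> < (2 / 3) powr (0::real)" using \<delta> by (intro powr_less_mono') auto
 hence z1: "z < 1" unfolding z_def by simp
 define c where "c = C * (2 * R / m) powr \<delta> * bvol TYPE('a) 2"
 have bv: "0 < bvol TYPE('a) 2" by (rule bvol_pos) simp
 have c: "0 <= c" unfolding c_def using C bv by simp
 have "(\<integral>x\<in>ball 0 R. enorm (k x y)) <= en (c / (1 - z)) * 1"
  if y: "y : ball 0 R" and km: "(%x. cmod (k x y)) : lmeas" for y
 proof (rule annuli_geometric[OF bm_ennreal[OF km] _ _ c z0 z1])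
  fix x assume x: "x : ball 0 R" "x ~= y"
  have "dist y x < 2 * R" using x(1) y dist_triangle[of y x 0] by (simp add: dist_commute)
  thus "\<exists>j. x : annulus y (R * (2 / 3) ^ j)" by (rule annuli_cover_in[OF x(2)])
 next
  fix j :: nat
  define r where "r = R * (2 / 3) ^ j"
  have r: "0 < r" unfolding r_def using R by simp
  define b where "b = C / r ^ DIM('a) * (2 * r / m) powr \<delta>"
  have b: "0 <= b" unfolding b_def using C r by simp
  have "(\<integral>x\<in>annulus y r. enorm (k x y)) <= (\<integral>x. en b * indicator (annulus y r) x)"
  proof (rule nn_integral_mono)
   fix x
   show "enorm (k x y) * indicator (annulus y r) x <= en b * indicator (annulus y r) x"
   proof (cases "x : annulus y r")
    case True
    hence x: "x ~= y" "r < dist x y" "dist x y < 2 * r" using r by (auto simp: annulus_def dist_commute)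
    have "(dist x y / \<rho> y) powr \<delta> <= (2 * r / m) powr \<delta>"
     using x m(1) m(2)[OF y] \<rho>_pos[of y] \<delta> by (intro powr_mono2 frac_le) auto
    hence "C / dist x y ^ DIM('a) * (dist x y / \<rho> y) powr \<delta> <= b"
     unfolding b_def using C r x(2) by (intro mult_mono divide_left_mono power_mono mult_pos_pos zero_less_power) auto
    thus ?thesis using k[OF x(1)] by (intro mult_right_mono ennreal_leI) auto
   qed simp
  qed
  also have "... = en b * \<mu> (annulus y r)" by (rule nn_integral_cmult_indicator[OF annulus_lebesgue])
  also have "... <= en b * \<mu> (ball y (2 * r))" by (rule mult_left_mono[OF emeasure_mono[OF annulus_ball]]) auto
  also have "... = en (b * bvol TYPE('a) (2 * r))" using r b by (subst emeasure_ball_bvol) (auto simp: ennreal_mult')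
  also have "b * bvol TYPE('a) (2 * r) = c * z ^ j"
  proof -
   have "bvol TYPE('a) (2 * r) = r ^ DIM('a) * bvol TYPE('a) 2" using bvol_scale[where 'a='a, of r 2] by (simp add: mult.commute)
   moreover have "(2 * r / m) powr \<delta> = (2 * R / m) powr \<delta> * z ^ j"
   proof -
    have "2 * r / m = (2 * R / m) * (2 / 3) ^ j" by (simp add: r_def)
    hence "(2 * r / m) powr \<delta> = (2 * R / m) powr \<delta> * ((2 / 3) ^ j) powr \<delta>" by (simp only: powr_mult)
    also have "((2 / 3) ^ j) powr \<delta> = z ^ j" unfolding z_def by (simp add: powr_realpow[symmetric] powr_powr mult.commute)
    finally show ?thesis .
   qed
   ultimately show ?thesis unfolding b_def c_def using r by simp
  qed
  finally show "(\<integral>x\<in>annulus y (R * (2 / 3) ^ j). enorm (k x y)) <= en (c * z ^ j) * 1" unfolding r_def by simp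
 qed
 thus ?thesis using c z1 by (intro exI[of _ "c / (1 - z)"]) simp
qed

text \<open>The L2 bound of T0 passes to its formal adjoint T1 with the same constant, by testing
  and the Cauchy-Schwarz inequality. Off the support of g the kernel of T1 is identified by testing
  against functions supported at a positive distance from it, where K0 is bounded.\<close>

lemma adjoint_difference:
 fixes T T0 Tadj :: "('a => complex) => ('a => complex)" and K K0 :: "'a => 'a => complex"
 assumes lin: "linear_operator_on bcs T" and ker: "has_kernel T K"
  and cz: "calderon_zygmund T0 K0" and czo: "cz_op T0 K0 C2 CK \<gamma>" and diff: "diff_integral_operator T K T0 K0"
  and C: "0 <= C" and \<delta>: "0 < \<delta>"
  and kd: "!!x y. x ~= y ==> cmod (K x y - K0 x y) <= C / dist x y ^ DIM('a) * (dist x y / \<rho> y) powr \<delta>"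
  and adj: "adjoint_operator T Tadj"
 shows "\<exists>T1. cz_op T1 (%x y. K0 y x) C2 CK \<gamma> & has_kernel Tadj (%x y. K y x) &
   diff_integral_operator Tadj (%x y. K y x) T1 (%x y. K0 y x)"
proof -
 let ?k = "%x y. K x y - K0 x y"
 interpret T0: cz_op T0 K0 C2 CK \<gamma> by (rule czo)
 have Km: "(%(x, y). K x y) : lmeas" using ker unfolding has_kernel_def by blast
 have K0m: "(%(x, y). K0 x y) : lmeas" using cz unfolding calderon_zygmund_def has_kernel_def by blast
 have kdm: "(%(x, y). ?k x y) : lmeas" using borel_measurable_diff[OF Km K0m] by (simp add: case_prod_beta')
 obtain CS where CS: "!!x y. x ~= y ==> cmod (K0 x y) <= CS / dist x y ^ DIM('a)" using cz unfolding calderon_zygmund_def cz_kernel_def by blast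
 have Tadj_meas: "Tadj g : lmeas" if "g : bcs" for g using adj that unfolding adjoint_operator_def linear_operator_on_def by blast
 have Tadj_add: "AE x. Tadj (%z. f z + g z) x = Tadj f x + Tadj g x" if "f : bcs" "g : bcs" for f g
  using adj that unfolding adjoint_operator_def linear_operator_on_def by blast
 have Tadj_scale: "AE x. Tadj (%z. c * f z) x = c * Tadj f x" if "f : bcs" for f c
  using adj that unfolding adjoint_operator_def linear_operator_on_def by blast
 have pair: "lintegrable (%x. T f x * g x)" "lintegrable (%y. f y * Tadj g y)"
  "(LINT x. T f x * g x) = (LINT y. f y * Tadj g y)"
  if "f : bcs" "g : bcs" for f g using adj that unfolding adjoint_operator_def by blast+
 have Drep: "AE x. T f x - T0 f x = (LINT y. ?k x y * f y)" if "f : bcs" for f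
 proof -
  have "AE x. lintegrable (%y. ?k x y * f y) &
    T f x - T0 f x = (LINT y. ?k x y * f y)" using diff that unfolding diff_integral_operator_def by blast
  thus ?thesis by eventually_elim blast
 qed
 define D where "D g y = (LINT x. ?k x y * g x)" for g y
 define T1 where "T1 g y = Tadj g y - D g y" for g y
 have Dm: "D g : lmeas" if "g : bcs" for g unfolding D_def[abs_def]
  by (rule kernel_operator_measurable[OF measurable_swap_lebesgue[OF kdm] bcs_measurable[OF that]])
 have cm: "(%x. enorm (f x)) : lmeas" if "f : bcs" for f :: "'a => complex" by (rule bm_enorm[OF bcs_measurable[OF that]])
 have fin: "(\<integral>y. enorm (f y) * (\<integral>x. enorm (?k x y) * enorm (g x))) < \<infinity>"
  if f: "f : bcs" and g: "g : bcs" for f g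
 proof -
  obtain M1 R1 where b1: "!!x. cmod (f x) <= M1" "0 <= M1" "!!x. f x ~= 0 ==> x : ball 0 R1" "0 < R1" by (rule bcsE[OF f]) (rule that)
  obtain M2 R2 where b2: "!!x. cmod (g x) <= M2" "0 <= M2" "!!x. g x ~= 0 ==> x : ball 0 R2" "0 < R2" by (rule bcsE[OF g]) (rule that)
  define R where "R = max R1 R2"
  have R: "0 < R" "ball 0 R1 <= ball (0::'a) R" "ball 0 R2 <= ball (0::'a) R" unfolding R_def using b1(4) by auto
  obtain E where E: "0 <= E" "!!y. y : ball 0 R ==> (%x. cmod (?k x y)) : lmeas ==>
    (\<integral>x\<in>ball 0 R. enorm (?k x y)) <= en E" using kernel_diff_integral[OF C \<delta> R(1), of "%x y. ?k x y"] kd by blast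
  define H where "H z = enorm (case z of (x, y) => ?k x y)" for z
  have H: "H : lmeas" using bm_enorm[OF kdm] unfolding H_def[abs_def] .
  have "(\<integral>y. enorm (f y) * (\<integral>x. enorm (?k x y) * enorm (g x)))
    <= (\<integral>y. en (M2 * E) * enorm (f y))"
  proof (rule nn_integral_mono_AE, use section_measurable[OF H] in eventually_elim)
   fix y assume m: "(%x. H (x, y)) : lmeas"
   have "(%x. enn2real (H (x, y))) : lmeas" by (rule borel_measurable_enn2real[OF m])
   hence m': "(%x. cmod (?k x y)) : lmeas" by (simp add: H_def)
   show "enorm (f y) * (\<integral>x. enorm (?k x y) * enorm (g x)) <= en (M2 * E) * enorm (f y)"
   proof (cases "f y = 0")
    case False
    hence y: "y : ball 0 R" using b1(3) R by blast
    have mi: "(%x. enorm (?k x y) * indicator (ball 0 R) x) : lmeas"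
     by (rule borel_measurable_times_ennreal[OF bm_ennreal[OF m'] borel_measurable_indicator]) auto
    have "(\<integral>x. enorm (?k x y) * enorm (g x))
      <= (\<integral>x. en M2 * (enorm (?k x y) * indicator (ball 0 R) x))"
    proof (rule nn_integral_mono)
     fix x
     show "enorm (?k x y) * enorm (g x) <= en M2 * (enorm (?k x y) * indicator (ball 0 R) x)"
     proof (cases "g x = 0")
      case False
      hence "x : ball 0 R" using b2(3) R by blast
      thus ?thesis using mult_left_mono[OF ennreal_leI[OF b2(1)[of x]], of "enorm (?k x y)"] by (simp add: mult.commute)
     qed simp
    qed
    also have "... = en M2 * (\<integral>x\<in>ball 0 R. enorm (?k x y))" by (rule nn_integral_cmult[OF mi])
    also have "... <= en M2 * en E" by (intro mult_left_mono E(2) y m') simp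
    also have "... = en (M2 * E)" using b2(2) by (rule ennreal_mult'[symmetric])
    finally show ?thesis by (subst (2) mult.commute) (rule mult_left_mono, simp_all)
   qed simp
  qed
  also have "... = en (M2 * E) * (\<integral>y. enorm (f y))" by (rule nn_integral_cmult[OF cm[OF f]])
  also have "... < \<infinity>" using bcs_fin[OF f] by (simp add: ennreal_mult_less_top)
  finally show ?thesis .
 qed
 \<comment> \<open>\<open>kernel_fubini\<close> gives integrability only where the test function is
   nonzero, hence the exhaustion by indicators of balls.\<close>
 have Dint: "AE y. lintegrable (%x. ?k x y * g x)" if g: "g : bcs" for g
 proof -
  have "AE y. y : ball 0 (real n) --> lintegrable (%x. ?k x y * g x)" for n
  proof -
   define f where "f = (indicator (ball 0 (real n)) :: 'a => complex)"
   have f: "f : bcs" unfolding f_def by (rule bcsI[of _ 1 "ball 0 (real n)"]) (auto simp: indicator_def intro!: borel_measurable_indicator)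
   have "AE y. f y ~= 0 --> lintegrable (%x. ?k x y * g x)" by (rule kernel_fubini(1)[OF kdm bcs_measurable[OF f] bcs_measurable[OF g] fin[OF f g]])
   thus ?thesis by eventually_elim (simp add: f_def)
  qed
  hence "AE y. \<forall>n::nat. y : ball 0 (real n) --> lintegrable (%x. ?k x y * g x)" by (rule AE_all_countable[THEN iffD2, OF allI])
  thus ?thesis
  proof eventually_elim
   fix y assume a: "\<forall>n::nat. y : ball 0 (real n) --> lintegrable (%x. ?k x y * g x)"
   obtain n where "norm y < real n" using reals_Archimedean2 by blast
   thus "lintegrable (%x. ?k x y * g x)" using a[rule_format, of n] by simp
  qed
 qed
 have T1m: "T1 g : lmeas" if "g : bcs" for g unfolding T1_def[abs_def] by (rule borel_measurable_diff[OF Tadj_meas[OF that] Dm[OF that]])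
 \<comment> \<open>In the pairing with f, the transposed difference operator subtracted in T1
   cancels T - T0, so T1 is the formal adjoint of T0.\<close>
 have dual: "lintegrable (%y. f y * T1 g y) & (LINT y. f y * T1 g y) = (LINT x. T0 f x * g x)"
  if f: "f : bcs" and g: "g : bcs" for f g
 proof -
  note fub = kernel_fubini[OF kdm bcs_measurable[OF f] bcs_measurable[OF g] fin[OF f g], folded D_def]
  have e: "(%y. f y * T1 g y) = (%y. f y * Tadj g y - f y * D g y)" by (simp add: T1_def right_diff_distrib)
  have i: "lintegrable (%y. f y * T1 g y)" unfolding e by (rule Bochner_Integration.integrable_diff[OF pair(2)[OF f g] fub(3)])
  have "(LINT y. f y * T1 g y) = (LINT y. f y * Tadj g y) - (LINT y. f y * D g y)"
   unfolding e by (rule Bochner_Integration.integral_diff[OF pair(2)[OF f g] fub(3)])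
  also have "... = (LINT x. T f x * g x) - (LINT x. (LINT y. ?k x y * f y) * g x)" using pair(3)[OF f g] fub(4) by simp
  also have "... = (LINT x. T f x * g x - (LINT y. ?k x y * f y) * g x)"
   by (rule Bochner_Integration.integral_diff[symmetric, OF pair(1)[OF f g] fub(2)])
  also have "... = (LINT x. T0 f x * g x)"
  proof (rule integral_cong_AE)
   show "(%x. T f x * g x - (LINT y. ?k x y * f y) * g x) : lmeas"
    by (rule borel_measurable_diff[OF borel_measurable_integrable[OF pair(1)[OF f g]] borel_measurable_integrable[OF fub(2)]])
   show "(%x. T0 f x * g x) : lmeas" by (rule borel_measurable_times[OF T0.T_measurable[OF f] bcs_measurable[OF g]])
   show "AE x. T f x * g x - (LINT y. ?k x y * f y) * g x = T0 f x * g x"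
    using Drep[OF f] by eventually_elim (simp add: left_diff_distrib[symmetric] algebra_simps)
  qed
  finally show ?thesis using i by blast
 qed
 have l2: "(\<integral>x. en ((cmod (T1 g x))\<^sup>2)) <= en C2 * (\<integral>x. en ((cmod (g x))\<^sup>2))"
  if g: "g : bcs" for g
 proof -
  define G where "G = (L2_fun_norm g)\<^sup>2"
  have G: "(\<integral>x. en ((cmod (g x))\<^sup>2)) = en G" unfolding G_def by (rule L2_nn_integral[OF bcs_L2[OF g]])
  have G0: "0 <= G" by (simp add: G_def)
  have "(\<integral>x. en ((cmod (T1 g x))\<^sup>2)) <= en (C2 * G)"
  proof (rule L2_duality[OF T1m[OF g]])
   show "0 <= C2 * G" using T0.C2 G0 by simp
   fix f :: "'a => complex" assume f: "f : bcs"
   note m = bm_enorm[OF T0.T_measurable[OF f]]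
   have "enorm (LINT x. T0 f x * g x) <= (\<integral>x. enorm (T0 f x) * enorm (g x))"
   proof (cases "lintegrable (%x. T0 f x * g x)")
    case True
    show ?thesis using integral_norm_bound_ennreal[OF True] by (simp add: norm_mult ennreal_mult)
   qed (simp add: not_integrable_integral_eq)
   hence "(enorm (LINT x. T0 f x * g x))\<^sup>2 <= (\<integral>x. enorm (T0 f x) * enorm (g x))\<^sup>2" by (rule power_mono) simp
   also have "... <= (\<integral>x. (enorm (T0 f x))\<^sup>2) * (\<integral>x. (enorm (g x))\<^sup>2)"
    by (rule Cauchy_Schwarz_nn_integral[OF m cm[OF g]])
   also have "... = (\<integral>x. en ((cmod (T0 f x))\<^sup>2)) * en G" by (simp add: ennreal_power G)
   also have "... <= (en C2 * (\<integral>x. en ((cmod (f x))\<^sup>2))) * en G" by (rule mult_right_mono[OF T0.l2[OF f]]) simp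
   also have "... = en (C2 * G) * (\<integral>x. en ((cmod (f x))\<^sup>2))" unfolding ennreal_mult'[OF T0.C2] by (simp only: mult_ac)
   finally show "en ((cmod (LINT x. f x * T1 g x))\<^sup>2) <= en (C2 * G) * (\<integral>x. en ((cmod (f x))\<^sup>2))"
    using dual[OF f g] by (simp add: ennreal_power)
  qed
  thus ?thesis unfolding G ennreal_mult'[OF T0.C2] .
 qed
 have rep: "AE y. y ~: fun_support g --> lintegrable (%x. K0 x y * g x) & T1 g y = (LINT x. K0 x y * g x)"
  if g: "g : bcs" for g
 proof -
  \<comment> \<open>Bounded sets at a positive distance from the support of g; they exhaust its
    complement, and K0 is bounded between them and the support.\<close>
  define S where "S n = {y. \<forall>x\<in>fun_support g. 1 / real (Suc n) <= dist x y} Int ball 0 (real n)" for n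
  have Sm: "S n : sets lebesgue" for n
  proof -
   have "{y. \<forall>x\<in>fun_support g. 1 / real (Suc n) <= dist x y} = - (\<Union>x\<in>fun_support g. ball x (1 / real (Suc n)))" by (auto simp: not_less)
   moreover have "closed (- (\<Union>x\<in>fun_support g. ball x (1 / real (Suc n))))" by (intro closed_Compl open_UN) auto
   ultimately have "closed {y. \<forall>x\<in>fun_support g. 1 / real (Suc n) <= dist x y}" by simp
   thus ?thesis unfolding S_def by (intro sets.Int) auto
  qed
  have gs: "x : fun_support g" if "g x ~= 0" for x using that closure_subset[of "{x. g x ~= 0}"] unfolding fun_support_def by blast
  have finK0: "(\<integral>y. enorm (f y) * (\<integral>x. enorm (K0 x y) * enorm (g x))) < \<infinity>"
   if f: "f : bcs" and fS: "!!y. f y ~= 0 ==> y : S n" for f n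
  proof -
   define B where "B = \<bar>CS\<bar> * real (Suc n) ^ DIM('a)"
   have "(\<integral>y. enorm (f y) * (\<integral>x. enorm (K0 x y) * enorm (g x)))
    <= (\<integral>y. (en B * (\<integral>x. enorm (g x))) * enorm (f y))"
   proof (rule nn_integral_mono)
    fix y
    show "enorm (f y) * (\<integral>x. enorm (K0 x y) * enorm (g x))
      <= (en B * (\<integral>x. enorm (g x))) * enorm (f y)"
    proof (cases "f y = 0")
     case False
     have "(\<integral>x. enorm (K0 x y) * enorm (g x)) <= (\<integral>x. en B * enorm (g x))"
     proof (rule nn_integral_mono)
      fix x
      show "enorm (K0 x y) * enorm (g x) <= en B * enorm (g x)"
      proof (cases "g x = 0")
       case False
       have d: "1 / real (Suc n) <= dist x y" using fS[OF \<open>f y ~= 0\<close>] gs[OF False] unfolding S_def by blast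
       moreover have "0 < 1 / real (Suc n)" by simp
       ultimately have "x ~= y" by auto
       have "(1 / real (Suc n)) ^ DIM('a) <= dist x y ^ DIM('a)" using d by (intro power_mono) auto
       hence "\<bar>CS\<bar> / dist x y ^ DIM('a) <= \<bar>CS\<bar> / (1 / real (Suc n)) ^ DIM('a)"
        using \<open>x ~= y\<close> by (intro divide_left_mono mult_pos_pos zero_less_power) auto
       also have "... = B" by (simp add: B_def power_divide)
       finally have "cmod (K0 x y) <= B" using CS[OF \<open>x ~= y\<close>] divide_right_mono[OF abs_ge_self[of CS], of "dist x y ^ DIM('a)"] by simp
       thus ?thesis by (intro mult_right_mono ennreal_leI) auto
      qed simp
     qed
     also have "... = en B * (\<integral>x. enorm (g x))" by (rule nn_integral_cmult[OF cm[OF g]])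
     finally show ?thesis by (subst (2) mult.commute) (rule mult_left_mono, simp_all)
    qed simp
   qed
   also have "... = (en B * (\<integral>x. enorm (g x))) * (\<integral>y. enorm (f y))" by (rule nn_integral_cmult[OF cm[OF f]])
   also have "... < \<infinity>" using bcs_fin[OF f] bcs_fin[OF g] by (simp add: ennreal_mult_less_top)
   finally show ?thesis .
  qed
  define h where "h y = T1 g y - (LINT x. K0 x y * g x)" for y
  have hm: "h : lmeas" unfolding h_def[abs_def]
   by (rule borel_measurable_diff[OF T1m[OF g] kernel_operator_measurable[OF measurable_swap_lebesgue[OF K0m] bcs_measurable[OF g]]])
  have "AE y. y : S n --> lintegrable (%x. K0 x y * g x) & h y = 0" for n
  proof -
   define f where "f = (indicator (S n) :: 'a => complex)"
   have fm: "f : lmeas" unfolding f_def by (rule borel_measurable_indicator[OF Sm])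
   have f: "f : bcs" by (rule bcsI[OF fm, of 1 "ball 0 (real n)"]) (auto simp: f_def S_def indicator_def)
   have fS: "y : S n" if "f y ~= 0" for y using that by (simp add: f_def indicator_def split: if_splits)
   have "AE y. f y ~= 0 --> lintegrable (%x. K0 x y * g x)"
    by (rule kernel_fubini(1)[OF K0m bcs_measurable[OF f] bcs_measurable[OF g] finK0[OF f fS]])
   moreover have "AE y. y : S n --> h y = 0"
   proof (rule AE_zero_by_duality[OF hm Sm])
    fix f :: "'a => complex" assume f: "f : bcs" and fS: "!!y. f y ~= 0 ==> y : S n"
    note fub = kernel_fubini[OF K0m bcs_measurable[OF f] bcs_measurable[OF g] finK0[OF f fS]]
    have e: "(%y. f y * h y) = (%y. f y * T1 g y - f y * (LINT x. K0 x y * g x))" by (simp add: h_def right_diff_distrib)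
    have "(LINT y. f y * h y) = (LINT y. f y * T1 g y) - (LINT y. f y * (LINT x. K0 x y * g x))"
     unfolding e by (rule Bochner_Integration.integral_diff) (use dual[OF f g] fub(3) in auto)
    also have "(LINT y. f y * T1 g y) = (LINT x. T0 f x * g x)" using dual[OF f g] by blast
    also have "... = (LINT x. (LINT y. K0 x y * f y) * g x)"
    proof (rule integral_cong_AE)
     show "(%x. T0 f x * g x) : lmeas" by (rule borel_measurable_times[OF T0.T_measurable[OF f] bcs_measurable[OF g]])
     show "(%x. (LINT y. K0 x y * f y) * g x) : lmeas" by (rule borel_measurable_integrable[OF fub(2)])
     show "AE x. T0 f x * g x = (LINT y. K0 x y * f y) * g x" using T0.rep[OF f]
     proof eventually_elim
      fix x assume a: "x ~: fun_support f --> lintegrable (%y. K0 x y * f y) & T0 f x = (LINT y. K0 x y * f y)"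
      show "T0 f x * g x = (LINT y. K0 x y * f y) * g x"
      proof (cases "g x = 0")
       case False
       have "x ~: fun_support f"
       proof
        assume "x : fun_support f"
        moreover have "0 < 1 / real (Suc n)" by simp
        ultimately obtain y where y: "f y ~= 0" "dist y x < 1 / real (Suc n)" unfolding fun_support_def closure_approachable by blast
        have "1 / real (Suc n) <= dist x y" using fS[OF y(1)] gs[OF False] unfolding S_def by blast
        thus False using y(2) by (simp add: dist_commute)
       qed
       thus ?thesis using a by simp
      qed simp
     qed
    qed
    also have "... = (LINT y. f y * (LINT x. K0 x y * g x))" by (rule fub(4))
    finally show "(LINT y. f y * h y) = 0" by simp
   qed
   ultimately show ?thesis by eventually_elim (simp add: f_def)
  qed
  hence "AE y. \<forall>n. y : S n --> lintegrable (%x. K0 x y * g x) & h y = 0" by (rule AE_all_countable[THEN iffD2, OF allI])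
  thus ?thesis
  proof eventually_elim
   fix y assume a: "\<forall>n. y : S n --> lintegrable (%x. K0 x y * g x) & h y = 0"
   show "y ~: fun_support g --> lintegrable (%x. K0 x y * g x) & T1 g y = (LINT x. K0 x y * g x)"
   proof
    assume "y ~: fun_support g"
    moreover have "open (- fun_support g)" unfolding fun_support_def by auto
    ultimately obtain e where e: "0 < e" "ball y e <= - fun_support g" by (meson ComplI openE)
    obtain n where n: "max (1 / e) (norm y) < real n" using reals_Archimedean2 by blast
    have "1 / real (Suc n) <= e" using n e(1) by (simp add: field_simps)
    moreover have "e <= dist x y" if "x : fun_support g" for x using that e(2) by (force simp: dist_commute not_less[symmetric])
    ultimately have "y : S n" using n unfolding S_def by force
    thus "lintegrable (%x. K0 x y * g x) & T1 g y = (LINT x. K0 x y * g x)" using a by (auto simp: h_def)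
   qed
  qed
 qed
 have D_add: "AE y. D (%z. f z + g z) y = D f y + D g y" if "f : bcs" "g : bcs" for f g
  using Dint[OF that(1)] Dint[OF that(2)] by eventually_elim (simp add: D_def distrib_left)
 have D_scale: "D (%z. c * f z) y = c * D f y" for c f y unfolding D_def by (subst integral_mult_right_zero[symmetric]) (simp add: mult_ac)
 have "cz_op T1 (%x y. K0 y x) C2 CK \<gamma>"
 proof
  show "linear_operator_on bcs T1" unfolding linear_operator_on_def
  proof (intro conjI ballI allI)
   fix f :: "'a => complex" assume f: "f : bcs"
   show "T1 f : lmeas" by (rule T1m[OF f])
   show "AE x. T1 (%z. c * f z) x = c * T1 f x" for c using Tadj_scale[OF f, of c] by eventually_elim (simp add: T1_def D_scale right_diff_distrib)
   fix g :: "'a => complex" assume g: "g : bcs"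
   show "AE x. T1 (%z. f z + g z) x = T1 f x + T1 g x" using Tadj_add[OF f g] D_add[OF f g] by eventually_elim (simp add: T1_def)
  qed
 qed (use T0.C2 T0.CK T0.\<gamma> T0.smooth1 T0.smooth2 l2 rep in auto)
 moreover have "has_kernel Tadj (%x y. K y x)" unfolding has_kernel_def
 proof (intro conjI ballI)
  show "(%(x, y). K y x) : lmeas" by (rule measurable_swap_lebesgue[OF Km])
  fix g :: "'a => complex" assume g: "g : bcs"
  show "AE x. x ~: fun_support g --> lintegrable (%y. K y x * g y) & Tadj g x = (LINT y. K y x * g y)" using rep[OF g] Dint[OF g]
  proof eventually_elim
   fix x assume a: "x ~: fun_support g --> lintegrable (%y. K0 y x * g y) & T1 g x = (LINT y. K0 y x * g y)"
    and d: "lintegrable (%y. ?k y x * g y)"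
   have e: "(%y. K y x * g y) = (%y. K0 y x * g y + ?k y x * g y)" by (simp add: algebra_simps)
   show "x ~: fun_support g --> lintegrable (%y. K y x * g y) & Tadj g x = (LINT y. K y x * g y)"
   proof
    assume "x ~: fun_support g"
    hence i: "lintegrable (%y. K0 y x * g y)" and t: "T1 g x = (LINT y. K0 y x * g y)" using a by auto
    have "Tadj g x = T1 g x + D g x" by (simp add: T1_def)
    also have "... = (LINT y. K y x * g y)" unfolding e t D_def by (rule Bochner_Integration.integral_add[OF i d, symmetric])
    finally show "lintegrable (%y. K y x * g y) & Tadj g x = (LINT y. K y x * g y)"
     unfolding e using Bochner_Integration.integrable_add[OF i d] by simp
   qed
  qed
 qed
 moreover have "diff_integral_operator Tadj (%x y. K y x) T1 (%x y. K0 y x)" unfolding diff_integral_operator_def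
 proof
  fix g :: "'a => complex" assume g: "g : bcs"
  show "AE x. lintegrable (%y. ?k y x * g y) & Tadj g x - T1 g x = (LINT y. ?k y x * g y)"
   using Dint[OF g] by eventually_elim (simp add: T1_def D_def)
 qed
 ultimately show ?thesis by blast
qed

end

section \<open>Kernel conditions measured at the other variable\<close>

context critical
begin

lemma kernel_size_switch:
 assumes size: "kernel_size_ptw \<rho> K" and N: "0 < N"
 shows "\<exists>C\<ge>0. \<forall>x y. x ~= y --> cmod (K x y) <= C / dist x y ^ DIM('a) * (1 + dist x y / \<rho> y) powr (- N)"
proof -
 \<comment> \<open>By \<open>critical_switch\<close> the decay exponent is divided by N0 +
   1.\<close>
 define N' where "N' = N * (N0 + 1)"
 have N': "0 < N'" unfolding N'_def using N N0 by simp
 obtain C where C: "!!x y. x ~= y ==> cmod (K x y) <= C / dist x y ^ DIM('a) * (1 + dist x y / \<rho> x) powr (- N')"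
  using size N' unfolding kernel_size_ptw_def by blast
 have "cmod (K x y) <= \<bar>C\<bar> * C0 powr N' / dist x y ^ DIM('a) * (1 + dist x y / \<rho> y) powr (- N)" if "x ~= y" for x y
 proof -
  define b where "b = 1 + dist x y / \<rho> y"
  have b: "0 < b" unfolding b_def using \<rho>_pos[of y] by (simp add: add_pos_nonneg)
  have "inverse C0 * b powr (1 / (N0 + 1)) <= 1 + dist x y / \<rho> x" unfolding b_def by (rule critical_switch)
  hence "(1 + dist x y / \<rho> x) powr (- N') <= (inverse C0 * b powr (1 / (N0 + 1))) powr (- N')" using N' C0 b by (intro powr_mono2') auto
  also have "... = C0 powr N' * b powr (- N)" using C0 b N0 by (simp add: powr_mult powr_powr N'_def powr_minus inverse_powr)
  finally have le: "(1 + dist x y / \<rho> x) powr (- N') <= C0 powr N' * b powr (- N)" .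
  have "cmod (K x y) <= C / dist x y ^ DIM('a) * (1 + dist x y / \<rho> x) powr (- N')" by (rule C[OF that])
  also have "... <= \<bar>C\<bar> / dist x y ^ DIM('a) * (C0 powr N' * b powr (- N))" by (intro mult_mono divide_right_mono le) auto
  finally show ?thesis unfolding b_def by (simp add: mult.assoc)
 qed
 thus ?thesis by (intro exI[of _ "\<bar>C\<bar> * C0 powr N'"]) simp
qed

text \<open>For dist x y <= 2 \<rho> y the lower bound in the definition of a critical radius
  function gives \<rho> y <= C0 3^N0 \<rho> x, where 3 = 1 + 2.\<close>

lemma kernel_diff_switch:
 assumes k: "!!x y. x ~= y ==> cmod (k x y) <= C / dist x y ^ DIM('a) * (dist x y / \<rho> y) powr \<delta>"
  and C: "0 <= C" and \<delta>: "0 < \<delta>" and xy: "x ~= y" "dist x y <= 2 * \<rho> y"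
 shows "cmod (k y x) <= C * (C0 * 3 powr N0) powr \<delta> / dist x y ^ DIM('a) * (dist x y / \<rho> y) powr \<delta>"
proof -
 define E where "E = C0 * 3 powr N0"
 have E: "0 < E" unfolding E_def using C0 by simp
 have ry: "0 < \<rho> y" "0 < \<rho> x" by (rule \<rho>_pos)+
 have "1 + dist y x / \<rho> y <= 3" using xy(2) ry by (simp add: dist_commute field_simps)
 hence "3 powr (- N0) <= (1 + dist y x / \<rho> y) powr (- N0)" using ry N0 by (intro powr_mono2') (auto simp: add_pos_nonneg)
 hence "inverse C0 * \<rho> y * 3 powr (- N0) <= inverse C0 * \<rho> y * (1 + dist y x / \<rho> y) powr (- N0)"
  using C0 ry by (intro mult_left_mono) auto
 also have "... <= \<rho> x" by (rule \<rho>_lower)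
 finally have "\<rho> y <= E * \<rho> x" using C0 unfolding E_def by (simp add: powr_minus field_simps)
 hence "dist y x * \<rho> y <= dist y x * (E * \<rho> x)" by (intro mult_left_mono) auto
 hence "dist y x / \<rho> x <= E * (dist y x / \<rho> y)" using ry by (simp add: field_simps)
 hence "(dist y x / \<rho> x) powr \<delta> <= (E * (dist y x / \<rho> y)) powr \<delta>" using \<delta> ry by (intro powr_mono2) auto
 also have "... = E powr \<delta> * (dist y x / \<rho> y) powr \<delta>" by (rule powr_mult)
 finally have le: "(dist y x / \<rho> x) powr \<delta> <= E powr \<delta> * (dist y x / \<rho> y) powr \<delta>" .
 have "cmod (k y x) <= C / dist y x ^ DIM('a) * (dist y x / \<rho> x) powr \<delta>" using xy(1) by (intro k) auto
 also have "... <= C / dist y x ^ DIM('a) * (E powr \<delta> * (dist y x / \<rho> y) powr \<delta>)" using C by (intro mult_left_mono le) auto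
 finally show ?thesis unfolding E_def by (simp add: dist_commute mult.assoc)
qed

end

theorem theorem4:
  fixes \<rho> :: "'a::euclidean_space \<Rightarrow> real"
    and T T0 :: "('a \<Rightarrow> complex) \<Rightarrow> ('a \<Rightarrow> complex)"
    and K K0 :: "'a \<Rightarrow> 'a \<Rightarrow> complex"
  assumes "critical_radius \<rho>"
    and "linear_operator_on bdd_compact_supp T"
    and "has_kernel T K"
    and "calderon_zygmund T0 K0"
    and "diff_integral_operator T K T0 K0"
  shows
    "(\<forall>s>1. kernel_size_Ls \<rho> s K \<and> kernel_diff_Ls \<rho> s K K0 \<longrightarrow>
        (\<forall>\<theta>\<ge>0. \<exists>C::real. \<forall>w f. weight w \<and> f \<in> bdd_compact_supp \<longrightarrow>
           (\<forall>t>0. wmeasure w {x. cmod (T f x) > t}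
              \<le> ennreal (C / t) *
                (\<integral>\<^sup>+x. ennreal (cmod (f x)) * M_theta_pow \<rho> \<theta> (conj_exp s) w x \<partial>lebesgue)))) \<and>
     (kernel_size_ptw \<rho> K \<and> kernel_diff_ptw \<rho> K K0 \<longrightarrow>
        (\<forall>\<theta>\<ge>0. \<forall>A \<in> (\<Union>p\<in>{1<..}. D_class p).
          (\<exists>C::real. \<forall>w f. weight w \<and> f \<in> bdd_compact_supp \<longrightarrow>
             (\<forall>t>0. wmeasure w {x. cmod (T f x) > t}
                \<le> ennreal (C / t) *
                  (\<integral>\<^sup>+x. ennreal (cmod (f x)) * (M_loc \<rho> A w x + M_theta_pow \<rho> \<theta> 1 w x) \<partial>lebesgue))) \<and>
          (\<forall>Tadj. adjoint_operator T Tadj \<longrightarrow>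
             (\<exists>C::real. \<forall>w f. weight w \<and> f \<in> bdd_compact_supp \<longrightarrow>
               (\<forall>t>0. wmeasure w {x. cmod (Tadj f x) > t}
                  \<le> ennreal (C / t) *
                    (\<integral>\<^sup>+x. ennreal (cmod (f x)) * (M_loc \<rho> A w x + M_theta_pow \<rho> \<theta> 1 w x) \<partial>lebesgue))))))"
proof -
  obtain C0 N0 where "critical \<rho> C0 N0"
    using assms(1) unfolding critical_radius_def critical_def by blast
  then interpret critical \<rho> C0 N0 .
  note lin = assms(2) and ker = assms(3) and cz = assms(4) and diff = assms(5)
  obtain C2 CK \<gamma> where czo: "cz_op T0 K0 C2 CK \<gamma>" using calderon_zygmund_cz_op[OF cz] by blast
  have K0m: "(\<lambda>(x, y). K0 x y) \<in> borel_measurable lebesgue" using cz unfolding calderon_zygmund_def has_kernel_def by blast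
  \<comment> \<open>\<open>weak_bound\<close> has one constant for all nonnegative measurable
    functions, of which weights are a special case.\<close>
  have wt: "\<exists>C. \<forall>w f. weight w \<and> f \<in> bdd_compact_supp \<longrightarrow> (\<forall>t>0. wmeasure w {x. cmod (S f x) > t}
      \<le> ennreal (C / t) * (\<integral>\<^sup>+x. ennreal (cmod (f x)) * M w x \<partial>lebesgue))" if "weak_bound S M" for S M
    using that unfolding weak_bound_def weight_def wmeasure_def by blast
  show ?thesis
  proof (intro conjI allI impI ballI)
    fix s \<theta> :: real assume "1 < s" "kernel_size_Ls \<rho> s K \<and> kernel_diff_Ls \<rho> s K K0" "0 \<le> \<theta>"
    thus "\<exists>C::real. \<forall>w f. weight w \<and> f \<in> bdd_compact_supp \<longrightarrow>
           (\<forall>t>0. wmeasure w {x. cmod (T f x) > t}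
              \<le> ennreal (C / t) * (\<integral>\<^sup>+x. ennreal (cmod (f x)) * M_theta_pow \<rho> \<theta> (conj_exp s) w x \<partial>lebesgue))"
      by (intro wt weak_type_Ls[OF lin ker czo K0m diff]) auto
  next
    fix \<theta> :: real and A :: "real \<Rightarrow> real"
    assume k: "kernel_size_ptw \<rho> K \<and> kernel_diff_ptw \<rho> K K0" and \<theta>: "0 \<le> \<theta>" and "A \<in> (\<Union>p\<in>{1<..}. D_class p)"
    then obtain p where p: "1 < p" and AD: "A \<in> D_class p" by auto
    obtain C \<delta> where C: "0 < C" "0 < \<delta>" and kd: "\<And>x y. x \<noteq> y \<Longrightarrow> cmod (K x y - K0 x y) \<le> C / dist x y ^ DIM('a) * (dist x y / \<rho> y) powr \<delta>"
      using k unfolding kernel_diff_ptw_def by blast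
    show "\<exists>C::real. \<forall>w f. weight w \<and> f \<in> bdd_compact_supp \<longrightarrow>
             (\<forall>t>0. wmeasure w {x. cmod (T f x) > t}
                \<le> ennreal (C / t) *
                  (\<integral>\<^sup>+x. ennreal (cmod (f x)) * (M_loc \<rho> A w x + M_theta_pow \<rho> \<theta> 1 w x) \<partial>lebesgue))"
    proof (rule wt, rule weak_type_pointwise[OF lin ker czo K0m diff _ _ AD p \<theta>])
      show "\<exists>C\<ge>0. \<forall>x y. x \<noteq> y \<longrightarrow> cmod (K x y) \<le> C / dist x y ^ DIM('a) * (1 + dist x y / \<rho> y) powr (- N)" if "0 < N" for N
        using k that by (intro kernel_size_switch) auto
      show "\<exists>C\<ge>0. \<exists>\<delta>>0. \<forall>x y. x \<noteq> y \<longrightarrow> dist x y \<le> 2 * \<rho> y \<longrightarrow>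
         cmod (K x y - K0 x y) \<le> C / dist x y ^ DIM('a) * (dist x y / \<rho> y) powr \<delta>"
        using C kd by (intro exI[of _ C] conjI exI[of _ \<delta>]) auto
    qed
    fix Tadj assume adj: "adjoint_operator T Tadj"
    obtain T1 where T1: "cz_op T1 (\<lambda>x y. K0 y x) C2 CK \<gamma>" "has_kernel Tadj (\<lambda>x y. K y x)"
      "diff_integral_operator Tadj (\<lambda>x y. K y x) T1 (\<lambda>x y. K0 y x)"
      using adjoint_difference[OF lin ker cz czo diff less_imp_le[OF C(1)] C(2) kd adj] by blast
    have linadj: "linear_operator_on bdd_compact_supp Tadj" using adj unfolding adjoint_operator_def by blast
    show "\<exists>C::real. \<forall>w f. weight w \<and> f \<in> bdd_compact_supp \<longrightarrow>
               (\<forall>t>0. wmeasure w {x. cmod (Tadj f x) > t}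
                  \<le> ennreal (C / t) *
                    (\<integral>\<^sup>+x. ennreal (cmod (f x)) * (M_loc \<rho> A w x + M_theta_pow \<rho> \<theta> 1 w x) \<partial>lebesgue))"
    proof (rule wt, rule weak_type_pointwise[OF linadj T1(2,1) measurable_swap_lebesgue[OF K0m] T1(3) _ _ AD p \<theta>])
      \<comment> \<open>For the transposed kernel the size condition is already measured at the
        second variable; here it is the difference condition that has to be switched.\<close>
      show "\<exists>C\<ge>0. \<forall>x y. x \<noteq> y \<longrightarrow> cmod (K y x) \<le> C / dist x y ^ DIM('a) * (1 + dist x y / \<rho> y) powr (- N)" if N: "0 < N" for N
      proof -
        obtain D where D: "\<And>x y. x \<noteq> y \<Longrightarrow> cmod (K x y) \<le> D / dist x y ^ DIM('a) * (1 + dist x y / \<rho> x) powr (- N)"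
          using k N unfolding kernel_size_ptw_def by blast
        have "cmod (K y x) \<le> \<bar>D\<bar> / dist x y ^ DIM('a) * (1 + dist x y / \<rho> y) powr (- N)" if "x \<noteq> y" for x y
        proof -
          have "cmod (K y x) \<le> D / dist x y ^ DIM('a) * (1 + dist x y / \<rho> y) powr (- N)"
            using D[of y x] that by (simp add: dist_commute)
          also have "\<dots> \<le> \<bar>D\<bar> / dist x y ^ DIM('a) * (1 + dist x y / \<rho> y) powr (- N)"
            by (intro mult_right_mono divide_right_mono) auto
          finally show ?thesis .
        qed
        thus ?thesis by (intro exI[of _ "\<bar>D\<bar>"]) simp
      qed
      have "0 \<le> C * (C0 * 3 powr N0) powr \<delta>" using C by simp
      moreover have "\<forall>x y. x \<noteq> y \<longrightarrow> dist x y \<le> 2 * \<rho> y \<longrightarrow>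
         cmod (K y x - K0 y x) \<le> C * (C0 * 3 powr N0) powr \<delta> / dist x y ^ DIM('a) * (dist x y / \<rho> y) powr \<delta>"
        using kernel_diff_switch[OF kd less_imp_le[OF C(1)] C(2)] by blast
      ultimately show "\<exists>C\<ge>0. \<exists>\<delta>>0. \<forall>x y. x \<noteq> y \<longrightarrow> dist x y \<le> 2 * \<rho> y \<longrightarrow>
         cmod (K y x - K0 y x) \<le> C / dist x y ^ DIM('a) * (dist x y / \<rho> y) powr \<delta>"
        using C(2) by blast
    qed
  qed
qed

end
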